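(* Let $\Lambda$ be a strongly connected, aperiodic, finite $k$-graph, and let $M$ be the Perron-Frobenius measure on $\Lambda^\infty$. Then there is a faithful representation of $C^*(\Lambda)$ on $L^2(\Lambda^\infty, M)$.
   Context: Notation: $\mathbb N=\{0,1,2,\dots\}$, $k\ge 1$, and $e_1,\dots,e_k$ are the generators of $\mathbb N^k$. $k$-graphs: A $k$-graph is a countable category $\Lambda$ with a functor $d:\Lambda\to\mathbb N^k$ satisfying the factorization property: whenever $d(\lambda)=m+n$ there are unique $\mu,\nu\in\Lambda$ with $\lambda=\mu\nu$, $d(\mu)=m$, $d(\nu)=n$. $\Lambda^0$ is the set of identity morphisms (vertices), $r,s:\Lambda\to\Lambda^0$ are the range and source maps, $\Lambda^n=\{\lambda: d(\lambda)=n\}$, $v\Lambda w=\{\lambda: r(\lambda)=v, s(\lambda)=w\}$, $v\Lambda^n=\{\lambda\in\Lambda^n:r(\lambda)=v\}$. $\Lambda$ is finite if every $\Lambda^n$ is finite; it is strongly connected if $v\Lambda w\neq\emptyset$ for all $v,w\in\Lambda^0$ (this implies that $\Lambda$ has no sources, i.e. $v\Lambda^n\neq\emptyset$ for all $v,n$). The vertex matrices are $A_i\in M_{\Lambda^0}(\mathbb N)$, $A_i(v,w)=|v\Lambda^{e_i}w|$. Infinite paths and aperiodicity: $\Omega_k=\{(p,q)\in\mathbb N^k\times\mathbb N^k: p\le q\}$ is the $k$-graph with $r(p,q)=p$, $s(p,q)=q$, $(p,q)(q,m)=(p,m)$, $d(p,q)=q-p$. An infinite path is a $k$-graph morphism (degree-preserving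 functor) $x:\Omega_k\to\Lambda$; $\Lambda^\infty$ is the set of them, with topology having as basis the cylinder sets $Z(\lambda)=\{x\in\Lambda^\infty: x(0,d(\lambda))=\lambda\}$; $\sigma^p(x)(m,n)=x(m+p,n+p)$. $\Lambda$ is aperiodic if for each $v\in\Lambda^0$ there is $x\in Z(v)$ such that $\sigma^m(x)\ne\sigma^n(x)$ for all $m\ne n\in\mathbb N^k$. Perron-Frobenius measure: For $\Lambda$ strongly connected and finite, $x^\Lambda$ denotes the unique vector with positive entries and $\ell^1$-norm one such that $A_ix^\Lambda=\rho(A_i)x^\Lambda$ for all $i$, where $\rho(A_i)$ is the spectral radius. Put $\rho(\Lambda)=(\rho(A_1),\dots,\rho(A_k))$ and $\rho(\Lambda)^n=\prod_i\rho(A_i)^{n_i}$. $M$ is the Borel probability measure on $\Lambda^\infty$ with $M(Z(\lambda))=\rho(\Lambda)^{-d(\lambda)}x^\Lambda_{s(\lambda)}$ for all $\lambda\in\Lambda$. $C^*(\Lambda)$: For $\Lambda$ finite with no sources, a Cuntz-Krieger $\Lambda$-family is a collection $\{t_\lambda:\lambda\in\Lambda\}$ of partial isometries in a $C^*$-algebra with (CK1) $\{t_v:v\in\Lambda^0\}$ mutually orthogonal projections; (CK2) $t_\mu t_\lambda=t_{\mu\lambda}$ whenever $s(\mu)=r(\lambda)$; (CK3) $t_\mu^*t_\mu=t_{s(\mu)}$ for all $\mu$; (CK4) $t_v=\sum_{\lambda\in v\Lambda^n}t_\lambda t_\lambda^*$ for all $v\in\Lambda^0$, $n\in\mathbb N^k$.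 $C^*(\Lambda)$ is the $C^*$-algebra generated by a universal Cuntz-Krieger $\Lambda$-family $\{s_\lambda\}$. *)

theory Defs
  imports
    "HOL-Probability.Probability"
    "HOL-Algebra.Algebraic_Closure_Type"
    "Jordan_Normal_Form.Spectral_Radius"
begin

no_notation Matrix.vec_index (infixl "$" 100)

section \<open>Higher-rank graphs\<close>

text \<open>
  A small category is given by its morphisms only: objects are identified with identity
  morphisms, so the range and source maps take values in the set of morphisms.
  The monoid of degrees is the type of \<^typ>\<open>nat\<close>-vectors indexed by a finite type, whose
  cardinality is the rank. Only \<^term>\<open>cmp L l m\<close> with \<^term>\<open>src L l = rng L m\<close> is meaningful.
\<close>

record ('a, 'k) kgraph =
  mor :: "'a set"
  cmp :: "'a \<Rightarrow> 'a \<Rightarrow> 'a"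
  rng :: "'a \<Rightarrow> 'a"
  src :: "'a \<Rightarrow> 'a"
  deg :: "'a \<Rightarrow> nat ^ 'k::finite"

definition vertices :: "('a, 'k::finite) kgraph \<Rightarrow> 'a set" where
  "vertices L = {v \<in> mor L. rng L v = v \<and> src L v = v}"

locale kgraph =
  fixes L :: "('a, 'k::finite) kgraph"
  assumes countable_mor: "countable (mor L)"
    and rng_vertex: "l \<in> mor L \<Longrightarrow> rng L l \<in> vertices L"
    and src_vertex: "l \<in> mor L \<Longrightarrow> src L l \<in> vertices L"
    and comp_mor: "\<lbrakk>l \<in> mor L; m \<in> mor L; src L l = rng L m\<rbrakk> \<Longrightarrow> cmp L l m \<in> mor L"
    and rng_comp: "\<lbrakk>l \<in> mor L; m \<in> mor L; src L l = rng L m\<rbrakk> \<Longrightarrow> rng L (cmp L l m) = rng L l"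
    and src_comp: "\<lbrakk>l \<in> mor L; m \<in> mor L; src L l = rng L m\<rbrakk> \<Longrightarrow> src L (cmp L l m) = src L m"
    and comp_assoc: "\<lbrakk>l \<in> mor L; m \<in> mor L; n \<in> mor L; src L l = rng L m; src L m = rng L n\<rbrakk>
      \<Longrightarrow> cmp L (cmp L l m) n = cmp L l (cmp L m n)"
    and comp_id_left: "l \<in> mor L \<Longrightarrow> cmp L (rng L l) l = l"
    and comp_id_right: "l \<in> mor L \<Longrightarrow> cmp L l (src L l) = l"
    and deg_comp: "\<lbrakk>l \<in> mor L; m \<in> mor L; src L l = rng L m\<rbrakk>
      \<Longrightarrow> deg L (cmp L l m) = deg L l + deg L m"
    and deg_vertex: "v \<in> vertices L \<Longrightarrow> deg L v = 0"
    and factorization: "\<lbrakk>l \<in> mor L; deg L l = p + q\<rbrakk>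
      \<Longrightarrow> \<exists>!(m, n). m \<in> mor L \<and> n \<in> mor L \<and> src L m = rng L n
            \<and> l = cmp L m n \<and> deg L m = p \<and> deg L n = q"

definition finite_kgraph :: "('a, 'k::finite) kgraph \<Rightarrow> bool" where
  "finite_kgraph L \<longleftrightarrow> (\<forall>n. finite {l \<in> mor L. deg L l = n})"

definition strongly_connected :: "('a, 'k::finite) kgraph \<Rightarrow> bool" where
  "strongly_connected L \<longleftrightarrow>
     (\<forall>v\<in>vertices L. \<forall>w\<in>vertices L. {l \<in> mor L. rng L l = v \<and> src L l = w} \<noteq> {})"

definition kgraph_morphism ::
    "('a, 'k::finite) kgraph \<Rightarrow> ('b, 'k) kgraph \<Rightarrow> ('a \<Rightarrow> 'b) \<Rightarrow> bool" where
  "kgraph_morphism K L x \<longleftrightarrow>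
     x \<in> mor K \<rightarrow> mor L
   \<and> (\<forall>a\<in>mor K. rng L (x a) = x (rng K a) \<and> src L (x a) = x (src K a) \<and> deg L (x a) = deg K a)
   \<and> (\<forall>a\<in>mor K. \<forall>b\<in>mor K. src K a = rng K b \<longrightarrow> x (cmp K a b) = cmp L (x a) (x b))"

text \<open>The vertex \<open>p\<close> of \<open>\<Omega>\<^sub>k\<close> is the identity morphism \<open>(p, p)\<close>.\<close>

definition Omega :: "((nat ^ 'k) \<times> (nat ^ 'k), 'k::finite) kgraph" where
  "Omega = \<lparr> mor = {(p, q). p \<le> q},
             cmp = (\<lambda>(p, q) (q', m). (p, m)),
             rng = (\<lambda>(p, q). (p, p)),
             src = (\<lambda>(p, q). (q, q)),
             deg = (\<lambda>(p, q). q - p) \<rparr>"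

type_synonym ('a, 'k) path = "(nat ^ 'k) \<times> (nat ^ 'k) \<Rightarrow> 'a"

text \<open>Infinite paths are extensional functions, so that HOL equality is equality of functors.\<close>

definition infinite_paths :: "('a, 'k::finite) kgraph \<Rightarrow> ('a, 'k) path set" where
  "infinite_paths L = {x \<in> extensional (mor Omega). kgraph_morphism Omega L x}"

definition cylinder :: "('a, 'k::finite) kgraph \<Rightarrow> 'a \<Rightarrow> ('a, 'k) path set" where
  "cylinder L l = {x \<in> infinite_paths L. x (0, deg L l) = l}"

definition path_topology :: "('a, 'k::finite) kgraph \<Rightarrow> ('a, 'k) path topology" where
  "path_topology L = topology_generated_by (cylinder L ` mor L)"

definition shift :: "nat ^ 'k \<Rightarrow> ('a, 'k::finite) path \<Rightarrow> ('a, 'k) path" where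
  "shift p x = restrict (\<lambda>(m, n). x (m + p, n + p)) (mor Omega)"

definition aperiodic :: "('a, 'k::finite) kgraph \<Rightarrow> bool" where
  "aperiodic L \<longleftrightarrow>
     (\<forall>v\<in>vertices L. \<exists>x\<in>cylinder L v. \<forall>m n. m \<noteq> n \<longrightarrow> shift m x \<noteq> shift n x)"

section \<open>The Perron-Frobenius measure\<close>

definition vertex_matrix :: "('a, 'k::finite) kgraph \<Rightarrow> 'k \<Rightarrow> 'a \<Rightarrow> 'a \<Rightarrow> nat" where
  "vertex_matrix L i v w =
     card {l \<in> mor L. deg L l = axis i 1 \<and> rng L l = v \<and> src L l = w}"

text \<open>
  The spectral radius in the library is defined for matrices indexed by an initial segment of the
  natural numbers, so the finite vertex set is enumerated; the result does not depend on the
  enumeration.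
\<close>

definition vertex_spectral_radius :: "('a, 'k::finite) kgraph \<Rightarrow> 'k \<Rightarrow> real" where
  "vertex_spectral_radius L i =
     (let n = card (vertices L); v = from_nat_into (vertices L)
      in spectral_radius (mat n n (\<lambda>(a, b). of_nat (vertex_matrix L i (v a) (v b)))))"

definition spectral_radius_power :: "('a, 'k::finite) kgraph \<Rightarrow> nat ^ 'k \<Rightarrow> real" where
  "spectral_radius_power L n = (\<Prod>i\<in>UNIV. vertex_spectral_radius L i ^ (n $ i))"

definition perron_frobenius_vector :: "('a, 'k::finite) kgraph \<Rightarrow> ('a \<Rightarrow> real) \<Rightarrow> bool" where
  "perron_frobenius_vector L x \<longleftrightarrow>
     (\<forall>v\<in>vertices L. x v > 0) \<and> (\<Sum>v\<in>vertices L. \<bar>x v\<bar>) = 1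
   \<and> (\<forall>i. \<forall>v\<in>vertices L. (\<Sum>w\<in>vertices L. real (vertex_matrix L i v w) * x w)
             = vertex_spectral_radius L i * x v)"

definition perron_frobenius_measure ::
    "('a, 'k::finite) kgraph \<Rightarrow> ('a, 'k) path measure \<Rightarrow> bool" where
  "perron_frobenius_measure L M \<longleftrightarrow>
     prob_space M
   \<and> space M = infinite_paths L
   \<and> sets M = sigma_sets (infinite_paths L) {U. openin (path_topology L) U}
   \<and> (\<exists>x. perron_frobenius_vector L x
        \<and> (\<forall>l\<in>mor L. measure M (cylinder L l)
              = inverse (spectral_radius_power L (deg L l)) * x (src L l)))"

section \<open>C*-algebras\<close>

text \<open>
  A C*-algebra is not required to have a unit; the field \<open>one\<close> inherited from
  \<^typ>\<open>(complex, 'a) module\<close> carries no meaning.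
\<close>

record 'a cstar = "(complex, 'a) module" +
  invol :: "'a \<Rightarrow> 'a"
  nrm :: "'a \<Rightarrow> real"

text \<open>
  The library's metric spaces require nonnegativity and symmetry of the distance off the carrier
  too.
\<close>

definition cstar_dist :: "'a cstar \<Rightarrow> 'a \<Rightarrow> 'a \<Rightarrow> real" where
  "cstar_dist A x y =
     (if x \<in> carrier A \<and> y \<in> carrier A then nrm A (x \<ominus>\<^bsub>A\<^esub> y) else 0)"

locale cstar_algebra = module "ring_of_type_algebra :: complex ring" A
  for A :: "'a cstar" (structure) +
  assumes mult_closed: "\<lbrakk>x \<in> carrier A; y \<in> carrier A\<rbrakk> \<Longrightarrow> x \<otimes> y \<in> carrier A"
    and mult_assoc: "\<lbrakk>x \<in> carrier A; y \<in> carrier A; z \<in> carrier A\<rbrakk>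
      \<Longrightarrow> (x \<otimes> y) \<otimes> z = x \<otimes> (y \<otimes> z)"
    and mult_add_left: "\<lbrakk>x \<in> carrier A; y \<in> carrier A; z \<in> carrier A\<rbrakk>
      \<Longrightarrow> (x \<oplus> y) \<otimes> z = x \<otimes> z \<oplus> y \<otimes> z"
    and mult_add_right: "\<lbrakk>x \<in> carrier A; y \<in> carrier A; z \<in> carrier A\<rbrakk>
      \<Longrightarrow> x \<otimes> (y \<oplus> z) = x \<otimes> y \<oplus> x \<otimes> z"
    and smult_mult_left: "\<lbrakk>x \<in> carrier A; y \<in> carrier A\<rbrakk> \<Longrightarrow> (c \<odot> x) \<otimes> y = c \<odot> (x \<otimes> y)"
    and smult_mult_right: "\<lbrakk>x \<in> carrier A; y \<in> carrier A\<rbrakk> \<Longrightarrow> x \<otimes> (c \<odot> y) = c \<odot> (x \<otimes> y)"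
    and invol_closed: "x \<in> carrier A \<Longrightarrow> invol A x \<in> carrier A"
    and invol_invol: "x \<in> carrier A \<Longrightarrow> invol A (invol A x) = x"
    and invol_add: "\<lbrakk>x \<in> carrier A; y \<in> carrier A\<rbrakk>
      \<Longrightarrow> invol A (x \<oplus> y) = invol A x \<oplus> invol A y"
    and invol_smult: "x \<in> carrier A \<Longrightarrow> invol A (c \<odot> x) = cnj c \<odot> invol A x"
    and invol_mult: "\<lbrakk>x \<in> carrier A; y \<in> carrier A\<rbrakk>
      \<Longrightarrow> invol A (x \<otimes> y) = invol A y \<otimes> invol A x"
    and nrm_nonneg: "x \<in> carrier A \<Longrightarrow> 0 \<le> nrm A x"
    and nrm_eq_0: "x \<in> carrier A \<Longrightarrow> nrm A x = 0 \<longleftrightarrow> x = \<zero>"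
    and nrm_triangle: "\<lbrakk>x \<in> carrier A; y \<in> carrier A\<rbrakk> \<Longrightarrow> nrm A (x \<oplus> y) \<le> nrm A x + nrm A y"
    and nrm_smult: "x \<in> carrier A \<Longrightarrow> nrm A (c \<odot> x) = cmod c * nrm A x"
    and nrm_mult: "\<lbrakk>x \<in> carrier A; y \<in> carrier A\<rbrakk> \<Longrightarrow> nrm A (x \<otimes> y) \<le> nrm A x * nrm A y"
    and cstar_identity: "x \<in> carrier A \<Longrightarrow> nrm A (invol A x \<otimes> x) = (nrm A x)\<^sup>2"
    and complete: "Metric_space.mcomplete (carrier A) (cstar_dist A)"

definition cstar_subalgebra :: "'a cstar \<Rightarrow> 'a set \<Rightarrow> bool" where
  "cstar_subalgebra A B \<longleftrightarrow>
     B \<subseteq> carrier A \<and> \<zero>\<^bsub>A\<^esub> \<in> B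
   \<and> (\<forall>x\<in>B. \<forall>y\<in>B. x \<oplus>\<^bsub>A\<^esub> y \<in> B \<and> x \<otimes>\<^bsub>A\<^esub> y \<in> B)
   \<and> (\<forall>x\<in>B. invol A x \<in> B \<and> (\<forall>c. c \<odot>\<^bsub>A\<^esub> x \<in> B))
   \<and> closedin (Metric_space.mtopology (carrier A) (cstar_dist A)) B"

definition generates_cstar :: "'a cstar \<Rightarrow> 'a set \<Rightarrow> bool" where
  "generates_cstar A S \<longleftrightarrow> (\<forall>B. cstar_subalgebra A B \<and> S \<subseteq> B \<longrightarrow> B = carrier A)"

definition star_hom :: "'a cstar \<Rightarrow> 'b cstar \<Rightarrow> ('a \<Rightarrow> 'b) \<Rightarrow> bool" where
  "star_hom A B f \<longleftrightarrow>
     f \<in> carrier A \<rightarrow> carrier B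
   \<and> (\<forall>x\<in>carrier A. \<forall>y\<in>carrier A.
        f (x \<oplus>\<^bsub>A\<^esub> y) = f x \<oplus>\<^bsub>B\<^esub> f y \<and> f (x \<otimes>\<^bsub>A\<^esub> y) = f x \<otimes>\<^bsub>B\<^esub> f y)
   \<and> (\<forall>x\<in>carrier A. f (invol A x) = invol B (f x) \<and> (\<forall>c. f (c \<odot>\<^bsub>A\<^esub> x) = c \<odot>\<^bsub>B\<^esub> f x))"

definition projection :: "'a cstar \<Rightarrow> 'a \<Rightarrow> bool" where
  "projection A p \<longleftrightarrow> p \<in> carrier A \<and> invol A p = p \<and> p \<otimes>\<^bsub>A\<^esub> p = p"

definition partial_isometry :: "'a cstar \<Rightarrow> 'a \<Rightarrow> bool" where
  "partial_isometry A t \<longleftrightarrow> t \<in> carrier A \<and> t \<otimes>\<^bsub>A\<^esub> invol A t \<otimes>\<^bsub>A\<^esub> t = t"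

section \<open>Cuntz-Krieger families and the C*-algebra of a higher-rank graph\<close>

definition cuntz_krieger_family ::
    "('a, 'k::finite) kgraph \<Rightarrow> 'b cstar \<Rightarrow> ('a \<Rightarrow> 'b) \<Rightarrow> bool" where
  "cuntz_krieger_family L B t \<longleftrightarrow>
     (\<forall>l\<in>mor L. partial_isometry B (t l))
   \<and> (\<forall>v\<in>vertices L. projection B (t v))
   \<and> (\<forall>v\<in>vertices L. \<forall>w\<in>vertices L. v \<noteq> w \<longrightarrow> t v \<otimes>\<^bsub>B\<^esub> t w = \<zero>\<^bsub>B\<^esub>)
   \<and> (\<forall>m\<in>mor L. \<forall>l\<in>mor L. src L m = rng L l \<longrightarrow> t m \<otimes>\<^bsub>B\<^esub> t l = t (cmp L m l))
   \<and> (\<forall>m\<in>mor L. invol B (t m) \<otimes>\<^bsub>B\<^esub> t m = t (src L m))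
   \<and> (\<forall>v\<in>vertices L. \<forall>n.
        t v = (\<Oplus>\<^bsub>B\<^esub>l\<in>{l \<in> mor L. deg L l = n \<and> rng L l = v}. t l \<otimes>\<^bsub>B\<^esub> invol B (t l)))"

text \<open>
  \<open>A\<close> is generated by a universal Cuntz-Krieger family \<open>s\<close>. HOL cannot quantify over all types, so
  the target algebras \<open>B\<close> range over all C*-algebras whose underlying set is a set of reals, with
  arbitrary operations. This loses nothing: a Cuntz-Krieger family is countable, so
  the C*-subalgebra it generates is separable, has at most the cardinality of the continuum, and
  is therefore isomorphic to a C*-algebra of this kind. The homomorphism is unique since \<open>s\<close>
  generates \<open>A\<close>.
\<close>

definition is_kgraph_cstar_algebra ::
    "('a, 'k::finite) kgraph \<Rightarrow> 'b cstar \<Rightarrow> ('a \<Rightarrow> 'b) \<Rightarrow> bool" where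
  "is_kgraph_cstar_algebra L A s \<longleftrightarrow>
     cstar_algebra A \<and> cuntz_krieger_family L A s \<and> generates_cstar A (s ` mor L)
   \<and> (\<forall>(B :: real cstar) t. cstar_algebra B \<and> cuntz_krieger_family L B t \<longrightarrow>
        (\<exists>f. star_hom A B f \<and> (\<forall>l\<in>mor L. f (s l) = t l)))"

section \<open>Operators on Hilbert space and representations\<close>

text \<open>
  Complex inner product spaces, with inner product linear in the first variable. The fields
  \<open>mult\<close> and \<open>one\<close> inherited from \<^typ>\<open>(complex, 'h) module\<close> carry no meaning.
\<close>

record 'h inner_space = "(complex, 'h) module" +
  ip :: "'h \<Rightarrow> 'h \<Rightarrow> complex"

definition ip_norm :: "'h inner_space \<Rightarrow> 'h \<Rightarrow> real" where
  "ip_norm H x = sqrt (Re (ip H x x))"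

definition bounded_operator :: "'h inner_space \<Rightarrow> ('h \<Rightarrow> 'h) \<Rightarrow> bool" where
  "bounded_operator H T \<longleftrightarrow>
     T \<in> carrier H \<rightarrow>\<^sub>E carrier H
   \<and> (\<forall>x\<in>carrier H. \<forall>y\<in>carrier H. T (x \<oplus>\<^bsub>H\<^esub> y) = T x \<oplus>\<^bsub>H\<^esub> T y)
   \<and> (\<forall>x\<in>carrier H. \<forall>c. T (c \<odot>\<^bsub>H\<^esub> x) = c \<odot>\<^bsub>H\<^esub> T x)
   \<and> (\<exists>C. \<forall>x\<in>carrier H. ip_norm H (T x) \<le> C * ip_norm H x)"

definition adjoint_operator :: "'h inner_space \<Rightarrow> ('h \<Rightarrow> 'h) \<Rightarrow> 'h \<Rightarrow> 'h" where
  "adjoint_operator H T =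
     (\<lambda>y\<in>carrier H. THE z. z \<in> carrier H \<and> (\<forall>x\<in>carrier H. ip H (T x) y = ip H x z))"

definition bounded_operators :: "'h inner_space \<Rightarrow> ('h \<Rightarrow> 'h) cstar" where
  "bounded_operators H =
     \<lparr> carrier = {T. bounded_operator H T},
       mult = (\<lambda>S T. \<lambda>x\<in>carrier H. S (T x)),
       one = (\<lambda>x\<in>carrier H. x),
       zero = (\<lambda>x\<in>carrier H. \<zero>\<^bsub>H\<^esub>),
       add = (\<lambda>S T. \<lambda>x\<in>carrier H. S x \<oplus>\<^bsub>H\<^esub> T x),
       smult = (\<lambda>c T. \<lambda>x\<in>carrier H. c \<odot>\<^bsub>H\<^esub> T x),
       invol = adjoint_operator H,
       nrm = (\<lambda>T. SUP x\<in>{x \<in> carrier H. ip_norm H x \<le> 1}. ip_norm H (T x)) \<rparr>"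

definition faithful_representation ::
    "'a cstar \<Rightarrow> 'h inner_space \<Rightarrow> ('a \<Rightarrow> 'h \<Rightarrow> 'h) \<Rightarrow> bool" where
  "faithful_representation A H \<pi> \<longleftrightarrow>
     star_hom A (bounded_operators H) \<pi> \<and> inj_on \<pi> (carrier A)"

text \<open>
  The Hilbert space of complex-valued square-integrable functions modulo equality almost
  everywhere. Values outside \<^term>\<open>space M\<close> are disregarded too.
\<close>

definition square_integrable :: "'x measure \<Rightarrow> ('x \<Rightarrow> complex) set" where
  "square_integrable M = {f \<in> borel_measurable M. integrable M (\<lambda>x. (cmod (f x))\<^sup>2)}"

definition ae_rel :: "'x measure \<Rightarrow> (('x \<Rightarrow> complex) \<times> ('x \<Rightarrow> complex)) set" where
  "ae_rel M = {(f, g). f \<in> square_integrable M \<and> g \<in> square_integrable M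
                \<and> (AE x in M. f x = g x)}"

definition L2 :: "'x measure \<Rightarrow> ('x \<Rightarrow> complex) set inner_space" where
  "L2 M =
     \<lparr> carrier = square_integrable M // ae_rel M,
       mult = undefined,
       one = undefined,
       zero = ae_rel M `` {\<lambda>_. 0},
       add = (\<lambda>F G. \<Union>f\<in>F. \<Union>g\<in>G. ae_rel M `` {\<lambda>x. f x + g x}),
       smult = (\<lambda>c F. \<Union>f\<in>F. ae_rel M `` {\<lambda>x. c * f x}),
       ip = (\<lambda>F G. the_elem (\<Union>f\<in>F. \<Union>g\<in>G. {LINT x|M. f x * cnj (g x)})) \<rparr>"

end

theory Submission
  imports Defs "HOL-Real_Asymp.Real_Asymp"
begin

text \<open>
  Each path \<open>\<lambda>\<close> acts on \<open>L\<^sup>2(\<Lambda>\<^sup>\<infinity>, M)\<close> by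
  \<open>T\<^sub>\<lambda> f = \<rho>(\<Lambda>)\<^bsup>d(\<lambda>)/2\<^esup> \<chi>\<^bsub>Z(\<lambda>)\<^esub> (f \<circ> \<sigma>\<^bsup>d(\<lambda>)\<^esup>)\<close>. The shift carries \<open>M\<close> restricted to \<open>Z(\<lambda>)\<close> to
  \<open>\<rho>(\<Lambda>)\<^bsup>-d(\<lambda>)\<^esup> M\<close> restricted to \<open>Z(s(\<lambda>))\<close>, so these operators form a Cuntz-Krieger family, and
  \<open>T\<^sub>v \<noteq> 0\<close> because \<open>M (Z(v)) = x\<^sub>v > 0\<close>. The universal property yields a representation \<open>\<pi>\<close>; as
  the property only concerns algebras of reals, a separable target is first transported there.

  Injectivity of \<open>\<pi>\<close> is the Cuntz-Krieger uniqueness theorem, proved without the gauge action. Let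
  \<open>p(a) = \<parallel>\<pi>(a)\<parallel>\<close>. Cutting with the projections built from a long initial segment of an aperiodic
  path kills all terms \<open>s\<^sub>\<mu> s\<^sub>\<nu>\<^sup>*\<close> of a finite sum \<open>a\<close> except those with one prescribed difference
  \<open>d(\<mu>) - d(\<nu>)\<close>, and is isometric up to a constant on what remains; hence every homogeneous
  component of \<open>a\<close> has norm at most \<open>p(a)\<close>. The powers \<open>(a\<^sup>* a)\<^sup>N\<close> have only polynomially many
  homogeneous components in \<open>N\<close>, so the C*-identity applied to iterated squares gives
  \<open>\<parallel>a\<parallel> \<le> p(a)\<close> on a dense subalgebra, and \<open>\<pi>\<close> is isometric.
\<close>

section \<open>C*-algebras\<close>

text \<open>(CK4) only says that the range projections of one degree add up to a vertex projection;
  that the summands are mutually orthogonal, on which every product formula rests, has to be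
  derived. All C*-theory is drawn from the norm axioms, for algebras that may have no unit, without
  spectrum, order or functional calculus: orthogonality comes from an extreme point argument,
  contractivity of homomorphisms from a square root supplied by Banach's fixed point theorem. In the
  uniqueness theorem the seminorm controls an element of fixed degrees only entry by entry, which
  costs the squared number of paths. This constant is the same for all powers of the element, so
  iterated squares remove it; squares are used because the C*-identity evaluates their norms
  exactly. The components of a general element are indexed by degree differences and not by pairs of
  degrees: degrees of terms may grow without control, while differences add under multiplication and
  can be counted.\<close>

lemma ring_of_type_algebra_simps [simp]:
  "carrier ring_of_type_algebra = UNIV"
  "x \<oplus>\<^bsub>ring_of_type_algebra\<^esub> y = x + y"
  "x \<otimes>\<^bsub>ring_of_type_algebra\<^esub> y = x * y"
  "\<zero>\<^bsub>ring_of_type_algebra\<^esub> = 0"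
  "\<one>\<^bsub>ring_of_type_algebra\<^esub> = 1"
  by (simp_all add: ring_of_type_algebra_def)

text \<open>The record extension is left open so that C*-algebras and inner product spaces share one
  vector space calculus.\<close>

locale complex_module = module "ring_of_type_algebra :: complex ring" A
  for A :: "(complex, 'a, 'm) module_scheme" (structure)
begin

lemma scale_closed [simp, intro]: "x \<in> carrier A \<Longrightarrow> c \<odot> x \<in> carrier A"
  by simp

lemma scale_add_left: "x \<in> carrier A \<Longrightarrow> (c + d) \<odot> x = c \<odot> x \<oplus> d \<odot> x"
  using smult_l_distr[of c d x] by simp

lemma scale_add_right: "x \<in> carrier A \<Longrightarrow> y \<in> carrier A \<Longrightarrow> c \<odot> (x \<oplus> y) = c \<odot> x \<oplus> c \<odot> y"
  using smult_r_distr[of c x y] by simp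

lemma scale_scale: "x \<in> carrier A \<Longrightarrow> c \<odot> (d \<odot> x) = (c * d) \<odot> x"
  using smult_assoc1[of c d x] by simp

lemma scale_one [simp]: "x \<in> carrier A \<Longrightarrow> 1 \<odot> x = x"
  using smult_one[of x] by simp

lemma scale_zero_left [simp]: "x \<in> carrier A \<Longrightarrow> 0 \<odot> x = \<zero>"
  using smult_l_null[of x] by simp

lemma scale_zero_right [simp]: "c \<odot> \<zero> = \<zero>"
  using smult_r_null[of c] by simp

lemma uminus_scale: "x \<in> carrier A \<Longrightarrow> \<ominus> x = (-1) \<odot> x"
  using scale_add_left[of x 1 "-1"] M.minus_equality[of "(-1) \<odot> x" x]
  by (simp add: M.a_comm)

lemma minus_scale: "x \<in> carrier A \<Longrightarrow> y \<in> carrier A \<Longrightarrow> x \<ominus> y = x \<oplus> (-1) \<odot> y"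
  by (simp add: a_minus_def uminus_scale)

lemma scale_collect:
  assumes "x \<in> carrier A"
  shows "c \<odot> x \<oplus> d \<odot> x = (c + d) \<odot> x"
    "x \<oplus> d \<odot> x = (1 + d) \<odot> x"
    "c \<odot> x \<oplus> x = (c + 1) \<odot> x"
    "x \<oplus> x = 2 \<odot> x"
  using assms scale_add_left[of x 1 1] scale_add_left[of x c 1] scale_add_left[of x 1 d]
  by (simp_all add: scale_add_left)

text \<open>Together with \<open>scale_collect\<close> this settles linear identities by rewriting:
  \<open>M.a_ac\<close> sorts a sum, multiples of one vector become neighbours, and their
  coefficients are added. The last rule cancels a pair that sorting leaves separated.\<close>

lemma scale_collect_left:
  assumes "x \<in> carrier A" "y \<in> carrier A"
  shows "c \<odot> x \<oplus> (d \<odot> x \<oplus> y) = (c + d) \<odot> x \<oplus> y"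
    "x \<oplus> (d \<odot> x \<oplus> y) = (1 + d) \<odot> x \<oplus> y"
    "c \<odot> x \<oplus> (x \<oplus> y) = (c + 1) \<odot> x \<oplus> y"
    "x \<oplus> (x \<oplus> y) = 2 \<odot> x \<oplus> y"
    "c \<odot> x \<oplus> (y \<oplus> (- c) \<odot> x) = y"
  using assms by (simp_all add: M.a_assoc[symmetric] scale_collect)
    (simp add: M.a_comm[of _ y] M.a_assoc scale_collect)

lemma finsum_scale:
  assumes "f \<in> I \<rightarrow> carrier A"
  shows "c \<odot> (\<Oplus>i\<in>I. f i) = (\<Oplus>i\<in>I. c \<odot> f i)"
  using assms
  by (induction I rule: infinite_finite_induct)
    (auto simp: M.finsum_infinite M.finsum_insert scale_add_right Pi_iff)

end

text \<open>The norm axioms without completeness: the metric has to be available before completeness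
  of the transported algebra and of the operator algebra can be proved.\<close>

locale normed_module = complex_module A for A :: "'a cstar" (structure) +
  assumes n_nonneg: "x \<in> carrier A \<Longrightarrow> 0 \<le> nrm A x"
    and n_eq_0: "x \<in> carrier A \<Longrightarrow> nrm A x = 0 \<longleftrightarrow> x = \<zero>"
    and n_triangle: "\<lbrakk>x \<in> carrier A; y \<in> carrier A\<rbrakk> \<Longrightarrow> nrm A (x \<oplus> y) \<le> nrm A x + nrm A y"
    and n_smult: "x \<in> carrier A \<Longrightarrow> nrm A (c \<odot> x) = cmod c * nrm A x"
begin

lemma nrm_zero [simp]: "nrm A \<zero> = 0"
  using n_eq_0[of \<zero>] by simp

lemma nrm_minus_commute:
  assumes "x \<in> carrier A" "y \<in> carrier A"
  shows "nrm A (x \<ominus> y) = nrm A (y \<ominus> x)"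
proof -
  have "x \<ominus> y = (-1) \<odot> (y \<ominus> x)"
    using assms by (simp add: minus_scale scale_add_right scale_scale M.a_comm)
  then show ?thesis
    using assms n_smult[of "y \<ominus> x" "-1"] by simp
qed

lemma minus_add_minus:
  assumes "x \<in> carrier A" "y \<in> carrier A" "z \<in> carrier A"
  shows "(x \<ominus> y) \<oplus> (y \<ominus> z) = x \<ominus> z"
  using assms by (simp add: minus_scale M.a_assoc scale_collect scale_collect_left)

lemma nrm_minus_triangle:
  assumes "x \<in> carrier A" "y \<in> carrier A" "z \<in> carrier A"
  shows "nrm A (x \<ominus> z) \<le> nrm A (x \<ominus> y) + nrm A (y \<ominus> z)"
  using n_triangle[of "x \<ominus> y" "y \<ominus> z"] assms by (simp add: minus_add_minus)

lemma nrm_le_minus: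
  assumes "x \<in> carrier A" "y \<in> carrier A"
  shows "nrm A x \<le> nrm A y + nrm A (x \<ominus> y)"
proof -
  have "x = y \<oplus> (x \<ominus> y)"
    using assms by (simp add: minus_scale M.a_ac scale_collect scale_collect_left)
  then show ?thesis
    using n_triangle[of y "x \<ominus> y"] assms by simp
qed

lemma nrm_minus_eq_0:
  assumes "x \<in> carrier A" "y \<in> carrier A"
  shows "nrm A (x \<ominus> y) = 0 \<longleftrightarrow> x = y"
  using assms by (simp add: n_eq_0)

lemma metric: "Metric_space (carrier A) (cstar_dist A)"
proof
  show "0 \<le> cstar_dist A x y" for x y
    by (simp add: cstar_dist_def n_nonneg)
  show "cstar_dist A x y = cstar_dist A y x" for x y
    by (simp add: cstar_dist_def nrm_minus_commute)
  show "cstar_dist A x y = 0 \<longleftrightarrow> x = y" if "x \<in> carrier A" "y \<in> carrier A" for x y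
    using that by (simp add: cstar_dist_def nrm_minus_eq_0)
  show "cstar_dist A x z \<le> cstar_dist A x y + cstar_dist A y z"
    if "x \<in> carrier A" "y \<in> carrier A" "z \<in> carrier A" for x y z
    using that by (simp add: cstar_dist_def nrm_minus_triangle)
qed

end

sublocale cstar_algebra \<subseteq> normed_module A
  by unfold_locales (fact nrm_nonneg nrm_eq_0 nrm_triangle nrm_smult)+

lemma closed_of_limits:
  assumes "Metric_space S d"
  shows "closedin (Metric_space.mtopology S d) B \<longleftrightarrow>
    B \<subseteq> S \<and> (\<forall>u l. range u \<subseteq> B \<and> l \<in> S \<and> (\<lambda>n. d (u n) l) \<longlonglongrightarrow> 0 \<longrightarrow> l \<in> B)"
proof -
  interpret Metric_space S d by fact
  have "limitin mtopology u l sequentially \<longleftrightarrow> l \<in> S \<and> (\<lambda>n. d (u n) l) \<longlonglongrightarrow> 0"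
    if "range u \<subseteq> B" "B \<subseteq> S" for u l
    using that by (auto simp: limitin_metric_dist_null intro!: always_eventually)
  then show ?thesis
    unfolding metric_closedin_iff_sequentially_closed by blast
qed

lemma le_one_of_power2_le: "x \<le> 1" if "x\<^sup>2 \<le> x" for x :: real
proof (rule ccontr)
  assume "\<not> x \<le> 1"
  then have "x * 1 < x * x" by (intro mult_strict_left_mono) auto
  then show False using that by (simp add: power2_eq_square)
qed

context cstar_algebra
begin

lemmas mult_closed' [simp, intro] = mult_closed

lemmas invol_closed' [simp, intro] = invol_closed

lemmas invol_invol' [simp] = invol_invol

lemma zero_mult [simp]: "x \<in> carrier A \<Longrightarrow> \<zero> \<otimes> x = \<zero>"
  using smult_mult_left[of \<zero> x 0] by simp

lemma mult_zero [simp]: "x \<in> carrier A \<Longrightarrow> x \<otimes> \<zero> = \<zero>"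
  using smult_mult_right[of x \<zero> 0] by simp

lemma invol_zero [simp]: "invol A \<zero> = \<zero>"
  using invol_smult[of \<zero> 0] by simp

definition converges :: "(nat \<Rightarrow> 'a) \<Rightarrow> 'a \<Rightarrow> bool" where
  "converges u l \<longleftrightarrow> range u \<subseteq> carrier A \<and> l \<in> carrier A \<and> (\<lambda>n. nrm A (u n \<ominus> l)) \<longlonglongrightarrow> 0"

lemma closed_iff:
  "closedin (Metric_space.mtopology (carrier A) (cstar_dist A)) B \<longleftrightarrow>
    B \<subseteq> carrier A \<and> (\<forall>u l. range u \<subseteq> B \<and> converges u l \<longrightarrow> l \<in> B)"
proof -
  have "(\<lambda>n. cstar_dist A (u n) l) \<longlonglongrightarrow> 0 \<longleftrightarrow> (\<lambda>n. nrm A (u n \<ominus> l)) \<longlonglongrightarrow> 0"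
    if "range u \<subseteq> carrier A" "l \<in> carrier A" for u l
    using that by (auto simp: cstar_dist_def image_subset_iff)
  then show ?thesis
    unfolding closed_of_limits[OF metric] converges_def by (meson subset_trans)
qed

lemma nrm_invol:
  assumes "x \<in> carrier A"
  shows "nrm A (invol A x) = nrm A x"
proof -
  have *: "nrm A x \<le> nrm A (invol A x)" if x: "x \<in> carrier A" for x
  proof (cases "nrm A x = 0")
    case False
    have "nrm A x * nrm A x \<le> nrm A (invol A x) * nrm A x"
      using cstar_identity[OF x] nrm_mult[of "invol A x" x] x by (simp add: power2_eq_square)
    then show ?thesis
      using False nrm_nonneg[OF x] by (simp add: mult_le_cancel_right)
  qed (use nrm_nonneg x in auto)
  show ?thesis
    using *[OF assms] *[of "invol A x"] assms by simp
qed

lemma converges_dist_le: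
  assumes "converges u l" "range v \<subseteq> carrier A" "m \<in> carrier A"
    and "\<And>n. nrm A (v n \<ominus> m) \<le> C * nrm A (u n \<ominus> l)"
  shows "converges v m"
proof -
  have "(\<lambda>n. C * nrm A (u n \<ominus> l)) \<longlonglongrightarrow> C * 0"
    using assms(1) by (intro tendsto_intros) (simp add: converges_def)
  then have "(\<lambda>n. nrm A (v n \<ominus> m)) \<longlonglongrightarrow> 0"
    using assms(2-4)
    by (intro Lim_null_comparison[OF always_eventually, of "\<lambda>n. nrm A (v n \<ominus> m)" "\<lambda>n. C * nrm A (u n \<ominus> l)"]) (auto simp: nrm_nonneg image_subset_iff)
  then show ?thesis using assms by (simp add: converges_def)
qed

lemma converges_unique:
  assumes "converges u l" "converges u m"
  shows "l = m"
proof -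
  have c: "l \<in> carrier A" "m \<in> carrier A" "\<And>n. u n \<in> carrier A"
    using assms by (auto simp: converges_def)
  have "(\<lambda>n. nrm A (u n \<ominus> l) + nrm A (u n \<ominus> m)) \<longlonglongrightarrow> 0 + 0"
    using assms by (intro tendsto_intros) (auto simp: converges_def)
  moreover have "nrm A (l \<ominus> m) \<le> nrm A (u n \<ominus> l) + nrm A (u n \<ominus> m)" for n
    using nrm_minus_triangle[of l "u n" m] c nrm_minus_commute[of l "u n"] by simp
  ultimately have "nrm A (l \<ominus> m) \<le> 0"
    by (intro tendsto_lowerbound[of "\<lambda>n. nrm A (u n \<ominus> l) + nrm A (u n \<ominus> m)"]) auto
  then show ?thesis
    using nrm_nonneg[of "l \<ominus> m"] nrm_minus_eq_0[of l m] c by simp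
qed

lemma converges_invol:
  assumes "converges u l"
  shows "converges (\<lambda>n. invol A (u n)) (invol A l)"
proof -
  have c: "l \<in> carrier A" "\<And>n. u n \<in> carrier A"
    using assms by (auto simp: converges_def)
  have "invol A x \<ominus> invol A l = invol A (x \<ominus> l)" if "x \<in> carrier A" for x
    using that c by (simp add: minus_scale invol_add invol_smult)
  then show ?thesis
    using c by (intro converges_dist_le[OF assms, of _ _ 1]) (auto simp: nrm_invol)
qed

lemma mult_minus_right:
  "x \<in> carrier A \<Longrightarrow> y \<in> carrier A \<Longrightarrow> z \<in> carrier A \<Longrightarrow> x \<otimes> y \<ominus> x \<otimes> z = x \<otimes> (y \<ominus> z)"
  by (simp add: minus_scale mult_add_right smult_mult_right)

lemma mult_minus_left:
  "x \<in> carrier A \<Longrightarrow> y \<in> carrier A \<Longrightarrow> z \<in> carrier A \<Longrightarrow> y \<otimes> x \<ominus> z \<otimes> x = (y \<ominus> z) \<otimes> x"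
  by (simp add: minus_scale mult_add_left smult_mult_left)

lemma converges_mult_left:
  assumes "converges u l" "x \<in> carrier A"
  shows "converges (\<lambda>n. x \<otimes> u n) (x \<otimes> l)"
proof -
  have c: "l \<in> carrier A" "\<And>n. u n \<in> carrier A"
    using assms by (auto simp: converges_def)
  then show ?thesis
    using assms(2)
    by (intro converges_dist_le[OF assms(1), of _ _ "nrm A x"]) (auto simp: mult_minus_right nrm_mult)
qed

lemma converges_mult_right:
  assumes "converges u l" "x \<in> carrier A"
  shows "converges (\<lambda>n. u n \<otimes> x) (l \<otimes> x)"
proof -
  have c: "l \<in> carrier A" "\<And>n. u n \<in> carrier A"
    using assms by (auto simp: converges_def)
  then show ?thesis
    using assms(2)
    by (intro converges_dist_le[OF assms(1), of _ _ "nrm A x"])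
      (auto simp: mult_minus_left nrm_mult mult.commute[of "nrm A x"])
qed

lemma add_minus_add:
  assumes "a \<in> carrier A" "b \<in> carrier A" "c \<in> carrier A" "d \<in> carrier A"
  shows "(a \<oplus> b) \<ominus> (c \<oplus> d) = (a \<ominus> c) \<oplus> (b \<ominus> d)"
  using assms by (simp add: minus_scale scale_add_right M.a_ac)

lemma converges_nrm_le:
  assumes "converges u l" "\<And>n. nrm A (u n) \<le> C"
  shows "nrm A l \<le> C"
proof -
  have c: "l \<in> carrier A" "\<And>n. u n \<in> carrier A"
    using assms by (auto simp: converges_def)
  have "(\<lambda>n. C + nrm A (u n \<ominus> l)) \<longlonglongrightarrow> C + 0"
    using assms by (intro tendsto_intros) (auto simp: converges_def)
  moreover have "nrm A l \<le> C + nrm A (u n \<ominus> l)" for n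
    using nrm_le_minus[of l "u n"] c nrm_minus_commute[of l "u n"] assms(2)[of n] by simp
  ultimately show ?thesis
    by (intro tendsto_lowerbound[of "\<lambda>n. C + nrm A (u n \<ominus> l)"]) auto
qed

lemma finsum_mult_left:
  assumes "f \<in> I \<rightarrow> carrier A" "x \<in> carrier A"
  shows "x \<otimes> (\<Oplus>i\<in>I. f i) = (\<Oplus>i\<in>I. x \<otimes> f i)"
  using assms
  by (induction I rule: infinite_finite_induct)
    (auto simp: M.finsum_infinite M.finsum_insert mult_add_right Pi_iff)

lemma finsum_mult_right:
  assumes "f \<in> I \<rightarrow> carrier A" "x \<in> carrier A"
  shows "(\<Oplus>i\<in>I. f i) \<otimes> x = (\<Oplus>i\<in>I. f i \<otimes> x)"
  using assms
  by (induction I rule: infinite_finite_induct)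
    (auto simp: M.finsum_infinite M.finsum_insert mult_add_left Pi_iff)

lemma invol_finsum:
  assumes "f \<in> I \<rightarrow> carrier A"
  shows "invol A (\<Oplus>i\<in>I. f i) = (\<Oplus>i\<in>I. invol A (f i))"
  using assms
  by (induction I rule: infinite_finite_induct)
    (auto simp: M.finsum_infinite M.finsum_insert invol_add Pi_iff)

lemma nrm_finsum:
  assumes "f \<in> I \<rightarrow> carrier A"
  shows "nrm A (\<Oplus>i\<in>I. f i) \<le> (\<Sum>i\<in>I. nrm A (f i))"
  using assms
proof (induction I rule: infinite_finite_induct)
  case (insert i I)
  then have "f i \<in> carrier A" "f \<in> I \<rightarrow> carrier A" by auto
  then show ?case
    using insert nrm_triangle[of "f i" "\<Oplus>i\<in>I. f i"] by (simp add: M.finsum_insert)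
qed (auto simp: M.finsum_infinite)

lemma nrm_projection_le:
  assumes "x \<in> carrier A" "invol A x \<otimes> x = x"
  shows "nrm A x \<le> 1"
proof -
  have "nrm A x = (nrm A x)\<^sup>2"
    using cstar_identity[OF assms(1)] assms(2) by simp
  then show ?thesis
    by (intro le_one_of_power2_le) simp
qed

lemma nrm_minus_self: "x \<in> carrier A \<Longrightarrow> nrm A (x \<ominus> x) = 0"
  by (simp add: nrm_minus_eq_0)

section \<open>Norm closures of sets of algebra elements\<close>

definition closure_set :: "'a set \<Rightarrow> 'a set" where
  "closure_set C = {x \<in> carrier A. \<forall>e>0. \<exists>y\<in>C. nrm A (x \<ominus> y) < e}"

lemma closure_set_subset: "C \<subseteq> carrier A \<Longrightarrow> C \<subseteq> closure_set C"
  using nrm_minus_self by (force simp: closure_set_def)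

lemma closure_set_approx:
  assumes "x \<in> carrier A" "\<And>e. 0 < e \<Longrightarrow> \<exists>y\<in>closure_set C. nrm A (x \<ominus> y) < e" "C \<subseteq> carrier A"
  shows "x \<in> closure_set C"
  unfolding closure_set_def
proof (intro CollectI conjI allI impI)
  fix e :: real assume e: "0 < e"
  obtain y where y: "y \<in> closure_set C" "nrm A (x \<ominus> y) < e / 2"
    using assms(2)[of "e / 2"] e by auto
  obtain z where z: "z \<in> C" "nrm A (y \<ominus> z) < e / 2"
    using y(1) e unfolding closure_set_def by (auto dest: spec[of _ "e / 2"])
  have "nrm A (x \<ominus> z) \<le> nrm A (x \<ominus> y) + nrm A (y \<ominus> z)"
    using assms y z by (intro nrm_minus_triangle) (auto simp: closure_set_def)
  then show "\<exists>y\<in>C. nrm A (x \<ominus> y) < e" using y z by (intro bexI[of _ z]) auto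
qed (rule assms)

text \<open>Scalar multiples have to be reached only approximately, so that a countable set closed
  under rational scalars also qualifies.\<close>

lemma closure_set_subalgebra:
  assumes C: "C \<subseteq> carrier A" "\<zero> \<in> C"
    and add: "\<And>x y. x \<in> C \<Longrightarrow> y \<in> C \<Longrightarrow> x \<oplus> y \<in> C"
    and mult: "\<And>x y. x \<in> C \<Longrightarrow> y \<in> C \<Longrightarrow> x \<otimes> y \<in> C"
    and inv: "\<And>x. x \<in> C \<Longrightarrow> invol A x \<in> C"
    and scale: "\<And>x c e. x \<in> C \<Longrightarrow> 0 < e \<Longrightarrow> \<exists>y\<in>C. nrm A (c \<odot> x \<ominus> y) < e"
  shows "cstar_subalgebra A (closure_set C)"
proof -
  let ?D = "closure_set C"
  have D: "?D \<subseteq> carrier A" by (auto simp: closure_set_def)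
  have half: "u * k < e / 2" if "u < e / (2 * k)" "0 < k" for u e k :: real
    using that by (simp add: pos_less_divide_eq algebra_simps)
  have near: "\<exists>y\<in>C. nrm A (x \<ominus> y) < e" if "x \<in> ?D" "0 < e" for x e
    using that by (auto simp: closure_set_def)
  have add': "x \<oplus> y \<in> ?D" if xy: "x \<in> ?D" "y \<in> ?D" for x y
    unfolding closure_set_def
  proof (intro CollectI conjI allI impI)
    fix e :: real assume "0 < e"
    then obtain a b where ab: "a \<in> C" "nrm A (x \<ominus> a) < e / 2" "b \<in> C" "nrm A (y \<ominus> b) < e / 2"
      using near[OF xy(1), of "e / 2"] near[OF xy(2), of "e / 2"] by auto
    have c: "a \<in> carrier A" "b \<in> carrier A" "x \<in> carrier A" "y \<in> carrier A"
      using ab C D xy by auto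
    have "nrm A ((x \<oplus> y) \<ominus> (a \<oplus> b)) \<le> nrm A (x \<ominus> a) + nrm A (y \<ominus> b)"
      using c by (simp add: add_minus_add nrm_triangle)
    then show "\<exists>z\<in>C. nrm A ((x \<oplus> y) \<ominus> z) < e"
      using ab add by (intro bexI[of _ "a \<oplus> b"]) auto
  qed (use D xy in auto)
  have mult': "x \<otimes> y \<in> ?D" if xy: "x \<in> ?D" "y \<in> ?D" for x y
    unfolding closure_set_def
  proof (intro CollectI conjI allI impI)
    fix e :: real assume e: "0 < e"
    have xyc: "x \<in> carrier A" "y \<in> carrier A" using D xy by auto
    have ny: "0 < nrm A y + 1" using nrm_nonneg[OF xyc(2)] by simp
    obtain a where a: "a \<in> C" "nrm A (x \<ominus> a) < e / (2 * (nrm A y + 1))"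
      using near[OF xy(1), of "e / (2 * (nrm A y + 1))"] e ny by auto
    then have ac: "a \<in> carrier A" using C by auto
    have na: "0 < nrm A a + 1" using nrm_nonneg[OF ac] by simp
    \<comment> \<open>\<open>b\<close> is chosen after \<open>a\<close>, because its tolerance
      depends on the norm of \<open>a\<close>; the summands 1 keep the denominators
      positive.\<close>
    obtain b where b: "b \<in> C" "nrm A (y \<ominus> b) < e / (2 * (nrm A a + 1))"
      using near[OF xy(2), of "e / (2 * (nrm A a + 1))"] e na by auto
    then have bc: "b \<in> carrier A" using C by auto
    have "x \<otimes> y \<ominus> a \<otimes> b = (x \<ominus> a) \<otimes> y \<oplus> a \<otimes> (y \<ominus> b)"
      using xyc ac bc by (simp add: minus_add_minus flip: mult_minus_left mult_minus_right)
    then have "nrm A (x \<otimes> y \<ominus> a \<otimes> b) \<le> nrm A (x \<ominus> a) * nrm A y + nrm A a * nrm A (y \<ominus> b)"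
      using xyc ac bc nrm_triangle[of "(x \<ominus> a) \<otimes> y" "a \<otimes> (y \<ominus> b)"]
        nrm_mult[of "x \<ominus> a" y] nrm_mult[of a "y \<ominus> b"] by simp
    also have "\<dots> \<le> nrm A (x \<ominus> a) * (nrm A y + 1) + (nrm A a + 1) * nrm A (y \<ominus> b)"
      using xyc ac bc by (intro add_mono mult_left_mono mult_right_mono) (auto simp: nrm_nonneg)
    also have "\<dots> < e / 2 + e / 2"
      using half[OF a(2) ny] half[OF b(2) na] by (simp add: mult.commute)
    finally show "\<exists>z\<in>C. nrm A (x \<otimes> y \<ominus> z) < e"
      using mult[OF a(1) b(1)] by (intro bexI[of _ "a \<otimes> b"]) auto
  qed (use D xy in auto)
  have inv': "invol A x \<in> ?D" if x: "x \<in> ?D" for x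
    unfolding closure_set_def
  proof (intro CollectI conjI allI impI)
    fix e :: real assume e: "0 < e"
    obtain a where a: "a \<in> C" "nrm A (x \<ominus> a) < e" using near[OF x e] by auto
    then have c: "a \<in> carrier A" "x \<in> carrier A" using C D x by auto
    then have "invol A x \<ominus> invol A a = invol A (x \<ominus> a)"
      by (simp add: minus_scale invol_add invol_smult)
    then have "nrm A (invol A x \<ominus> invol A a) = nrm A (x \<ominus> a)" using c by (simp add: nrm_invol)
    then show "\<exists>z\<in>C. nrm A (invol A x \<ominus> z) < e"
      using a inv by (intro bexI[of _ "invol A a"]) auto
  qed (use D x in auto)
  have scale': "c \<odot> x \<in> ?D" if x: "x \<in> ?D" for x c
    unfolding closure_set_def
  proof (intro CollectI conjI allI impI)
    fix e :: real assume e: "0 < e"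
    have pos: "0 < e / (2 * (cmod c + 1))"
      using e by (intro divide_pos_pos) (auto intro: add_nonneg_pos)
    obtain a where a: "a \<in> C" "nrm A (x \<ominus> a) < e / (2 * (cmod c + 1))"
      using near[OF x pos] by auto
    then have ac: "a \<in> carrier A" "x \<in> carrier A" using C D x by auto
    obtain b where b: "b \<in> C" "nrm A (c \<odot> a \<ominus> b) < e / 2"
      using scale[OF a(1), of "e / 2" c] e by auto
    have "c \<odot> x \<ominus> c \<odot> a = c \<odot> (x \<ominus> a)"
      using ac by (simp add: minus_scale scale_add_right scale_scale)
    then have "nrm A (c \<odot> x \<ominus> c \<odot> a) = cmod c * nrm A (x \<ominus> a)"
      using ac by (simp add: nrm_smult)
    also have "\<dots> \<le> (cmod c + 1) * nrm A (x \<ominus> a)"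
      using ac by (intro mult_right_mono) (auto simp: nrm_nonneg)
    also have "\<dots> < e / 2"
    proof -
      have "0 < cmod c + 1" by (simp add: add_nonneg_pos)
      then show ?thesis using half[OF a(2)] by (simp add: mult.commute)
    qed
    finally have "nrm A (c \<odot> x \<ominus> b) < e"
      using nrm_minus_triangle[of "c \<odot> x" "c \<odot> a" b] ac b C by auto
    then show "\<exists>z\<in>C. nrm A (c \<odot> x \<ominus> z) < e" using b by blast
  qed (use D x in auto)
  have "closedin (Metric_space.mtopology (carrier A) (cstar_dist A)) ?D"
    unfolding closed_iff
  proof (intro conjI allI impI)
    fix u l assume ul: "range u \<subseteq> ?D \<and> converges u l"
    then have l: "l \<in> carrier A" and lim: "(\<lambda>n. nrm A (u n \<ominus> l)) \<longlonglongrightarrow> 0"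
      by (auto simp: converges_def)
    show "l \<in> ?D"
    proof (rule closure_set_approx[OF l _ C(1)])
      fix e :: real assume "0 < e"
      then have "\<forall>\<^sub>F n in sequentially. nrm A (u n \<ominus> l) < e"
        using lim by (rule order_tendstoD(2)[rotated])
      then obtain n where "nrm A (u n \<ominus> l) < e" by (auto simp: eventually_sequentially)
      moreover have "u n \<in> ?D" using ul by auto
      ultimately show "\<exists>y\<in>?D. nrm A (l \<ominus> y) < e"
        using nrm_minus_commute[of l "u n"] l D by (intro bexI[of _ "u n"]) auto
    qed
  qed (rule D)
  moreover have "\<zero> \<in> ?D" using closure_set_subset[OF C(1)] C(2) by (rule subsetD)
  ultimately show ?thesis
    unfolding cstar_subalgebra_def
    by (intro conjI ballI allI) (simp_all add: D add' mult' inv' scale')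
qed

end

section \<open>Contractivity of *-homomorphisms\<close>

context cstar_algebra
begin

text \<open>Expanding \<open>(1 - d)^2 = 1 - x^2\<close> leaves an equation free of the unit:
  \<open>d\<close> is a fixed point of half of \<open>x x + d d\<close>. For
  \<open>r = nrm A x < 1\<close> this map contracts with factor \<open>r\<close> on the closed set
  \<open>S\<close>, so Banach's theorem delivers a \<open>d\<close> that is also self-adjoint and
  commutes with \<open>x\<close>.\<close>

lemma ex_sqrt_fixpoint:
  assumes x: "x \<in> carrier A" "invol A x = x" and lt: "nrm A x < 1"
  obtains d where "d \<in> carrier A" "invol A d = d" "d \<otimes> x = x \<otimes> d"
    "x \<otimes> x \<oplus> d \<otimes> d = 2 \<odot> d"
proof -
  define r where "r = nrm A x"
  have r: "0 \<le> r" "r < 1" using lt x by (auto simp: r_def nrm_nonneg)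
  define S where "S = {d \<in> carrier A. nrm A d \<le> r \<and> invol A d = d \<and> d \<otimes> x = x \<otimes> d}"
  define g where "g d = (1/2) \<odot> (x \<otimes> x \<oplus> d \<otimes> d)" for d
  interpret MS: Metric_space "carrier A" "cstar_dist A" by (rule metric)
  interpret Sub: Submetric "carrier A" "cstar_dist A" S
    by unfold_locales (auto simp: S_def)
  have "closedin MS.mtopology S"
    unfolding closed_iff
  proof (intro conjI allI impI)
    fix u l assume u: "range u \<subseteq> S \<and> converges u l"
    then have l: "l \<in> carrier A" and c: "converges u l" and uS: "\<And>n. u n \<in> S"
      by (auto simp: converges_def)
    have "nrm A l \<le> r"
      using uS by (intro converges_nrm_le[OF c]) (simp add: S_def)
    moreover have "invol A l = l"
      using converges_unique[OF converges_invol[OF c], of l] uS c by (simp add: S_def)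
    moreover have "l \<otimes> x = x \<otimes> l"
      using converges_unique[OF converges_mult_right[OF c x(1)], of "x \<otimes> l"]
        converges_mult_left[OF c x(1)] uS by (simp add: S_def)
    ultimately show "l \<in> S" using l by (simp add: S_def)
  qed (auto simp: S_def)
  then have comp: "Sub.sub.mcomplete"
    using Sub.closedin_mcomplete_imp_mcomplete complete by blast
  have gS: "g d \<in> S" if d: "d \<in> S" for d
  proof -
    have [simp]: "d \<in> carrier A" "invol A d = d" "d \<otimes> x = x \<otimes> d" "nrm A d \<le> r"
      using d by (auto simp: S_def)
    have "nrm A (x \<otimes> x \<oplus> d \<otimes> d) \<le> r * r + r * r"
      using nrm_triangle[of "x \<otimes> x" "d \<otimes> d"] nrm_mult[of x x] nrm_mult[of d d] x
        mult_mono[of "nrm A d" r "nrm A d" r] r by (simp add: nrm_nonneg flip: r_def)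
    then have "nrm A (g d) \<le> r * r"
      using x by (simp add: g_def nrm_smult)
    also have "\<dots> \<le> r"
      using r mult_left_le[of r r] by simp
    finally have "nrm A (g d) \<le> r" .
    moreover have "invol A (g d) = g d"
      using x by (simp add: g_def invol_smult invol_add invol_mult)
    moreover have "g d \<otimes> x = x \<otimes> g d"
    proof -
      have "d \<otimes> d \<otimes> x = x \<otimes> (d \<otimes> d)"
        using x mult_assoc[of d d x] mult_assoc[of d x d] mult_assoc[of x d d] by simp
      then show ?thesis
        using x by (simp add: g_def smult_mult_left smult_mult_right mult_add_left mult_add_right mult_assoc)
    qed
    ultimately show ?thesis
      using x by (simp add: S_def g_def)
  qed
  have con: "cstar_dist A (g d) (g e) \<le> r * cstar_dist A d e" if de: "d \<in> S" "e \<in> S" for d e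
  proof -
    have [simp]: "d \<in> carrier A" "e \<in> carrier A" "nrm A d \<le> r" "nrm A e \<le> r"
      using de by (auto simp: S_def)
    have "g d \<ominus> g e = (1/2) \<odot> ((d \<otimes> d) \<ominus> (e \<otimes> e))"
      using x by (simp add: g_def minus_scale scale_add_right scale_scale M.a_ac scale_collect scale_collect_left)
    also have "(d \<otimes> d) \<ominus> (e \<otimes> e) = d \<otimes> (d \<ominus> e) \<oplus> (d \<ominus> e) \<otimes> e"
      by (simp add: minus_scale mult_add_left mult_add_right smult_mult_left smult_mult_right
          M.a_ac scale_collect scale_collect_left)
    finally have eq: "g d \<ominus> g e = (1/2) \<odot> (d \<otimes> (d \<ominus> e) \<oplus> (d \<ominus> e) \<otimes> e)" .
    have "nrm A (d \<otimes> (d \<ominus> e)) \<le> r * nrm A (d \<ominus> e)"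
      using nrm_mult[of d "d \<ominus> e"] mult_right_mono[of "nrm A d" r "nrm A (d \<ominus> e)"]
      by (simp add: nrm_nonneg)
    moreover have "nrm A ((d \<ominus> e) \<otimes> e) \<le> r * nrm A (d \<ominus> e)"
      using nrm_mult[of "d \<ominus> e" e] mult_left_mono[of "nrm A e" r "nrm A (d \<ominus> e)"]
      by (simp add: nrm_nonneg mult.commute)
    ultimately have "nrm A (d \<otimes> (d \<ominus> e) \<oplus> (d \<ominus> e) \<otimes> e) \<le> 2 * (r * nrm A (d \<ominus> e))"
      using nrm_triangle[of "d \<otimes> (d \<ominus> e)" "(d \<ominus> e) \<otimes> e"] by simp
    then show ?thesis
      using gS[OF de(1)] gS[OF de(2)] by (simp add: cstar_dist_def S_def eq nrm_smult)
  qed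
  have "\<zero> \<in> S" using x r by (simp add: S_def)
  then obtain d where d: "d \<in> S" "g d = d"
    using Sub.sub.Banach_fixedpoint_thm[OF comp _ _ r(2), of g] gS con by blast
  have "x \<otimes> x \<oplus> d \<otimes> d = 2 \<odot> g d"
    using x d(1) by (simp add: g_def scale_scale S_def)
  then show ?thesis
    using d that[of d] by (auto simp: S_def)
qed

text \<open>Formally \<open>u = x + \<omega> (1 - d)\<close> is unitary, since \<open>1 - d\<close> is a square root of \<open>1 - x\<^sup>2\<close>; the
  algebra need not have a unit, so \<open>u\<close> is only used as a left multiplier.\<close>

lemma nrm_sqrt_unitary_mult:
  assumes [simp]: "x \<in> carrier A" "invol A x = x" "d \<in> carrier A" "invol A d = d" "b \<in> carrier A"
    and comm: "d \<otimes> x = x \<otimes> d" and eq: "x \<otimes> x \<oplus> d \<otimes> d = 2 \<odot> d"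
    and w: "\<omega> * \<omega> = -1" "cnj \<omega> = - \<omega>"
  shows "nrm A ((x \<otimes> b \<oplus> \<omega> \<odot> b) \<oplus> (-\<omega>) \<odot> (d \<otimes> b)) = nrm A b"
proof -
  let ?u = "(x \<otimes> b \<oplus> \<omega> \<odot> b) \<oplus> (-\<omega>) \<odot> (d \<otimes> b)"
  let ?b = "invol A b"
  have w': "-1 = \<omega> * \<omega>" "\<omega> * - \<omega> = 1" "- \<omega> * \<omega> = 1" using w by simp_all
  have 1: "?b \<otimes> (x \<otimes> (x \<otimes> b)) \<oplus> ?b \<otimes> (d \<otimes> (d \<otimes> b)) = 2 \<odot> (?b \<otimes> (d \<otimes> b))"
  proof -
    have "?b \<otimes> ((x \<otimes> x \<oplus> d \<otimes> d) \<otimes> b) = ?b \<otimes> ((2 \<odot> d) \<otimes> b)"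
      by (simp add: eq)
    then show ?thesis
      by (simp add: mult_add_left mult_add_right smult_mult_left smult_mult_right mult_assoc)
  qed
  have 2: "?b \<otimes> (d \<otimes> (x \<otimes> b)) = ?b \<otimes> (x \<otimes> (d \<otimes> b))"
    using comm mult_assoc[of d x b] mult_assoc[of x d b] by simp
  have "invol A ?u \<otimes> ?u = (?b \<otimes> b \<oplus> (-2) \<odot> (?b \<otimes> (d \<otimes> b))) \<oplus>
     (?b \<otimes> (x \<otimes> (x \<otimes> b)) \<oplus> ?b \<otimes> (d \<otimes> (d \<otimes> b)))"
    by (simp add: invol_add invol_smult invol_mult mult_add_left mult_add_right smult_mult_left
        smult_mult_right mult_assoc w scale_add_right scale_scale 2 M.a_ac scale_collect scale_collect_left)
  also have "\<dots> = ?b \<otimes> b"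
    by (simp add: 1 M.a_ac scale_collect scale_collect_left)
  finally have "(nrm A ?u)\<^sup>2 = (nrm A b)\<^sup>2"
    using cstar_identity[of ?u] cstar_identity[of b] by simp
  then show ?thesis
    by (simp add: nrm_nonneg)
qed

text \<open>\<open>x\<close> is the average of the two unitaries \<open>x + i (1 - d)\<close> and
  \<open>x - i (1 - d)\<close>, and multiplication by either of them preserves the norm of
  \<open>b\<close>.\<close>

lemma nrm_mult_le_of_sqrt:
  assumes [simp]: "x \<in> carrier A" "invol A x = x" "d \<in> carrier A" "invol A d = d" "b \<in> carrier A"
    and "d \<otimes> x = x \<otimes> d" "x \<otimes> x \<oplus> d \<otimes> d = 2 \<odot> d"
  shows "nrm A (x \<otimes> b) \<le> nrm A b"
proof -
  let ?u = "\<lambda>\<omega>. (x \<otimes> b \<oplus> \<omega> \<odot> b) \<oplus> (-\<omega>) \<odot> (d \<otimes> b)"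
  have u: "nrm A (?u \<i>) = nrm A b" "nrm A (?u (-\<i>)) = nrm A b"
    by (rule nrm_sqrt_unitary_mult; use assms in simp)+
  have "x \<otimes> b = (1/2) \<odot> (?u \<i> \<oplus> ?u (-\<i>))"
    by (simp add: scale_add_right scale_scale M.a_ac scale_collect scale_collect_left)
  then have "nrm A (x \<otimes> b) = (1/2) * nrm A (?u \<i> \<oplus> ?u (-\<i>))"
    using nrm_smult[of "?u \<i> \<oplus> ?u (-\<i>)" "1/2"] by simp
  also have "\<dots> \<le> nrm A b"
    using nrm_triangle[of "?u \<i>" "?u (-\<i>)"] u by simp
  finally show ?thesis .
qed

end

lemma star_homD:
  assumes "star_hom A B f"
  shows "x \<in> carrier A \<Longrightarrow> f x \<in> carrier B"
    "x \<in> carrier A \<Longrightarrow> y \<in> carrier A \<Longrightarrow> f (x \<oplus>\<^bsub>A\<^esub> y) = f x \<oplus>\<^bsub>B\<^esub> f y"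
    "x \<in> carrier A \<Longrightarrow> y \<in> carrier A \<Longrightarrow> f (x \<otimes>\<^bsub>A\<^esub> y) = f x \<otimes>\<^bsub>B\<^esub> f y"
    "x \<in> carrier A \<Longrightarrow> f (invol A x) = invol B (f x)"
    "x \<in> carrier A \<Longrightarrow> f (c \<odot>\<^bsub>A\<^esub> x) = c \<odot>\<^bsub>B\<^esub> f x"
  using assms by (auto simp: star_hom_def)

text \<open>The relation \<open>x x + d d = 2 d\<close> is algebraic, so \<open>f\<close> carries it
  to \<open>B\<close>, where it bounds multiplication by \<open>f x\<close> whatever the norm of
  \<open>f x\<close> is. Scaling treats self-adjoint elements of any norm, and the C*-identity the
  remaining ones.\<close>

theorem star_hom_contractive:
  assumes "cstar_algebra A" "cstar_algebra B" and f: "star_hom A B f" and "x \<in> carrier A"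
  shows "nrm B (f x) \<le> nrm A x"
proof -
  interpret A: cstar_algebra A by fact
  interpret B: cstar_algebra B by fact
  note f_simps = star_homD[OF f]
  have 1: "nrm B (f x) \<le> 1" if x: "x \<in> carrier A" "invol A x = x" "nrm A x < 1" for x
  proof -
    obtain d where d: "d \<in> carrier A" "invol A d = d" "d \<otimes>\<^bsub>A\<^esub> x = x \<otimes>\<^bsub>A\<^esub> d"
      "x \<otimes>\<^bsub>A\<^esub> x \<oplus>\<^bsub>A\<^esub> d \<otimes>\<^bsub>A\<^esub> d = 2 \<odot>\<^bsub>A\<^esub> d"
      using A.ex_sqrt_fixpoint[OF x] .
    have "f x \<otimes>\<^bsub>B\<^esub> f x \<oplus>\<^bsub>B\<^esub> f d \<otimes>\<^bsub>B\<^esub> f d = 2 \<odot>\<^bsub>B\<^esub> f d"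
      using d x f_simps by (metis A.mult_closed)
    moreover have "invol B (f x) = f x" "invol B (f d) = f d" "f d \<otimes>\<^bsub>B\<^esub> f x = f x \<otimes>\<^bsub>B\<^esub> f d"
      using d x f_simps by metis+
    \<comment> \<open>The bound is applied to \<open>f x\<close> itself: with the C*-identity it
      reads \<open>(nrm B (f x))^2 \<le> nrm B (f x)\<close>.\<close>
    ultimately have "nrm B (f x \<otimes>\<^bsub>B\<^esub> f x) \<le> nrm B (f x)"
      using x d by (intro B.nrm_mult_le_of_sqrt[of _ "f d"]) (auto simp: f_simps)
    then have "(nrm B (f x))\<^sup>2 \<le> nrm B (f x)"
      using B.cstar_identity[of "f x"] x \<open>invol B (f x) = f x\<close> by (simp add: f_simps(1))
    then show ?thesis
      by (rule le_one_of_power2_le)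
  qed
  have 2: "nrm B (f x) \<le> nrm A x" if x: "x \<in> carrier A" "invol A x = x" for x
  proof (rule field_le_epsilon)
    fix e :: real assume e: "0 < e"
    \<comment> \<open>The slack \<open>e\<close> makes the norm of \<open>x / t\<close> strictly
      smaller than 1 and keeps \<open>t\<close> positive for \<open>x = 0\<close>.\<close>
    define t where "t = nrm A x + e"
    have t: "0 < t" using e x by (simp add: t_def add_nonneg_pos A.nrm_nonneg)
    let ?y = "complex_of_real (1 / t) \<odot>\<^bsub>A\<^esub> x"
    have "nrm A ?y < 1"
      using t e x by (simp add: A.nrm_smult norm_divide) (simp add: t_def)
    then have "nrm B (f ?y) \<le> 1"
      using x by (intro 1) (auto simp: A.invol_smult)
    then have "nrm B (f x) / t \<le> 1"
      using t x by (simp add: B.nrm_smult norm_divide f_simps)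
    then show "nrm B (f x) \<le> nrm A x + e"
      using t by (simp add: t_def field_simps)
  qed
  note x = \<open>x \<in> carrier A\<close>
  have "(nrm B (f x))\<^sup>2 = nrm B (f (invol A x \<otimes>\<^bsub>A\<^esub> x))"
    using x B.cstar_identity[of "f x"] by (simp add: f_simps)
  also have "\<dots> \<le> nrm A (invol A x \<otimes>\<^bsub>A\<^esub> x)"
    using x by (intro 2) (auto simp: A.invol_mult)
  also have "\<dots> = (nrm A x)\<^sup>2"
    using x by (simp add: A.cstar_identity)
  finally show ?thesis
    using A.nrm_nonneg[OF x] power2_le_imp_le by blast
qed

lemma sum_root_unity_power:
  assumes "0 < l" "l < N"
  shows "(\<Sum>k<N. exp (2 * of_real pi * \<i> * of_nat k / of_nat N) ^ l) = 0"
proof -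
  let ?w = "exp (2 * of_real pi * \<i> * of_nat l / of_nat N)"
  have "\<not> N dvd l" using assms by (auto dest: dvd_imp_le)
  then have "?w \<noteq> 1"
    using complex_root_unity_eq_1[of N l] assms by simp
  moreover have "?w ^ N = 1"
    using complex_root_unity[of N l] assms by simp
  moreover have "(\<Sum>k<N. exp (2 * of_real pi * \<i> * of_nat k / of_nat N) ^ l) = (\<Sum>k<N. ?w ^ k)"
    by (simp flip: exp_of_nat_mult add: mult_ac)
  ultimately show ?thesis
    by (simp add: geometric_sum)
qed

section \<open>Projections that add up to a projection are orthogonal\<close>

context cstar_algebra
begin

text \<open>The unit of a corner is an extreme point of its unit ball: if \<open>e + \<omega> g\<close> is a contraction for
  all unimodular \<open>\<omega>\<close>, then so is \<open>(e + \<omega> g)\<^sup>n\<close>, whose coefficient of \<open>\<omega>\<close>, extracted by averaging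
  over roots of unity, is \<open>n g\<close>.\<close>

lemma zero_of_contractions:
  assumes [simp]: "e \<in> carrier A" "g \<in> carrier A" and eg: "e \<otimes> g = g" and ge: "g \<otimes> e = g" and ee: "e \<otimes> e = e"
    and le: "nrm A e \<le> 1" "\<And>\<omega>. cmod \<omega> = 1 \<Longrightarrow> nrm A (e \<oplus> \<omega> \<odot> g) \<le> 1"
  shows "g = \<zero>"
proof -
  have bound: "real n * nrm A g \<le> 1" for n
  proof -
    \<comment> \<open>The power used below has exponent \<open>n + 1\<close>, so
      \<open>n + 2\<close> roots of unity keep all its coefficients apart.\<close>
    define N where "N = Suc (Suc n)"
    define w where "w k = exp (2 * of_real pi * \<i> * of_nat k / of_nat N)" for k
    have w1: "cmod (w k) = 1" "w k ^ N = 1" for k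
      using complex_root_unity[of N k] by (simp_all add: w_def N_def)
    have w0: "(\<Sum>k<N. w k ^ l) = 0" if "0 < l" "l < N" for l
      using sum_root_unity_power[OF that] by (simp add: w_def)
    define F where "F m k = rec_nat e (\<lambda>_ x. x \<otimes> (e \<oplus> w k \<odot> g)) m" for m k
    have F_simps: "F 0 k = e" "F (Suc m) k = F m k \<otimes> (e \<oplus> w k \<odot> g)" for m k
      by (simp_all add: F_def)
    have F_closed [simp]: "F m k \<in> carrier A" for m k
      by (induction m) (simp_all add: F_simps)
    have F_nrm: "nrm A (F m k) \<le> 1" for m k
    proof (induction m)
      case (Suc m)
      then show ?case
        using nrm_mult[of "F m k" "e \<oplus> w k \<odot> g"] le(2)[of "w k"] w1
          mult_mono[of "nrm A (F m k)" 1 "nrm A (e \<oplus> w k \<odot> g)" 1]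
        by (simp add: F_simps nrm_nonneg)
    qed (simp add: F_simps le)
    \<comment> \<open>\<open>N\<close> times the sum of the coefficients of the \<open>m\<close>-th
      power at exponents congruent to \<open>-l\<close> modulo \<open>N\<close>;
      \<open>l = Suc n\<close>, which is \<open>-1\<close> modulo \<open>N\<close>, isolates the
      linear coefficient.\<close>
    define G where "G l m = (\<Oplus>k\<in>{..<N}. (w k ^ l) \<odot> F m k)" for l m
    have G_closed [simp]: "G l m \<in> carrier A" for l m
      by (simp add: G_def Pi_iff)
    have G_0: "G l 0 = (\<Sum>k<N. w k ^ l) \<odot> e" for l
    proof -
      have "(\<Oplus>k\<in>K. (w k ^ l) \<odot> e) = (\<Sum>k\<in>K. w k ^ l) \<odot> e" if "finite K" for K
        using that by (induction K) (simp_all add: scale_add_left M.finsum_insert Pi_iff)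
      then show ?thesis by (simp add: G_def F_simps)
    qed
    have G_Suc: "G l (Suc m) = G l m \<otimes> e \<oplus> G (Suc l) m \<otimes> g" for l m
      by (simp add: G_def F_simps finsum_mult_right Pi_iff mult_add_right smult_mult_right
          smult_mult_left scale_add_right scale_scale mult.commute M.finsum_addf)
    have G_zero: "G l m = \<zero>" if "0 < l" "l + m < N" for l m
      using that by (induction m arbitrary: l) (simp_all add: G_0 w0 G_Suc)
    have G_N: "G N m = G 0 m" for m
      by (simp add: G_def w1)
    have G_0m: "G 0 m = of_nat N \<odot> e" if "m < N" for m
      using that
      by (induction m) (simp_all add: G_0 G_Suc G_zero smult_mult_left ee)
    \<comment> \<open>Splitting off one factor raises \<open>Suc n\<close> to \<open>N\<close>,
      which counts as 0 by periodicity; hence each of the \<open>m\<close> factors contributes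
      another \<open>N g\<close>.\<close>
    have G_last: "G (Suc n) m = of_nat (N * m) \<odot> g" if "m < N" for m
      using that
    proof (induction m)
      case 0
      have "(\<Sum>k<N. w k ^ Suc n) = 0" by (rule w0) (simp_all add: N_def)
      then show ?case by (simp only: G_0) simp
    next
      case (Suc m)
      then have "G (Suc n) (Suc m) = of_nat (N * m) \<odot> g \<oplus> of_nat N \<odot> g"
        using G_N[of m] G_0m[of m]
        by (simp add: G_Suc smult_mult_left eg ge flip: N_def)
      then show ?case by (simp add: scale_collect algebra_simps)
    qed
    have "nrm A (G (Suc n) (Suc n)) \<le> (\<Sum>k<N. nrm A ((w k ^ Suc n) \<odot> F (Suc n) k))"
      unfolding G_def by (rule nrm_finsum) auto
    also have "\<dots> \<le> (\<Sum>k<N. 1)"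
      using F_nrm by (intro sum_mono) (simp add: nrm_smult norm_mult norm_power w1)
    finally have "nrm A (G (Suc n) (Suc n)) \<le> real N" by simp
    moreover have "Suc n < N" by (simp add: N_def)
    then have "nrm A (G (Suc n) (Suc n)) = real N * (real (Suc n) * nrm A g)"
      by (simp only: G_last nrm_smult assms(2) norm_of_nat of_nat_mult norm_mult mult.assoc)
    moreover have "0 < real N" by (simp add: N_def)
    ultimately have "real (Suc n) * nrm A g \<le> 1"
      using mult_le_cancel_left_pos[of "real N" "real (Suc n) * nrm A g" 1] by simp
    then show ?thesis
      using nrm_nonneg[of g] by (simp add: algebra_simps)
  qed
  have "nrm A g = 0"
  proof (rule ccontr)
    assume "nrm A g \<noteq> 0"
    then have "0 < nrm A g" using nrm_nonneg[of g] by simp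
    then obtain n where "1 < real n * nrm A g"
      using reals_Archimedean3 by blast
    then show False using bound[of n] by simp
  qed
  then show ?thesis by (simp add: nrm_eq_0)
qed

text \<open>For self-adjoint \<open>g\<close> real signs suffice. The average of the squares of
  \<open>e + g\<close> and \<open>e - g\<close> is \<open>e + g g\<close>, which is therefore a
  contraction; by the C*-identity so are \<open>e + i g\<close> and \<open>e - i g\<close>. Convex
  combinations of these with \<open>e\<close> reach \<open>e + w (g / 2)\<close> for every
  unimodular \<open>w\<close>.\<close>

lemma zero_of_selfadjoint_contractions:
  assumes [simp]: "e \<in> carrier A" "g \<in> carrier A" "invol A e = e" "invol A g = g"
    and eg: "e \<otimes> g = g" "g \<otimes> e = g" and ee: "e \<otimes> e = e"
    and le: "nrm A (e \<oplus> g) \<le> 1" "nrm A (e \<oplus> (-1) \<odot> g) \<le> 1"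
  shows "g = \<zero>"
proof -
  have e1: "nrm A e \<le> 1" by (rule nrm_projection_le) (simp_all add: ee)
  have sq: "nrm A (e \<oplus> g \<otimes> g) \<le> 1"
  proof -
    let ?p = "e \<oplus> g" and ?m = "e \<oplus> (-1) \<odot> g"
    have "e \<oplus> g \<otimes> g = (1/2) \<odot> (?p \<otimes> ?p \<oplus> ?m \<otimes> ?m)"
      by (simp add: mult_add_left mult_add_right smult_mult_left smult_mult_right ee eg
          scale_add_right scale_scale M.a_ac scale_collect scale_collect_left)
    moreover have "nrm A (?p \<otimes> ?p) \<le> 1" "nrm A (?m \<otimes> ?m) \<le> 1"
      using nrm_mult[of ?p ?p] nrm_mult[of ?m ?m] le
        mult_mono[of "nrm A ?p" 1 "nrm A ?p" 1] mult_mono[of "nrm A ?m" 1 "nrm A ?m" 1]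
      by (simp_all add: nrm_nonneg)
    ultimately show ?thesis
      using nrm_triangle[of "?p \<otimes> ?p" "?m \<otimes> ?m"] by (simp add: nrm_smult)
  qed
  have im: "nrm A (e \<oplus> c \<odot> g) \<le> 1" if c: "c = \<i> \<or> c = -\<i>" for c
  proof -
    have "invol A (e \<oplus> c \<odot> g) \<otimes> (e \<oplus> c \<odot> g) = e \<oplus> g \<otimes> g"
      using c by (auto simp: invol_add invol_smult mult_add_left mult_add_right smult_mult_left
          smult_mult_right ee eg scale_scale scale_add_right M.a_ac scale_collect scale_collect_left
          scale_collect_left(5)[of g _ "-\<i>", simplified])
    then have "(nrm A (e \<oplus> c \<odot> g))\<^sup>2 \<le> 1\<^sup>2"
      using cstar_identity[of "e \<oplus> c \<odot> g"] sq by simp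
    then show ?thesis by (rule power2_le_imp_le) simp
  qed
  have "(1/2) \<odot> g = \<zero>"
  proof (rule zero_of_contractions[of e])
    fix w :: complex assume w: "cmod w = 1"
    define s t where "s = Re w" and "t = Im w"
    have st: "\<bar>s\<bar> \<le> 1" "\<bar>t\<bar> \<le> 1"
      using abs_Re_le_cmod[of w] abs_Im_le_cmod[of w] w by (simp_all add: s_def t_def)
    have w_eq: "w = of_real s + of_real t * \<i>" by (simp add: s_def t_def complex_eq_iff)
    define a b where "a = (if s \<ge> 0 then g else (-1) \<odot> g)"
      and "b = (if t \<ge> 0 then \<i> \<odot> g else (-\<i>) \<odot> g)"
    have [simp]: "a \<in> carrier A" "b \<in> carrier A" by (auto simp: a_def b_def)
    have ab: "nrm A (e \<oplus> a) \<le> 1" "nrm A (e \<oplus> b) \<le> 1"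
      using le im by (auto simp: a_def b_def)
    \<comment> \<open>The weight left for \<open>e\<close>. Halving \<open>g\<close> keeps it
      nonnegative, since real and imaginary part of \<open>w\<close> are each at most 1 in absolute
      value.\<close>
    let ?c = "1 - \<bar>s\<bar>/2 - \<bar>t\<bar>/2"
    have "of_real \<bar>s\<bar> \<odot> a = of_real s \<odot> g" "of_real \<bar>t\<bar> \<odot> b = (of_real t * \<i>) \<odot> g"
      by (auto simp: a_def b_def scale_scale)
    then have "of_real (\<bar>s\<bar>/2) \<odot> a = of_real (s/2) \<odot> g" "of_real (\<bar>t\<bar>/2) \<odot> b = (of_real (t/2) * \<i>) \<odot> g"
      by (auto simp: a_def b_def scale_scale)
    then have "e \<oplus> w \<odot> ((1/2) \<odot> g) = of_real ?c \<odot> e \<oplus>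
        (of_real (\<bar>s\<bar>/2) \<odot> (e \<oplus> a) \<oplus> of_real (\<bar>t\<bar>/2) \<odot> (e \<oplus> b))"
      by (simp add: w_eq scale_add_right scale_scale scale_add_left M.a_ac)
         (simp add: M.a_ac scale_collect scale_collect_left add_divide_distrib)
    then have "nrm A (e \<oplus> w \<odot> ((1/2) \<odot> g)) \<le> nrm A (of_real ?c \<odot> e) +
        (nrm A (of_real (\<bar>s\<bar>/2) \<odot> (e \<oplus> a)) + nrm A (of_real (\<bar>t\<bar>/2) \<odot> (e \<oplus> b)))"
      using order_trans[OF nrm_triangle add_left_mono[OF nrm_triangle]] by simp
    also have "\<dots> = ?c * nrm A e + (\<bar>s\<bar>/2 * nrm A (e \<oplus> a) + \<bar>t\<bar>/2 * nrm A (e \<oplus> b))"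
      using st by (simp only: nrm_smult M.a_closed assms(1) norm_of_real \<open>a \<in> carrier A\<close> \<open>b \<in> carrier A\<close>) simp
    also have "\<dots> \<le> ?c * 1 + (\<bar>s\<bar>/2 * 1 + \<bar>t\<bar>/2 * 1)"
      using st ab e1 by (intro add_mono mult_left_mono) auto
    finally show "nrm A (e \<oplus> w \<odot> ((1/2) \<odot> g)) \<le> 1" by simp
  qed (use eg ee e1 in \<open>simp_all add: smult_mult_left smult_mult_right\<close>)
  then have "2 \<odot> ((1/2) \<odot> g) = \<zero>" by simp
  then show ?thesis by (simp add: scale_scale)
qed

text \<open>Compress to the corner of \<open>e = p i\<close>, with \<open>a l = e (p l) e\<close>.
  The \<open>a l\<close> add up to \<open>e\<close>, and \<open>a i = e\<close>, so the others add
  up to 0. Averaging the contractions \<open>e - a l\<close> over the \<open>m\<close> indices other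
  than \<open>i\<close> and \<open>j\<close> gives \<open>e + a j / m\<close>, while
  \<open>e - a j / m\<close> lies between \<open>e\<close> and \<open>e - a j\<close>. Extremality
  of \<open>e\<close> forces \<open>a j = 0\<close>, and the C*-identity turns this into a vanishing
  product.\<close>

lemma orthogonal_projections:
  assumes fin: "finite I" and ij: "i \<in> I" "j \<in> I" "i \<noteq> j"
    and p: "\<And>i. i \<in> I \<Longrightarrow> p i \<in> carrier A" "\<And>i. i \<in> I \<Longrightarrow> invol A (p i) = p i"
      "\<And>i. i \<in> I \<Longrightarrow> p i \<otimes> p i = p i"
    and q: "q = (\<Oplus>i\<in>I. p i)" "\<And>i. i \<in> I \<Longrightarrow> q \<otimes> p i = p i"
  shows "p i \<otimes> p j = \<zero>"
proof -
  have [simp]: "q \<in> carrier A" using q(1) p by auto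
  have qi: "invol A q = q"
    using p unfolding q(1) by (subst invol_finsum) (auto intro!: M.finsum_cong')
  have pq: "p i \<otimes> q = p i" if "i \<in> I" for i
    using invol_mult[of q "p i"] q(2)[OF that] p that qi by simp
  have qq: "q \<otimes> q = q"
  proof -
    have "q \<otimes> (\<Oplus>i\<in>I. p i) = (\<Oplus>i\<in>I. p i)"
      using p q(2) by (subst finsum_mult_left) (auto intro!: M.finsum_cong')
    then show ?thesis using q(1) by simp
  qed
  define e where "e = p i"
  have e: "e \<in> carrier A" "invol A e = e" "e \<otimes> e = e" "e \<otimes> q = e" "q \<otimes> e = e"
    using p q pq ij by (auto simp: e_def)
  note [simp] = e(1)
  define a where "a l = e \<otimes> (p l \<otimes> e)" for l
  have a: "a l \<in> carrier A" "invol A (a l) = a l" "e \<otimes> a l = a l" "a l \<otimes> e = a l" if "l \<in> I" for l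
    using p[OF that] e by (simp_all add: a_def invol_mult mult_assoc) (simp add: e flip: mult_assoc)
  have contr: "nrm A (e \<oplus> (-1) \<odot> a l) \<le> 1" if "l \<in> I" for l
  proof -
    have e_le: "nrm A e \<le> 1" by (rule nrm_projection_le) (simp_all add: e)
    \<comment> \<open>\<open>q - p l\<close> is again a projection, because \<open>q\<close> acts as
      a unit on \<open>p l\<close>; its compression to \<open>e\<close> is
      \<open>e - a l\<close>.\<close>
    have q_le: "nrm A (q \<oplus> (-1) \<odot> p l) \<le> 1"
      using p[OF that] q(2)[OF that] pq[OF that]
      by (intro nrm_projection_le)
        (simp_all add: invol_add invol_smult qi qq mult_add_left mult_add_right smult_mult_left
          smult_mult_right scale_scale M.a_ac scale_collect scale_collect_left)
    have "e \<oplus> (-1) \<odot> a l = e \<otimes> ((q \<oplus> (-1) \<odot> p l) \<otimes> e)"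
      using p[OF that] by (simp add: a_def mult_add_left mult_add_right smult_mult_left smult_mult_right e)
    then have "nrm A (e \<oplus> (-1) \<odot> a l) \<le> nrm A e * (nrm A (q \<oplus> (-1) \<odot> p l) * nrm A e)"
      using p[OF that]
        order_trans[OF nrm_mult mult_left_mono[OF nrm_mult nrm_nonneg]] by simp
    also have "\<dots> \<le> 1 * (1 * 1)"
      using p[OF that] e_le q_le by (intro mult_mono) (auto simp: nrm_nonneg)
    finally show ?thesis by simp
  qed
  define J where "J = I - {i, j}"
  have IJ: "I = insert i (insert j J)" "i \<notin> insert j J" "j \<notin> J" "finite J"
    using ij fin by (auto simp: J_def)
  define b where "b = (\<Oplus>l\<in>J. a l)"
  have [simp]: "b \<in> carrier A" using a IJ by (auto simp: b_def)
  have aj [simp]: "a j \<in> carrier A" using a ij by auto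
  have "e = e \<otimes> (q \<otimes> e)" by (simp add: e)
  also have "\<dots> = (\<Oplus>l\<in>I. a l)"
    using p unfolding q(1) a_def by (simp add: finsum_mult_left finsum_mult_right Pi_iff)
  also have "\<dots> = e \<oplus> (a j \<oplus> b)"
  proof -
    have "a \<in> I \<rightarrow> carrier A" using a by auto
    then have "(\<Oplus>l\<in>I. a l) = a i \<oplus> (a j \<oplus> b)"
      using IJ by (simp add: b_def M.finsum_insert Pi_iff)
    then show ?thesis by (simp add: a_def e flip: e_def)
  qed
  finally have ajb: "a j \<oplus> b = \<zero>"
    by (metis M.a_closed M.add.r_cancel_one' M.a_comm e(1) aj \<open>b \<in> carrier A\<close>)
  have "a j = \<zero>"
  proof (cases "J = {}")
    case True
    then show ?thesis using ajb by (simp add: b_def)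
  next
    case False
    define m where "m = card J"
    have m: "m > 0" using False IJ by (simp add: m_def card_gt_0_iff)
    define g where "g = (1 / of_nat m) \<odot> a j"
    have b_eq: "b = (-1) \<odot> a j"
      using ajb by (metis M.minus_equality M.a_comm uminus_scale aj \<open>b \<in> carrier A\<close>)
    have "g = \<zero>"
    proof (rule zero_of_selfadjoint_contractions[of e])
      have *: "(\<Oplus>l\<in>K. e \<oplus> (-1) \<odot> a l) = of_nat (card K) \<odot> e \<oplus> (-1) \<odot> (\<Oplus>l\<in>K. a l)"
        if "finite K" "K \<subseteq> I" for K
        using that
        by (induction K) (simp_all add: M.finsum_insert Pi_iff a subset_iff scale_add_right
            scale_add_left M.a_ac)
      have "e \<oplus> g = (1 / of_nat m) \<odot> (\<Oplus>l\<in>J. e \<oplus> (-1) \<odot> a l)"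
      proof -
        have "J \<subseteq> I" by (auto simp: J_def)
        then have "(\<Oplus>l\<in>J. e \<oplus> (-1) \<odot> a l) = of_nat m \<odot> e \<oplus> (-1) \<odot> b"
          using *[OF IJ(4)] by (simp add: b_def m_def)
        then show ?thesis
          using m by (simp add: b_eq g_def scale_add_right scale_scale)
      qed
      then have "nrm A (e \<oplus> g) = (1 / m) * nrm A (\<Oplus>l\<in>J. e \<oplus> (-1) \<odot> a l)"
        using a IJ by (simp add: nrm_smult norm_divide Pi_iff)
      moreover have "nrm A (\<Oplus>l\<in>J. e \<oplus> (-1) \<odot> a l) \<le> (\<Sum>l\<in>J. nrm A (e \<oplus> (-1) \<odot> a l))"
        using a IJ by (intro nrm_finsum) auto
      moreover have "\<dots> \<le> (\<Sum>l\<in>J. 1)" using contr IJ by (intro sum_mono) auto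
      ultimately show "nrm A (e \<oplus> g) \<le> 1" using m by (simp add: divide_le_eq flip: m_def)
      have e_le: "nrm A e \<le> 1" by (rule nrm_projection_le) (simp_all add: e)
      have "e \<oplus> (-1) \<odot> g = of_real (1 - 1/m) \<odot> e \<oplus> of_real (1/m) \<odot> (e \<oplus> (-1) \<odot> a j)"
        by (simp add: g_def scale_add_right scale_scale scale_collect_left)
      then have "nrm A (e \<oplus> (-1) \<odot> g) \<le> (1 - 1/m) * nrm A e + (1/m) * nrm A (e \<oplus> (-1) \<odot> a j)"
      proof -
        have "nrm A (of_real (1 - 1/m) \<odot> e) = (1 - 1/m) * nrm A e"
          "nrm A (of_real (1/m) \<odot> (e \<oplus> (-1) \<odot> a j)) = (1/m) * nrm A (e \<oplus> (-1) \<odot> a j)"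
          using m by (simp_all only: nrm_smult M.a_closed scale_closed e aj norm_of_real) simp_all
        then show ?thesis
          using nrm_triangle[of "of_real (1 - 1/m) \<odot> e" "of_real (1/m) \<odot> (e \<oplus> (-1) \<odot> a j)"]
            \<open>e \<oplus> (-1) \<odot> g = _\<close> by simp
      qed
      also have "\<dots> \<le> (1 - 1/m) * 1 + (1/m) * 1"
        using m e_le contr[OF ij(2)] by (intro add_mono mult_left_mono) auto
      finally show "nrm A (e \<oplus> (-1) \<odot> g) \<le> 1" by simp
    qed (use a[OF ij(2)] e in \<open>simp_all add: g_def invol_smult smult_mult_left smult_mult_right\<close>)
    then have "of_nat m \<odot> g = \<zero>" by simp
    then show ?thesis using m by (simp add: g_def scale_scale)
  qed
  moreover have "p j \<otimes> (p j \<otimes> e) = p j \<otimes> e"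
    using p[OF ij(2)] mult_assoc[of "p j" "p j" e] by simp
  ultimately have "invol A (p j \<otimes> e) \<otimes> (p j \<otimes> e) = \<zero>"
    using p[OF ij(2)] e by (simp add: a_def invol_mult mult_assoc)
  then have "p j \<otimes> e = \<zero>"
    using cstar_identity[of "p j \<otimes> e"] p[OF ij(2)] by (simp add: nrm_eq_0)
  then have "invol A (p j \<otimes> e) = \<zero>" by simp
  then show ?thesis
    using p ij by (simp add: e_def invol_mult)
qed

end

section \<open>Paths in higher-rank graphs\<close>

lemmas vec_le_iff = Finite_Cartesian_Product.less_eq_vec_def

lemma vec_nat_le_iff: "(p :: nat ^ 'k::finite) \<le> q \<longleftrightarrow> (\<exists>r. q = p + r)"
proof
  assume "p \<le> q"
  then have "q = p + (q - p)" by (simp add: Finite_Cartesian_Product.vec_eq_iff vec_le_iff)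
  then show "\<exists>r. q = p + r" ..
qed (auto simp: vec_le_iff)

lemma vec_nat_diff_simps [simp]:
  fixes p q :: "nat ^ 'k::finite"
  shows "p + q - p = q" "q + p - p = q" "p \<le> p + q" "p \<le> q + p" "0 \<le> p" "p - 0 = p" "p - p = 0"
  by (simp_all add: Finite_Cartesian_Product.vec_eq_iff vec_le_iff)

lemma vec_nat_add_diff:
  fixes p q :: "nat ^ 'k::finite"
  assumes "p \<le> q"
  shows "p + (q - p) = q" "q - p + p = q"
  using assms by (simp_all add: Finite_Cartesian_Product.vec_eq_iff vec_le_iff)

lemma vec_nat_diff_le: "q - p \<le> (q :: nat ^ 'k::finite)"
  by (simp add: vec_le_iff)

lemma finite_vec_nat_le: "finite {p :: nat ^ 'k::finite. p \<le> q}"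
proof -
  have "finite (PiE UNIV (\<lambda>i. {..q $ i}))"
    by (rule finite_PiE) auto
  then have "finite {f :: 'k \<Rightarrow> nat. \<forall>i. f i \<in> {..q $ i}}"
    by (rule finite_subset[rotated]) auto
  moreover have "{p. p \<le> q} \<subseteq> vec_lambda ` {f. \<forall>i. f i \<in> {..q $ i}}"
  proof
    fix p assume "p \<in> {p. p \<le> q}"
    then have "vec_nth p \<in> {f. \<forall>i. f i \<in> {..q $ i}}" by (simp add: vec_le_iff)
    then show "p \<in> vec_lambda ` {f. \<forall>i. f i \<in> {..q $ i}}"
      by (rule image_eqI[rotated]) (simp add: Finite_Cartesian_Product.vec_eq_iff)
  qed
  ultimately show ?thesis by (meson finite_imageI finite_subset)
qed

context kgraph
begin

lemma vertex_mor: "v \<in> vertices L \<Longrightarrow> v \<in> mor L"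
  and vertex_rng: "v \<in> vertices L \<Longrightarrow> rng L v = v"
  and vertex_src: "v \<in> vertices L \<Longrightarrow> src L v = v"
  by (auto simp: vertices_def)

lemma src_src: "l \<in> mor L \<Longrightarrow> src L (src L l) = src L l"
  and rng_src: "l \<in> mor L \<Longrightarrow> rng L (src L l) = src L l"
  and src_mor: "l \<in> mor L \<Longrightarrow> src L l \<in> mor L"
  and rng_mor: "l \<in> mor L \<Longrightarrow> rng L l \<in> mor L"
  using rng_vertex src_vertex vertex_rng vertex_src vertex_mor by auto

lemma factorization_unique:
  assumes "m \<in> mor L" "n \<in> mor L" "src L m = rng L n"
    and "m' \<in> mor L" "n' \<in> mor L" "src L m' = rng L n'"
    and "cmp L m n = cmp L m' n'" "deg L m = deg L m'"
  shows "m = m' \<and> n = n'"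
proof -
  have "deg L m + deg L n = deg L m' + deg L n'"
    using assms deg_comp by metis
  then have deg: "deg L n = deg L n'" using assms(8) by simp
  let ?P = "\<lambda>(a, b). a \<in> mor L \<and> b \<in> mor L \<and> src L a = rng L b
            \<and> cmp L m n = cmp L a b \<and> deg L a = deg L m \<and> deg L b = deg L n"
  have ex: "\<exists>!z. ?P z"
    using factorization[of "cmp L m n" "deg L m" "deg L n"] comp_mor[of m n] deg_comp[of m n] assms
    by simp
  have 1: "?P (m, n)" and 2: "?P (m', n')"
    using assms deg by simp_all
  have "(m, n) = (m', n')"
    by (rule trans[OF sym[OF the1_equality[OF ex 1]] the1_equality[OF ex 2]])
  then show ?thesis by simp
qed

lemma factorE:
  assumes "l \<in> mor L" "deg L l = p + q"
  obtains m n where "m \<in> mor L" "n \<in> mor L" "src L m = rng L n" "l = cmp L m n"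
    "deg L m = p" "deg L n = q"
  using factorization[OF assms] by (auto simp: Ex1_def)

lemma factor_leE:
  assumes "l \<in> mor L" "p \<le> deg L l"
  obtains m n where "m \<in> mor L" "n \<in> mor L" "src L m = rng L n" "l = cmp L m n" "deg L m = p"
  using factorE[of l p "deg L l - p"] assms vec_nat_add_diff(1)[of p "deg L l"] by metis

lemma infinite_path_simps:
  assumes "x \<in> infinite_paths L" "p \<le> q"
  shows "x (p, q) \<in> mor L" "deg L (x (p, q)) = q - p" "rng L (x (p, q)) = x (p, p)"
    "src L (x (p, q)) = x (q, q)"
proof -
  have m: "kgraph_morphism Omega L x" using assms by (simp add: infinite_paths_def)
  have pq: "(p, q) \<in> mor Omega" using assms by (simp add: Omega_def)
  show "x (p, q) \<in> mor L"
    using m pq unfolding kgraph_morphism_def by (intro Pi_mem[of x "mor Omega" "\<lambda>_. mor L"]) auto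
  have "rng L (x (p, q)) = x (rng Omega (p, q)) \<and> src L (x (p, q)) = x (src Omega (p, q)) \<and>
      deg L (x (p, q)) = deg Omega (p, q)"
    using m pq unfolding kgraph_morphism_def by blast
  then show "deg L (x (p, q)) = q - p" "rng L (x (p, q)) = x (p, p)"
    "src L (x (p, q)) = x (q, q)"
    by (simp_all add: Omega_def)
qed

lemma infinite_path_comp:
  assumes "x \<in> infinite_paths L" "p \<le> q" "q \<le> r"
  shows "x (p, r) = cmp L (x (p, q)) (x (q, r))"
proof -
  have m: "kgraph_morphism Omega L x" using assms by (simp add: infinite_paths_def)
  have "(p, q) \<in> mor Omega" "(q, r) \<in> mor Omega" "src Omega (p, q) = rng Omega (q, r)"
    using assms by (simp_all add: Omega_def)
  then have "x (cmp Omega (p, q) (q, r)) = cmp L (x (p, q)) (x (q, r))"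
    using m unfolding kgraph_morphism_def by blast
  then show ?thesis by (simp add: Omega_def)
qed

text \<open>By unique factorization a segment determines its subsegments, so tails that agree on
  every initial segment agree altogether. Distinct tails thus differ on a finite window, which one
  finite path can contain.\<close>

lemma shift_neqD:
  assumes x: "x \<in> infinite_paths L" and neq: "shift p x \<noteq> shift q x"
  shows "\<exists>b. x (p, p + b) \<noteq> x (q, q + b)"
proof (rule ccontr)
  assume "\<not> ?thesis"
  then have eq: "x (p, p + b) = x (q, q + b)" for b by blast
  have "x (a + p, c + p) = x (a + q, c + q)" if "a \<le> c" for a c
  proof -
    have ac: "p + a \<le> p + c" "q + a \<le> q + c" using that by (auto simp: vec_nat_le_iff add.assoc)
    have "cmp L (x (p, p + a)) (x (p + a, p + c)) = cmp L (x (q, q + a)) (x (q + a, q + c))"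
      using infinite_path_comp[OF x _ ac(1), of p] infinite_path_comp[OF x _ ac(2), of q] eq[of c]
      by simp
    then have "x (p + a, p + c) = x (q + a, q + c)"
      using factorization_unique[of "x (p, p + a)" "x (p + a, p + c)" "x (q, q + a)" "x (q + a, q + c)"]
        infinite_path_simps[OF x ac(1)] infinite_path_simps[OF x ac(2)]
        infinite_path_simps[OF x, of p "p + a"] infinite_path_simps[OF x, of q "q + a"] by simp
    then show ?thesis by (simp add: add.commute)
  qed
  then have "shift p x = shift q x"
    unfolding shift_def by (intro restrict_ext) (simp add: Omega_def case_prod_beta)
  then show False using neq by simp
qed

text \<open>The paths \<open>\<lambda>\<close> used to cut down to a corner in which the terms \<open>s\<^sub>\<mu> s\<^sub>\<nu>\<^sup>*\<close> with
  \<open>d(\<mu>) \<noteq> d(\<nu>)\<close> vanish.\<close>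

lemma aperiodic_ex_path:
  assumes "aperiodic L" and v: "v \<in> vertices L"
  shows "\<exists>l\<in>mor L. rng L l = v \<and> (\<forall>a\<in>mor L. \<forall>b\<in>mor L. \<forall>c\<in>mor L. \<forall>d\<in>mor L.
    src L a = v \<and> src L b = v \<and> src L l = rng L c \<and> src L l = rng L d \<and>
    deg L a \<le> N \<and> deg L b \<le> N \<and> deg L a \<noteq> deg L b \<longrightarrow>
    cmp L (cmp L a l) c \<noteq> cmp L (cmp L b l) d)"
proof -
  have "\<exists>x\<in>cylinder L v. \<forall>m n. m \<noteq> n \<longrightarrow> shift m x \<noteq> shift n x"
    using assms by (simp add: aperiodic_def)
  then obtain x where xv: "x \<in> cylinder L v" and ap: "\<And>m n. m \<noteq> n \<Longrightarrow> shift m x \<noteq> shift n x"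
    by auto
  have x: "x \<in> infinite_paths L" and x0: "x (0, 0) = v"
    using xv deg_vertex[OF v] by (simp_all add: cylinder_def)
  have "\<forall>m n. \<exists>b. m \<noteq> n \<longrightarrow> x (m, m + b) \<noteq> x (n, n + b)"
    using shift_neqD[OF x] ap by blast
  then obtain b where b: "\<And>m n. m \<noteq> n \<Longrightarrow> x (m, m + b m n) \<noteq> x (n, n + b m n)"
    by metis
  let ?I = "{p. p \<le> N} \<times> {p. p \<le> N}"
  \<comment> \<open>The order on degrees is only partial, so a sum serves as upper bound of the
    finitely many window lengths.\<close>
  define B where "B = (\<Sum>(m, n)\<in>?I. b m n)"
  have fin: "finite ?I" by (intro finite_cartesian_product finite_vec_nat_le)
  have bB: "b m n \<le> B" if "m \<le> N" "n \<le> N" for m n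
  proof -
    have "B = b m n + (\<Sum>(m, n)\<in>?I - {(m, n)}. b m n)"
      using that fin unfolding B_def by (subst sum.remove[of _ "(m, n)"]) auto
    then show ?thesis by (auto simp: vec_nat_le_iff)
  qed
  \<comment> \<open>Long enough to contain every window that starts at a degree at most
    \<open>N\<close> and has length at most \<open>B\<close>.\<close>
  define l where "l = x (0, N + B)"
  have l: "l \<in> mor L" "rng L l = v" "src L l = x (N + B, N + B)"
    using infinite_path_simps[OF x, of 0 "N + B"] x0 by (auto simp: l_def)
  \<comment> \<open>In the path \<open>a l c\<close> the window of \<open>x\<close> starting at
    \<open>u\<close> sits at degree \<open>deg L a + u\<close>.\<close>
  have seg: "\<exists>f g. f \<in> mor L \<and> g \<in> mor L \<and> src L f = rng L (x (u, u + w)) \<and>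
      src L (x (u, u + w)) = rng L g \<and>
      deg L f = deg L a + u \<and> cmp L (cmp L a l) c = cmp L f (cmp L (x (u, u + w)) g)"
    if a: "a \<in> mor L" "src L a = v" and c: "c \<in> mor L" "src L l = rng L c" and u: "u \<le> N"
      and w: "w \<le> B" for a c u w
  proof -
    have le: "0 \<le> u" "u \<le> u + w" "u + w \<le> N + B" "u \<le> N + B"
      using u w by (simp_all add: vec_le_iff add_mono trans_le_add1)
    note s1 = infinite_path_simps[OF x le(1)] and s2 = infinite_path_simps[OF x le(2)]
      and s3 = infinite_path_simps[OF x le(3)] and s4 = infinite_path_simps[OF x le(4)]
    have ls: "l = cmp L (x (0, u)) (cmp L (x (u, u + w)) (x (u + w, N + B)))"
      using infinite_path_comp[OF x le(1) le(4)] infinite_path_comp[OF x le(2) le(3)]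
      by (simp add: l_def)
    have 1: "cmp L (x (u, u + w)) (x (u + w, N + B)) \<in> mor L"
      using s2 s3 by (intro comp_mor) auto
    have "cmp L (cmp L a l) c = cmp L a (cmp L l c)"
      using a c l by (intro comp_assoc) auto
    also have "cmp L l c = cmp L (x (0, u)) (cmp L (x (u, u + w)) (cmp L (x (u + w, N + B)) c))"
      using c l s1 s2 s3 1 by (simp add: ls comp_assoc src_comp rng_comp)
    also have "cmp L a \<dots> = cmp L (cmp L a (x (0, u)))
        (cmp L (x (u, u + w)) (cmp L (x (u + w, N + B)) c))"
      using a c l s1 s2 s3 1 x0 by (subst comp_assoc) (auto simp: rng_comp comp_mor)
    finally show ?thesis
      using a c l s1 s2 s3 1 x0
      by (intro exI[of _ "cmp L a (x (0, u))"] exI[of _ "cmp L (x (u + w, N + B)) c"])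
        (auto simp: comp_mor src_comp rng_comp deg_comp)
  qed
  have "cmp L (cmp L a l) c \<noteq> cmp L (cmp L a' l) c'"
    if a: "a \<in> mor L" "src L a = v" and c: "c \<in> mor L" "src L l = rng L c"
      and a': "a' \<in> mor L" "src L a' = v" and c': "c' \<in> mor L" "src L l = rng L c'"
      and le: "deg L a \<le> N" "deg L a' \<le> N" and neq: "deg L a \<noteq> deg L a'" for a a' c c'
  proof
    assume eq: "cmp L (cmp L a l) c = cmp L (cmp L a' l) c'"
    \<comment> \<open>\<open>deg L a + u\<close> and \<open>deg L a' + u'\<close> are both the join
      of the two degrees. At this degree the common path would show the windows of \<open>x\<close>
      at \<open>u\<close> and at \<open>u'\<close>, which differ.\<close>
    define u u' where "u = deg L a' - deg L a" and "u' = deg L a - deg L a'"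
    have uu: "deg L a + u = deg L a' + u'"
    proof -
      have "m + (n - m) = n + (m - n)" for m n :: nat by arith
      then show ?thesis
        by (simp add: u_def u'_def Finite_Cartesian_Product.vec_eq_iff)
    qed
    then have neq': "u \<noteq> u'" using neq by auto
    have uN: "u \<le> N" "u' \<le> N"
      using le order_trans[OF vec_nat_diff_le] by (auto simp: u_def u'_def)
    define w where "w = b u u'"
    have w: "w \<le> B" using bB uN by (simp add: w_def)
    obtain f g where f: "f \<in> mor L" "g \<in> mor L" "src L f = rng L (x (u, u + w))"
      "src L (x (u, u + w)) = rng L g" "deg L f = deg L a + u"
      "cmp L (cmp L a l) c = cmp L f (cmp L (x (u, u + w)) g)"
      using seg[OF a c uN(1) w] by (elim exE conjE)
    obtain f' g' where f': "f' \<in> mor L" "g' \<in> mor L" "src L f' = rng L (x (u', u' + w))"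
      "src L (x (u', u' + w)) = rng L g'" "deg L f' = deg L a' + u'"
      "cmp L (cmp L a' l) c' = cmp L f' (cmp L (x (u', u' + w)) g')"
      using seg[OF a' c' uN(2) w] by (elim exE conjE)
    have xm: "x (u, u + w) \<in> mor L" "x (u', u' + w) \<in> mor L"
      "deg L (x (u, u + w)) = w" "deg L (x (u', u' + w)) = w"
      using infinite_path_simps[OF x, of u "u + w"] infinite_path_simps[OF x, of u' "u' + w"] by auto
    have "cmp L (x (u, u + w)) g = cmp L (x (u', u' + w)) g'"
      using factorization_unique[of f "cmp L (x (u, u + w)) g" f' "cmp L (x (u', u' + w)) g'"]
        f f' eq uu xm by (auto simp: comp_mor rng_comp)
    then have "x (u, u + w) = x (u', u' + w)"
      using factorization_unique[of "x (u, u + w)" g "x (u', u' + w)" g'] f f' xm by auto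
    then show False using b[OF neq'] by (simp add: w_def)
  qed
  then show ?thesis using l by blast
qed

end

section \<open>The Cuntz-Krieger uniqueness theorem\<close>

locale kgraph_cstar = kgraph L + cstar_algebra A
  for L :: "('a, 'k::finite) kgraph" and A :: "'b cstar" (structure) +
  fixes s :: "'a \<Rightarrow> 'b"
  assumes finite_graph: "finite_kgraph L" and family: "cuntz_krieger_family L A s"
begin

lemma s_closed [simp]: "l \<in> mor L \<Longrightarrow> s l \<in> carrier A"
  using family by (simp add: cuntz_krieger_family_def partial_isometry_def)

lemma s_vertex:
  assumes "v \<in> vertices L"
  shows "invol A (s v) = s v" "s v \<otimes> s v = s v"
  using family assms by (auto simp: cuntz_krieger_family_def projection_def)

lemma s_vertex_orth: "v \<in> vertices L \<Longrightarrow> w \<in> vertices L \<Longrightarrow> v \<noteq> w \<Longrightarrow> s v \<otimes> s w = \<zero>"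
  using family by (simp add: cuntz_krieger_family_def)

lemma s_comp: "m \<in> mor L \<Longrightarrow> l \<in> mor L \<Longrightarrow> src L m = rng L l \<Longrightarrow> s (cmp L m l) = s m \<otimes> s l"
  using family by (simp add: cuntz_krieger_family_def)

lemma s_star_s: "m \<in> mor L \<Longrightarrow> invol A (s m) \<otimes> s m = s (src L m)"
  using family by (simp add: cuntz_krieger_family_def)

lemma s_rng: "l \<in> mor L \<Longrightarrow> s (rng L l) \<otimes> s l = s l"
  and s_src: "l \<in> mor L \<Longrightarrow> s l \<otimes> s (src L l) = s l"
  using s_comp[of "rng L l" l] s_comp[of l "src L l"] rng_vertex src_vertex
  by (simp_all add: vertex_mor vertex_src vertex_rng comp_id_left comp_id_right)

lemma star_s_rng: "l \<in> mor L \<Longrightarrow> invol A (s l) \<otimes> s (rng L l) = invol A (s l)"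
  and star_s_src: "l \<in> mor L \<Longrightarrow> s (src L l) \<otimes> invol A (s l) = invol A (s l)"
  using s_rng[of l] s_src[of l] invol_mult[of "s (rng L l)" "s l"] invol_mult[of "s l" "s (src L l)"]
    s_vertex rng_vertex src_vertex
  by (simp_all add: vertex_mor)

definition S :: "'a \<Rightarrow> 'a \<Rightarrow> 'b" where "S m n = s m \<otimes> invol A (s n)"

lemma S_closed [simp]: "m \<in> mor L \<Longrightarrow> n \<in> mor L \<Longrightarrow> S m n \<in> carrier A"
  by (simp add: S_def)

lemma invol_S: "m \<in> mor L \<Longrightarrow> n \<in> mor L \<Longrightarrow> invol A (S m n) = S n m"
  by (simp add: S_def invol_mult)

definition paths :: "'a \<Rightarrow> nat ^ 'k \<Rightarrow> 'a set" where
  "paths v n = {l \<in> mor L. deg L l = n \<and> rng L l = v}"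

lemma finite_deg: "finite {l \<in> mor L. deg L l = n}"
  using finite_graph by (simp add: finite_kgraph_def)

lemma finite_paths [simp]: "finite (paths v n)"
  by (rule finite_subset[OF _ finite_deg[of n]]) (auto simp: paths_def)

lemma s_vertex_sum: "v \<in> vertices L \<Longrightarrow> s v = (\<Oplus>l\<in>paths v n. S l l)"
  using family by (simp add: cuntz_krieger_family_def paths_def S_def)

lemma S_mult_s: "l \<in> mor L \<Longrightarrow> S l l \<otimes> s l = s l"
  by (simp add: S_def mult_assoc s_star_s s_src src_mor)

lemma star_s_S: "l \<in> mor L \<Longrightarrow> invol A (s l) \<otimes> S l l = invol A (s l)"
  using invol_mult[of "S l l" "s l"] by (simp add: S_mult_s invol_S)

text \<open>For a common range, the range projections of all paths of this degree add up to the
  vertex projection and are orthogonal by \<open>orthogonal_projections\<close>; different ranges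
  are separated by the vertex projections.\<close>

lemma s_orth:
  assumes l: "l \<in> mor L" and m: "m \<in> mor L" and deg: "deg L l = deg L m" and neq: "l \<noteq> m"
  shows "invol A (s l) \<otimes> s m = \<zero>"
proof (cases "rng L l = rng L m")
  case False
  have "invol A (s l) \<otimes> s m = (invol A (s l) \<otimes> s (rng L l)) \<otimes> (s (rng L m) \<otimes> s m)"
    using l m by (simp add: s_rng star_s_rng)
  also have "\<dots> = invol A (s l) \<otimes> ((s (rng L l) \<otimes> s (rng L m)) \<otimes> s m)"
    using l m by (simp add: mult_assoc rng_mor)
  also have "\<dots> = \<zero>"
    using l m False by (simp add: s_vertex_orth rng_vertex rng_mor)
  finally show ?thesis .
next
  case True
  define v where "v = rng L l"
  have v: "v \<in> vertices L" using l by (simp add: v_def rng_vertex)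
  have "S l l \<otimes> S m m = \<zero>"
  proof (rule orthogonal_projections[OF finite_paths, of l v "deg L l" m "\<lambda>l. S l l" "s v"])
    show "S i i \<otimes> S i i = S i i" if "i \<in> paths v (deg L l)" for i
    proof -
      have i: "i \<in> mor L" using that by (simp add: paths_def)
      have "S i i \<otimes> S i i = (S i i \<otimes> s i) \<otimes> invol A (s i)"
        using i by (simp add: S_def mult_assoc)
      then show ?thesis using i by (simp add: S_mult_s) (simp add: S_def)
    qed
    show "s v \<otimes> S i i = S i i" if "i \<in> paths v (deg L l)" for i
      using that v s_rng[of i] by (auto simp: paths_def S_def vertex_mor simp flip: mult_assoc)
    show "s v = (\<Oplus>i\<in>paths v (deg L l). S i i)" by (rule s_vertex_sum[OF v])
  qed (use l m deg neq True in \<open>auto simp: paths_def v_def invol_S\<close>)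
  then have "invol A (s l) \<otimes> (S l l \<otimes> S m m) \<otimes> s m = \<zero>"
    using l m by simp
  then have "(invol A (s l) \<otimes> S l l) \<otimes> (S m m \<otimes> s m) = \<zero>"
    using l m by (simp add: mult_assoc)
  then show ?thesis using l m by (simp add: star_s_S S_mult_s)
qed

lemma star_s_comp:
  assumes "l \<in> mor L" "a \<in> mor L" "src L l = rng L a"
  shows "invol A (s l) \<otimes> s (cmp L l a) = s a"
proof -
  have "invol A (s l) \<otimes> s (cmp L l a) = (invol A (s l) \<otimes> s l) \<otimes> s a"
    using assms by (simp add: s_comp mult_assoc)
  then show ?thesis using assms by (simp add: s_star_s s_rng)
qed

text \<open>\<open>m\<close> is cut at the degree of \<open>l\<close>; unless the cut yields
  \<open>l\<close> itself, orthogonality of paths of equal degree annihilates the product.\<close>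

lemma star_s_mult_cases:
  assumes l: "l \<in> mor L" and m: "m \<in> mor L" and le: "deg L l \<le> deg L m"
  obtains a where "a \<in> mor L" "src L l = rng L a" "m = cmp L l a" "invol A (s l) \<otimes> s m = s a"
  | "invol A (s l) \<otimes> s m = \<zero>"
proof -
  obtain l' a where f: "l' \<in> mor L" "a \<in> mor L" "src L l' = rng L a" "m = cmp L l' a" "deg L l' = deg L l"
    using factor_leE[OF m le] .
  show thesis
  proof (cases "l' = l")
    case True
    then show thesis using f l star_s_comp[of l a] that(1)[of a] by simp
  next
    case False
    have "invol A (s l) \<otimes> s m = (invol A (s l) \<otimes> s l') \<otimes> s a"
      using f l by (simp add: s_comp mult_assoc)
    also have "\<dots> = \<zero>" using False f l s_orth[of l l'] by simp
    finally show thesis by (rule that(2))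
  qed
qed

lemma mult_finsum_mult:
  assumes f: "f \<in> I \<rightarrow> carrier A" and x: "x \<in> carrier A" and y: "y \<in> carrier A"
  shows "x \<otimes> ((\<Oplus>i\<in>I. f i) \<otimes> y) = (\<Oplus>i\<in>I. x \<otimes> (f i \<otimes> y))"
proof -
  have "(\<lambda>i. f i \<otimes> y) \<in> I \<rightarrow> carrier A" using f y by auto
  then show ?thesis
    by (simp only: finsum_mult_right[OF f y] finsum_mult_left[OF _ x])
qed

section \<open>Linear spans of the elements \<open>S m n\<close>\<close>

inductive_set lin :: "('a \<times> 'a) set \<Rightarrow> 'b set" for P where
  zero: "\<zero> \<in> lin P"
| step: "x \<in> lin P \<Longrightarrow> (m, n) \<in> P \<Longrightarrow> x \<oplus> c \<odot> S m n \<in> lin P"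

definition pairs :: "('a \<times> 'a) set" where
  "pairs = {(m, n). m \<in> mor L \<and> n \<in> mor L \<and> src L m = src L n}"

lemma lin_closed: "x \<in> lin P \<Longrightarrow> P \<subseteq> pairs \<Longrightarrow> x \<in> carrier A"
  by (induction rule: lin.induct) (auto simp: pairs_def)

lemma lin_mono: "x \<in> lin P \<Longrightarrow> P \<subseteq> Q \<Longrightarrow> x \<in> lin Q"
  by (induction rule: lin.induct) (auto intro: lin.intros)

lemma lin_add:
  assumes "P \<subseteq> pairs" "x \<in> lin P" "y \<in> lin P"
  shows "x \<oplus> y \<in> lin P"
  using assms(3)
proof (induction rule: lin.induct)
  case zero
  then show ?case using assms lin_closed by simp
next
  case (step y m n c)
  then have "y \<in> carrier A" "m \<in> mor L" "n \<in> mor L" "x \<in> carrier A"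
    using assms lin_closed by (auto simp: pairs_def)
  then have "x \<oplus> (y \<oplus> c \<odot> S m n) = (x \<oplus> y) \<oplus> c \<odot> S m n" by (simp add: M.a_assoc)
  then show ?case using step by (simp add: lin.step)
qed

lemma lin_scale:
  assumes "P \<subseteq> pairs" "x \<in> lin P"
  shows "c \<odot> x \<in> lin P"
  using assms(2)
proof (induction rule: lin.induct)
  case (step y m n d)
  then have "y \<in> carrier A" "m \<in> mor L" "n \<in> mor L"
    using assms lin_closed by (auto simp: pairs_def)
  then show ?case using step by (simp add: scale_add_right scale_scale lin.step)
qed (simp add: lin.zero)

lemma lin_gen:
  assumes "P \<subseteq> pairs" "(m, n) \<in> P"
  shows "S m n \<in> lin P"
proof -
  have "m \<in> mor L" "n \<in> mor L" using assms by (auto simp: pairs_def)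
  then have "\<zero> \<oplus> 1 \<odot> S m n = S m n" by simp
  then show ?thesis using lin.step[OF lin.zero assms(2), of 1] by simp
qed

lemma lin_finsum:
  assumes "P \<subseteq> pairs" "\<And>i. i \<in> I \<Longrightarrow> f i \<in> lin P"
  shows "(\<Oplus>i\<in>I. f i) \<in> lin P"
  using assms(2)
proof (induction I rule: infinite_finite_induct)
  case (insert i I)
  then have "f \<in> I \<rightarrow> carrier A" "f i \<in> carrier A"
    using lin_closed[OF _ assms(1)] by auto
  then show ?case using insert by (simp add: M.finsum_insert lin_add[OF assms(1)])
qed (simp_all add: M.finsum_infinite lin.zero)

text \<open>\<open>cnj'\<close> is \<open>id\<close> for linear maps and \<open>cnj\<close> for the
  involution, so one induction serves both.\<close>

lemma lin_linear:
  assumes x: "x \<in> lin P" and P: "P \<subseteq> pairs" and f0: "f \<zero> = \<zero>"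
    and f: "\<And>x y. x \<in> carrier A \<Longrightarrow> y \<in> carrier A \<Longrightarrow> f (x \<oplus> y) = f x \<oplus> f y"
    "\<And>x c. x \<in> carrier A \<Longrightarrow> f (c \<odot> x) = cnj' c \<odot> f x"
    and Q: "Q \<subseteq> pairs" and gen: "\<And>m n. (m, n) \<in> P \<Longrightarrow> f (S m n) \<in> lin Q"
  shows "f x \<in> lin Q"
  using x
proof (induction rule: lin.induct)
  case (step x m n c)
  then have "x \<in> carrier A" "m \<in> mor L" "n \<in> mor L"
    using P lin_closed by (auto simp: pairs_def)
  then show ?case
    using step gen[of m n] by (simp add: f lin_add lin_scale Q)
qed (simp add: f0 lin.zero)

lemma lin_eq:
  assumes x: "x \<in> lin P" and P: "P \<subseteq> pairs" and f0: "f \<zero> = g \<zero>"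
    and f: "\<And>x y. x \<in> carrier A \<Longrightarrow> y \<in> carrier A \<Longrightarrow> f (x \<oplus> y) = f x \<oplus> f y"
    "\<And>x c. x \<in> carrier A \<Longrightarrow> f (c \<odot> x) = c \<odot> f x"
    and g: "\<And>x y. x \<in> carrier A \<Longrightarrow> y \<in> carrier A \<Longrightarrow> g (x \<oplus> y) = g x \<oplus> g y"
    "\<And>x c. x \<in> carrier A \<Longrightarrow> g (c \<odot> x) = c \<odot> g x"
    and gen: "\<And>m n. (m, n) \<in> P \<Longrightarrow> f (S m n) = g (S m n)"
  shows "f x = g x"
  using x
proof (induction rule: lin.induct)
  case (step x m n c)
  then have "x \<in> carrier A" "m \<in> mor L" "n \<in> mor L"
    using P lin_closed by (auto simp: pairs_def)
  then show ?case
    using step gen[of m n] by (simp add: f g)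
qed (simp add: f0)

lemma lin_invol:
  assumes "x \<in> lin P" "P \<subseteq> pairs" "\<And>m n. (m, n) \<in> P \<Longrightarrow> (n, m) \<in> Q" "Q \<subseteq> pairs"
  shows "invol A x \<in> lin Q"
proof (rule lin_linear[OF assms(1,2), where cnj' = cnj])
  show "invol A (S m n) \<in> lin Q" if "(m, n) \<in> P" for m n
    using assms that lin_gen[OF assms(4), of n m] by (auto simp: invol_S pairs_def)
qed (simp_all add: invol_add invol_smult assms)

lemma lin_mult:
  assumes "x \<in> lin P" "y \<in> lin Q" "P \<subseteq> pairs" "Q \<subseteq> pairs" "R \<subseteq> pairs"
    and gen: "\<And>m n m' n'. (m, n) \<in> P \<Longrightarrow> (m', n') \<in> Q \<Longrightarrow> S m n \<otimes> S m' n' \<in> lin R"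
  shows "x \<otimes> y \<in> lin R"
proof (rule lin_linear[OF assms(1,3), of "\<lambda>x. x \<otimes> y" id])
  have y: "y \<in> carrier A" using assms lin_closed by blast
  show "S m n \<otimes> y \<in> lin R" if "(m, n) \<in> P" for m n
  proof (rule lin_linear[OF assms(2,4), of "\<lambda>y. S m n \<otimes> y" id])
    have "m \<in> mor L" "n \<in> mor L" using assms that by (auto simp: pairs_def)
    then show "S m n \<otimes> \<zero> = \<zero>"
      "\<And>x y. x \<in> carrier A \<Longrightarrow> y \<in> carrier A \<Longrightarrow> S m n \<otimes> (x \<oplus> y) = S m n \<otimes> x \<oplus> S m n \<otimes> y"
      "\<And>x c. x \<in> carrier A \<Longrightarrow> S m n \<otimes> (c \<odot> x) = id c \<odot> (S m n \<otimes> x)"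
      by (simp_all add: mult_add_right smult_mult_right)
  qed (use assms gen that in auto)
  show "\<zero> \<otimes> y = \<zero>" "\<And>x z. x \<in> carrier A \<Longrightarrow> z \<in> carrier A \<Longrightarrow> (x \<oplus> z) \<otimes> y = x \<otimes> y \<oplus> z \<otimes> y"
    "\<And>x c. x \<in> carrier A \<Longrightarrow> c \<odot> x \<otimes> y = id c \<odot> (x \<otimes> y)"
    using y by (simp_all add: mult_add_left smult_mult_left)
qed (use assms in auto)

text \<open>All products of generators are expanded over the paths of degree \<open>d(\<nu>) + d(\<mu>')\<close>.\<close>

lemma S_mult_S:
  assumes "(m, n) \<in> pairs" "(m', n') \<in> pairs"
  shows "S m n \<otimes> S m' n' \<in>
    lin {(a, b) \<in> pairs. deg L a + deg L n + deg L n' = deg L b + deg L m + deg L m'}"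
    (is "_ \<in> lin ?R")
proof -
  have mn: "m \<in> mor L" "n \<in> mor L" "m' \<in> mor L" "n' \<in> mor L" "src L m = src L n" "src L m' = src L n'"
    using assms by (auto simp: pairs_def)
  have R: "?R \<subseteq> pairs" by auto
  let ?v = "rng L n" and ?N = "deg L n + deg L m'"
  have v: "?v \<in> vertices L" using mn by (simp add: rng_vertex)
  have pm: "l \<in> mor L" "deg L l = ?N" if "l \<in> paths ?v ?N" for l using that by (simp_all add: paths_def)
  have "S m n \<otimes> S m' n' = s m \<otimes> (invol A (s n) \<otimes> s ?v) \<otimes> (s m' \<otimes> invol A (s n'))"
    using mn by (simp add: S_def star_s_rng)
  also have "\<dots> = (s m \<otimes> invol A (s n)) \<otimes> (s ?v \<otimes> (s m' \<otimes> invol A (s n')))"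
    using mn v by (simp add: mult_assoc vertex_mor)
  \<comment> \<open>The degree dominates those of \<open>n\<close> and \<open>m'\<close>, so that
    both inner products can be evaluated path by path.\<close>
  also have "s ?v = (\<Oplus>l\<in>paths ?v ?N. S l l)" by (rule s_vertex_sum[OF v])
  also have "(s m \<otimes> invol A (s n)) \<otimes> (\<dots> \<otimes> (s m' \<otimes> invol A (s n'))) =
    (\<Oplus>l\<in>paths ?v ?N. (s m \<otimes> invol A (s n)) \<otimes> (S l l \<otimes> (s m' \<otimes> invol A (s n'))))"
    by (rule mult_finsum_mult) (simp_all add: Pi_iff pm(1) mn(1-4))
  also have "\<dots> \<in> lin ?R"
  proof (rule lin_finsum[OF R])
    fix l assume l: "l \<in> paths ?v ?N"
    have e: "(s m \<otimes> invol A (s n)) \<otimes> (S l l \<otimes> (s m' \<otimes> invol A (s n'))) =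
      (s m \<otimes> (invol A (s n) \<otimes> s l)) \<otimes> ((invol A (s l) \<otimes> s m') \<otimes> invol A (s n'))"
      using mn pm[OF l] by (simp add: S_def mult_assoc)
    have le: "deg L n \<le> deg L l" "deg L m' \<le> deg L l" using pm[OF l] by simp_all
    have ex: "invol A (s l) \<otimes> s m' = invol A (invol A (s m') \<otimes> s l)"
      using mn pm[OF l] by (simp add: invol_mult)
    show "(s m \<otimes> invol A (s n)) \<otimes> (S l l \<otimes> (s m' \<otimes> invol A (s n'))) \<in> lin ?R"
    proof (cases rule: star_s_mult_cases[OF mn(2) pm(1)[OF l] le(1)])
      case (1 a)
      note a = 1
      show ?thesis
      proof (cases rule: star_s_mult_cases[OF mn(3) pm(1)[OF l] le(2)])
        case (1 b)
        note b = 1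
        have srcs: "src L a = src L b"
          using a b mn by (metis src_comp)
        have "deg L n + deg L a = ?N" "deg L m' + deg L b = ?N"
          using a b mn pm[OF l] by (metis deg_comp)+
        then have d: "deg L a = deg L m'" "deg L b = deg L n"
          by (metis add.commute add_left_cancel)+
        have "(cmp L m a, cmp L n' b) \<in> ?R"
          using a b mn srcs d by (simp add: pairs_def comp_mor src_comp deg_comp add_ac)
        moreover have "(s m \<otimes> (invol A (s n) \<otimes> s l)) \<otimes> ((invol A (s l) \<otimes> s m') \<otimes> invol A (s n')) =
          S (cmp L m a) (cmp L n' b)"
          unfolding ex a(4) b(4) using a(1-3) b(1-3) mn by (simp add: S_def s_comp invol_mult)
        ultimately show ?thesis unfolding e using lin_gen[OF R] by simp
      next
        case 2
        show ?thesis unfolding e ex 2 using mn pm[OF l] by (simp add: lin.zero)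
      qed
    next
      case 2
      show ?thesis unfolding e 2 using mn pm[OF l] by (simp add: lin.zero)
    qed
  qed
  finally show ?thesis .
qed

end

section \<open>Paths without a common extension\<close>

context kgraph_cstar
begin

text \<open>A surviving term of the expansion over paths of degree \<open>deg L a + deg L b\<close>
  would come from a path that extends both \<open>a\<close> and \<open>b\<close>.\<close>

lemma star_s_comp_eq_zero:
  assumes a: "a \<in> mor L" and b: "b \<in> mor L"
    and sep: "\<And>c d. c \<in> mor L \<Longrightarrow> d \<in> mor L \<Longrightarrow> src L a = rng L c \<Longrightarrow> src L b = rng L d \<Longrightarrow>
      cmp L a c \<noteq> cmp L b d"
  shows "invol A (s a) \<otimes> s b = \<zero>"
proof -
  let ?v = "rng L a" and ?N = "deg L a + deg L b"
  have v: "?v \<in> vertices L" using a by (simp add: rng_vertex)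
  have pm: "l \<in> mor L" "deg L l = ?N" if "l \<in> paths ?v ?N" for l using that by (simp_all add: paths_def)
  have "invol A (s a) \<otimes> s b = invol A (s a) \<otimes> (s ?v \<otimes> s b)"
    using a b v by (simp add: star_s_rng vertex_mor flip: mult_assoc)
  also have "\<dots> = (\<Oplus>l\<in>paths ?v ?N. invol A (s a) \<otimes> (S l l \<otimes> s b))"
    unfolding s_vertex_sum[OF v, of ?N]
    by (rule mult_finsum_mult) (simp_all add: Pi_iff pm(1) a b)
  also have "\<dots> = (\<Oplus>l\<in>paths ?v ?N. \<zero>)"
  proof (rule M.finsum_cong')
    fix l assume l: "l \<in> paths ?v ?N"
    note lm = pm(1)[OF l]
    have le: "deg L a \<le> deg L l" "deg L b \<le> deg L l" using pm[OF l] by simp_all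
    have e: "invol A (s a) \<otimes> (S l l \<otimes> s b) = (invol A (s a) \<otimes> s l) \<otimes> invol A (invol A (s b) \<otimes> s l)"
      using a b lm by (simp add: S_def mult_assoc invol_mult)
    show "invol A (s a) \<otimes> (S l l \<otimes> s b) = \<zero>"
    proof (cases rule: star_s_mult_cases[OF a lm le(1)])
      case (1 c)
      note c = 1
      show ?thesis
      proof (cases rule: star_s_mult_cases[OF b lm le(2)])
        case (1 d)
        then show ?thesis using sep[of c d] c by simp
      next
        case 2
        then show ?thesis unfolding e 2 using a lm by simp
      qed
    next
      case 2
      show ?thesis unfolding e 2 using b lm by simp
    qed
  qed simp_all
  finally show ?thesis by simp
qed

definition spaths :: "'a \<Rightarrow> nat ^ 'k \<Rightarrow> 'a set" where
  "spaths v n = {l \<in> mor L. deg L l = n \<and> src L l = v}"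

lemma finite_spaths [simp]: "finite (spaths v n)"
  by (rule finite_subset[OF _ finite_deg[of n]]) (auto simp: spaths_def)

end

section \<open>Corner projections attached to a path\<close>

locale kgraph_cstar_corner = kgraph_cstar L A s
  for L :: "('a, 'k::finite) kgraph" and A :: "'b cstar" (structure) and s :: "'a \<Rightarrow> 'b" +
  fixes l v :: 'a
  assumes l [simp]: "l \<in> mor L" and v: "rng L l = v"
begin

text \<open>On infinite paths this is the projection onto those in which \<open>l\<close> occurs at
  degree \<open>q\<close>, after an arbitrary initial segment.\<close>

definition Q :: "nat ^ 'k \<Rightarrow> 'b" where
  "Q q = (\<Oplus>t\<in>spaths v q. S (cmp L t l) (cmp L t l))"

lemma spathsD:
  assumes "t \<in> spaths v q"
  shows "t \<in> mor L" "deg L t = q" "src L t = v" "cmp L t l \<in> mor L"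
  using assms v by (auto simp: spaths_def intro!: comp_mor)

lemma Q_closed [simp]: "Q q \<in> carrier A"
  unfolding Q_def by (intro M.finsum_closed) (auto simp: spathsD)

lemma Q_invol: "invol A (Q q) = Q q"
  unfolding Q_def by (subst invol_finsum) (auto simp: spathsD invol_S intro!: M.finsum_cong')

lemma Q_mult_s:
  assumes m: "m \<in> mor L" "deg L m = q"
  shows "Q q \<otimes> s m = (if src L m = v then s (cmp L m l) \<otimes> invol A (s l) else \<zero>)"
proof -
  have t: "S (cmp L t l) (cmp L t l) \<otimes> s m =
      (if m = t then s (cmp L t l) \<otimes> invol A (s l) else \<zero>)" if "t \<in> spaths v q" for t
  proof -
    note t = spathsD[OF that]
    have "S (cmp L t l) (cmp L t l) \<otimes> s m =
      s (cmp L t l) \<otimes> (invol A (s l) \<otimes> (invol A (s t) \<otimes> s m))"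
      using t m v by (simp add: S_def s_comp invol_mult mult_assoc)
    also have "\<dots> = (if m = t then s (cmp L t l) \<otimes> invol A (s l) else \<zero>)"
      using t m v star_s_rng[OF l] by (auto simp: s_star_s s_orth)
    finally show ?thesis .
  qed
  have "Q q \<otimes> s m = (\<Oplus>t\<in>spaths v q. S (cmp L t l) (cmp L t l) \<otimes> s m)"
    unfolding Q_def by (rule finsum_mult_right) (auto simp: spathsD m)
  also have "\<dots> = (\<Oplus>t\<in>spaths v q. if m = t then s (cmp L t l) \<otimes> invol A (s l) else \<zero>)"
    by (rule M.finsum_cong') (auto simp: t spathsD)
  also have "\<dots> = (if src L m = v then s (cmp L m l) \<otimes> invol A (s l) else \<zero>)"
  proof (cases "src L m = v")
    case True
    then have "m \<in> spaths v q" using m by (simp add: spaths_def)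
    then show ?thesis
      using True by (subst M.finsum_singleton) (auto simp: spathsD)
  next
    case False
    have "(\<Oplus>t\<in>spaths v q. if m = t then s (cmp L t l) \<otimes> invol A (s l) else \<zero>) =
      (\<Oplus>t\<in>spaths v q. \<zero>)"
      using False by (intro M.finsum_cong') (auto simp: spaths_def)
    then show ?thesis using False by simp
  qed
  finally show ?thesis .
qed

lemma star_s_mult_Q:
  assumes m: "m \<in> mor L" "deg L m = q"
  shows "invol A (s m) \<otimes> Q q = (if src L m = v then s l \<otimes> invol A (s (cmp L m l)) else \<zero>)"
proof -
  have "invol A (s m) \<otimes> Q q = invol A (Q q \<otimes> s m)"
    using m by (simp add: invol_mult Q_invol)
  then show ?thesis
    unfolding Q_mult_s[OF m] using m v by (auto simp: invol_mult comp_mor)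
qed

text \<open>Both sides equal \<open>S (cmp L m l) (cmp L n l)\<close> if the common source is
  \<open>v\<close>, and 0 otherwise: replacing the initial segment \<open>n\<close> by
  \<open>m\<close> moves an occurrence of \<open>l\<close> from degree \<open>q'\<close> to degree
  \<open>q\<close>.\<close>

lemma Q_comm_S:
  assumes mn: "(m, n) \<in> pairs" "deg L m = q" "deg L n = q'"
  shows "Q q \<otimes> S m n = S m n \<otimes> Q q'"
proof -
  have c: "m \<in> mor L" "n \<in> mor L" "src L m = src L n" using mn by (auto simp: pairs_def)
  have 1: "Q q \<otimes> S m n = (Q q \<otimes> s m) \<otimes> invol A (s n)"
    using c by (simp add: S_def mult_assoc)
  have 2: "S m n \<otimes> Q q' = s m \<otimes> (invol A (s n) \<otimes> Q q')"
    using c by (simp add: S_def mult_assoc)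
  show ?thesis
    unfolding 1 2 Q_mult_s[OF c(1) mn(2)] star_s_mult_Q[OF c(2) mn(3)]
    using c v by (auto simp: s_comp invol_mult mult_assoc)
qed

lemma Q_mult_s_comp:
  assumes t: "t \<in> spaths v q"
  shows "Q q \<otimes> s (cmp L t l) = s (cmp L t l)"
proof -
  note td = spathsD[OF t]
  have "Q q \<otimes> s (cmp L t l) = (Q q \<otimes> s t) \<otimes> s l"
    using td v by (simp add: s_comp mult_assoc)
  also have "\<dots> = s (cmp L t l) \<otimes> (invol A (s l) \<otimes> s l)"
    using td v by (simp add: Q_mult_s mult_assoc)
  also have "\<dots> = s (cmp L t l)"
    using td v s_src[of "cmp L t l"] by (simp add: s_star_s src_comp)
  finally show ?thesis .
qed

lemma star_s_comp_mult_Q: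
  assumes t: "t \<in> spaths v q"
  shows "invol A (s (cmp L t l)) \<otimes> Q q = invol A (s (cmp L t l))"
  using invol_mult[of "Q q" "s (cmp L t l)"] Q_mult_s_comp[OF t] spathsD[OF t]
  by (simp add: Q_invol)

lemma Q_idem: "Q q \<otimes> Q q = Q q"
proof -
  have term_eq: "Q q \<otimes> S (cmp L t l) (cmp L t l) = S (cmp L t l) (cmp L t l)" if "t \<in> spaths v q" for t
    using Q_mult_s_comp[OF that] spathsD[OF that] by (simp add: S_def flip: mult_assoc)
  have "Q q \<otimes> (\<Oplus>t\<in>spaths v q. S (cmp L t l) (cmp L t l)) =
    (\<Oplus>t\<in>spaths v q. Q q \<otimes> S (cmp L t l) (cmp L t l))"
    by (rule finsum_mult_left) (auto simp: spathsD)
  also have "\<dots> = (\<Oplus>t\<in>spaths v q. S (cmp L t l) (cmp L t l))"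
    by (rule M.finsum_cong') (auto simp: spathsD term_eq)
  finally show ?thesis by (simp flip: Q_def)
qed

text \<open>A surviving term needs \<open>t = m a\<close> and \<open>t' = n b\<close>, and then
  contains the adjoint of \<open>s (cmp L a l)\<close> times \<open>s (cmp L b l)\<close>. The last
  hypothesis says \<open>deg L a \<noteq> deg L b\<close> without subtraction, so by separation the
  two paths have no common extension.\<close>

lemma Q_kill:
  assumes sep: "\<And>a b c d. \<lbrakk>a \<in> mor L; b \<in> mor L; c \<in> mor L; d \<in> mor L; src L a = v; src L b = v;
      src L l = rng L c; src L l = rng L d; deg L a \<le> N; deg L b \<le> N; deg L a \<noteq> deg L b\<rbrakk>
      \<Longrightarrow> cmp L (cmp L a l) c \<noteq> cmp L (cmp L b l) d"
    and mn: "(m, n) \<in> pairs" "deg L m \<le> q" "deg L n \<le> q'" and N: "q \<le> N" "q' \<le> N"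
    and neq: "q + deg L n \<noteq> q' + deg L m"
  shows "Q q \<otimes> (S m n \<otimes> Q q') = \<zero>"
proof -
  have c: "m \<in> mor L" "n \<in> mor L" using mn by (auto simp: pairs_def)
  have z: "invol A (s (cmp L t l)) \<otimes> (S m n \<otimes> s (cmp L t' l)) = \<zero>"
    if t: "t \<in> spaths v q" and t': "t' \<in> spaths v q'" for t t'
  proof -
    note td = spathsD[OF t] and td' = spathsD[OF t']
    have le: "deg L m \<le> deg L t" "deg L n \<le> deg L t'" using mn td td' by simp_all
    have e: "invol A (s (cmp L t l)) \<otimes> (S m n \<otimes> s (cmp L t' l)) =
      invol A ((invol A (s m) \<otimes> s t) \<otimes> s l) \<otimes> ((invol A (s n) \<otimes> s t') \<otimes> s l)"
      using td td' c v by (simp add: S_def s_comp mult_assoc invol_mult)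
    show ?thesis
    proof (cases rule: star_s_mult_cases[OF c(1) td(1) le(1)])
      case (1 a)
      note a = 1
      show ?thesis
      proof (cases rule: star_s_mult_cases[OF c(2) td'(1) le(2)])
        case (1 b)
        have da: "q = deg L m + deg L a" and db: "q' = deg L n + deg L b"
          using a 1 c td td' by (metis deg_comp)+
        have ne: "deg L a \<noteq> deg L b"
          using neq da db by (auto simp: add_ac)
        have aN: "deg L a \<le> N" "deg L b \<le> N"
          using N da db by (auto intro: order_trans[OF vec_nat_diff_simps(4)])
        have sa: "src L a = v" "src L b = v"
          using a 1 c td td' by (metis src_comp)+
        have "invol A (s (cmp L a l)) \<otimes> s (cmp L b l) = \<zero>"
          using sep[OF a(1) 1(1) _ _ sa _ _ aN ne] a 1 sa v
          by (intro star_s_comp_eq_zero) (auto simp: comp_mor src_comp)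
        then show ?thesis
          unfolding e
            a(4) 1(4) using a(1) 1(1) sa v by (simp add: s_comp)
      next
        case 2
        show ?thesis unfolding e 2
          using td c by simp
      qed
    next
      case 2
      show ?thesis unfolding e 2 using td' c by simp
    qed
  qed
  have "Q q \<otimes> (S m n \<otimes> Q q') = (\<Oplus>t\<in>spaths v q. \<zero>)"
  proof -
    have "Q q \<otimes> (S m n \<otimes> Q q') = (\<Oplus>t\<in>spaths v q. S (cmp L t l) (cmp L t l) \<otimes> (S m n \<otimes> Q q'))"
      unfolding Q_def[of q] by (rule finsum_mult_right) (auto simp: spathsD c)
    also have "\<dots> = (\<Oplus>t\<in>spaths v q. \<zero>)"
    proof (rule M.finsum_cong')
      fix t assume t: "t \<in> spaths v q"
      note td = spathsD[OF t]
      have "S m n \<otimes> Q q' = (\<Oplus>t'\<in>spaths v q'. S m n \<otimes> S (cmp L t' l) (cmp L t' l))"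
        unfolding Q_def by (rule finsum_mult_left) (auto simp: spathsD c)
      then have "invol A (s (cmp L t l)) \<otimes> (S m n \<otimes> Q q') =
        (\<Oplus>t'\<in>spaths v q'. invol A (s (cmp L t l)) \<otimes> (S m n \<otimes> S (cmp L t' l) (cmp L t' l)))"
        using td c by (subst finsum_mult_left[symmetric]) (auto simp: spathsD)
      also have "\<dots> = (\<Oplus>t'\<in>spaths v q'. \<zero>)"
      proof (rule M.finsum_cong')
        fix t' assume t': "t' \<in> spaths v q'"
        note td' = spathsD[OF t']
        have "invol A (s (cmp L t l)) \<otimes> (S m n \<otimes> S (cmp L t' l) (cmp L t' l)) =
          (invol A (s (cmp L t l)) \<otimes> (S m n \<otimes> s (cmp L t' l))) \<otimes> invol A (s (cmp L t' l))"
          using td td' c by (simp add: S_def mult_assoc)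
        then show "invol A (s (cmp L t l)) \<otimes> (S m n \<otimes> S (cmp L t' l) (cmp L t' l)) = \<zero>"
          using z[OF t t'] td' by simp
      qed simp_all
      finally have "invol A (s (cmp L t l)) \<otimes> (S m n \<otimes> Q q') = \<zero>" by simp
      then show "S (cmp L t l) (cmp L t l) \<otimes> (S m n \<otimes> Q q') = \<zero>"
        using td c by (simp add: S_def[of "cmp L t l"] mult_assoc)
    qed simp_all
    finally show ?thesis .
  qed
  then show ?thesis by simp
qed

end

text \<open>Subexponential factors disappear when a submultiplicative estimate is applied to
  iterated squares.\<close>

lemma le_of_power_growth:
  fixes a b C :: real
  assumes a: "0 \<le> a" and b: "0 \<le> b" and le: "\<And>j. a ^ (2 ^ j) \<le> C * real (2 ^ j) ^ k * b ^ (2 ^ j)"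
  shows "a \<le> b"
proof (rule ccontr)
  assume "\<not> a \<le> b"
  then have ab: "b < a" by simp
  have b0: "0 < b"
    using le[of 0] ab b by (cases "b = 0") auto
  define r where "r = a / b"
  have r: "1 < r" using ab b0 by (simp add: r_def)
  have bound: "1 \<le> C * (real (2 ^ j) ^ k * (1 / r) ^ (2 ^ j))" for j
  proof -
    have "a ^ (2 ^ j) = r ^ (2 ^ j) * b ^ (2 ^ j)"
      using b0 by (simp add: r_def power_divide)
    then have "r ^ (2 ^ j) \<le> C * real (2 ^ j) ^ k"
      using le[of j] b0 by simp
    then show ?thesis using r by (simp add: power_divide divide_simps mult.assoc)
  qed
  have "(\<lambda>n. real n ^ k * (1 / r) ^ n) \<longlonglongrightarrow> 0"
    using r by real_asymp
  then have "(\<lambda>n. C * (real n ^ k * (1 / r) ^ n)) \<longlonglongrightarrow> C * 0"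
    by (intro tendsto_intros)
  moreover have "filterlim (\<lambda>j. 2 ^ j :: nat) at_top sequentially"
    by real_asymp
  ultimately have "(\<lambda>j. C * (real (2 ^ j) ^ k * (1 / r) ^ (2 ^ j))) \<longlonglongrightarrow> C * 0"
    by (rule filterlim_compose)
  then have "(1::real) \<le> C * 0"
    using bound by (intro tendsto_lowerbound[of _ "C * 0"]) auto
  then show False by simp
qed

section \<open>Comparison of the norm with a C*-seminorm for fixed degrees\<close>

locale kgraph_cstar_seminorm = kgraph_cstar L A s
  for L :: "('a, 'k::finite) kgraph" and A :: "'b cstar" (structure) and s :: "'a \<Rightarrow> 'b" +
  fixes p :: "'b \<Rightarrow> real"
  assumes p_nonneg: "x \<in> carrier A \<Longrightarrow> 0 \<le> p x"
    and p_mult: "x \<in> carrier A \<Longrightarrow> y \<in> carrier A \<Longrightarrow> p (x \<otimes> y) \<le> p x * p y"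
    and p_scale: "x \<in> carrier A \<Longrightarrow> p (c \<odot> x) = cmod c * p x"
    and p_star: "x \<in> carrier A \<Longrightarrow> p (invol A x \<otimes> x) = (p x)\<^sup>2"
    and p_vertex: "v \<in> vertices L \<Longrightarrow> p (s v) \<noteq> 0"
    and aper: "aperiodic L"
begin

lemma p_invol:
  assumes "x \<in> carrier A"
  shows "p (invol A x) = p x"
proof -
  have *: "p x \<le> p (invol A x)" if x: "x \<in> carrier A" for x
  proof (cases "p x = 0")
    case False
    have "p x * p x \<le> p (invol A x) * p x"
      using p_star[OF x] p_mult[of "invol A x" x] x by (simp add: power2_eq_square)
    then show ?thesis
      using False p_nonneg[OF x] by (simp add: mult_le_cancel_right)
  qed (use p_nonneg x in auto)
  show ?thesis
    using *[OF assms] *[of "invol A x"] assms by simp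
qed

lemma p_projection_le:
  assumes "x \<in> carrier A" "invol A x \<otimes> x = x"
  shows "p x \<le> 1"
  using p_star[OF assms(1)] assms(2) by (intro le_one_of_power2_le) simp

lemma p_s_vertex: "v \<in> vertices L \<Longrightarrow> p (s v) = 1"
  using p_star[of "s v"] p_vertex[of v] s_vertex[of v]
  by (simp add: vertex_mor power2_eq_square)

lemma p_s: "m \<in> mor L \<Longrightarrow> p (s m) = 1"
  using p_star[of "s m"] p_nonneg[of "s m"]
  by (simp add: s_star_s p_s_vertex src_vertex power2_eq_1_iff)

lemma nrm_s_vertex_le: "v \<in> vertices L \<Longrightarrow> nrm A (s v) \<le> 1"
  by (intro nrm_projection_le) (simp_all add: s_vertex vertex_mor)

lemma nrm_s_le:
  assumes "m \<in> mor L"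
  shows "nrm A (s m) \<le> 1"
proof -
  have "(nrm A (s m))\<^sup>2 \<le> 1\<^sup>2"
    using cstar_identity[of "s m"] nrm_s_vertex_le[of "src L m"] assms
    by (simp add: s_star_s src_vertex)
  then show ?thesis by (rule power2_le_imp_le) simp
qed

text \<open>Between paths of fixed degrees the \<open>S m n\<close> multiply like matrix units; the
  span consists of matrices with rows of degree \<open>q\<close> and columns of degree
  \<open>q'\<close>, finitely many of each.\<close>

definition sq :: "nat ^ 'k \<Rightarrow> nat ^ 'k \<Rightarrow> ('a \<times> 'a) set" where
  "sq q q' = {(m, n) \<in> pairs. deg L m = q \<and> deg L n = q'}"

lemma sq_pairs: "sq q q' \<subseteq> pairs" by (auto simp: sq_def)

lemma sq_mult:
  assumes "x \<in> lin (sq q q')" "y \<in> lin (sq q' q'')"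
  shows "x \<otimes> y \<in> lin (sq q q'')"
proof (rule lin_mult[OF assms sq_pairs sq_pairs sq_pairs])
  fix m n m' n' assume *: "(m, n) \<in> sq q q'" "(m', n') \<in> sq q' q''"
  then have c: "m \<in> mor L" "n \<in> mor L" "m' \<in> mor L" "n' \<in> mor L" "src L m = src L n" "src L m' = src L n'"
    and d: "deg L n = deg L m'"
    by (auto simp: sq_def pairs_def)
  have e: "S m n \<otimes> S m' n' = s m \<otimes> ((invol A (s n) \<otimes> s m') \<otimes> invol A (s n'))"
    using c by (simp add: S_def mult_assoc)
  show "S m n \<otimes> S m' n' \<in> lin (sq q q'')"
  proof (cases "n = m'")
    case True
    then have "S m n \<otimes> S m' n' = S m n'"
      unfolding e using c by (simp add: S_def s_star_s star_s_src)
    moreover have "(m, n') \<in> sq q q''" using * True c by (auto simp: sq_def pairs_def)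
    ultimately show ?thesis using lin_gen[OF sq_pairs] by simp
  next
    case False
    then show ?thesis unfolding e using c d by (simp add: s_orth lin.zero)
  qed
qed

lemma sq_invol: "x \<in> lin (sq q q') \<Longrightarrow> invol A x \<in> lin (sq q' q)"
  by (rule lin_invol) (auto simp: sq_def pairs_def)

definition allpaths :: "nat ^ 'k \<Rightarrow> 'a set" where "allpaths q = {l \<in> mor L. deg L l = q}"

lemma finite_allpaths [simp]: "finite (allpaths q)"
  unfolding allpaths_def by (rule finite_deg)

lemma sum_S_mult:
  assumes "m \<in> allpaths q"
  shows "(\<Oplus>t\<in>allpaths q. S t t \<otimes> s m) = s m"
proof -
  have m: "m \<in> mor L" using assms by (simp add: allpaths_def)
  have "(\<Oplus>t\<in>allpaths q. S t t \<otimes> s m) = (\<Oplus>t\<in>allpaths q. if m = t then s m else \<zero>)"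
  proof (rule M.finsum_cong')
    fix t assume "t \<in> allpaths q"
    then have t: "t \<in> mor L" "deg L t = deg L m" using assms by (auto simp: allpaths_def)
    then have "S t t \<otimes> s m = s t \<otimes> (invol A (s t) \<otimes> s m)"
      using m by (simp add: S_def mult_assoc)
    then show "S t t \<otimes> s m = (if m = t then s m else \<zero>)"
      using t m by (auto simp: s_star_s s_src s_orth)
  qed (use m in auto)
  also have "\<dots> = s m"
    using assms m by (subst M.finsum_singleton) auto
  finally show ?thesis .
qed

text \<open>This is the matrix entry of \<open>y\<close> at row \<open>t\<close> and column
  \<open>t'\<close>, a scalar multiple of the projection at the common source.\<close>

lemma star_s_sq_mult_s:
  assumes y: "y \<in> lin (sq q q')" and t: "t \<in> allpaths q" "t' \<in> allpaths q'"
  shows "(src L t = src L t' \<and> (\<exists>c. invol A (s t) \<otimes> (y \<otimes> s t') = c \<odot> s (src L t))) \<or>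
    invol A (s t) \<otimes> (y \<otimes> s t') = \<zero>"
proof -
  have tm: "t \<in> mor L" "t' \<in> mor L" "deg L t = q" "deg L t' = q'"
    using t by (auto simp: allpaths_def)
  have gen: "invol A (s t) \<otimes> (S m n \<otimes> s t') = (if t = m \<and> t' = n then s (src L t) else \<zero>)"
    if mn: "(m, n) \<in> sq q q'" for m n
  proof -
    have c: "m \<in> mor L" "n \<in> mor L" "src L m = src L n" "deg L m = q" "deg L n = q'"
      using mn by (auto simp: sq_def pairs_def)
    have "invol A (s t) \<otimes> (S m n \<otimes> s t') = (invol A (s t) \<otimes> s m) \<otimes> (invol A (s n) \<otimes> s t')"
      using c tm by (simp add: S_def mult_assoc)
    also have "\<dots> = (if t = m \<and> t' = n then s (src L t) else \<zero>)"
      using c tm by (auto simp: s_star_s s_orth[of t] s_orth[of n] s_vertex src_vertex src_mor)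
    finally show ?thesis .
  qed
  show ?thesis
    using y
  proof (induction rule: lin.induct)
    case zero
    show ?case using tm by simp
  next
    case (step x m n d)
    have c: "m \<in> mor L" "n \<in> mor L" "src L m = src L n" "x \<in> carrier A"
      using step(1,2) lin_closed[OF _ sq_pairs] by (auto simp: sq_def pairs_def)
    have e: "invol A (s t) \<otimes> ((x \<oplus> d \<odot> S m n) \<otimes> s t') =
      invol A (s t) \<otimes> (x \<otimes> s t') \<oplus> d \<odot> (if t = m \<and> t' = n then s (src L t) else \<zero>)"
      using c tm gen[OF step(2)]
      by (simp add: mult_add_left mult_add_right smult_mult_left smult_mult_right)
    have sc: "s (src L t) \<in> carrier A" using tm by (simp add: src_mor)
    show ?case
    proof (cases "t = m \<and> t' = n")
      case True
      then have "src L t = src L t'" using c by simp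
      moreover have "\<exists>c. invol A (s t) \<otimes> (x \<otimes> s t') = c \<odot> s (src L t)"
        using step.IH sc by (metis scale_zero_left)
      then have "\<exists>c. invol A (s t) \<otimes> (x \<otimes> s t') \<oplus> d \<odot> s (src L t) = c \<odot> s (src L t)"
        using sc scale_collect(1) by metis
      ultimately show ?thesis unfolding e using True by simp
    next
      case False
      then show ?thesis unfolding e using step.IH tm c by auto
    qed
  qed
qed

lemma allpathsD: "t \<in> allpaths q \<Longrightarrow> t \<in> mor L"
  by (simp add: allpaths_def)

lemma sum_S_lin:
  assumes y: "y \<in> lin (sq q q')"
  shows "(\<Oplus>t\<in>allpaths q. S t t \<otimes> y) = y"
proof (rule lin_eq[OF y sq_pairs, of "\<lambda>y. \<Oplus>t\<in>allpaths q. S t t \<otimes> y" "\<lambda>y. y"])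
  fix m n assume "(m, n) \<in> sq q q'"
  then have c: "m \<in> mor L" "n \<in> mor L" "m \<in> allpaths q" by (auto simp: sq_def pairs_def allpaths_def)
  have "(\<Oplus>t\<in>allpaths q. S t t \<otimes> S m n) = (\<Oplus>t\<in>allpaths q. S t t \<otimes> s m \<otimes> invol A (s n))"
    using c by (intro M.finsum_cong') (auto simp: allpathsD S_def[of m] mult_assoc)
  also have "\<dots> = (\<Oplus>t\<in>allpaths q. S t t \<otimes> s m) \<otimes> invol A (s n)"
    using c by (intro finsum_mult_right[symmetric]) (auto simp: allpathsD)
  also have "\<dots> = S m n"
    unfolding sum_S_mult[OF c(3)] by (simp add: S_def)
  finally show "(\<Oplus>t\<in>allpaths q. S t t \<otimes> S m n) = S m n" .
next
  show "(\<Oplus>t\<in>allpaths q. S t t \<otimes> (x \<oplus> z)) = (\<Oplus>t\<in>allpaths q. S t t \<otimes> x) \<oplus> (\<Oplus>t\<in>allpaths q. S t t \<otimes> z)"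
    if "x \<in> carrier A" "z \<in> carrier A" for x z
  proof -
    have "(\<Oplus>t\<in>allpaths q. S t t \<otimes> (x \<oplus> z)) = (\<Oplus>t\<in>allpaths q. S t t \<otimes> x \<oplus> S t t \<otimes> z)"
      using that by (intro M.finsum_cong') (auto simp: allpathsD mult_add_right)
    also have "\<dots> = (\<Oplus>t\<in>allpaths q. S t t \<otimes> x) \<oplus> (\<Oplus>t\<in>allpaths q. S t t \<otimes> z)"
      using that by (intro M.finsum_addf) (auto simp: allpathsD)
    finally show ?thesis .
  qed
  show "(\<Oplus>t\<in>allpaths q. S t t \<otimes> (c \<odot> x)) = c \<odot> (\<Oplus>t\<in>allpaths q. S t t \<otimes> x)"
    if "x \<in> carrier A" for x c
    using that by (subst finsum_scale) (auto simp: allpathsD smult_mult_right intro!: M.finsum_cong')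
  have "(\<Oplus>t\<in>allpaths q. S t t \<otimes> \<zero>) = (\<Oplus>t\<in>allpaths q. \<zero>)"
    by (intro M.finsum_cong') (auto simp: allpathsD)
  then show "(\<Oplus>t\<in>allpaths q. S t t \<otimes> \<zero>) = \<zero>" by simp
qed auto

lemma sum_lin_S:
  assumes y: "y \<in> lin (sq q q')"
  shows "(\<Oplus>t\<in>allpaths q'. y \<otimes> S t t) = y"
proof -
  have yc: "y \<in> carrier A" using lin_closed[OF y sq_pairs] .
  have "invol A (invol A y) = invol A (\<Oplus>t\<in>allpaths q'. S t t \<otimes> invol A y)"
    by (simp add: sum_S_lin[OF sq_invol[OF y]])
  also have "\<dots> = (\<Oplus>t\<in>allpaths q'. invol A (S t t \<otimes> invol A y))"
    using yc by (intro invol_finsum) (auto simp: allpathsD)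
  also have "\<dots> = (\<Oplus>t\<in>allpaths q'. y \<otimes> S t t)"
    using yc by (intro M.finsum_cong') (auto simp: allpathsD invol_mult invol_S)
  finally show ?thesis using yc by simp
qed

text \<open>A crude bound by the number of entries; its constant depends on \<open>q\<close> and
  \<open>q'\<close> only, so that taking powers in \<open>nrm_le_corner_selfadjoint\<close> removes
  it.\<close>

lemma nrm_sq_le:
  assumes y: "y \<in> lin (sq q q')"
    and le: "\<And>t t'. t \<in> allpaths q \<Longrightarrow> t' \<in> allpaths q' \<Longrightarrow> nrm A (invol A (s t) \<otimes> (y \<otimes> s t')) \<le> B"
  shows "nrm A y \<le> real (card (allpaths q)) * (real (card (allpaths q')) * B)"
proof -
  have yc: "y \<in> carrier A" using lin_closed[OF y sq_pairs] .
  have "nrm A y = nrm A (\<Oplus>t\<in>allpaths q. S t t \<otimes> y)" by (simp add: sum_S_lin[OF y])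
  also have "\<dots> \<le> (\<Sum>t\<in>allpaths q. nrm A (S t t \<otimes> y))"
    using yc by (intro nrm_finsum) (auto simp: allpathsD)
  also have "\<dots> \<le> (\<Sum>t\<in>allpaths q. real (card (allpaths q')) * B)"
  proof (intro sum_mono)
    fix t assume t: "t \<in> allpaths q"
    have "S t t \<otimes> y = S t t \<otimes> (\<Oplus>t'\<in>allpaths q'. y \<otimes> S t' t')"
      by (simp add: sum_lin_S[OF y])
    also have "\<dots> = (\<Oplus>t'\<in>allpaths q'. S t t \<otimes> (y \<otimes> S t' t'))"
      using yc t by (intro finsum_mult_left) (auto simp: allpathsD)
    finally have "nrm A (S t t \<otimes> y) \<le> (\<Sum>t'\<in>allpaths q'. nrm A (S t t \<otimes> (y \<otimes> S t' t')))"
      using yc t nrm_finsum[of "\<lambda>t'. S t t \<otimes> (y \<otimes> S t' t')" "allpaths q'"] by (simp add: Pi_iff allpathsD)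
    also have "\<dots> \<le> (\<Sum>t'\<in>allpaths q'. B)"
    proof (intro sum_mono)
      fix t' assume t': "t' \<in> allpaths q'"
      note tm = allpathsD[OF t] allpathsD[OF t']
      let ?c = "invol A (s t) \<otimes> (y \<otimes> s t')"
      have "S t t \<otimes> (y \<otimes> S t' t') = s t \<otimes> (?c \<otimes> invol A (s t'))"
        using tm yc by (simp add: S_def mult_assoc)
      then have "nrm A (S t t \<otimes> (y \<otimes> S t' t')) \<le> nrm A (s t) * (nrm A ?c * nrm A (invol A (s t')))"
        using tm yc order_trans[OF nrm_mult mult_left_mono[OF nrm_mult nrm_nonneg]] by simp
      also have "\<dots> \<le> 1 * (B * 1)"
      proof -
        have "0 \<le> B" using tm yc order_trans[OF nrm_nonneg le[OF t t']] by simp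
        then show ?thesis
          using tm yc le[OF t t'] by (intro mult_mono) (auto simp: nrm_invol nrm_s_le nrm_nonneg)
      qed
      finally show "nrm A (S t t \<otimes> (y \<otimes> S t' t')) \<le> B" by simp
    qed
    finally show "nrm A (S t t \<otimes> y) \<le> real (card (allpaths q')) * B" by simp
  qed
  finally show ?thesis by simp
qed

abbreviation QQ :: "'a \<Rightarrow> nat ^ 'k \<Rightarrow> 'b" where
  "QQ l \<equiv> kgraph_cstar_corner.Q L A s l (rng L l)"

lemma corner: "l \<in> mor L \<Longrightarrow> kgraph_cstar_corner L A s l (rng L l)"
  by unfold_locales simp_all

lemma QQ_comm:
  assumes l: "l \<in> mor L" and y: "y \<in> lin (sq q q')"
  shows "QQ l q \<otimes> y = y \<otimes> QQ l q'"
proof -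
  interpret kgraph_cstar_corner L A s l "rng L l" by (rule corner[OF l])
  show ?thesis
  proof (rule lin_eq[OF y sq_pairs, of "\<lambda>y. Q q \<otimes> y" "\<lambda>y. y \<otimes> Q q'"])
    show "Q q \<otimes> S m n = S m n \<otimes> Q q'" if "(m, n) \<in> sq q q'" for m n
      using that by (intro Q_comm_S) (auto simp: sq_def)
  qed (simp_all add: mult_add_left mult_add_right smult_mult_left smult_mult_right)
qed

text \<open>For an entry with scalar \<open>c\<close> at a vertex \<open>v\<close> and a path
  \<open>l\<close> with range \<open>v\<close>, the element \<open>c \<odot> s (src L l)\<close> is
  the compression of \<open>QQ l q\<close> times \<open>y\<close> by the partial isometries of
  \<open>t l\<close> and \<open>t' l\<close>. These have \<open>p\<close> equal to 1, so
  \<open>cmod c\<close> is at most \<open>B\<close>: here a bound on \<open>p\<close> becomes one on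
  the norm. The path \<open>l\<close> may vary with the vertex.\<close>

lemma nrm_le_corner:
  assumes y: "y \<in> lin (sq q q)" and B: "0 \<le> B"
    and le: "\<And>v. v \<in> vertices L \<Longrightarrow> \<exists>l\<in>mor L. rng L l = v \<and> p (QQ l q \<otimes> y) \<le> B"
  shows "nrm A y \<le> (real (card (allpaths q)))\<^sup>2 * B"
proof -
  have yc: "y \<in> carrier A" using lin_closed[OF y sq_pairs] .
  have "nrm A (invol A (s t) \<otimes> (y \<otimes> s t')) \<le> B" if t: "t \<in> allpaths q" "t' \<in> allpaths q" for t t'
  proof (cases "invol A (s t) \<otimes> (y \<otimes> s t') = \<zero>")
    case True
    then show ?thesis using B by simp
  next
    case False
    then obtain c where src: "src L t = src L t'"
      and c: "invol A (s t) \<otimes> (y \<otimes> s t') = c \<odot> s (src L t)"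
      using star_s_sq_mult_s[OF y t] by blast
    note tm = allpathsD[OF t(1)] allpathsD[OF t(2)]
    obtain l where l: "l \<in> mor L" "rng L l = src L t" "p (QQ l q \<otimes> y) \<le> B"
      using le[of "src L t"] tm src_vertex by blast
    interpret C: kgraph_cstar_corner L A s l "rng L l" by (rule corner[OF l(1)])
    have sp: "t \<in> spaths (rng L l) q" "t' \<in> spaths (rng L l) q"
      using t l src by (auto simp: allpaths_def spaths_def)
    note tl = C.spathsD(4)[OF sp(1)] C.spathsD(4)[OF sp(2)]
    have "c \<odot> s (src L l) = invol A (s l) \<otimes> ((c \<odot> s (src L t)) \<otimes> s l)"
      using l s_rng[OF l(1)] tm by (simp add: smult_mult_left smult_mult_right s_star_s src_mor)
    also have "\<dots> = invol A (s (cmp L t l)) \<otimes> (y \<otimes> s (cmp L t' l))"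
      unfolding c[symmetric] using l tm yc src by (simp add: s_comp invol_mult mult_assoc)
    also have "\<dots> = (invol A (s (cmp L t l)) \<otimes> QQ l q) \<otimes> (y \<otimes> s (cmp L t' l))"
      by (simp only: C.star_s_comp_mult_Q[OF sp(1)])
    also have "\<dots> = invol A (s (cmp L t l)) \<otimes> ((QQ l q \<otimes> y) \<otimes> s (cmp L t' l))"
      using tl yc by (simp add: mult_assoc)
    finally have "p (c \<odot> s (src L l)) \<le> p (invol A (s (cmp L t l))) * (p (QQ l q \<otimes> y) * p (s (cmp L t' l)))"
      using tl yc order_trans[OF p_mult mult_left_mono[OF p_mult p_nonneg]] by simp
    then have "cmod c \<le> B"
      using l tl by (simp add: p_invol p_s p_scale p_s_vertex src_mor src_vertex)
    moreover have "nrm A (c \<odot> s (src L t)) \<le> cmod c"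
      using nrm_s_vertex_le[of "src L t"] tm by (simp add: nrm_smult src_mor src_vertex mult_left_le)
    ultimately show ?thesis unfolding c by simp
  qed
  then show ?thesis
    using nrm_sq_le[OF y, of B] by (simp add: power2_eq_square mult.assoc)
qed

text \<open>The power \<open>x ^ (2 ^ j)\<close>; for self-adjoint \<open>x\<close> the C*-identity,
  applied once per squaring, evaluates its norm.\<close>

primrec iter :: "'b \<Rightarrow> nat \<Rightarrow> 'b" where
  "iter x 0 = x"
| "iter x (Suc j) = iter x j \<otimes> iter x j"

lemma iter_selfadjoint:
  assumes "x \<in> carrier A" "invol A x = x"
  shows "iter x j \<in> carrier A" "invol A (iter x j) = iter x j"
proof -
  have "iter x j \<in> carrier A \<and> invol A (iter x j) = iter x j"
    using assms by (induction j) (auto simp: invol_mult)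
  then show "iter x j \<in> carrier A" "invol A (iter x j) = iter x j" by auto
qed

lemma nrm_iter:
  assumes "x \<in> carrier A" "invol A x = x"
  shows "nrm A (iter x j) = nrm A x ^ (2 ^ j)" "p (iter x j) = p x ^ (2 ^ j)"
proof -
  note i = iter_selfadjoint[OF assms]
  show "nrm A (iter x j) = nrm A x ^ (2 ^ j)"
    using cstar_identity[OF i(1)] i
    by (induction j) (auto simp: power_mult mult.commute[of 2])
  show "p (iter x j) = p x ^ (2 ^ j)"
    using p_star[OF i(1)] i
    by (induction j) (auto simp: power_mult mult.commute[of 2])
qed

text \<open>\<open>QQ l q\<close> commutes with \<open>y\<close>, so it may be distributed over the
  factors of an iterated square. The constant of \<open>nrm_le_corner\<close> is the same for all
  powers, hence \<open>k = 0\<close> in the growth argument.\<close>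

lemma nrm_le_corner_selfadjoint:
  assumes y: "y \<in> lin (sq q q)" "invol A y = y" and B: "0 \<le> B"
    and le: "\<And>v. v \<in> vertices L \<Longrightarrow> \<exists>l\<in>mor L. rng L l = v \<and> p (QQ l q \<otimes> y) \<le> B"
  shows "nrm A y \<le> B"
proof (rule le_of_power_growth[where k = 0])
  have yc: "y \<in> carrier A" using lin_closed[OF y(1) sq_pairs] .
  note i = iter_selfadjoint[OF yc y(2)]
  have il: "iter y j \<in> lin (sq q q)" for j
    by (induction j) (auto simp: y sq_mult)
  have pow: "p (QQ l q \<otimes> iter y j) \<le> p (QQ l q \<otimes> y) ^ (2 ^ j)" if l: "l \<in> mor L" for l j
  proof (induction j)
    case (Suc j)
    interpret C: kgraph_cstar_corner L A s l "rng L l" by (rule corner[OF l])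
    have "QQ l q \<otimes> iter y (Suc j) = (QQ l q \<otimes> QQ l q) \<otimes> (iter y j \<otimes> iter y j)"
      by (simp only: C.Q_idem iter.simps)
    also have "\<dots> = QQ l q \<otimes> ((QQ l q \<otimes> iter y j) \<otimes> iter y j)"
      using i by (simp add: mult_assoc)
    also have "\<dots> = QQ l q \<otimes> ((iter y j \<otimes> QQ l q) \<otimes> iter y j)"
      by (simp only: QQ_comm[OF l il[of j]])
    also have "\<dots> = (QQ l q \<otimes> iter y j) \<otimes> (QQ l q \<otimes> iter y j)"
      using i(1) by (simp add: mult_assoc)
    finally have "p (QQ l q \<otimes> iter y (Suc j)) \<le> p (QQ l q \<otimes> iter y j) * p (QQ l q \<otimes> iter y j)"
      using i by (simp add: p_mult)
    also have "\<dots> \<le> p (QQ l q \<otimes> y) ^ (2 ^ j) * p (QQ l q \<otimes> y) ^ (2 ^ j)"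
      using Suc i yc by (intro mult_mono) (auto simp: p_nonneg)
    finally show ?case by (simp add: power_mult mult.commute[of 2] power2_eq_square)
  qed simp
  show "nrm A y ^ (2 ^ j) \<le> (real (card (allpaths q)))\<^sup>2 * real (2 ^ j) ^ 0 * B ^ (2 ^ j)" for j
  proof -
    have "\<exists>l\<in>mor L. rng L l = v \<and> p (QQ l q \<otimes> iter y j) \<le> B ^ (2 ^ j)" if v: "v \<in> vertices L" for v
    proof -
      obtain l where l: "l \<in> mor L" "rng L l = v" "p (QQ l q \<otimes> y) \<le> B"
        using le[OF v] by blast
      interpret C: kgraph_cstar_corner L A s l "rng L l" by (rule corner[OF l(1)])
      have "p (QQ l q \<otimes> y) ^ (2 ^ j) \<le> B ^ (2 ^ j)"
        using l yc by (intro power_mono) (auto simp: p_nonneg)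
      then show ?thesis using pow[OF l(1), of j] l by (intro bexI[of _ l]) auto
    qed
    then show ?thesis
      using nrm_le_corner[OF il, of "B ^ (2 ^ j)" j] B nrm_iter(1)[OF yc y(2), of j] by simp
  qed
qed (use B lin_closed[OF y(1) sq_pairs] nrm_nonneg in auto)

text \<open>Write \<open>Q\<close> and \<open>Q'\<close> for the projections at \<open>q\<close> and
  \<open>q'\<close>. The product of \<open>b\<close> with its adjoint has equal degrees on both
  sides, and its corner is \<open>Q b\<close> times the adjoint of \<open>Q b\<close>. Moreover
  \<open>Q b = Q b Q' = Q a Q'\<close>, whence \<open>p (Q b)\<close> is at most
  \<open>p a\<close>.\<close>

lemma nrm_le_of_corner_eq:
  assumes b: "b \<in> lin (sq q q')" and a: "a \<in> carrier A"
    and eq: "\<And>v. v \<in> vertices L \<Longrightarrow> \<exists>l\<in>mor L. rng L l = v \<and>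
      QQ l q \<otimes> (a \<otimes> QQ l q') = QQ l q \<otimes> (b \<otimes> QQ l q')"
  shows "nrm A b \<le> p a"
proof -
  have bc: "b \<in> carrier A" using lin_closed[OF b sq_pairs] .
  have "nrm A (b \<otimes> invol A b) \<le> (p a)\<^sup>2"
  proof (rule nrm_le_corner_selfadjoint)
    show "b \<otimes> invol A b \<in> lin (sq q q)" by (rule sq_mult[OF b sq_invol[OF b]])
    fix v assume v: "v \<in> vertices L"
    obtain l where l: "l \<in> mor L" "rng L l = v"
      and e: "QQ l q \<otimes> (a \<otimes> QQ l q') = QQ l q \<otimes> (b \<otimes> QQ l q')"
      using eq[OF v] by blast
    interpret C: kgraph_cstar_corner L A s l "rng L l" by (rule corner[OF l(1)])
    let ?x = "QQ l q \<otimes> b"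
    have x: "?x = QQ l q \<otimes> (a \<otimes> QQ l q')"
    proof -
      have "?x = (QQ l q \<otimes> QQ l q) \<otimes> b" by (simp only: C.Q_idem)
      also have "\<dots> = QQ l q \<otimes> (b \<otimes> QQ l q')"
        using bc by (simp add: mult_assoc QQ_comm[OF l(1) b])
      finally show ?thesis by (simp only: e)
    qed
    have Q1: "p (QQ l r) \<le> 1" for r
      by (rule p_projection_le) (simp_all add: C.Q_invol C.Q_idem)
    have "p ?x \<le> p (QQ l q) * (p a * p (QQ l q'))"
      unfolding x using a order_trans[OF p_mult mult_left_mono[OF p_mult p_nonneg]] by simp
    also have "\<dots> \<le> 1 * (p a * 1)"
      using a Q1 by (intro mult_mono) (auto simp: p_nonneg)
    finally have px: "p ?x \<le> p a" by simp
    have "QQ l q \<otimes> (b \<otimes> invol A b) = invol A (invol A ?x) \<otimes> invol A ?x"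
    proof -
      have "invol A ?x = invol A b \<otimes> QQ l q" using bc by (simp add: invol_mult C.Q_invol)
      then have "invol A (invol A ?x) \<otimes> invol A ?x = (QQ l q \<otimes> (b \<otimes> invol A b)) \<otimes> QQ l q"
        using bc by (simp add: mult_assoc C.Q_invol invol_mult)
      also have "\<dots> = (b \<otimes> invol A b) \<otimes> (QQ l q \<otimes> QQ l q)"
        unfolding QQ_comm[OF l(1) sq_mult[OF b sq_invol[OF b]]] using bc by (simp add: mult_assoc)
      also have "\<dots> = QQ l q \<otimes> (b \<otimes> invol A b)"
        unfolding QQ_comm[OF l(1) sq_mult[OF b sq_invol[OF b]]] by (simp only: C.Q_idem)
      finally show ?thesis by simp
    qed
    then have "p (QQ l q \<otimes> (b \<otimes> invol A b)) = (p ?x)\<^sup>2"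
      using bc p_star[of "invol A ?x"] by (simp add: p_invol)
    also have "\<dots> \<le> (p a)\<^sup>2" using px bc by (intro power_mono) (auto simp: p_nonneg)
    finally show "\<exists>l\<in>mor L. rng L l = v \<and> p (QQ l q \<otimes> (b \<otimes> invol A b)) \<le> (p a)\<^sup>2"
      using l by blast
  qed (use bc in \<open>auto simp: invol_mult\<close>)
  then have "(nrm A b)\<^sup>2 \<le> (p a)\<^sup>2"
    using cstar_identity[of "invol A b"] bc by (simp add: nrm_invol)
  then show ?thesis by (rule power2_le_imp_le) (rule p_nonneg[OF a])
qed

end

section \<open>Homogeneous components with respect to the degree difference\<close>

context kgraph_cstar_seminorm
begin

definition degdiff :: "'a \<times> 'a \<Rightarrow> int ^ 'k" where
  "degdiff = (\<lambda>(m, n). \<chi> i. int (deg L m $ i) - int (deg L n $ i))"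

definition cls :: "int ^ 'k \<Rightarrow> nat ^ 'k \<Rightarrow> ('a \<times> 'a) set" where
  "cls z T = {(m, n) \<in> pairs. degdiff (m, n) = z \<and> deg L m \<le> T \<and> deg L n \<le> T}"

text \<open>With \<open>neg\<close> the decomposition \<open>z = pos z - neg z\<close>, by which a
  prescribed integer difference becomes an equation between degrees.\<close>

definition pos :: "int ^ 'k \<Rightarrow> nat ^ 'k" where "pos z = (\<chi> i. nat (z $ i))"

definition neg :: "int ^ 'k \<Rightarrow> nat ^ 'k" where "neg z = (\<chi> i. nat (- z $ i))"

lemma cls_pairs: "cls z T \<subseteq> pairs" by (auto simp: cls_def)

lemma degdiff_eq_iff:
  "degdiff (m, n) = z \<longleftrightarrow> deg L m + neg z = deg L n + pos z"
proof -
  have "int a - int b = c \<longleftrightarrow> a + nat (- c) = b + nat c" for a b c by arith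
  then show ?thesis
    by (simp add: degdiff_def pos_def neg_def Finite_Cartesian_Product.vec_eq_iff)
qed

text \<open>Inserting the projection of the common source as a sum over paths of degree
  \<open>e\<close> lengthens \<open>m\<close> and \<open>n\<close> by the same amount and so
  preserves the degree difference.\<close>

lemma S_expand:
  assumes mn: "(m, n) \<in> pairs" and q: "deg L m + e = q" "deg L n + e = q'"
  shows "S m n \<in> lin (sq q q')"
proof -
  have c: "m \<in> mor L" "n \<in> mor L" "src L m = src L n" using mn by (auto simp: pairs_def)
  have pm: "l \<in> mor L" if "l \<in> paths v e" for l v using that by (simp add: paths_def)
  have "S m n = s m \<otimes> (s (src L m) \<otimes> invol A (s n))"
    using c star_s_src[of n] by (simp add: S_def)
  also have "\<dots> = (\<Oplus>l\<in>paths (src L m) e. s m \<otimes> (S l l \<otimes> invol A (s n)))"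
    unfolding s_vertex_sum[OF src_vertex[OF c(1)], of e]
    by (rule mult_finsum_mult) (use c pm in auto)
  also have "\<dots> \<in> lin (sq q q')"
  proof (rule lin_finsum[OF sq_pairs])
    fix l assume "l \<in> paths (src L m) e"
    then have l: "l \<in> mor L" "deg L l = e" "rng L l = src L m" by (auto simp: paths_def)
    have "s m \<otimes> (S l l \<otimes> invol A (s n)) = S (cmp L m l) (cmp L n l)"
      using c l by (simp add: S_def s_comp invol_mult mult_assoc)
    moreover have "(cmp L m l, cmp L n l) \<in> sq q q'"
      using c l q by (auto simp: sq_def pairs_def comp_mor src_comp deg_comp)
    ultimately show "s m \<otimes> (S l l \<otimes> invol A (s n)) \<in> lin (sq q q')"
      using lin_gen[OF sq_pairs] by simp
  qed
  finally show ?thesis .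
qed

text \<open>The two target degrees differ by \<open>z\<close> and dominate all degrees in the class,
  so every term can be lengthened to this one pair.\<close>

lemma cls_lin_sq:
  assumes "x \<in> lin (cls z T)"
  shows "x \<in> lin (sq (T + pos z) (T + neg z))"
proof (rule lin_linear[OF assms cls_pairs, of "\<lambda>x. x" id])
  fix m n assume "(m, n) \<in> cls z T"
  then have mn: "(m, n) \<in> pairs" "deg L m + neg z = deg L n + pos z" "deg L m \<le> T" "deg L n \<le> T"
    by (auto simp: cls_def degdiff_eq_iff)
  have le: "deg L m \<le> T + pos z"
    using mn(3) by (auto simp: vec_le_iff trans_le_add1)
  obtain e where e: "deg L m + e = T + pos z"
    using vec_nat_add_diff(1)[OF le] by blast
  have "deg L n + e = T + neg z"
  proof -
    have "(deg L n + e) + pos z = (deg L n + pos z) + e" by (simp only: add_ac)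
    also have "\<dots> = (deg L m + e) + neg z" unfolding mn(2)[symmetric] by (simp only: add_ac)
    also have "\<dots> = (T + neg z) + pos z" unfolding e by (simp only: add_ac)
    finally show ?thesis by simp
  qed
  then show "S m n \<in> lin (sq (T + pos z) (T + neg z))"
    using S_expand[OF mn(1) e] by simp
qed (auto simp: sq_pairs)

text \<open>At the degrees \<open>?q\<close> and \<open>?q'\<close>, whose difference is
  \<open>z\<close>, \<open>Q_kill\<close> annihilates every term with another degree difference, so
  the corner of the whole sum is that of the single component \<open>b z\<close>.\<close>

lemma nrm_component_le:
  assumes Z: "finite Z" and b: "\<And>z. z \<in> Z \<Longrightarrow> b z \<in> lin (cls z T)" and z: "z \<in> Z"
  shows "nrm A (b z) \<le> p (\<Oplus>z\<in>Z. b z)"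
proof (rule nrm_le_of_corner_eq[OF cls_lin_sq[OF b[OF z]]])
  have bc: "b w \<in> carrier A" if "w \<in> Z" for w using lin_closed[OF b[OF that] cls_pairs] .
  then show "(\<Oplus>z\<in>Z. b z) \<in> carrier A" by auto
  let ?q = "T + pos z" and ?q' = "T + neg z"
  let ?N = "?q + ?q'"
  fix v assume v: "v \<in> vertices L"
  obtain l where l: "l \<in> mor L" "rng L l = v" and
    sep: "\<forall>a\<in>mor L. \<forall>b\<in>mor L. \<forall>c\<in>mor L. \<forall>d\<in>mor L.
      src L a = v \<and> src L b = v \<and> src L l = rng L c \<and> src L l = rng L d \<and>
      deg L a \<le> ?N \<and> deg L b \<le> ?N \<and> deg L a \<noteq> deg L b \<longrightarrow>
      cmp L (cmp L a l) c \<noteq> cmp L (cmp L b l) d"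
    using aperiodic_ex_path[OF aper v, of ?N] by (elim bexE conjE)
  interpret C: kgraph_cstar_corner L A s l "rng L l" by (rule corner[OF l(1)])
  have kill: "QQ l ?q \<otimes> (b w \<otimes> QQ l ?q') = \<zero>" if w: "w \<in> Z" "w \<noteq> z" for w
  proof (rule lin_eq[OF b[OF w(1)] cls_pairs, of "\<lambda>x. QQ l ?q \<otimes> (x \<otimes> QQ l ?q')" "\<lambda>_. \<zero>"])
    fix m n assume "(m, n) \<in> cls w T"
    then have mn: "(m, n) \<in> pairs" "degdiff (m, n) = w" "deg L m \<le> T" "deg L n \<le> T"
      by (auto simp: cls_def)
    have "degdiff (m, n) \<noteq> z" using mn w by simp
    then have ne: "?q + deg L n \<noteq> ?q' + deg L m"
      by (simp add: degdiff_eq_iff add_ac)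
    have le: "deg L m \<le> ?q" "deg L n \<le> ?q'"
      using mn(3,4) by (auto simp: vec_le_iff trans_le_add1)
    show "QQ l ?q \<otimes> (S m n \<otimes> QQ l ?q') = \<zero>"
      by (rule C.Q_kill[OF _ mn(1) le _ _ ne, of ?N]) (use sep l in simp_all)
  qed (simp_all add: mult_add_left mult_add_right smult_mult_left smult_mult_right)
  have "QQ l ?q \<otimes> ((\<Oplus>w\<in>Z. b w) \<otimes> QQ l ?q') = (\<Oplus>w\<in>Z. QQ l ?q \<otimes> (b w \<otimes> QQ l ?q'))"
    using bc by (intro mult_finsum_mult) auto
  also have "\<dots> = (\<Oplus>w\<in>Z. if z = w then QQ l ?q \<otimes> (b w \<otimes> QQ l ?q') else \<zero>)"
    using bc kill by (intro M.finsum_cong') auto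
  also have "\<dots> = QQ l ?q \<otimes> (b z \<otimes> QQ l ?q')"
    using z Z bc by (subst M.finsum_singleton) auto
  finally show "\<exists>l\<in>mor L. rng L l = v \<and>
      QQ l ?q \<otimes> ((\<Oplus>w\<in>Z. b w) \<otimes> QQ l ?q') = QQ l ?q \<otimes> (b z \<otimes> QQ l ?q')"
    using l by blast
qed

definition band :: "nat \<Rightarrow> ('a \<times> 'a) set" where
  "band D = {(m, n) \<in> pairs. \<forall>i. \<bar>degdiff (m, n) $ i\<bar> \<le> int D}"

lemma band_pairs: "band D \<subseteq> pairs" by (auto simp: band_def)

definition boxes :: "nat \<Rightarrow> (int ^ 'k) set" where
  "boxes D = {z. \<forall>i. \<bar>z $ i\<bar> \<le> int D}"

text \<open>The count is polynomial in \<open>D\<close>, of degree \<open>CARD('k)\<close>; this is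
  the growth that iterated squares absorb.\<close>

lemma boxes: "finite (boxes D)" "card (boxes D) \<le> (2 * D + 1) ^ CARD('k)"
proof -
  let ?F = "PiE (UNIV :: 'k set) (\<lambda>_. {- int D..int D})"
  have fin: "finite ?F" by (rule finite_PiE) auto
  have sub: "boxes D \<subseteq> vec_lambda ` ?F"
  proof
    fix z assume "z \<in> boxes D"
    then have "vec_nth z \<in> ?F" by (auto simp: boxes_def abs_le_iff) (metis minus_le_iff)
    then show "z \<in> vec_lambda ` ?F"
      by (rule image_eqI[rotated]) (simp add: Finite_Cartesian_Product.vec_eq_iff)
  qed
  show "finite (boxes D)" by (rule finite_subset[OF sub]) (use fin in simp)
  have "card (boxes D) \<le> card (vec_lambda ` ?F)"
    by (rule card_mono[OF _ sub]) (use fin in simp)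
  also have "\<dots> \<le> card ?F" by (rule card_image_le[OF fin])
  also have "\<dots> = (2 * D + 1) ^ CARD('k)"
    by (simp add: card_PiE) (simp add: nat_add_distrib nat_mult_distrib algebra_simps)
  finally show "card (boxes D) \<le> (2 * D + 1) ^ CARD('k)" .
qed

text \<open>All components have to share one bound \<open>T\<close>, so a new term enlarges
  \<open>T\<close> for the components already present as well.\<close>

lemma band_decompose:
  assumes "x \<in> lin (band D)"
  shows "\<exists>T b. (\<forall>z\<in>boxes D. b z \<in> lin (cls z T)) \<and> x = (\<Oplus>z\<in>boxes D. b z)"
  using assms
proof (induction rule: lin.induct)
  case zero
  show ?case by (intro exI[of _ 0] exI[of _ "\<lambda>_. \<zero>"]) (simp add: lin.zero)
next
  case (step x m n c)
  then obtain T b where b: "\<forall>z\<in>boxes D. b z \<in> lin (cls z T)" and x: "x = (\<Oplus>z\<in>boxes D. b z)"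
    by blast
  have mn: "m \<in> mor L" "n \<in> mor L" "(m, n) \<in> pairs" using step.hyps by (auto simp: band_def pairs_def)
  define w where "w = degdiff (m, n)"
  have w: "w \<in> boxes D" using step.hyps by (auto simp: w_def boxes_def band_def)
  define T' where "T' = T + (deg L m + deg L n)"
  have sub: "cls z T \<subseteq> cls z T'" for z
    by (auto simp: cls_def T'_def vec_le_iff trans_le_add1)
  have mem: "(m, n) \<in> cls w T'"
    using mn by (auto simp: cls_def w_def T'_def vec_le_iff trans_le_add2)
  define b' where "b' z = b z \<oplus> (if w = z then c \<odot> S m n else \<zero>)" for z
  have bc: "b z \<in> carrier A" if "z \<in> boxes D" for z
    using b that lin_closed cls_pairs by blast
  have "b' z \<in> lin (cls z T')" if z: "z \<in> boxes D" for z
  proof -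
    have "b z \<in> lin (cls z T')" using b z lin_mono[OF _ sub] by blast
    then show ?thesis
      using mem bc[OF z] by (auto simp: b'_def lin.step)
  qed
  moreover have "x \<oplus> c \<odot> S m n = (\<Oplus>z\<in>boxes D. b' z)"
  proof -
    have "(\<Oplus>z\<in>boxes D. b' z) = (\<Oplus>z\<in>boxes D. b z) \<oplus> (\<Oplus>z\<in>boxes D. if w = z then c \<odot> S m n else \<zero>)"
      unfolding b'_def using bc mn by (intro M.finsum_addf) auto
    also have "(\<Oplus>z\<in>boxes D. if w = z then c \<odot> S m n else \<zero>) = c \<odot> S m n"
      using w mn boxes(1) by (subst M.finsum_singleton) auto
    finally show ?thesis by (simp add: x)
  qed
  ultimately show ?case by blast
qed

lemma nrm_band_le:
  assumes x: "x \<in> lin (band D)"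
  shows "nrm A x \<le> real ((2 * D + 1) ^ CARD('k)) * p x"
proof -
  obtain T b where b: "\<And>z. z \<in> boxes D \<Longrightarrow> b z \<in> lin (cls z T)" and e: "x = (\<Oplus>z\<in>boxes D. b z)"
    using band_decompose[OF x] by blast
  have bc: "b z \<in> carrier A" if "z \<in> boxes D" for z
    using b that lin_closed cls_pairs by blast
  have xc: "x \<in> carrier A" using lin_closed[OF x band_pairs] .
  have "nrm A x \<le> (\<Sum>z\<in>boxes D. nrm A (b z))"
    unfolding e using bc by (intro nrm_finsum) auto
  also have "\<dots> \<le> (\<Sum>z\<in>boxes D. p x)"
    unfolding e using nrm_component_le[OF boxes(1) b] by (intro sum_mono) auto
  also have "\<dots> = real (card (boxes D)) * p x" by simp
  also have "\<dots> \<le> real ((2 * D + 1) ^ CARD('k)) * p x"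
    using boxes(2)[of D] p_nonneg[OF xc] by (intro mult_right_mono) (simp_all only: of_nat_le_iff)
  finally show ?thesis .
qed

lemma band_mult:
  assumes "x \<in> lin (band D)" "y \<in> lin (band E)"
  shows "x \<otimes> y \<in> lin (band (D + E))"
proof (rule lin_mult[OF assms band_pairs band_pairs band_pairs])
  fix m n m' n' assume *: "(m, n) \<in> band D" "(m', n') \<in> band E"
  then have mn: "(m, n) \<in> pairs" "(m', n') \<in> pairs" by (auto simp: band_def)
  \<comment> \<open>The degree equation from \<open>S_mult_S\<close> says that degree differences
    add under multiplication.\<close>
  have "{(a, b) \<in> pairs. deg L a + deg L n + deg L n' = deg L b + deg L m + deg L m'} \<subseteq> band (D + E)"
  proof (clarsimp simp: band_def)
    fix a b i assume d: "deg L a + deg L n + deg L n' = deg L b + deg L m + deg L m'"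
    then have "(deg L a + deg L n + deg L n') $ i = (deg L b + deg L m + deg L m') $ i" by simp
    moreover have "\<bar>int (deg L m $ i) - int (deg L n $ i)\<bar> \<le> int D"
      "\<bar>int (deg L m' $ i) - int (deg L n' $ i)\<bar> \<le> int E"
      using * by (auto simp: band_def degdiff_def)
    ultimately show "\<bar>degdiff (a, b) $ i\<bar> \<le> int D + int E"
      by (simp add: degdiff_def)
  qed
  then show "S m n \<otimes> S m' n' \<in> lin (band (D + E))"
    by (rule lin_mono[OF S_mult_S[OF mn]])
qed

lemma band_invol: "x \<in> lin (band D) \<Longrightarrow> invol A x \<in> lin (band D)"
  by (rule lin_invol) (auto simp: band_def pairs_def degdiff_def abs_minus_commute)

lemma ex_band:
  assumes "x \<in> lin pairs"
  shows "\<exists>D. x \<in> lin (band D)"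
  using assms
proof (induction rule: lin.induct)
  case zero
  show ?case using lin.zero by blast
next
  case (step x m n c)
  then obtain D where D: "x \<in> lin (band D)" by blast
  define N where "N = (\<Sum>i\<in>UNIV. nat \<bar>degdiff (m, n) $ i\<bar>)"
  define E where "E = D + N"
  have "nat \<bar>degdiff (m, n) $ i\<bar> \<le> N" for i
    unfolding N_def by (rule member_le_sum) auto
  then have "\<bar>degdiff (m, n) $ i\<bar> \<le> int N" for i
    by (simp only: nat_le_iff)
  then have "\<bar>degdiff (m, n) $ i\<bar> \<le> int E" for i
    unfolding E_def by (rule order_trans) simp
  then have "(m, n) \<in> band E" using step.hyps by (simp add: band_def)
  moreover have "band D \<subseteq> band E" by (auto simp: band_def E_def intro: order_trans)
  ultimately show ?case using lin_mono[OF D] lin.step by blast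
qed

theorem nrm_le_seminorm:
  assumes x: "x \<in> lin pairs"
  shows "nrm A x \<le> p x"
proof -
  obtain D where D: "x \<in> lin (band D)" using ex_band[OF x] by blast
  have xc: "x \<in> carrier A" using lin_closed[OF x] by simp
  let ?y = "invol A x \<otimes> x"
  have y: "?y \<in> carrier A" "invol A ?y = ?y" using xc by (simp_all add: invol_mult)
  have il: "iter ?y j \<in> lin (band (2 ^ j * (2 * D)))" for j
  proof (induction j)
    case 0
    show ?case using band_mult[OF band_invol[OF D] D] by (simp add: mult_2)
  next
    case (Suc j)
    show ?case using band_mult[OF Suc Suc] by (simp add: mult_ac)
  qed
  have "nrm A ?y \<le> p ?y"
  proof (rule le_of_power_growth[where k = "CARD('k)"])
    fix j
    \<comment> \<open>\<open>?y\<close> lies in band \<open>2 * D\<close> and its power in band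
      \<open>2 ^ j * (2 * D)\<close>. Pulling out \<open>4 * D + 1\<close> leaves a pure power of
      \<open>2 ^ j\<close>, as the growth argument requires.\<close>
    have "real ((2 * (2 ^ j * (2 * D)) + 1) ^ CARD('k)) \<le> real (((4 * D + 1) * 2 ^ j) ^ CARD('k))"
      unfolding of_nat_le_iff by (intro power_mono) (auto simp: algebra_simps)
    also have "\<dots> = real ((4 * D + 1) ^ CARD('k)) * real (2 ^ j) ^ CARD('k)"
      by (simp only: power_mult_distrib of_nat_mult of_nat_power)
    finally have "nrm A (iter ?y j) \<le> (real ((4 * D + 1) ^ CARD('k)) * real (2 ^ j) ^ CARD('k)) * p (iter ?y j)"
      using nrm_band_le[OF il[of j]] iter_selfadjoint(1)[OF y, of j]
      by (meson mult_right_mono order_trans p_nonneg)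
    then show "nrm A ?y ^ 2 ^ j \<le> real ((4 * D + 1) ^ CARD('k)) * real (2 ^ j) ^ CARD('k) * p ?y ^ 2 ^ j"
      by (simp only: nrm_iter[OF y])
  qed (use y in \<open>auto simp: nrm_nonneg p_nonneg\<close>)
  then have "(nrm A x)\<^sup>2 \<le> (p x)\<^sup>2"
    using xc by (simp add: cstar_identity p_star)
  then show ?thesis by (rule power2_le_imp_le) (rule p_nonneg[OF xc])
qed

end

section \<open>Density of the span and the uniqueness theorem\<close>

context kgraph_cstar
begin

text \<open>The span is closed under products by \<open>S_mult_S\<close>, and it contains each
  generator because \<open>S l (src L l) = s l\<close>.\<close>

lemma closure_lin_pairs:
  assumes gen: "generates_cstar A (s ` mor L)"
  shows "closure_set (lin pairs) = carrier A"
proof -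
  have lc: "lin pairs \<subseteq> carrier A" using lin_closed by blast
  have "cstar_subalgebra A (closure_set (lin pairs))"
  proof (rule closure_set_subalgebra[OF lc lin.zero])
    show "x \<oplus> y \<in> lin pairs" if "x \<in> lin pairs" "y \<in> lin pairs" for x y
      using that by (intro lin_add) auto
    show "x \<otimes> y \<in> lin pairs" if "x \<in> lin pairs" "y \<in> lin pairs" for x y
      using that by (rule lin_mult) (auto intro: lin_mono[OF S_mult_S])
    show "invol A x \<in> lin pairs" if "x \<in> lin pairs" for x
      using that by (rule lin_invol) (auto simp: pairs_def)
    show "\<exists>y\<in>lin pairs. nrm A (c \<odot> x \<ominus> y) < e" if "x \<in> lin pairs" "0 < e" for x c e
      using that lc by (intro bexI[of _ "c \<odot> x"] lin_scale) (auto simp: nrm_minus_self)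
  qed
  moreover have "s ` mor L \<subseteq> closure_set (lin pairs)"
  proof
    fix y assume "y \<in> s ` mor L"
    then obtain l where l: "l \<in> mor L" "y = s l" by blast
    have "S l (src L l) = s l"
      using l by (simp add: S_def s_vertex src_vertex s_src)
    moreover have "S l (src L l) \<in> lin pairs"
      using l by (intro lin_gen) (auto simp: pairs_def src_mor src_src)
    ultimately show "y \<in> closure_set (lin pairs)"
      using closure_set_subset[OF lc] l by auto
  qed
  ultimately show ?thesis
    using gen unfolding generates_cstar_def by blast
qed

end

text \<open>By \<open>nrm_le_seminorm\<close>, \<open>f\<close> does not decrease norms on the dense
  span. As \<open>f\<close> is contractive, span elements close to an element of the kernel have
  small norm, so the kernel is trivial.\<close>

theorem cuntz_krieger_uniqueness:
  assumes L: "kgraph L" "finite_kgraph L" "aperiodic L"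
    and A: "cstar_algebra A" "cuntz_krieger_family L A s" "generates_cstar A (s ` mor L)"
    and B: "cstar_algebra B" and f: "star_hom A B f"
    and nz: "\<And>v. v \<in> vertices L \<Longrightarrow> f (s v) \<noteq> \<zero>\<^bsub>B\<^esub>"
  shows "inj_on f (carrier A)"
proof -
  interpret kgraph L by fact
  interpret A: cstar_algebra A by fact
  interpret B: cstar_algebra B by fact
  interpret kgraph_cstar L A s by unfold_locales (fact L A)+
  note f_simps = star_homD[OF f]
  \<comment> \<open>Pulling the norm of \<open>B\<close> back lets all estimates take place inside
    \<open>A\<close>.\<close>
  define p where "p x = nrm B (f x)" for x
  interpret kgraph_cstar_seminorm L A s p
  proof unfold_locales
    show "p (s v) \<noteq> 0" if "v \<in> vertices L" for v
      using nz[OF that] that by (simp add: p_def B.nrm_eq_0 vertex_mor f_simps)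
  qed (use L in \<open>auto simp: p_def f_simps B.nrm_nonneg B.nrm_mult B.nrm_smult B.cstar_identity\<close>)
  have f_minus: "f (x \<ominus>\<^bsub>A\<^esub> y) = f x \<ominus>\<^bsub>B\<^esub> f y" if "x \<in> carrier A" "y \<in> carrier A" for x y
    using that by (simp add: A.minus_scale B.minus_scale f_simps)
  have zero: "x = \<zero>\<^bsub>A\<^esub>" if x: "x \<in> carrier A" and fx: "f x = \<zero>\<^bsub>B\<^esub>" for x
  proof -
    have "nrm A x \<le> 0 + e" if "0 < e" for e
    proof -
      have "x \<in> A.closure_set (lin pairs)" using closure_lin_pairs[OF A(3)] x by simp
      then obtain y where y: "y \<in> lin pairs" "nrm A (x \<ominus>\<^bsub>A\<^esub> y) < e / 2"
        using \<open>0 < e\<close> unfolding A.closure_set_def by (auto dest: spec[of _ "e / 2"])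
      have yc: "y \<in> carrier A" using lin_closed[OF y(1)] by simp
      have "nrm A y \<le> p y" by (rule nrm_le_seminorm[OF y(1)])
      also have "p y \<le> p x + nrm B (f (y \<ominus>\<^bsub>A\<^esub> x))"
        unfolding p_def using B.nrm_le_minus[of "f y" "f x"] x yc by (simp add: f_minus f_simps)
      \<comment> \<open>\<open>p x\<close> is 0, so the norm of \<open>y\<close> is at most its
        distance to \<open>x\<close>, and the norm of \<open>x\<close> at most twice that
        distance.\<close>
      also have "\<dots> \<le> 0 + nrm A (y \<ominus>\<^bsub>A\<^esub> x)"
        using star_hom_contractive[OF A(1) B f, of "y \<ominus>\<^bsub>A\<^esub> x"] x yc by (simp add: p_def fx)
      finally have "nrm A y \<le> nrm A (x \<ominus>\<^bsub>A\<^esub> y)" using A.nrm_minus_commute[of x y] x yc by simp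
      then show ?thesis
        using A.nrm_le_minus[of x y] x yc y(2) by simp
    qed
    then have "nrm A x \<le> 0" using field_le_epsilon[of "nrm A x" 0] by simp
    then show ?thesis using A.nrm_nonneg[OF x] A.nrm_eq_0[OF x] by simp
  qed
  show ?thesis
  proof (rule inj_onI)
    fix x y assume xy: "x \<in> carrier A" "y \<in> carrier A" "f x = f y"
    then have "f (x \<ominus>\<^bsub>A\<^esub> y) = \<zero>\<^bsub>B\<^esub>"
      by (simp add: f_minus f_simps)
    then have "x \<ominus>\<^bsub>A\<^esub> y = \<zero>\<^bsub>A\<^esub>" using zero xy by simp
    then show "x = y" using xy by simp
  qed
qed

section \<open>The universal property for arbitrary C*-algebras\<close>

lemma mcomplete_sequential:
  assumes "Metric_space S d"
  shows "Metric_space.mcomplete S d \<longleftrightarrow>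
    (\<forall>u. range u \<subseteq> S \<and> (\<forall>e>0. \<exists>N. \<forall>m n. N \<le> m \<longrightarrow> N \<le> n \<longrightarrow> d (u m) (u n) < e) \<longrightarrow>
      (\<exists>l\<in>S. (\<lambda>n. d (u n) l) \<longlonglongrightarrow> 0))"
proof -
  interpret Metric_space S d by fact
  have "limitin mtopology u l sequentially \<longleftrightarrow> l \<in> S \<and> (\<lambda>n. d (u n) l) \<longlonglongrightarrow> 0"
    if "range u \<subseteq> S" for u l
    using that by (auto simp: limitin_metric_dist_null intro!: always_eventually)
  then have "(\<exists>l. limitin mtopology u l sequentially) \<longleftrightarrow> (\<exists>l\<in>S. (\<lambda>n. d (u n) l) \<longlonglongrightarrow> 0)"
    if "range u \<subseteq> S" for u
    using that by (simp add: Bex_def)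
  then show ?thesis
    unfolding mcomplete_def MCauchy_def by (intro iff_allI) (simp cong: conj_cong imp_cong)
qed

lemma ring_of_type_algebra_cring: "cring (ring_of_type_algebra :: complex ring)"
  by (rule cring_from_type_algebra)

section \<open>Transport of a subalgebra along an injection\<close>

locale cstar_transport = cstar_algebra A for A :: "'a cstar" (structure) +
  fixes D :: "'a set" and e :: "'a \<Rightarrow> 'c"
  assumes D: "cstar_subalgebra A D" and e: "inj_on e D"
begin

abbreviation "g \<equiv> the_inv_into D e"

text \<open>The norm, too, is pulled back along the inverse of \<open>e\<close>, so \<open>e\<close>
  may be any injection, however discontinuous.\<close>

definition A' :: "'c cstar" where
  "A' = \<lparr>carrier = e ` D, mult = (\<lambda>x y. e (g x \<otimes> g y)), one = undefined, zero = e \<zero>,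
     add = (\<lambda>x y. e (g x \<oplus> g y)), smult = (\<lambda>c x. e (c \<odot> g x)),
     invol = (\<lambda>x. e (invol A (g x))), nrm = (\<lambda>x. nrm A (g x))\<rparr>"

lemma D_simps [simp, intro]:
  "x \<in> D \<Longrightarrow> x \<in> carrier A" "\<zero> \<in> D" "x \<in> D \<Longrightarrow> y \<in> D \<Longrightarrow> x \<oplus> y \<in> D"
  "x \<in> D \<Longrightarrow> y \<in> D \<Longrightarrow> x \<otimes> y \<in> D" "x \<in> D \<Longrightarrow> invol A x \<in> D" "x \<in> D \<Longrightarrow> c \<odot> x \<in> D"
  using D by (auto simp: cstar_subalgebra_def)

lemma g_e [simp]: "x \<in> D \<Longrightarrow> g (e x) = x"
  using e by (simp add: the_inv_into_f_f)

lemma A'_simps [simp]: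
  "carrier A' = e ` D" "zero A' = e \<zero>" "nrm A' x = nrm A (g x)"
  "x \<otimes>\<^bsub>A'\<^esub> y = e (g x \<otimes> g y)" "x \<oplus>\<^bsub>A'\<^esub> y = e (g x \<oplus> g y)"
  "c \<odot>\<^bsub>A'\<^esub> x = e (c \<odot> g x)" "invol A' x = e (invol A (g x))"
  by (simp_all add: A'_def)

lemma D_limit: "range u \<subseteq> D \<Longrightarrow> converges u l \<Longrightarrow> l \<in> D"
  using D by (simp add: cstar_subalgebra_def closed_iff)

lemma module_A': "module (ring_of_type_algebra :: complex ring) A'"
proof (rule moduleI[OF ring_of_type_algebra_cring])
  show "abelian_group A'"
  proof (rule abelian_groupI)
    fix x assume "x \<in> carrier A'"
    then obtain a where a: "a \<in> D" "x = e a" by auto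
    show "\<exists>y\<in>carrier A'. y \<oplus>\<^bsub>A'\<^esub> x = \<zero>\<^bsub>A'\<^esub>"
      using a by (intro bexI[of _ "e ((-1) \<odot> a)"]) (auto simp: scale_collect)
  qed (auto simp: M.a_ac)
qed (auto simp: scale_add_left scale_add_right scale_scale)

lemma complex_module_A': "complex_module A'"
  unfolding complex_module_def by (rule module_A')

lemma cstar_dist_A':
  assumes "a \<in> D" "b \<in> D"
  shows "cstar_dist A' (e a) (e b) = cstar_dist A a b"
proof -
  interpret C: complex_module A' by (rule complex_module_A')
  have "e a \<ominus>\<^bsub>A'\<^esub> e b = e (a \<ominus> b)"
    using assms by (simp add: C.minus_scale minus_scale)
  moreover have "a \<ominus> b \<in> D" using assms by (simp add: minus_scale)
  ultimately show ?thesis using assms by (simp add: cstar_dist_def)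
qed

lemma metric_A': "Metric_space (carrier A') (cstar_dist A')"
proof -
  interpret C: complex_module A' by (rule complex_module_A')
  interpret C: normed_module A'
    by unfold_locales
      (auto simp: nrm_nonneg nrm_eq_0 nrm_triangle nrm_smult inj_on_eq_iff[OF e])
  show ?thesis by (rule C.metric)
qed

lemma cstar_A': "cstar_algebra A'"
proof (intro cstar_algebra.intro module_A' cstar_algebra_axioms.intro)
  show "Metric_space.mcomplete (carrier A') (cstar_dist A')"
    unfolding mcomplete_sequential[OF metric_A']
  proof (intro allI impI)
    fix u :: "nat \<Rightarrow> 'c" assume u: "range u \<subseteq> carrier A' \<and> (\<forall>ea>0. \<exists>N. \<forall>m n. N \<le> m \<longrightarrow> N \<le> n \<longrightarrow> cstar_dist A' (u m) (u n) < ea)"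
    then have "u n \<in> e ` D" for n by auto
    then have "\<forall>n. \<exists>a. a \<in> D \<and> u n = e a" by blast
    then obtain w where w: "\<And>n. w n \<in> D" "\<And>n. u n = e (w n)" by metis
    have wr: "range w \<subseteq> carrier A" using w by auto
    have "\<forall>ea>0. \<exists>N. \<forall>m n. N \<le> m \<longrightarrow> N \<le> n \<longrightarrow> cstar_dist A (w m) (w n) < ea"
      using u by (simp add: w cstar_dist_A')
    moreover have "range v \<subseteq> carrier A \<and> (\<forall>e>0. \<exists>N. \<forall>m n. N \<le> m \<longrightarrow> N \<le> n \<longrightarrow> cstar_dist A (v m) (v n) < e) \<longrightarrow>
        (\<exists>l\<in>carrier A. (\<lambda>n. cstar_dist A (v n) l) \<longlonglongrightarrow> 0)" for v
      using complete unfolding mcomplete_sequential[OF metric] by (rule spec)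
    ultimately obtain l where l: "l \<in> carrier A" "(\<lambda>n. cstar_dist A (w n) l) \<longlonglongrightarrow> 0"
      using wr by meson
    have "converges w l"
      using l wr w by (simp add: converges_def cstar_dist_def)
    then have lD: "l \<in> D"
      using D_limit[of w l] w(1) by auto
    then show "\<exists>l\<in>carrier A'. (\<lambda>n. cstar_dist A' (u n) l) \<longlonglongrightarrow> 0"
      using l(2) by (intro bexI[of _ "e l"]) (auto simp: w cstar_dist_A')
  qed
qed (auto simp: mult_assoc mult_add_left mult_add_right smult_mult_left smult_mult_right invol_add
    invol_smult invol_mult nrm_nonneg nrm_eq_0 nrm_triangle nrm_smult nrm_mult cstar_identity
    inj_on_eq_iff[OF e])

lemma star_hom_g: "star_hom A' A g"
  by (auto simp: star_hom_def)

lemma finsum_A':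
  assumes "f \<in> I \<rightarrow> D"
  shows "(\<Oplus>\<^bsub>A'\<^esub>i\<in>I. e (f i)) = e (\<Oplus>i\<in>I. f i) \<and> (\<Oplus>i\<in>I. f i) \<in> D"
proof -
  interpret C: complex_module A' by (rule complex_module_A')
  show ?thesis
    using assms
  proof (induction I rule: infinite_finite_induct)
    case (insert i I)
    then show ?case by (simp add: C.M.finsum_insert M.finsum_insert Pi_iff)
  qed (auto simp: C.M.finsum_infinite M.finsum_infinite)
qed

lemma cuntz_krieger_family_A':
  assumes t: "cuntz_krieger_family L A t" and tD: "t ` mor L \<subseteq> D"
    and v: "vertices L \<subseteq> mor L" and src: "\<And>m. m \<in> mor L \<Longrightarrow> src L m \<in> mor L"
    and comp: "\<And>m l. m \<in> mor L \<Longrightarrow> l \<in> mor L \<Longrightarrow> src L m = rng L l \<Longrightarrow> cmp L m l \<in> mor L"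
  shows "cuntz_krieger_family L A' (\<lambda>l. e (t l))"
proof -
  have tD': "t l \<in> D" if "l \<in> mor L" for l using tD that by auto
  have sum: "e (t w) = (\<Oplus>\<^bsub>A'\<^esub>l\<in>{l \<in> mor L. deg L l = n \<and> rng L l = w}. e (t l \<otimes> invol A (t l)))"
    if "w \<in> vertices L" for w n
  proof -
    have eq: "t w = (\<Oplus>l\<in>{l \<in> mor L. deg L l = n \<and> rng L l = w}. t l \<otimes> invol A (t l))"
      using t that unfolding cuntz_krieger_family_def by blast
    have "(\<lambda>l. t l \<otimes> invol A (t l)) \<in> {l \<in> mor L. deg L l = n \<and> rng L l = w} \<rightarrow> D"
      using tD' by auto
    then show ?thesis unfolding eq by (rule finsum_A'[THEN conjunct1, symmetric])
  qed
  interpret C: complex_module A' by (rule complex_module_A')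
  have sum': "e (t w) = (\<Oplus>\<^bsub>A'\<^esub>l\<in>{l \<in> mor L. deg L l = n \<and> rng L l = w}. e (t l) \<otimes>\<^bsub>A'\<^esub> invol A' (e (t l)))"
    if "w \<in> vertices L" for w n
    unfolding sum[OF that, of n] by (rule C.M.finsum_cong') (auto simp: tD')
  have t': "\<And>l. l \<in> mor L \<Longrightarrow> t l \<otimes> invol A (t l) \<otimes> t l = t l"
    "\<And>v. v \<in> vertices L \<Longrightarrow> invol A (t v) = t v" "\<And>v. v \<in> vertices L \<Longrightarrow> t v \<otimes> t v = t v"
    "\<And>v w. v \<in> vertices L \<Longrightarrow> w \<in> vertices L \<Longrightarrow> v \<noteq> w \<Longrightarrow> t v \<otimes> t w = \<zero>"
    "\<And>m l. m \<in> mor L \<Longrightarrow> l \<in> mor L \<Longrightarrow> src L m = rng L l \<Longrightarrow> t m \<otimes> t l = t (cmp L m l)"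
    "\<And>m. m \<in> mor L \<Longrightarrow> invol A (t m) \<otimes> t m = t (src L m)"
    using t by (auto simp: cuntz_krieger_family_def partial_isometry_def projection_def)
  have vD: "t w \<in> D" if "w \<in> vertices L" for w using tD' v that by auto
  show ?thesis
    unfolding cuntz_krieger_family_def partial_isometry_def projection_def
  proof (intro conjI ballI impI allI)
    show "e (t w) = (\<Oplus>\<^bsub>A'\<^esub>l\<in>{l \<in> mor L. deg L l = n \<and> rng L l = w}. e (t l) \<otimes>\<^bsub>A'\<^esub> invol A' (e (t l)))"
      if "w \<in> vertices L" for w n
      by (rule sum'[OF that])
  qed (simp_all add: tD' vD t')
qed

end

section \<open>Separable subalgebras embed into the reals\<close>

lemma complex_rational_approx:
  assumes "0 < e"
  shows "\<exists>p q :: rat. cmod (c - Complex (of_rat p) (of_rat q)) < e"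
proof -
  obtain p where p: "Re c < of_rat p" "of_rat p < Re c + e / 2"
    using of_rat_dense[of "Re c" "Re c + e / 2"] assms by auto
  obtain q where q: "Im c < of_rat q" "of_rat q < Im c + e / 2"
    using of_rat_dense[of "Im c" "Im c + e / 2"] assms by auto
  have "cmod (c - Complex (of_rat p) (of_rat q)) \<le> \<bar>Re c - of_rat p\<bar> + \<bar>Im c - of_rat q\<bar>"
    using cmod_le[of "c - Complex (of_rat p) (of_rat q)"] by simp
  also have "\<dots> < e" using p q by linarith
  finally show ?thesis by blast
qed

context cstar_algebra
begin

text \<open>\<open>C\<close> arises from \<open>Y\<close> by iterating the operations, with scalars
  restricted to rational real and imaginary parts to stay countable; arbitrary scalars are recovered
  in the closure.\<close>

lemma countable_dense_subalgebra:
  assumes Y: "countable Y" "Y \<subseteq> carrier A"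
  obtains C where "countable C" "C \<subseteq> carrier A" "Y \<subseteq> C" "C \<noteq> {}" "cstar_subalgebra A (closure_set C)"
proof -
  define step where "step F = F \<union> (\<lambda>(x, y). x \<oplus> y) ` (F \<times> F) \<union> (\<lambda>(x, y). x \<otimes> y) ` (F \<times> F) \<union>
    invol A ` F \<union> (\<lambda>(p, q, x). Complex (of_rat p) (of_rat q) \<odot> x) ` (UNIV \<times> UNIV \<times> F)" for F
  have stepI: "x \<oplus> y \<in> step F" "x \<otimes> y \<in> step F" "invol A x \<in> step F"
    "Complex (of_rat p) (of_rat q) \<odot> x \<in> step F" if "x \<in> F" "y \<in> F" for x y p q F
    using imageI[of "(x, y)" "F \<times> F" "\<lambda>(x, y). x \<oplus> y"] imageI[of "(x, y)" "F \<times> F" "\<lambda>(x, y). x \<otimes> y"]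
      imageI[of x F "invol A"]
      imageI[of "(p, q, x)" "UNIV \<times> UNIV \<times> F" "\<lambda>(p, q, x). Complex (of_rat p) (of_rat q) \<odot> x"] that
    by (simp_all add: step_def)
  define E where "E n = (step ^^ n) (insert \<zero> Y)" for n
  define C where "C = (\<Union>n. E n)"
  have E0: "E 0 = insert \<zero> Y" and ES: "E (Suc n) = step (E n)" for n
    by (simp_all add: E_def)
  have cE: "countable (E n)" for n
  proof (induction n)
    case (Suc n)
    have "countable (UNIV \<times> UNIV \<times> E n :: (rat \<times> rat \<times> 'a) set)"
      using Suc by (intro countable_SIGMA) auto
    then show ?case using Suc unfolding ES step_def by (intro countable_Un countable_image countable_SIGMA) auto
  qed (use Y in \<open>simp add: E0\<close>)
  have EA: "E n \<subseteq> carrier A" for n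
  proof (induction n)
    case (Suc n)
    then show ?case unfolding ES step_def by auto
  qed (use Y in \<open>simp add: E0\<close>)
  have sub: "E n \<subseteq> E (Suc n)" for n by (auto simp: ES step_def)
  have mono: "E m \<subseteq> E n" if "m \<le> n" for m n
    using that by (induction rule: dec_induct) (use sub in auto)
  have two: "\<exists>n. x \<in> E n \<and> y \<in> E n" if xy: "x \<in> C" "y \<in> C" for x y
  proof -
    obtain m n where "x \<in> E m" "y \<in> E n" using xy unfolding C_def by (elim UN_E)
    then show ?thesis using mono[of m "max m n"] mono[of n "max m n"] by (intro exI[of _ "max m n"]) auto
  qed
  have CA: "C \<subseteq> carrier A" using EA by (auto simp: C_def)
  have memI: "x \<in> C" if "x \<in> step (E n)" for x n
    using that unfolding C_def ES[symmetric] by (rule UN_I[OF UNIV_I])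
  show ?thesis
  proof
    show "countable C" using cE by (auto simp: C_def)
    show "Y \<subseteq> C" "C \<noteq> {}" using E0 by (auto simp: C_def)
    show "cstar_subalgebra A (closure_set C)"
    proof (rule closure_set_subalgebra[OF CA])
      show "\<zero> \<in> C" using E0 by (auto simp: C_def)
      fix x y assume "x \<in> C" "y \<in> C"
      then obtain n where "x \<in> E n" "y \<in> E n" using two by blast
      then have "x \<oplus> y \<in> step (E n)" "x \<otimes> y \<in> step (E n)" by (auto intro: stepI)
      then show "x \<oplus> y \<in> C" "x \<otimes> y \<in> C" by (auto intro: memI)
    next
      fix x assume "x \<in> C"
      then obtain n where n: "x \<in> E n" unfolding C_def by (elim UN_E)
      then have "invol A x \<in> step (E n)" by (rule stepI(3)) (rule n)
      then show "invol A x \<in> C" by (rule memI)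
      have xc: "x \<in> carrier A" using n EA by blast
      fix c :: complex and e :: real assume e: "0 < e"
      have pos: "0 < nrm A x + 1" using nrm_nonneg[OF xc] by simp
      then obtain p q where pq: "cmod (c - Complex (of_rat p) (of_rat q)) < e / (nrm A x + 1)"
        using complex_rational_approx[OF divide_pos_pos[OF e pos], of c] by (elim exE)
      let ?d = "Complex (of_rat p) (of_rat q)"
      have "?d \<odot> x \<in> step (E n)" by (rule stepI(4)[OF n n])
      then have "?d \<odot> x \<in> C" by (rule memI)
      moreover have "nrm A (c \<odot> x \<ominus> ?d \<odot> x) < e"
      proof -
        have "c \<odot> x \<ominus> ?d \<odot> x = (c - ?d) \<odot> x"
          using xc by (simp add: minus_scale scale_scale scale_collect)
        then have "nrm A (c \<odot> x \<ominus> ?d \<odot> x) \<le> cmod (c - ?d) * (nrm A x + 1)"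
          using xc by (simp add: nrm_smult mult_left_mono)
        also have "\<dots> < e" using pq pos by (simp add: pos_less_divide_eq)
        finally show ?thesis .
      qed
      ultimately show "\<exists>y\<in>C. nrm A (c \<odot> x \<ominus> y) < e" by blast
    qed
  qed (rule CA)
qed

text \<open>An element of the closure is determined by which members of \<open>C\<close> lie within
  \<open>1 / (j + 1)\<close> of it, for each \<open>j\<close>. These answers form a set of naturals,
  and sets of naturals inject into the reals.\<close>

lemma separable_inj_real:
  assumes C: "countable C" "C \<subseteq> carrier A" "C \<noteq> {}"
  obtains e :: "'a \<Rightarrow> real" where "inj_on e (closure_set C)"
proof -
  define h where "h x = {n. nrm A (x \<ominus> from_nat_into C (fst (prod_decode n))) < 1 / real (Suc (snd (prod_decode n)))}" for x
  have h_iff: "prod_encode (i, j) \<in> h x \<longleftrightarrow> nrm A (x \<ominus> from_nat_into C i) < 1 / real (Suc j)" for i j x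
    by (simp add: h_def)
  have "inj_on h (closure_set C)"
  proof (rule inj_onI)
    fix x y assume xy: "x \<in> closure_set C" "y \<in> closure_set C" "h x = h y"
    have c: "x \<in> carrier A" "y \<in> carrier A" using xy by (auto simp: closure_set_def)
    have "nrm A (x \<ominus> y) \<le> 0 + d" if d: "0 < d" for d
    proof -
      obtain j where j: "1 / real (Suc j) < d / 2"
        using reals_Archimedean[of "d / 2"] d by (auto simp: inverse_eq_divide)
      obtain z where z: "z \<in> C" "nrm A (x \<ominus> z) < 1 / real (Suc j)"
        using xy(1) unfolding closure_set_def by (auto dest!: spec[of _ "1 / real (Suc j)"])
      obtain i where i: "z = from_nat_into C i"
        using from_nat_into_surj[OF C(1) z(1)] by metis
      have zc: "z \<in> carrier A" using z C by auto
      have "nrm A (y \<ominus> z) < 1 / real (Suc j)"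
        using h_iff[of i j x] h_iff[of i j y] z xy(3) i by simp
      then show ?thesis
        using nrm_minus_triangle[of x z y] nrm_minus_commute[of y z] c zc z j by simp
    qed
    then have "nrm A (x \<ominus> y) \<le> 0" using field_le_epsilon[of "nrm A (x \<ominus> y)" 0] by simp
    then show "x = y" using nrm_nonneg[of "x \<ominus> y"] nrm_minus_eq_0[of x y] c by simp
  qed
  moreover obtain k :: "nat set \<Rightarrow> real" where "inj k"
    using nat_sets_lepoll_reals01 unfolding lepoll_def by auto
  ultimately have "inj_on (k \<circ> h) (closure_set C)"
    by (intro comp_inj_on) (auto intro: inj_on_subset)
  then show ?thesis by (rule that)
qed

end

text \<open>The family is countable, so it lies in a separable subalgebra even if \<open>B\<close>
  is not separable. The homomorphism into the real copy of that subalgebra is composed with the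
  inverse of the injection.\<close>

theorem kgraph_cstar_universal:
  fixes B :: "'c cstar"
  assumes L: "kgraph L" and A: "is_kgraph_cstar_algebra L A s"
    and B: "cstar_algebra B" and t: "cuntz_krieger_family L B t"
  shows "\<exists>f. star_hom A B f \<and> (\<forall>l\<in>mor L. f (s l) = t l)"
proof -
  interpret kgraph L by fact
  interpret B: cstar_algebra B by fact
  have tc: "t ` mor L \<subseteq> carrier B"
    using t by (auto simp: cuntz_krieger_family_def partial_isometry_def)
  obtain C where C: "countable C" "C \<subseteq> carrier B" "t ` mor L \<subseteq> C" "C \<noteq> {}"
    and sub: "cstar_subalgebra B (B.closure_set C)"
    using B.countable_dense_subalgebra[OF countable_image[OF countable_mor] tc] .
  obtain e :: "'c \<Rightarrow> real" where e: "inj_on e (B.closure_set C)"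
    using B.separable_inj_real[OF C(1,2,4)] .
  interpret T: cstar_transport B "B.closure_set C" e
    by unfold_locales (fact sub e)+
  have tD: "t ` mor L \<subseteq> B.closure_set C"
    using B.closure_set_subset[OF C(2)] C(3) by blast
  have univ: "\<exists>f. star_hom A B' f \<and> (\<forall>l\<in>mor L. f (s l) = t' l)"
    if "cstar_algebra B'" "cuntz_krieger_family L B' t'" for B' :: "real cstar" and t'
    using A that by (simp add: is_kgraph_cstar_algebra_def)
  have ck: "cuntz_krieger_family L T.A' (\<lambda>l. e (t l))"
    by (rule T.cuntz_krieger_family_A'[OF t tD]) (auto simp: vertex_mor src_mor comp_mor)
  obtain f where f: "star_hom A T.A' f" "\<forall>l\<in>mor L. f (s l) = e (t l)"
    using univ[OF T.cstar_A' ck] by (elim exE conjE)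
  have "star_hom A B (T.g \<circ> f)"
    using star_homD[OF f(1)] star_homD[OF T.star_hom_g] unfolding star_hom_def
    by (simp del: T.A'_simps)
  moreover have "(T.g \<circ> f) (s l) = t l" if "l \<in> mor L" for l
    using f(2) tD that by auto
  ultimately show ?thesis by blast
qed

section \<open>Adjointable operators on a Hilbert space\<close>

locale hilbert_space = complex_module H for H :: "'h inner_space" (structure) +
  assumes ip_add_left: "\<lbrakk>x \<in> carrier H; y \<in> carrier H; z \<in> carrier H\<rbrakk> \<Longrightarrow> ip H (x \<oplus> y) z = ip H x z + ip H y z"
    and ip_scale_left: "\<lbrakk>x \<in> carrier H; y \<in> carrier H\<rbrakk> \<Longrightarrow> ip H (c \<odot> x) y = c * ip H x y"
    and ip_cnj: "\<lbrakk>x \<in> carrier H; y \<in> carrier H\<rbrakk> \<Longrightarrow> cnj (ip H x y) = ip H y x"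
    and ip_nonneg: "x \<in> carrier H \<Longrightarrow> 0 \<le> Re (ip H x x)"
    and ip_zeroD: "\<lbrakk>x \<in> carrier H; ip H x x = 0\<rbrakk> \<Longrightarrow> x = \<zero>"
    and cauchy_limit: "\<lbrakk>range u \<subseteq> carrier H;
      \<And>e. 0 < e \<Longrightarrow> \<exists>N. \<forall>m n. N \<le> m \<longrightarrow> N \<le> n \<longrightarrow> ip_norm H (u m \<ominus> u n) < e\<rbrakk>
      \<Longrightarrow> \<exists>l\<in>carrier H. (\<lambda>n. ip_norm H (u n \<ominus> l)) \<longlonglongrightarrow> 0"
begin

lemma ip_add_right:
  assumes "x \<in> carrier H" "y \<in> carrier H" "z \<in> carrier H"
  shows "ip H z (x \<oplus> y) = ip H z x + ip H z y"
  using assms ip_add_left[of x y z] ip_cnj[of "x \<oplus> y" z] ip_cnj[of x z] ip_cnj[of y z]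
  by (metis M.a_closed complex_cnj_add)

lemma ip_scale_right:
  assumes "x \<in> carrier H" "y \<in> carrier H"
  shows "ip H x (c \<odot> y) = cnj c * ip H x y"
  using assms ip_scale_left[of y x c] ip_cnj[of "c \<odot> y" x] ip_cnj[of y x]
  by (metis scale_closed complex_cnj_mult)

lemma ip_self:
  assumes "x \<in> carrier H"
  shows "ip H x x = of_real ((ip_norm H x)\<^sup>2)"
proof -
  have "Im (ip H x x) = 0"
    using ip_cnj[OF assms assms] by (metis complex_cnj_cancel_iff complex_is_Real_iff Reals_cnj_iff)
  then show ?thesis using ip_nonneg[OF assms] by (simp add: ip_norm_def complex_eq_iff)
qed

lemma ip_norm_nonneg: "x \<in> carrier H \<Longrightarrow> 0 \<le> ip_norm H x"
  by (simp add: ip_norm_def ip_nonneg)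

lemma ip_zero_left [simp]: "x \<in> carrier H \<Longrightarrow> ip H \<zero> x = 0"
  using ip_scale_left[of \<zero> x 0] by simp

lemma ip_zero_right [simp]: "x \<in> carrier H \<Longrightarrow> ip H x \<zero> = 0"
  using ip_scale_right[of x \<zero> 0] by simp

lemma ip_norm_eq_0: "x \<in> carrier H \<Longrightarrow> ip_norm H x = 0 \<longleftrightarrow> x = \<zero>"
  using ip_self[of x] ip_zeroD[of x] by (auto simp: ip_norm_def)

lemma ip_norm_zero: "ip_norm H \<zero> = 0"
  by (simp add: ip_norm_eq_0)

lemma ip_norm_scale:
  assumes "x \<in> carrier H"
  shows "ip_norm H (c \<odot> x) = cmod c * ip_norm H x"
proof -
  have "ip H (c \<odot> x) (c \<odot> x) = (c * cnj c) * ip H x x"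
    using assms by (simp add: ip_scale_left ip_scale_right)
  then have "of_real ((ip_norm H (c \<odot> x))\<^sup>2) = (of_real ((cmod c * ip_norm H x)\<^sup>2) :: complex)"
    using assms complex_norm_square[of c] by (simp add: ip_self power_mult_distrib)
  then have "(ip_norm H (c \<odot> x))\<^sup>2 = (cmod c * ip_norm H x)\<^sup>2"
    by (simp only: of_real_eq_iff)
  then show ?thesis using assms by (simp add: ip_norm_nonneg)
qed

lemma cauchy_schwarz:
  assumes x: "x \<in> carrier H" and y: "y \<in> carrier H"
  shows "cmod (ip H x y) \<le> ip_norm H x * ip_norm H y"
proof (cases "y = \<zero>")
  case True
  then show ?thesis using x by (simp add: ip_norm_nonneg)
next
  case False
  define n where "n = (ip_norm H y)\<^sup>2"
  have n: "0 < n" using False ip_norm_eq_0[OF y] by (simp add: n_def)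
  \<comment> \<open>The scalar that makes \<open>x + t y\<close> orthogonal to
    \<open>y\<close>.\<close>
  define t where "t = - (ip H x y / of_real n)"
  let ?z = "x \<oplus> t \<odot> y"
  have "ip H ?z ?z = ip H x x + (t * ip H y x + cnj t * ip H x y + t * cnj t * of_real n)"
    using x y by (simp add: ip_add_left ip_add_right ip_scale_left ip_scale_right ip_self[OF y] n_def
        algebra_simps)
  also have "t * ip H y x + cnj t * ip H x y + t * cnj t * of_real n = - of_real ((cmod (ip H x y))\<^sup>2 / n)"
  proof -
    have "ip H x y * ip H y x = of_real ((cmod (ip H x y))\<^sup>2)"
      using ip_cnj[OF x y] complex_norm_square[of "ip H x y"] by simp
    moreover have "cnj (ip H x y) = ip H y x" by (rule ip_cnj[OF x y])
    ultimately show ?thesis using n by (simp add: t_def field_simps power2_eq_square)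
  qed
  finally have "ip H ?z ?z = of_real ((ip_norm H x)\<^sup>2 - (cmod (ip H x y))\<^sup>2 / n)"
    using x by (simp add: ip_self)
  then have "0 \<le> (ip_norm H x)\<^sup>2 - (cmod (ip H x y))\<^sup>2 / n"
    using ip_nonneg[of ?z] x y by simp
  then have "(cmod (ip H x y))\<^sup>2 \<le> (ip_norm H x * ip_norm H y)\<^sup>2"
    using n by (simp add: pos_divide_le_eq power_mult_distrib flip: n_def)
  then show ?thesis
    by (rule power2_le_imp_le) (simp add: x y ip_norm_nonneg)
qed

lemma ip_norm_triangle:
  assumes x: "x \<in> carrier H" and y: "y \<in> carrier H"
  shows "ip_norm H (x \<oplus> y) \<le> ip_norm H x + ip_norm H y"
proof -
  have "ip H (x \<oplus> y) (x \<oplus> y) = ip H x x + (ip H x y + cnj (ip H x y)) + ip H y y"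
    unfolding ip_cnj[OF x y] using x y by (simp add: ip_add_left ip_add_right)
  then have "Re (ip H (x \<oplus> y) (x \<oplus> y)) = Re (ip H x x) + 2 * Re (ip H x y) + Re (ip H y y)"
    by simp
  then have "(ip_norm H (x \<oplus> y))\<^sup>2 = (ip_norm H x)\<^sup>2 + 2 * Re (ip H x y) + (ip_norm H y)\<^sup>2"
    using x y ip_nonneg[of "x \<oplus> y"] by (simp add: ip_norm_def ip_nonneg)
  also have "\<dots> \<le> (ip_norm H x)\<^sup>2 + 2 * (ip_norm H x * ip_norm H y) + (ip_norm H y)\<^sup>2"
    using order_trans[OF complex_Re_le_cmod cauchy_schwarz[OF x y]] by simp
  also have "\<dots> = (ip_norm H x + ip_norm H y)\<^sup>2" by (simp add: power2_sum)
  finally show ?thesis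
    by (rule power2_le_imp_le) (simp add: x y ip_norm_nonneg)
qed

lemma ip_eqI:
  assumes "y \<in> carrier H" "z \<in> carrier H" "\<And>x. x \<in> carrier H \<Longrightarrow> ip H x y = ip H x z"
  shows "y = z"
proof -
  have "ip H (y \<ominus> z) (y \<ominus> z) = 0"
    using assms assms(3)[of "y \<ominus> z"] by (simp add: minus_scale ip_add_right ip_scale_right)
  then show ?thesis
    using ip_zeroD[of "y \<ominus> z"] assms by simp
qed

lemma ip_norm_minus_commute:
  assumes "x \<in> carrier H" "y \<in> carrier H"
  shows "ip_norm H (x \<ominus> y) = ip_norm H (y \<ominus> x)"
proof -
  have "x \<ominus> y = (-1) \<odot> (y \<ominus> x)"
    using assms by (simp add: minus_scale scale_add_right scale_scale M.a_comm)
  then show ?thesis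
    using assms ip_norm_scale[of "y \<ominus> x" "-1"] by simp
qed

lemma ip_norm_minus_triangle:
  assumes "x \<in> carrier H" "y \<in> carrier H" "z \<in> carrier H"
  shows "ip_norm H (x \<ominus> z) \<le> ip_norm H (x \<ominus> y) + ip_norm H (y \<ominus> z)"
proof -
  have "x \<ominus> z = (x \<ominus> y) \<oplus> (y \<ominus> z)"
    using assms by (simp add: minus_scale M.a_assoc scale_collect scale_collect_left)
  then show ?thesis using ip_norm_triangle[of "x \<ominus> y" "y \<ominus> z"] assms by simp
qed

definition tends :: "(nat \<Rightarrow> 'h) \<Rightarrow> 'h \<Rightarrow> bool" where
  "tends u l \<longleftrightarrow> range u \<subseteq> carrier H \<and> l \<in> carrier H \<and> (\<lambda>n. ip_norm H (u n \<ominus> l)) \<longlonglongrightarrow> 0"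

lemma tendsD: "tends u l \<Longrightarrow> u n \<in> carrier H" "tends u l \<Longrightarrow> l \<in> carrier H"
  by (auto simp: tends_def)

lemma tends_unique:
  assumes "tends u l" "tends u m"
  shows "l = m"
proof -
  note c = tendsD[OF assms(1)] tendsD[OF assms(2)]
  have "(\<lambda>n. ip_norm H (u n \<ominus> l) + ip_norm H (u n \<ominus> m)) \<longlonglongrightarrow> 0 + 0"
    using assms by (intro tendsto_intros) (auto simp: tends_def)
  moreover have "ip_norm H (l \<ominus> m) \<le> ip_norm H (u n \<ominus> l) + ip_norm H (u n \<ominus> m)" for n
    using ip_norm_minus_triangle[of l "u n" m] c ip_norm_minus_commute[of l "u n"] by simp
  ultimately have "ip_norm H (l \<ominus> m) \<le> 0"
    by (intro tendsto_lowerbound[of "\<lambda>n. ip_norm H (u n \<ominus> l) + ip_norm H (u n \<ominus> m)"]) auto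
  then show ?thesis
    using ip_norm_nonneg[of "l \<ominus> m"] ip_norm_eq_0[of "l \<ominus> m"] c by simp
qed

lemma tends_le:
  assumes "range u \<subseteq> carrier H" "l \<in> carrier H" "\<And>n. ip_norm H (u n \<ominus> l) \<le> f n" "f \<longlonglongrightarrow> 0"
  shows "tends u l"
proof -
  have "(\<lambda>n. ip_norm H (u n \<ominus> l)) \<longlonglongrightarrow> 0"
    using assms by (intro Lim_null_comparison[OF always_eventually assms(4)])
      (auto simp: ip_norm_nonneg image_subset_iff)
  then show ?thesis using assms by (simp add: tends_def)
qed

lemma tends_add:
  assumes "tends u l" "tends v m"
  shows "tends (\<lambda>n. u n \<oplus> v n) (l \<oplus> m)"
proof (rule tends_le)
  note c = tendsD[OF assms(1)] tendsD[OF assms(2)]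
  show "range (\<lambda>n. u n \<oplus> v n) \<subseteq> carrier H" "l \<oplus> m \<in> carrier H" using c by auto
  show "(\<lambda>n. ip_norm H (u n \<ominus> l) + ip_norm H (v n \<ominus> m)) \<longlonglongrightarrow> 0"
    using assms by (intro tendsto_add_zero) (auto simp: tends_def)
  have "(u n \<oplus> v n) \<ominus> (l \<oplus> m) = (u n \<ominus> l) \<oplus> (v n \<ominus> m)" for n
    using c by (simp add: minus_scale scale_add_right M.a_ac)
  then show "ip_norm H ((u n \<oplus> v n) \<ominus> (l \<oplus> m)) \<le> ip_norm H (u n \<ominus> l) + ip_norm H (v n \<ominus> m)" for n
    using c by (simp add: ip_norm_triangle)
qed

lemma tends_scale:
  assumes "tends u l"
  shows "tends (\<lambda>n. c \<odot> u n) (c \<odot> l)"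
proof (rule tends_le)
  note cc = tendsD[OF assms(1)]
  show "range (\<lambda>n. c \<odot> u n) \<subseteq> carrier H" "c \<odot> l \<in> carrier H" using cc by auto
  show "(\<lambda>n. cmod c * ip_norm H (u n \<ominus> l)) \<longlonglongrightarrow> 0"
    using assms by (intro tendsto_mult_right_zero) (auto simp: tends_def)
  have "c \<odot> u n \<ominus> c \<odot> l = c \<odot> (u n \<ominus> l)" for n
    using cc by (simp add: minus_scale scale_add_right scale_scale M.a_ac)
  then show "ip_norm H (c \<odot> u n \<ominus> c \<odot> l) \<le> cmod c * ip_norm H (u n \<ominus> l)" for n
    using cc by (simp add: ip_norm_scale)
qed

lemma tends_ip:
  assumes "tends u l" "y \<in> carrier H"
  shows "(\<lambda>n. ip H (u n) y) \<longlonglongrightarrow> ip H l y" "(\<lambda>n. ip H y (u n)) \<longlonglongrightarrow> ip H y l"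
proof -
  note c = tendsD[OF assms(1)]
  show left: "(\<lambda>n. ip H (u n) y) \<longlonglongrightarrow> ip H l y"
  proof (rule LIM_zero_cancel, rule Lim_null_comparison[OF always_eventually])
    have "ip H (u n) y - ip H l y = ip H (u n \<ominus> l) y" for n
      using c assms(2) by (simp add: minus_scale ip_add_left ip_scale_left)
    then show "\<forall>n. norm (ip H (u n) y - ip H l y) \<le> ip_norm H (u n \<ominus> l) * ip_norm H y"
      using c assms(2) cauchy_schwarz by simp
    show "(\<lambda>n. ip_norm H (u n \<ominus> l) * ip_norm H y) \<longlonglongrightarrow> 0"
      using assms by (intro tendsto_mult_left_zero) (auto simp: tends_def)
  qed
  have "(\<lambda>n. cnj (ip H (u n) y)) \<longlonglongrightarrow> cnj (ip H l y)"
    by (intro tendsto_intros left)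
  then show "(\<lambda>n. ip H y (u n)) \<longlonglongrightarrow> ip H y l"
    using c assms(2) by (simp add: ip_cnj)
qed

section \<open>Bounded operators and their adjoints\<close>

lemma bounded_operatorD:
  assumes "bounded_operator H T"
  shows "x \<in> carrier H \<Longrightarrow> T x \<in> carrier H"
    "x \<in> carrier H \<Longrightarrow> y \<in> carrier H \<Longrightarrow> T (x \<oplus> y) = T x \<oplus> T y"
    "x \<in> carrier H \<Longrightarrow> T (c \<odot> x) = c \<odot> T x"
    "T \<in> extensional (carrier H)"
  using assms by (auto simp: bounded_operator_def PiE_iff)

definition opnorm :: "('h \<Rightarrow> 'h) \<Rightarrow> real" where
  "opnorm T = (SUP x\<in>{x \<in> carrier H. ip_norm H x \<le> 1}. ip_norm H (T x))"

lemma opnorm_le: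
  assumes "0 \<le> C" "\<And>x. x \<in> carrier H \<Longrightarrow> ip_norm H (T x) \<le> C * ip_norm H x"
  shows "opnorm T \<le> C"
  unfolding opnorm_def
proof (rule cSUP_least)
  have "\<zero> \<in> {x \<in> carrier H. ip_norm H x \<le> 1}" using ip_norm_eq_0[of \<zero>] by simp
  then show "{x \<in> carrier H. ip_norm H x \<le> 1} \<noteq> {}" by blast
  show "ip_norm H (T x) \<le> C" if "x \<in> {x \<in> carrier H. ip_norm H x \<le> 1}" for x
    using assms(2)[of x] that mult_left_mono[of "ip_norm H x" 1 C] assms(1) by simp
qed

lemma opnorm_bound:
  assumes T: "bounded_operator H T"
  shows "0 \<le> opnorm T" "x \<in> carrier H \<Longrightarrow> ip_norm H (T x) \<le> opnorm T * ip_norm H x"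
proof -
  obtain C where C: "\<And>x. x \<in> carrier H \<Longrightarrow> ip_norm H (T x) \<le> C * ip_norm H x"
    using T unfolding bounded_operator_def by blast
  let ?B = "{x \<in> carrier H. ip_norm H x \<le> 1}"
  have bdd: "bdd_above ((\<lambda>x. ip_norm H (T x)) ` ?B)"
  proof (rule bdd_aboveI2)
    fix x assume x: "x \<in> ?B"
    then have "ip_norm H (T x) \<le> \<bar>C\<bar> * ip_norm H x"
      using order_trans[OF C mult_right_mono[OF abs_ge_self]] by (simp add: ip_norm_nonneg)
    also have "\<dots> \<le> \<bar>C\<bar>" using x by (simp add: mult_left_le ip_norm_nonneg)
    finally show "ip_norm H (T x) \<le> \<bar>C\<bar>" .
  qed
  have up: "ip_norm H (T x) \<le> opnorm T" if "x \<in> ?B" for x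
    unfolding opnorm_def by (rule cSUP_upper[OF that bdd])
  have z: "\<zero> \<in> ?B" using ip_norm_eq_0[of \<zero>] by simp
  have "0 \<le> ip_norm H (T \<zero>)" by (intro ip_norm_nonneg bounded_operatorD[OF T]) simp
  then show "0 \<le> opnorm T" using up[OF z] by linarith
  show "ip_norm H (T x) \<le> opnorm T * ip_norm H x" if x: "x \<in> carrier H"
  proof (cases "x = \<zero>")
    case True
    then show ?thesis using C[of \<zero>] ip_norm_eq_0[of \<zero>] by simp
  next
    case False
    then have n: "0 < ip_norm H x" using ip_norm_nonneg[OF x] ip_norm_eq_0[OF x] by simp
    let ?c = "complex_of_real (1 / ip_norm H x)"
    have cn: "cmod ?c = 1 / ip_norm H x" using n by (simp add: norm_divide)
    have "?c \<odot> x \<in> ?B" using x n by (simp add: ip_norm_scale cn del: of_real_divide)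
    then have "ip_norm H (?c \<odot> T x) \<le> opnorm T"
      using up[of "?c \<odot> x"] bounded_operatorD(3)[OF T x, of ?c] by simp
    then show ?thesis
      using n bounded_operatorD(1)[OF T x]
      by (simp add: ip_norm_scale cn pos_divide_le_eq del: of_real_divide)
  qed
qed

lemma bounded_operatorI:
  assumes "\<And>x. x \<in> carrier H \<Longrightarrow> T x \<in> carrier H"
    "\<And>x y. x \<in> carrier H \<Longrightarrow> y \<in> carrier H \<Longrightarrow> T (x \<oplus> y) = T x \<oplus> T y"
    "\<And>x c. x \<in> carrier H \<Longrightarrow> T (c \<odot> x) = c \<odot> T x"
    "\<And>x. x \<in> carrier H \<Longrightarrow> ip_norm H (T x) \<le> C * ip_norm H x"
  shows "bounded_operator H (restrict T (carrier H))"
  using assms(1-3) by (auto simp: bounded_operator_def intro!: exI[of _ C] assms(4))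

text \<open>Working with explicit adjoint pairs makes the Riesz representation theorem unnecessary.\<close>

definition adjoint_pair :: "('h \<Rightarrow> 'h) \<Rightarrow> ('h \<Rightarrow> 'h) \<Rightarrow> bool" where
  "adjoint_pair T T' \<longleftrightarrow> bounded_operator H T \<and> bounded_operator H T' \<and>
    (\<forall>x\<in>carrier H. \<forall>y\<in>carrier H. ip H (T x) y = ip H x (T' y))"

lemma adjoint_pairD:
  assumes "adjoint_pair T T'"
  shows "bounded_operator H T" "bounded_operator H T'"
    "x \<in> carrier H \<Longrightarrow> y \<in> carrier H \<Longrightarrow> ip H (T x) y = ip H x (T' y)"
  using assms by (auto simp: adjoint_pair_def)

lemma adjoint_pair_sym:
  assumes "adjoint_pair T T'"
  shows "adjoint_pair T' T"
  unfolding adjoint_pair_def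
proof (intro conjI ballI)
  note T = adjoint_pairD[OF assms]
  fix x y assume xy: "x \<in> carrier H" "y \<in> carrier H"
  have "ip H (T' x) y = cnj (ip H y (T' x))"
    using xy bounded_operatorD(1)[OF T(2)] by (simp add: ip_cnj)
  also have "\<dots> = cnj (ip H (T y) x)" using T(3)[OF xy(2,1)] by simp
  also have "\<dots> = ip H x (T y)" using xy bounded_operatorD(1)[OF T(1)] by (simp add: ip_cnj)
  finally show "ip H (T' x) y = ip H x (T y)" .
qed (use adjoint_pairD[OF assms] in auto)

text \<open>A given adjoint supplies existence for the description in
  \<open>adjoint_operator\<close>, and \<open>ip_eqI\<close> uniqueness.\<close>

lemma adjoint_operator_eq:
  assumes "adjoint_pair T T'"
  shows "adjoint_operator H T = T'"
proof (rule extensionalityI)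
  note T = adjoint_pairD[OF assms]
  show "adjoint_operator H T \<in> extensional (carrier H)" by (simp add: adjoint_operator_def)
  show "T' \<in> extensional (carrier H)" by (rule bounded_operatorD(4)[OF T(2)])
  fix y assume y: "y \<in> carrier H"
  have "(THE z. z \<in> carrier H \<and> (\<forall>x\<in>carrier H. ip H (T x) y = ip H x z)) = T' y"
  proof (rule the_equality)
    show "T' y \<in> carrier H \<and> (\<forall>x\<in>carrier H. ip H (T x) y = ip H x (T' y))"
      using T y bounded_operatorD(1)[OF T(2) y] by blast
    show "z = T' y" if "z \<in> carrier H \<and> (\<forall>x\<in>carrier H. ip H (T x) y = ip H x z)" for z
      using that T(3) y bounded_operatorD(1)[OF T(2) y] by (intro ip_eqI) auto
  qed
  then show "adjoint_operator H T y = T' y" using y by (simp add: adjoint_operator_def)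
qed

text \<open>The squared norm of \<open>T' y\<close> is the inner product of \<open>T (T' y)\<close>
  with \<open>y\<close>; apply Cauchy-Schwarz and divide by the norm of \<open>T' y\<close>.\<close>

lemma adjoint_pair_opnorm_le:
  assumes "adjoint_pair T T'"
  shows "opnorm T' \<le> opnorm T"
proof (rule opnorm_le)
  note T = adjoint_pairD[OF assms]
  show "0 \<le> opnorm T" by (rule opnorm_bound(1)[OF T(1)])
  fix y assume y: "y \<in> carrier H"
  note T'y = bounded_operatorD(1)[OF T(2) y]
  have "ip H (T (T' y)) y = of_real ((ip_norm H (T' y))\<^sup>2)"
    unfolding T(3)[OF T'y y] by (rule ip_self[OF T'y])
  then have "(ip_norm H (T' y))\<^sup>2 = cmod (ip H (T (T' y)) y)"
    by (simp only: norm_of_real) simp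
  also have "\<dots> \<le> ip_norm H (T (T' y)) * ip_norm H y"
    using y bounded_operatorD(1)[OF T(1) T'y] by (intro cauchy_schwarz)
  also have "\<dots> \<le> (opnorm T * ip_norm H (T' y)) * ip_norm H y"
    using y opnorm_bound(2)[OF T(1) T'y] by (intro mult_right_mono) (auto simp: ip_norm_nonneg)
  finally have *: "ip_norm H (T' y) * ip_norm H (T' y) \<le> (opnorm T * ip_norm H y) * ip_norm H (T' y)"
    by (simp add: power2_eq_square mult_ac)
  show "ip_norm H (T' y) \<le> opnorm T * ip_norm H y"
  proof (cases "ip_norm H (T' y) = 0")
    case True
    then show ?thesis using opnorm_bound(1)[OF T(1)] y by (simp add: ip_norm_nonneg)
  next
    case False
    then show ?thesis using * ip_norm_nonneg[OF T'y] by (simp add: mult_le_cancel_right)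
  qed
qed

text \<open>The operations are literally those of \<open>bounded_operators H\<close>, so a
  homomorphism into this algebra is one into the bounded operators as well.\<close>

definition adjointable :: "('h \<Rightarrow> 'h) cstar" where
  "adjointable = (bounded_operators H)\<lparr>carrier := {T. \<exists>T'. adjoint_pair T T'}\<rparr>"

lemma adjointableI: "adjoint_pair T T' \<Longrightarrow> T \<in> carrier adjointable"
  by (auto simp: adjointable_def)

lemma adjointableE:
  assumes "T \<in> carrier adjointable"
  obtains T' where "adjoint_pair T T'"
  using assms by (auto simp: adjointable_def)

lemma adjointable_bounded: "T \<in> carrier adjointable \<Longrightarrow> bounded_operator H T"
  by (elim adjointableE adjoint_pairD(1))

lemma adjointable_simps [simp]:
  "S \<otimes>\<^bsub>adjointable\<^esub> T = (\<lambda>x\<in>carrier H. S (T x))"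
  "S \<oplus>\<^bsub>adjointable\<^esub> T = (\<lambda>x\<in>carrier H. S x \<oplus> T x)"
  "c \<odot>\<^bsub>adjointable\<^esub> T = (\<lambda>x\<in>carrier H. c \<odot> T x)"
  "\<zero>\<^bsub>adjointable\<^esub> = (\<lambda>x\<in>carrier H. \<zero>)"
  "invol adjointable T = adjoint_operator H T"
  "nrm adjointable T = opnorm T"
  by (simp_all add: adjointable_def bounded_operators_def opnorm_def)

lemma adjoint_pair_add:
  assumes "adjoint_pair S S'" "adjoint_pair T T'"
  shows "adjoint_pair (\<lambda>x\<in>carrier H. S x \<oplus> T x) (\<lambda>x\<in>carrier H. S' x \<oplus> T' x)"
proof -
  have bd: "bounded_operator H (\<lambda>x\<in>carrier H. S x \<oplus> T x)"
    if S: "bounded_operator H S" and T: "bounded_operator H T" for S T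
  proof (rule bounded_operatorI[where C = "opnorm S + opnorm T"])
    fix x assume x: "x \<in> carrier H"
    show "ip_norm H (S x \<oplus> T x) \<le> (opnorm S + opnorm T) * ip_norm H x"
      using ip_norm_triangle[of "S x" "T x"] opnorm_bound(2)[OF S x] opnorm_bound(2)[OF T x]
        bounded_operatorD(1)[OF S x] bounded_operatorD(1)[OF T x] by (simp add: algebra_simps)
  qed (auto simp: bounded_operatorD[OF S] bounded_operatorD[OF T] M.a_ac scale_add_right)
  note S = adjoint_pairD[OF assms(1)] and T = adjoint_pairD[OF assms(2)]
  show ?thesis
    unfolding adjoint_pair_def
    using bd S T bounded_operatorD(1)[OF S(1)] bounded_operatorD(1)[OF S(2)]
      bounded_operatorD(1)[OF T(1)] bounded_operatorD(1)[OF T(2)]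
    by (simp add: ip_add_left ip_add_right)
qed

lemma adjoint_pair_scale:
  assumes "adjoint_pair T T'"
  shows "adjoint_pair (\<lambda>x\<in>carrier H. c \<odot> T x) (\<lambda>x\<in>carrier H. cnj c \<odot> T' x)"
proof -
  have bd: "bounded_operator H (\<lambda>x\<in>carrier H. c \<odot> T x)"
    if T: "bounded_operator H T" for T c
  proof (rule bounded_operatorI[where C = "cmod c * opnorm T"])
    fix x assume x: "x \<in> carrier H"
    show "ip_norm H (c \<odot> T x) \<le> cmod c * opnorm T * ip_norm H x"
      using opnorm_bound(2)[OF T x] bounded_operatorD(1)[OF T x]
      by (simp add: ip_norm_scale mult.assoc mult_left_mono)
  qed (auto simp: bounded_operatorD[OF T] scale_add_right scale_scale mult.commute)
  note T = adjoint_pairD[OF assms(1)]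
  show ?thesis
    unfolding adjoint_pair_def
    using bd T bounded_operatorD(1)[OF T(1)] bounded_operatorD(1)[OF T(2)]
    by (simp add: ip_scale_left ip_scale_right)
qed

lemma adjoint_pair_mult:
  assumes "adjoint_pair S S'" "adjoint_pair T T'"
  shows "adjoint_pair (\<lambda>x\<in>carrier H. S (T x)) (\<lambda>x\<in>carrier H. T' (S' x))"
    and opnorm_mult_le: "opnorm (\<lambda>x\<in>carrier H. S (T x)) \<le> opnorm S * opnorm T"
proof -
  have est: "ip_norm H (S (T x)) \<le> opnorm S * opnorm T * ip_norm H x"
    if S: "bounded_operator H S" and T: "bounded_operator H T" and x: "x \<in> carrier H" for S T x
  proof -
    have "ip_norm H (S (T x)) \<le> opnorm S * ip_norm H (T x)"
      by (intro opnorm_bound(2)[OF S] bounded_operatorD(1)[OF T x])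
    also have "\<dots> \<le> opnorm S * (opnorm T * ip_norm H x)"
      by (intro mult_left_mono opnorm_bound[OF T] x opnorm_bound[OF S])
    finally show ?thesis by (simp add: mult.assoc)
  qed
  have bd: "bounded_operator H (\<lambda>x\<in>carrier H. S (T x))"
    if S: "bounded_operator H S" and T: "bounded_operator H T" for S T
    by (rule bounded_operatorI[where C = "opnorm S * opnorm T"])
      (auto simp: bounded_operatorD[OF S] bounded_operatorD[OF T] est[OF S T])
  note S = adjoint_pairD[OF assms(1)] and T = adjoint_pairD[OF assms(2)]
  show "adjoint_pair (\<lambda>x\<in>carrier H. S (T x)) (\<lambda>x\<in>carrier H. T' (S' x))"
    unfolding adjoint_pair_def
    using bd S T bounded_operatorD(1)[OF S(1)] bounded_operatorD(1)[OF S(2)]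
      bounded_operatorD(1)[OF T(1)] bounded_operatorD(1)[OF T(2)]
    by simp
  show "opnorm (\<lambda>x\<in>carrier H. S (T x)) \<le> opnorm S * opnorm T"
    by (rule opnorm_le) (simp_all add: est[OF S(1) T(1)] opnorm_bound S(1) T(1))
qed

lemma adjoint_pair_zero: "adjoint_pair (\<lambda>x\<in>carrier H. \<zero>) (\<lambda>x\<in>carrier H. \<zero>)"
proof -
  have "bounded_operator H (\<lambda>x\<in>carrier H. \<zero>)"
    by (rule bounded_operatorI[where C = 0]) (simp_all add: ip_norm_zero)
  then show ?thesis by (simp add: adjoint_pair_def)
qed

lemma module_adjointable: "module (ring_of_type_algebra :: complex ring) adjointable"
proof (rule moduleI[OF ring_of_type_algebra_cring])
  have D: "T x \<in> carrier H" "T \<in> extensional (carrier H)"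
    if "T \<in> carrier adjointable" "x \<in> carrier H" for T x
    using bounded_operatorD(1,4)[OF adjointable_bounded[OF that(1)]] that(2) by blast+
  have E: "T \<in> extensional (carrier H)" if "T \<in> carrier adjointable" for T
    using bounded_operatorD(4)[OF adjointable_bounded[OF that]] .
  show "abelian_group adjointable"
  proof (rule abelian_groupI)
    show "S \<oplus>\<^bsub>adjointable\<^esub> T \<in> carrier adjointable"
      if "S \<in> carrier adjointable" "T \<in> carrier adjointable" for S T
      using that by (auto elim!: adjointableE intro: adjointableI adjoint_pair_add)
    show "\<zero>\<^bsub>adjointable\<^esub> \<in> carrier adjointable" using adjointableI[OF adjoint_pair_zero] by simp
    show "R \<oplus>\<^bsub>adjointable\<^esub> S \<oplus>\<^bsub>adjointable\<^esub> T = R \<oplus>\<^bsub>adjointable\<^esub> (S \<oplus>\<^bsub>adjointable\<^esub> T)"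
      if "R \<in> carrier adjointable" "S \<in> carrier adjointable" "T \<in> carrier adjointable" for R S T
      using D(1)[OF that(1)] D(1)[OF that(2)] D(1)[OF that(3)]
      by (simp add: M.a_assoc cong: restrict_cong)
    show "S \<oplus>\<^bsub>adjointable\<^esub> T = T \<oplus>\<^bsub>adjointable\<^esub> S"
      if "S \<in> carrier adjointable" "T \<in> carrier adjointable" for S T
      using D(1)[OF that(1)] D(1)[OF that(2)] by (simp add: M.a_comm cong: restrict_cong)
    show "\<zero>\<^bsub>adjointable\<^esub> \<oplus>\<^bsub>adjointable\<^esub> T = T" if "T \<in> carrier adjointable" for T
      using D(1)[OF that] E[OF that] by (intro ext) (auto simp: extensional_def)
    show "\<exists>S\<in>carrier adjointable. S \<oplus>\<^bsub>adjointable\<^esub> T = \<zero>\<^bsub>adjointable\<^esub>"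
      if T: "T \<in> carrier adjointable" for T
    proof (rule bexI)
      show "(\<lambda>x\<in>carrier H. (-1) \<odot> T x) \<in> carrier adjointable"
        using T by (auto elim!: adjointableE intro: adjointableI adjoint_pair_scale)
      show "(\<lambda>x\<in>carrier H. (-1) \<odot> T x) \<oplus>\<^bsub>adjointable\<^esub> T = \<zero>\<^bsub>adjointable\<^esub>"
        using D(1)[OF T] by (simp add: scale_collect cong: restrict_cong)
    qed
  qed
  show "c \<odot>\<^bsub>adjointable\<^esub> T \<in> carrier adjointable" if "T \<in> carrier adjointable" for c T
    using that by (auto elim!: adjointableE intro: adjointableI adjoint_pair_scale)
  fix T assume T: "T \<in> carrier adjointable"
  note TD = D(1)[OF T] E[OF T]
  show "(c \<oplus>\<^bsub>ring_of_type_algebra\<^esub> d) \<odot>\<^bsub>adjointable\<^esub> T =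
      c \<odot>\<^bsub>adjointable\<^esub> T \<oplus>\<^bsub>adjointable\<^esub> d \<odot>\<^bsub>adjointable\<^esub> T" for c d
    using TD by (simp add: scale_add_left cong: restrict_cong)
  show "c \<otimes>\<^bsub>ring_of_type_algebra\<^esub> d \<odot>\<^bsub>adjointable\<^esub> T = c \<odot>\<^bsub>adjointable\<^esub> (d \<odot>\<^bsub>adjointable\<^esub> T)" for c d
    using TD by (simp add: scale_scale cong: restrict_cong)
  show "\<one>\<^bsub>ring_of_type_algebra\<^esub> \<odot>\<^bsub>adjointable\<^esub> T = T"
    using TD by (intro ext) (auto simp: extensional_def)
  show "c \<odot>\<^bsub>adjointable\<^esub> (S \<oplus>\<^bsub>adjointable\<^esub> T) = c \<odot>\<^bsub>adjointable\<^esub> S \<oplus>\<^bsub>adjointable\<^esub> c \<odot>\<^bsub>adjointable\<^esub> T"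
    if S: "S \<in> carrier adjointable" for S c
    using TD D(1)[OF S] by (simp add: scale_add_right cong: restrict_cong)
qed

lemma adjointable_ext:
  assumes "S \<in> carrier adjointable" "T \<in> carrier adjointable" "\<And>x. x \<in> carrier H \<Longrightarrow> S x = T x"
  shows "S = T"
  by (rule extensionalityI[of _ "carrier H"])
    (use assms bounded_operatorD(4)[OF adjointable_bounded] in auto)

lemma opnorm_eq_0:
  assumes T: "bounded_operator H T" and "opnorm T = 0"
  shows "T = (\<lambda>x\<in>carrier H. \<zero>)"
proof (rule extensionalityI)
  show "T x = (\<lambda>x\<in>carrier H. \<zero>) x" if x: "x \<in> carrier H" for x
    using opnorm_bound(2)[OF T x] assms(2) ip_norm_nonneg[of "T x"] ip_norm_eq_0[of "T x"]
      bounded_operatorD(1)[OF T x] x by simp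
qed (use bounded_operatorD(4)[OF T] in auto)

lemma opnorm_triangle:
  assumes S: "bounded_operator H S" and T: "bounded_operator H T"
  shows "opnorm (\<lambda>x\<in>carrier H. S x \<oplus> T x) \<le> opnorm S + opnorm T"
proof (rule opnorm_le)
  fix x assume x: "x \<in> carrier H"
  show "ip_norm H ((\<lambda>x\<in>carrier H. S x \<oplus> T x) x) \<le> (opnorm S + opnorm T) * ip_norm H x"
    using ip_norm_triangle[of "S x" "T x"] opnorm_bound(2)[OF S x] opnorm_bound(2)[OF T x]
      bounded_operatorD(1)[OF S x] bounded_operatorD(1)[OF T x] x by (simp add: algebra_simps)
qed (simp add: opnorm_bound(1) S T)

lemma opnorm_scale_le:
  assumes T: "bounded_operator H T"
  shows "opnorm (\<lambda>x\<in>carrier H. c \<odot> T x) \<le> cmod c * opnorm T"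
proof (rule opnorm_le)
  fix x assume x: "x \<in> carrier H"
  show "ip_norm H ((\<lambda>x\<in>carrier H. c \<odot> T x) x) \<le> cmod c * opnorm T * ip_norm H x"
    using opnorm_bound(2)[OF T x] bounded_operatorD(1)[OF T x] x
    by (simp add: ip_norm_scale mult.assoc mult_left_mono)
qed (simp add: opnorm_bound(1) T)

lemma opnorm_scale:
  assumes T: "adjoint_pair T T'"
  shows "opnorm (\<lambda>x\<in>carrier H. c \<odot> T x) = cmod c * opnorm T"
proof (cases "c = 0")
  case True
  then show ?thesis
    using opnorm_scale_le[OF adjoint_pairD(1)[OF T], of 0]
      opnorm_bound(1)[OF adjoint_pairD(1)[OF adjoint_pair_scale[OF T, of 0]]] by simp
next
  case False
  note Tb = adjoint_pairD(1)[OF T]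
  have "T = (\<lambda>x\<in>carrier H. (1 / c) \<odot> (\<lambda>x\<in>carrier H. c \<odot> T x) x)"
    using bounded_operatorD(1,4)[OF Tb] False
    by (intro extensionalityI[of _ "carrier H"]) (auto simp: scale_scale)
  then have "opnorm T \<le> cmod (1 / c) * opnorm (\<lambda>x\<in>carrier H. c \<odot> T x)"
    using opnorm_scale_le[OF adjoint_pairD(1)[OF adjoint_pair_scale[OF T, of c]], of "1 / c"] by simp
  then have "cmod c * opnorm T \<le> opnorm (\<lambda>x\<in>carrier H. c \<odot> T x)"
    using False by (simp add: norm_divide field_simps)
  then show ?thesis using opnorm_scale_le[OF Tb, of c] by simp
qed

lemma normed_module_adjointable: "normed_module adjointable"
proof (intro normed_module.intro complex_module.intro module_adjointable normed_module_axioms.intro)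
  fix T assume "T \<in> carrier adjointable"
  then obtain T' where T: "adjoint_pair T T'" by (rule adjointableE)
  show "0 \<le> nrm adjointable T" using opnorm_bound(1) adjoint_pairD(1)[OF T] by simp
  show "nrm adjointable T = 0 \<longleftrightarrow> T = \<zero>\<^bsub>adjointable\<^esub>"
  proof
    assume "T = \<zero>\<^bsub>adjointable\<^esub>"
    then have "opnorm T \<le> 0" by (intro opnorm_le) (auto simp: ip_norm_zero)
    then show "nrm adjointable T = 0" using opnorm_bound(1)[OF adjoint_pairD(1)[OF T]] by simp
  qed (use opnorm_eq_0[OF adjoint_pairD(1)[OF T]] in simp)
  show "nrm adjointable (c \<odot>\<^bsub>adjointable\<^esub> T) = cmod c * nrm adjointable T" for c
    using opnorm_scale[OF T] by simp
  show "nrm adjointable (T \<oplus>\<^bsub>adjointable\<^esub> S) \<le> nrm adjointable T + nrm adjointable S"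
    if "S \<in> carrier adjointable" for S
    using opnorm_triangle[OF adjoint_pairD(1)[OF T] adjointable_bounded[OF that]] by simp
qed

lemma opnorm_star:
  assumes T: "adjoint_pair T T'"
  shows "opnorm (\<lambda>x\<in>carrier H. T' (T x)) = (opnorm T)\<^sup>2"
proof (rule antisym)
  note Tb = adjoint_pairD(1)[OF T] and Tb' = adjoint_pairD(2)[OF T]
  let ?P = "\<lambda>x\<in>carrier H. T' (T x)"
  note P = adjoint_pair_mult[OF adjoint_pair_sym[OF T] T]
  have "opnorm ?P \<le> opnorm T' * opnorm T" by (rule opnorm_mult_le[OF adjoint_pair_sym[OF T] T])
  also have "\<dots> \<le> opnorm T * opnorm T"
    by (intro mult_right_mono adjoint_pair_opnorm_le[OF T] opnorm_bound(1)[OF Tb])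
  finally show "opnorm ?P \<le> (opnorm T)\<^sup>2" by (simp add: power2_eq_square)
  have Pb: "bounded_operator H ?P" using adjoint_pairD(1)[OF P(1)] .
  have "opnorm T \<le> sqrt (opnorm ?P)"
  proof (rule opnorm_le)
    show "0 \<le> sqrt (opnorm ?P)" by (simp add: opnorm_bound(1)[OF Pb])
    fix x assume x: "x \<in> carrier H"
    note Tx = bounded_operatorD(1)[OF Tb x]
    have "ip H x (T' (T x)) = of_real ((ip_norm H (T x))\<^sup>2)"
      unfolding adjoint_pairD(3)[OF T x Tx, symmetric] by (rule ip_self[OF Tx])
    then have "(ip_norm H (T x))\<^sup>2 = cmod (ip H x (T' (T x)))"
      by (simp only: norm_of_real) simp
    also have "\<dots> \<le> ip_norm H x * ip_norm H (T' (T x))"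
      using x bounded_operatorD(1)[OF Tb' Tx] by (intro cauchy_schwarz)
    also have "\<dots> \<le> ip_norm H x * (opnorm ?P * ip_norm H x)"
      using opnorm_bound(2)[OF Pb x] x by (intro mult_left_mono) (auto simp: ip_norm_nonneg)
    also have "\<dots> = (sqrt (opnorm ?P) * ip_norm H x)\<^sup>2"
      by (simp add: power_mult_distrib opnorm_bound(1)[OF Pb] power2_eq_square)
    finally show "ip_norm H (T x) \<le> sqrt (opnorm ?P) * ip_norm H x"
      by (rule power2_le_imp_le) (simp add: ip_norm_nonneg x opnorm_bound(1)[OF Pb])
  qed
  then have "(opnorm T)\<^sup>2 \<le> (sqrt (opnorm ?P))\<^sup>2"
    by (intro power_mono opnorm_bound(1)[OF Tb])
  then show "(opnorm T)\<^sup>2 \<le> opnorm ?P" by (simp add: opnorm_bound(1)[OF Pb])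
qed

text \<open>A limit must again have an adjoint. Passing to adjoints does not increase the operator
  norm, so the adjoints form a Cauchy sequence too, and continuity of the inner product makes the
  two limits an adjoint pair.\<close>

lemma adjointable_complete: "Metric_space.mcomplete (carrier adjointable) (cstar_dist adjointable)"
proof -
  interpret N: normed_module adjointable by (rule normed_module_adjointable)
  have minus: "S \<ominus>\<^bsub>adjointable\<^esub> T = (\<lambda>x\<in>carrier H. S x \<ominus> T x)"
    if "S \<in> carrier adjointable" "T \<in> carrier adjointable" for S T
    using bounded_operatorD(1)[OF adjointable_bounded[OF that(1)]]
      bounded_operatorD(1)[OF adjointable_bounded[OF that(2)]] unfolding N.minus_scale[OF that]
    by (simp add: minus_scale cong: restrict_cong)
  show ?thesis
    unfolding mcomplete_sequential[OF N.metric]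
  proof (intro allI impI)
    fix u :: "nat \<Rightarrow> 'h \<Rightarrow> 'h" assume u: "range u \<subseteq> carrier adjointable \<and>
      (\<forall>e>0. \<exists>N. \<forall>m n. N \<le> m \<longrightarrow> N \<le> n \<longrightarrow> cstar_dist adjointable (u m) (u n) < e)"
    then have uc: "u n \<in> carrier adjointable" for n by blast
    then have "\<forall>n. \<exists>T'. adjoint_pair (u n) T'" by (meson adjointableE)
    then obtain w where w: "\<And>n. adjoint_pair (u n) (w n)" by metis
    note ub = adjoint_pairD(1)[OF w] and wb = adjoint_pairD(2)[OF w]
    have wc: "w n \<in> carrier adjointable" for n using adjointableI[OF adjoint_pair_sym[OF w]] .
    have diff: "adjoint_pair (u m \<ominus>\<^bsub>adjointable\<^esub> u n) (w m \<ominus>\<^bsub>adjointable\<^esub> w n)" for m n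
    proof -
      have "adjoint_pair (\<lambda>x\<in>carrier H. u m x \<oplus> (\<lambda>x\<in>carrier H. (-1) \<odot> u n x) x)
          (\<lambda>x\<in>carrier H. w m x \<oplus> (\<lambda>x\<in>carrier H. cnj (-1) \<odot> w n x) x)"
        by (rule adjoint_pair_add[OF w adjoint_pair_scale[OF w]])
      then show ?thesis
        using N.minus_scale[OF uc uc] N.minus_scale[OF wc wc] by simp
    qed
    have cau: "\<exists>N. \<forall>m n. N \<le> m \<longrightarrow> N \<le> n \<longrightarrow> opnorm (u m \<ominus>\<^bsub>adjointable\<^esub> u n) < e" if "0 < e" for e
      using u that uc by (simp add: cstar_dist_def)
    have cau': "\<exists>N. \<forall>m n. N \<le> m \<longrightarrow> N \<le> n \<longrightarrow> opnorm (w m \<ominus>\<^bsub>adjointable\<^esub> w n) < e" if "0 < e" for e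
      using cau[OF that] adjoint_pair_opnorm_le[OF diff] by (meson order_le_less_trans)
    \<comment> \<open>Stated for a general sequence \<open>v\<close>, since it is applied to the
      operators and to their adjoints.\<close>
    have lim: "\<exists>T. (\<forall>x\<in>carrier H. tends (\<lambda>n. v n x) (T x)) \<and> bounded_operator H T \<and>
        (\<forall>e>0. \<exists>N. \<forall>n\<ge>N. \<forall>x\<in>carrier H. ip_norm H (v n x \<ominus> T x) \<le> e * ip_norm H x)"
      if v: "\<And>n. v n \<in> carrier adjointable" and cv:
        "\<And>e. 0 < e \<Longrightarrow> \<exists>N. \<forall>m n. N \<le> m \<longrightarrow> N \<le> n \<longrightarrow> opnorm (v m \<ominus>\<^bsub>adjointable\<^esub> v n) < e" for v
    proof -
      have vb: "bounded_operator H (v n)" for n by (rule adjointable_bounded[OF v])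
      have vd: "bounded_operator H (v m \<ominus>\<^bsub>adjointable\<^esub> v n)" for m n
        by (rule adjointable_bounded[OF N.M.minus_closed[OF v v]])
      have est: "ip_norm H (v m x \<ominus> v n x) \<le> opnorm (v m \<ominus>\<^bsub>adjointable\<^esub> v n) * ip_norm H x"
        if x: "x \<in> carrier H" for m n x
        using opnorm_bound(2)[OF vd x, of m n] x by (simp add: minus[OF v v])
      have pt: "\<exists>l. tends (\<lambda>n. v n x) l" if x: "x \<in> carrier H" for x
      proof -
        have vx: "range (\<lambda>n. v n x) \<subseteq> carrier H" using bounded_operatorD(1)[OF vb x] by auto
        have "\<exists>l\<in>carrier H. (\<lambda>n. ip_norm H (v n x \<ominus> l)) \<longlonglongrightarrow> 0"
        proof (rule cauchy_limit[OF vx])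
          fix e :: real assume e: "0 < e"
          have pos: "0 < ip_norm H x + 1" using ip_norm_nonneg[OF x] by simp
          obtain N where N: "\<And>m n. N \<le> m \<Longrightarrow> N \<le> n \<Longrightarrow> opnorm (v m \<ominus>\<^bsub>adjointable\<^esub> v n) < e / (ip_norm H x + 1)"
            using cv[OF divide_pos_pos[OF e pos]] by blast
          have "ip_norm H (v m x \<ominus> v n x) < e" if mn: "N \<le> m" "N \<le> n" for m n
          proof -
            have "ip_norm H (v m x \<ominus> v n x) \<le> opnorm (v m \<ominus>\<^bsub>adjointable\<^esub> v n) * (ip_norm H x + 1)"
              using est[OF x, of m n] opnorm_bound(1)[OF vd, of m n] by (simp add: algebra_simps)
            also have "\<dots> < e" using N[OF mn] pos by (simp add: pos_less_divide_eq)
            finally show ?thesis .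
          qed
          then show "\<exists>N. \<forall>m n. N \<le> m \<longrightarrow> N \<le> n \<longrightarrow> ip_norm H (v m x \<ominus> v n x) < e" by blast
        qed
        then show ?thesis using vx by (auto simp: tends_def)
      qed
      define T where "T = (\<lambda>x\<in>carrier H. SOME l. tends (\<lambda>n. v n x) l)"
      have T: "tends (\<lambda>n. v n x) (T x)" if "x \<in> carrier H" for x
        using someI_ex[OF pt[OF that]] that by (simp add: T_def)
      have Tc: "T x \<in> carrier H" if "x \<in> carrier H" for x using tendsD(2)[OF T[OF that]] .
      \<comment> \<open>Letting \<open>m\<close> tend to infinity in the Cauchy estimate keeps the
        bound uniform in \<open>x\<close>, which upgrades pointwise convergence to convergence in
        operator norm.\<close>
      have unif: "\<exists>N. \<forall>n\<ge>N. \<forall>x\<in>carrier H. ip_norm H (v n x \<ominus> T x) \<le> e * ip_norm H x"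
        if e: "0 < e" for e
      proof -
        obtain N where N: "\<And>m n. N \<le> m \<Longrightarrow> N \<le> n \<Longrightarrow> opnorm (v m \<ominus>\<^bsub>adjointable\<^esub> v n) < e"
          using cv[OF e] by blast
        have "ip_norm H (v n x \<ominus> T x) \<le> e * ip_norm H x" if n: "N \<le> n" and x: "x \<in> carrier H" for n x
        proof -
          have "(\<lambda>m. e * ip_norm H x + ip_norm H (v m x \<ominus> T x)) \<longlonglongrightarrow> e * ip_norm H x + 0"
            using T[OF x] by (intro tendsto_intros) (simp add: tends_def)
          moreover have "\<forall>\<^sub>F m in sequentially. ip_norm H (v n x \<ominus> T x) \<le> e * ip_norm H x + ip_norm H (v m x \<ominus> T x)"
            using eventually_ge_at_top[of N]
          proof eventually_elim
            case (elim m)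
            have "ip_norm H (v n x \<ominus> v m x) \<le> e * ip_norm H x"
              using est[OF x, of n m] mult_right_mono[OF less_imp_le[OF N[OF n elim]] ip_norm_nonneg[OF x]]
              by simp
            then show ?case
              using ip_norm_minus_triangle[of "v n x" "v m x" "T x"] Tc[OF x] bounded_operatorD(1)[OF vb x]
              by simp
          qed
          ultimately show ?thesis
            by (intro tendsto_lowerbound[of "\<lambda>m. e * ip_norm H x + ip_norm H (v m x \<ominus> T x)"]) auto
        qed
        then show ?thesis by blast
      qed
      have "bounded_operator H T"
      proof -
        obtain N where N: "\<And>x. x \<in> carrier H \<Longrightarrow> ip_norm H (v N x \<ominus> T x) \<le> 1 * ip_norm H x"
          using unif[of 1] by auto
        have "bounded_operator H (restrict T (carrier H))"
        proof (rule bounded_operatorI[where C = "opnorm (v N) + 1"])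
          fix x assume x: "x \<in> carrier H"
          show "T x \<in> carrier H" by (rule Tc[OF x])
          have "ip_norm H (T x \<ominus> \<zero>) \<le> ip_norm H (T x \<ominus> v N x) + ip_norm H (v N x \<ominus> \<zero>)"
            using Tc[OF x] bounded_operatorD(1)[OF vb x] by (intro ip_norm_minus_triangle) auto
          then show "ip_norm H (T x) \<le> (opnorm (v N) + 1) * ip_norm H x"
            using N[OF x] opnorm_bound(2)[OF vb x, of N] Tc[OF x] bounded_operatorD(1)[OF vb x]
              ip_norm_minus_commute[of "T x" "v N x"]
            by (simp add: algebra_simps minus_scale)
          show "T (c \<odot> x) = c \<odot> T x" for c
          proof (rule tends_unique)
            show "tends (\<lambda>n. v n (c \<odot> x)) (T (c \<odot> x))" using x by (intro T) simp
            show "tends (\<lambda>n. v n (c \<odot> x)) (c \<odot> T x)"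
              using tends_scale[OF T[OF x], of c] bounded_operatorD(3)[OF vb x] by simp
          qed
          fix y assume y: "y \<in> carrier H"
          show "T (x \<oplus> y) = T x \<oplus> T y"
          proof (rule tends_unique)
            show "tends (\<lambda>n. v n (x \<oplus> y)) (T (x \<oplus> y))" using x y by (intro T) simp
            show "tends (\<lambda>n. v n (x \<oplus> y)) (T x \<oplus> T y)"
              using tends_add[OF T[OF x] T[OF y]] bounded_operatorD(2)[OF vb x y] by simp
          qed
        qed
        moreover have "restrict T (carrier H) = T" by (simp add: T_def)
        ultimately show ?thesis by simp
      qed
      then show ?thesis using T unif by blast
    qed
    obtain T where T: "\<And>x. x \<in> carrier H \<Longrightarrow> tends (\<lambda>n. u n x) (T x)" "bounded_operator H T"
      and unif: "\<And>e. 0 < e \<Longrightarrow> \<exists>N. \<forall>n\<ge>N. \<forall>x\<in>carrier H. ip_norm H (u n x \<ominus> T x) \<le> e * ip_norm H x"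
      using lim[OF uc cau] by blast
    obtain T' where T': "\<And>x. x \<in> carrier H \<Longrightarrow> tends (\<lambda>n. w n x) (T' x)" "bounded_operator H T'"
      using lim[OF wc cau'] by blast
    have pair: "adjoint_pair T T'"
      unfolding adjoint_pair_def
    proof (intro conjI ballI T T')
      fix x y assume xy: "x \<in> carrier H" "y \<in> carrier H"
      have "(\<lambda>n. ip H (u n x) y) \<longlonglongrightarrow> ip H (T x) y" by (rule tends_ip(1)[OF T(1)[OF xy(1)] xy(2)])
      moreover have "(\<lambda>n. ip H (u n x) y) \<longlonglongrightarrow> ip H x (T' y)"
        using tends_ip(2)[OF T'(1)[OF xy(2)] xy(1)] adjoint_pairD(3)[OF w xy] by simp
      ultimately show "ip H (T x) y = ip H x (T' y)" by (rule LIMSEQ_unique)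
    qed
    then have Tc: "T \<in> carrier adjointable" by (rule adjointableI)
    have "(\<lambda>n. cstar_dist adjointable (u n) T) \<longlonglongrightarrow> 0"
    proof (rule LIMSEQ_I)
      fix e :: real assume e: "0 < e"
      obtain N where N: "\<And>n x. N \<le> n \<Longrightarrow> x \<in> carrier H \<Longrightarrow> ip_norm H (u n x \<ominus> T x) \<le> e / 2 * ip_norm H x"
        using unif[of "e / 2"] e by (metis half_gt_zero)
      have "norm (cstar_dist adjointable (u n) T - 0) < e" if n: "N \<le> n" for n
      proof -
        have "opnorm (u n \<ominus>\<^bsub>adjointable\<^esub> T) \<le> e / 2"
          by (rule opnorm_le) (use e N[OF n] minus[OF uc Tc] in auto)
        moreover have "0 \<le> opnorm (u n \<ominus>\<^bsub>adjointable\<^esub> T)"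
          using N.n_nonneg[OF N.M.minus_closed[OF uc Tc]] by simp
        ultimately show ?thesis using uc Tc e by (simp add: cstar_dist_def)
      qed
      then show "\<exists>no. \<forall>n\<ge>no. norm (cstar_dist adjointable (u n) T - 0) < e" by blast
    qed
    then show "\<exists>l\<in>carrier adjointable. (\<lambda>n. cstar_dist adjointable (u n) l) \<longlonglongrightarrow> 0"
      using Tc by blast
  qed
qed

theorem cstar_algebra_adjointable: "cstar_algebra adjointable"
proof (intro cstar_algebra.intro module_adjointable cstar_algebra_axioms.intro)
  interpret N: normed_module adjointable by (rule normed_module_adjointable)
  have inv: "adjoint_operator H T = T'" if "adjoint_pair T T'" for T T'
    by (rule adjoint_operator_eq[OF that])
  show "Metric_space.mcomplete (carrier adjointable) (cstar_dist adjointable)"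
    by (rule adjointable_complete)
  fix R S T assume "R \<in> carrier adjointable" "S \<in> carrier adjointable"  "T \<in> carrier adjointable"
  then obtain R' S' T' where p: "adjoint_pair R R'" "adjoint_pair S S'" "adjoint_pair T T'"
    by (elim adjointableE)
  note b = bounded_operatorD[OF adjoint_pairD(1)[OF p(1)]] bounded_operatorD[OF adjoint_pairD(1)[OF p(2)]]
    bounded_operatorD[OF adjoint_pairD(1)[OF p(3)]]
  show "R \<otimes>\<^bsub>adjointable\<^esub> S \<in> carrier adjointable"
    using adjointableI[OF adjoint_pair_mult(1)[OF p(1,2)]] by simp
  show "R \<otimes>\<^bsub>adjointable\<^esub> S \<otimes>\<^bsub>adjointable\<^esub> T = R \<otimes>\<^bsub>adjointable\<^esub> (S \<otimes>\<^bsub>adjointable\<^esub> T)"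
    using b by (simp cong: restrict_cong)
  show "(R \<oplus>\<^bsub>adjointable\<^esub> S) \<otimes>\<^bsub>adjointable\<^esub> T =
      R \<otimes>\<^bsub>adjointable\<^esub> T \<oplus>\<^bsub>adjointable\<^esub> S \<otimes>\<^bsub>adjointable\<^esub> T"
    using b by (simp cong: restrict_cong)
  show "R \<otimes>\<^bsub>adjointable\<^esub> (S \<oplus>\<^bsub>adjointable\<^esub> T) =
      R \<otimes>\<^bsub>adjointable\<^esub> S \<oplus>\<^bsub>adjointable\<^esub> R \<otimes>\<^bsub>adjointable\<^esub> T"
    using b by (simp cong: restrict_cong)
  show "c \<odot>\<^bsub>adjointable\<^esub> R \<otimes>\<^bsub>adjointable\<^esub> S = c \<odot>\<^bsub>adjointable\<^esub> (R \<otimes>\<^bsub>adjointable\<^esub> S)"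
    "R \<otimes>\<^bsub>adjointable\<^esub> (c \<odot>\<^bsub>adjointable\<^esub> S) = c \<odot>\<^bsub>adjointable\<^esub> (R \<otimes>\<^bsub>adjointable\<^esub> S)" for c
    using b by (simp_all cong: restrict_cong)
  show "invol adjointable R \<in> carrier adjointable"
    using adjointableI[OF adjoint_pair_sym[OF p(1)]] inv[OF p(1)] by simp
  show "invol adjointable (invol adjointable R) = R"
    using inv[OF p(1)] inv[OF adjoint_pair_sym[OF p(1)]] by simp
  show "invol adjointable (R \<oplus>\<^bsub>adjointable\<^esub> S) = invol adjointable R \<oplus>\<^bsub>adjointable\<^esub> invol adjointable S"
    using inv[OF p(1)] inv[OF p(2)] inv[OF adjoint_pair_add[OF p(1,2)]] by simp
  show "invol adjointable (c \<odot>\<^bsub>adjointable\<^esub> R) = cnj c \<odot>\<^bsub>adjointable\<^esub> invol adjointable R" for c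
    using inv[OF p(1)] inv[OF adjoint_pair_scale[OF p(1)]] by simp
  show "invol adjointable (R \<otimes>\<^bsub>adjointable\<^esub> S) = invol adjointable S \<otimes>\<^bsub>adjointable\<^esub> invol adjointable R"
    using inv[OF p(1)] inv[OF p(2)] inv[OF adjoint_pair_mult(1)[OF p(1,2)]] by simp
  show "nrm adjointable (R \<otimes>\<^bsub>adjointable\<^esub> S) \<le> nrm adjointable R * nrm adjointable S"
    using opnorm_mult_le[OF p(1,2)] by simp
  show "nrm adjointable (invol adjointable R \<otimes>\<^bsub>adjointable\<^esub> R) = (nrm adjointable R)\<^sup>2"
    using opnorm_star[OF p(1)] inv[OF p(1)] by simp
  show "0 \<le> nrm adjointable R" "nrm adjointable R = 0 \<longleftrightarrow> R = \<zero>\<^bsub>adjointable\<^esub>"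
    "nrm adjointable (R \<oplus>\<^bsub>adjointable\<^esub> S) \<le> nrm adjointable R + nrm adjointable S"
    "nrm adjointable (c \<odot>\<^bsub>adjointable\<^esub> R) = cmod c * nrm adjointable R" for c
    by (intro N.n_nonneg N.n_eq_0 N.n_triangle N.n_smult adjointableI[OF p(1)] adjointableI[OF p(2)])+
qed

lemma star_hom_bounded_operators:
  assumes "star_hom A adjointable f"
  shows "star_hom A (bounded_operators H) f"
  using assms adjoint_pairD(1)
  by (auto simp: star_hom_def adjointable_def bounded_operators_def Pi_iff)

end

section \<open>Square-integrable functions\<close>

definition ae_class :: "'x measure \<Rightarrow> ('x \<Rightarrow> complex) \<Rightarrow> ('x \<Rightarrow> complex) set" where
  "ae_class M f = ae_rel M `` {f}"

lemma square_integrableD: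
  assumes "f \<in> square_integrable M"
  shows "f \<in> borel_measurable M" "integrable M (\<lambda>x. (cmod (f x))\<^sup>2)"
  using assms by (auto simp: square_integrable_def)

lemma square_integrable_bound:
  assumes f: "f \<in> borel_measurable M" and g: "integrable M g" and le: "AE x in M. (cmod (f x))\<^sup>2 \<le> g x"
  shows "f \<in> square_integrable M"
proof -
  have "integrable M (\<lambda>x. (cmod (f x))\<^sup>2)"
    using f le by (intro Bochner_Integration.integrable_bound[OF g]) (auto elim: eventually_mono)
  then show ?thesis using f by (simp add: square_integrable_def)
qed

lemma square_integrable_zero: "(\<lambda>_. 0) \<in> square_integrable M"
  by (simp add: square_integrable_def)

lemma cmod_add_square_le: "(cmod (a + b))\<^sup>2 \<le> 2 * (cmod a)\<^sup>2 + 2 * (cmod b)\<^sup>2"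
proof -
  have "(cmod (a + b))\<^sup>2 \<le> (cmod a + cmod b)\<^sup>2"
    by (intro power_mono norm_triangle_ineq) simp
  also have "\<dots> \<le> 2 * (cmod a)\<^sup>2 + 2 * (cmod b)\<^sup>2"
    using sum_squares_bound[of "cmod a" "cmod b"] by (simp add: power2_sum)
  finally show ?thesis .
qed

lemma square_integrable_add:
  assumes f: "f \<in> square_integrable M" and g: "g \<in> square_integrable M"
  shows "(\<lambda>x. f x + g x) \<in> square_integrable M"
  by (rule square_integrable_bound[of _ _ "\<lambda>x. 2 * (cmod (f x))\<^sup>2 + 2 * (cmod (g x))\<^sup>2"])
    (use square_integrableD[OF f] square_integrableD[OF g] in \<open>auto intro: cmod_add_square_le\<close>)

lemma square_integrable_scale:
  assumes f: "f \<in> square_integrable M"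
  shows "(\<lambda>x. c * f x) \<in> square_integrable M"
  using square_integrableD[OF f] by (auto simp: square_integrable_def norm_mult power_mult_distrib)

lemma square_integrable_diff:
  assumes "f \<in> square_integrable M" "g \<in> square_integrable M"
  shows "(\<lambda>x. f x - g x) \<in> square_integrable M"
  using square_integrable_add[OF assms(1) square_integrable_scale[OF assms(2), of "-1"]] by simp

lemma measurable_cnj [measurable]: "cnj \<in> borel_measurable borel"
  by (intro borel_measurable_continuous_onI continuous_intros)

lemma integrable_mult_cnj:
  assumes f: "f \<in> square_integrable M" and g: "g \<in> square_integrable M"
  shows "integrable M (\<lambda>x. f x * cnj (g x))"
proof (rule Bochner_Integration.integrable_bound)
  note fD = square_integrableD[OF f] and gD = square_integrableD[OF g]
  show "integrable M (\<lambda>x. (cmod (f x))\<^sup>2 + (cmod (g x))\<^sup>2)" using fD gD by simp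
  note [measurable] = fD(1) gD(1)
  show "(\<lambda>x. f x * cnj (g x)) \<in> borel_measurable M" by measurable
  have "cmod a * cmod b \<le> (cmod a)\<^sup>2 + (cmod b)\<^sup>2" for a b
  proof -
    have "0 \<le> cmod a * cmod b" by simp
    then show ?thesis using sum_squares_bound[of "cmod a" "cmod b"] by linarith
  qed
  then show "AE x in M. norm (f x * cnj (g x)) \<le> norm ((cmod (f x))\<^sup>2 + (cmod (g x))\<^sup>2)"
    by (simp add: norm_mult)
qed

lemma ae_class_iff:
  assumes "f \<in> square_integrable M"
  shows "g \<in> ae_class M f \<longleftrightarrow> g \<in> square_integrable M \<and> (AE x in M. f x = g x)"
  using assms by (auto simp: ae_class_def ae_rel_def)

lemma ae_class_eq_iff:
  assumes f: "f \<in> square_integrable M" and g: "g \<in> square_integrable M"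
  shows "ae_class M f = ae_class M g \<longleftrightarrow> (AE x in M. f x = g x)"
proof
  assume "ae_class M f = ae_class M g"
  moreover have "g \<in> ae_class M g" using g by (simp add: ae_class_iff)
  ultimately show "AE x in M. f x = g x" using ae_class_iff[OF f, of g] by simp
next
  assume ae: "AE x in M. f x = g x"
  have "(AE x in M. f x = h x) \<longleftrightarrow> (AE x in M. g x = h x)" for h
    using ae by (auto elim: eventually_elim2)
  then show "ae_class M f = ae_class M g"
    by (auto simp: ae_class_iff[OF f] ae_class_iff[OF g])
qed

section \<open>Classes of square-integrable functions as an inner product space\<close>

lemma L2_carrier: "carrier (L2 M) = ae_class M ` square_integrable M"
  by (auto simp: L2_def quotient_def ae_class_def)

lemma ae_class_mem: "f \<in> square_integrable M \<Longrightarrow> ae_class M f \<in> carrier (L2 M)"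
  by (auto simp: L2_carrier)

text \<open>The operations of \<open>L2\<close> are unions over all representatives; they collapse
  to one value once it is known not to depend on the representative.\<close>

lemma UN_constant_eq: "x \<in> I \<Longrightarrow> (\<And>y. y \<in> I \<Longrightarrow> B y = C) \<Longrightarrow> (\<Union>y\<in>I. B y) = C"
  by auto

lemma ae_class_self: "f \<in> square_integrable M \<Longrightarrow> f \<in> ae_class M f"
  by (simp add: ae_class_iff)

lemma L2_zero: "zero (L2 M) = ae_class M (\<lambda>_. 0)"
  by (simp add: L2_def ae_class_def)

lemma L2_add:
  assumes f: "f \<in> square_integrable M" and g: "g \<in> square_integrable M"
  shows "ae_class M f \<oplus>\<^bsub>L2 M\<^esub> ae_class M g = ae_class M (\<lambda>x. f x + g x)"
proof -
  have "(\<Union>f'\<in>ae_class M f. \<Union>g'\<in>ae_class M g. ae_class M (\<lambda>x. f' x + g' x)) =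
    ae_class M (\<lambda>x. f x + g x)"
  proof (intro UN_constant_eq[OF ae_class_self[OF f]] UN_constant_eq[OF ae_class_self[OF g]])
    fix f' g' assume "f' \<in> ae_class M f" "g' \<in> ae_class M g"
    then have *: "f' \<in> square_integrable M" "AE x in M. f x = f' x" "g' \<in> square_integrable M" "AE x in M. g x = g' x"
      by (auto simp: ae_class_iff f g)
    have "AE x in M. f' x + g' x = f x + g x" using *(2,4) by eventually_elim simp
    then show "ae_class M (\<lambda>x. f' x + g' x) = ae_class M (\<lambda>x. f x + g x)"
      using * f g by (subst ae_class_eq_iff) (auto intro: square_integrable_add)
  qed
  then show ?thesis by (simp add: L2_def ae_class_def)
qed

lemma L2_scale:
  assumes f: "f \<in> square_integrable M"
  shows "c \<odot>\<^bsub>L2 M\<^esub> ae_class M f = ae_class M (\<lambda>x. c * f x)"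
proof -
  have "(\<Union>f'\<in>ae_class M f. ae_class M (\<lambda>x. c * f' x)) = ae_class M (\<lambda>x. c * f x)"
  proof (intro UN_constant_eq[OF ae_class_self[OF f]])
    fix f' assume "f' \<in> ae_class M f"
    then have *: "f' \<in> square_integrable M" "AE x in M. f x = f' x"
      by (auto simp: ae_class_iff f)
    have "AE x in M. c * f' x = c * f x" using *(2) by eventually_elim simp
    then show "ae_class M (\<lambda>x. c * f' x) = ae_class M (\<lambda>x. c * f x)"
      using * f by (subst ae_class_eq_iff) (auto intro: square_integrable_scale)
  qed
  then show ?thesis by (simp add: L2_def ae_class_def)
qed

lemma L2_ip:
  assumes f: "f \<in> square_integrable M" and g: "g \<in> square_integrable M"
  shows "ip (L2 M) (ae_class M f) (ae_class M g) = (LINT x|M. f x * cnj (g x))"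
proof -
  have "(\<Union>f'\<in>ae_class M f. \<Union>g'\<in>ae_class M g. {LINT x|M. f' x * cnj (g' x)}) =
    {LINT x|M. f x * cnj (g x)}"
  proof (intro UN_constant_eq[OF ae_class_self[OF f]] UN_constant_eq[OF ae_class_self[OF g]])
    fix f' g' assume "f' \<in> ae_class M f" "g' \<in> ae_class M g"
    then have *: "f' \<in> square_integrable M" "AE x in M. f x = f' x" "g' \<in> square_integrable M" "AE x in M. g x = g' x"
      by (auto simp: ae_class_iff f g)
    have ae: "AE x in M. f' x * cnj (g' x) = f x * cnj (g x)" using *(2,4) by eventually_elim simp
    have "(LINT x|M. f' x * cnj (g' x)) = (LINT x|M. f x * cnj (g x))"
      using * f g square_integrableD(1) by (intro integral_cong_AE ae) (auto dest!: square_integrableD(1))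
    then show "{LINT x|M. f' x * cnj (g' x)} = {LINT x|M. f x * cnj (g x)}" by simp
  qed
  then show ?thesis by (simp add: L2_def)
qed

lemma L2_module: "module (ring_of_type_algebra :: complex ring) (L2 M)"
proof (rule moduleI[OF ring_of_type_algebra_cring])
  note [simp] = L2_add L2_scale square_integrable_add square_integrable_scale square_integrable_zero L2_zero
  show "abelian_group (L2 M)"
  proof (rule abelian_groupI)
    fix F assume "F \<in> carrier (L2 M)"
    then obtain f where f: "f \<in> square_integrable M" "F = ae_class M f" by (auto simp: L2_carrier)
    show "\<exists>G\<in>carrier (L2 M). G \<oplus>\<^bsub>L2 M\<^esub> F = \<zero>\<^bsub>L2 M\<^esub>"
      using f square_integrable_scale[OF f(1), of "-1"]
      by (intro bexI[of _ "ae_class M (\<lambda>x. (-1) * f x)"]) (auto simp: ae_class_mem)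
  qed (auto simp: L2_carrier algebra_simps)
qed (auto simp: L2_carrier algebra_simps L2_add L2_scale square_integrable_add square_integrable_scale)

lemma L2_minus:
  assumes "f \<in> square_integrable M" "g \<in> square_integrable M"
  shows "ae_class M f \<ominus>\<^bsub>L2 M\<^esub> ae_class M g = ae_class M (\<lambda>x. f x - g x)"
proof -
  interpret complex_module "L2 M" by (rule complex_module.intro[OF L2_module])
  show ?thesis
    using assms square_integrable_scale[OF assms(2), of "-1"]
    by (simp add: minus_scale ae_class_mem L2_scale L2_add)
qed

lemma L2_norm:
  assumes f: "f \<in> square_integrable M"
  shows "(ip_norm (L2 M) (ae_class M f))\<^sup>2 = (LINT x|M. (cmod (f x))\<^sup>2)"
    "0 \<le> ip_norm (L2 M) (ae_class M f)"
    "(\<integral>\<^sup>+ x. ennreal ((cmod (f x))\<^sup>2) \<partial>M) = ennreal ((ip_norm (L2 M) (ae_class M f))\<^sup>2)"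
proof -
  have "ip (L2 M) (ae_class M f) (ae_class M f) = (LINT x|M. complex_of_real ((cmod (f x))\<^sup>2))"
    unfolding L2_ip[OF f f] by (rule Bochner_Integration.integral_cong) (simp_all only: complex_norm_square)
  also have "\<dots> = of_real (LINT x|M. (cmod (f x))\<^sup>2)" by (rule integral_complex_of_real)
  finally have "ip (L2 M) (ae_class M f) (ae_class M f) = of_real (LINT x|M. (cmod (f x))\<^sup>2)" .
  then show n: "(ip_norm (L2 M) (ae_class M f))\<^sup>2 = (LINT x|M. (cmod (f x))\<^sup>2)"
    and "0 \<le> ip_norm (L2 M) (ae_class M f)"
    by (simp_all add: ip_norm_def)
  show "(\<integral>\<^sup>+ x. ennreal ((cmod (f x))\<^sup>2) \<partial>M) = ennreal ((ip_norm (L2 M) (ae_class M f))\<^sup>2)"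
    unfolding n by (rule nn_integral_eq_integral[OF square_integrableD(2)[OF f]]) simp
qed

text \<open>Riesz--Fischer. On a probability space \<open>|h| \<le> 2\<^sup>k |h|\<^sup>2 + 2\<^sup>-\<^sup>k\<close> turns \<open>L\<^sup>2\<close>-smallness of the
  increments of a rapidly converging subsequence into almost sure summability.\<close>

lemma (in prob_space) AE_convergent_of_L2_increments:
  assumes f: "\<And>k. f k \<in> square_integrable M"
    and le: "\<And>k. (LINT x|M. (cmod (f (Suc k) x - f k x))\<^sup>2) \<le> (1/4) ^ k"
  shows "AE x in M. convergent (\<lambda>k. f k x)"
proof -
  define h where "h k x = cmod (f (Suc k) x - f k x)" for k x
  have hm [measurable]: "h k \<in> borel_measurable M" for k
    unfolding h_def using square_integrableD(1)[OF f] by measurable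
  have hi: "integrable M (\<lambda>x. (h k x)\<^sup>2)" for k
    unfolding h_def using square_integrableD(2)[OF square_integrable_diff[OF f f]] .
  have bound: "(\<integral>\<^sup>+ x. ennreal (h k x) \<partial>M) \<le> ennreal (2 * (1/2) ^ k)" for k
  proof -
    have "a \<le> 2 ^ k * a\<^sup>2 + (1/2) ^ k" if "0 \<le> a" for a :: real
    proof -
      have "0 \<le> 2 ^ k * (a - (1/2) ^ k)\<^sup>2" by simp
      also have "\<dots> = 2 ^ k * a\<^sup>2 - 2 * a + (1/2) ^ k"
        by (simp add: power2_eq_square algebra_simps power_one_over)
      finally show ?thesis using that by simp
    qed
    then have "(\<integral>\<^sup>+ x. ennreal (h k x) \<partial>M) \<le> (\<integral>\<^sup>+ x. ennreal (2 ^ k * (h k x)\<^sup>2 + (1/2) ^ k) \<partial>M)"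
      by (intro nn_integral_mono ennreal_leI) (simp add: h_def)
    also have "\<dots> = ennreal (LINT x|M. 2 ^ k * (h k x)\<^sup>2 + (1/2) ^ k)"
      using hi by (intro nn_integral_eq_integral) auto
    also have "(LINT x|M. 2 ^ k * (h k x)\<^sup>2 + (1/2) ^ k) = 2 ^ k * (LINT x|M. (h k x)\<^sup>2) + (1/2) ^ k"
      using hi by (subst Bochner_Integration.integral_add) (auto simp: prob_space)
    also have "\<dots> \<le> 2 ^ k * (1/4) ^ k + (1/2) ^ k"
      using le[of k] by (simp add: h_def)
    also have "2 ^ k * (1/4) ^ k = (1/2 :: real) ^ k"
      by (simp flip: power_mult_distrib)
    finally show ?thesis by (simp add: ennreal_leI)
  qed
  have sm: "summable (\<lambda>k. 2 * (1/2 :: real) ^ k)" by (intro summable_mult summable_geometric) simp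
  have "(\<integral>\<^sup>+ x. (\<Sum>k. ennreal (h k x)) \<partial>M) = (\<Sum>k. \<integral>\<^sup>+ x. ennreal (h k x) \<partial>M)"
    by (rule nn_integral_suminf) simp
  also have "\<dots> \<le> (\<Sum>k. ennreal (2 * (1/2) ^ k))"
    by (intro suminf_le bound) auto
  also have "\<dots> = ennreal (\<Sum>k. 2 * (1/2) ^ k)"
    using sm by (intro suminf_ennreal2) auto
  also have "\<dots> < \<infinity>" by simp
  finally have "AE x in M. (\<Sum>k. ennreal (h k x)) \<noteq> \<infinity>"
    by (intro nn_integral_PInf_AE) auto
  then show ?thesis
  proof eventually_elim
    case (elim x)
    then have "summable (\<lambda>k. h k x)"
      by (intro summable_suminf_not_top) (auto simp: h_def)
    then have "summable (\<lambda>k. f (Suc k) x - f k x)"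
      unfolding h_def by (rule summable_norm_cancel)
    then have "convergent (\<lambda>n. \<Sum>k<n. f (Suc k) x - f k x)"
      by (simp add: summable_iff_convergent)
    then have "convergent (\<lambda>n. (f n x - f 0 x) + f 0 x)"
      using sum_lessThan_telescope[of "\<lambda>k. f k x"] by (intro convergent_add) (simp_all add: convergent_const)
    then show ?case by simp
  qed
qed

text \<open>A subsequence with geometrically small increments converges almost everywhere. Fatou's
  lemma bounds the distance of \<open>f n\<close> to its limit by the distances to the subsequence,
  which the Cauchy property controls.\<close>

lemma (in prob_space) L2_complete:
  assumes f: "\<And>n. f n \<in> square_integrable M"
    and cau: "\<And>e. 0 < e \<Longrightarrow> \<exists>N. \<forall>m n. N \<le> m \<longrightarrow> N \<le> n \<longrightarrow> ip_norm (L2 M) (ae_class M (\<lambda>x. f m x - f n x)) < e"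
  shows "\<exists>g\<in>square_integrable M. (\<lambda>n. ip_norm (L2 M) (ae_class M (\<lambda>x. f n x - g x))) \<longlonglongrightarrow> 0"
proof -
  note fm [measurable] = square_integrableD(1)[OF f]
  let ?d = "\<lambda>m n. ip_norm (L2 M) (ae_class M (\<lambda>x. f m x - f n x))"
  have "\<exists>N. \<forall>m n. N \<le> m \<longrightarrow> N \<le> n \<longrightarrow> ?d m n < (1/2) ^ k" for k
    by (rule cau) simp
  then obtain N where N: "\<And>k m n. N k \<le> m \<Longrightarrow> N k \<le> n \<Longrightarrow> ?d m n < (1/2) ^ k" by metis
  \<comment> \<open>The sum over \<open>j \<le> k\<close> makes \<open>r\<close> monotone and at
    least \<open>N k\<close>; the summand \<open>k\<close> makes it unbounded.\<close>
  define r where "r k = (\<Sum>j\<le>k. N j) + k" for k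
  have rN: "N k \<le> r k" for k
    unfolding r_def by (intro trans_le_add1 member_le_sum) auto
  have rS: "r k \<le> r (Suc k)" for k by (simp add: r_def)
  have rk: "k \<le> r k" for k by (simp add: r_def)
  have conv: "AE x in M. convergent (\<lambda>k. f (r k) x)"
  proof (rule AE_convergent_of_L2_increments[OF f])
    fix k
    have "?d (r (Suc k)) (r k) < (1/2) ^ k" using rN[of k] rS[of k] by (intro N) auto
    then have "(?d (r (Suc k)) (r k))\<^sup>2 \<le> ((1/2) ^ k)\<^sup>2"
      using L2_norm(2)[OF square_integrable_diff[OF f f]] by (intro power_mono) auto
    also have "((1/2 :: real) ^ k)\<^sup>2 = (1/4) ^ k"
      by (simp add: power2_eq_square flip: power_mult_distrib)
    finally show "(LINT x|M. (cmod (f (r (Suc k)) x - f (r k) x))\<^sup>2) \<le> (1/4) ^ k"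
      by (simp add: L2_norm(1)[OF square_integrable_diff[OF f f]])
  qed
  \<comment> \<open>Where the subsequence diverges, on a null set, \<open>lim\<close> takes an
    unspecified value; \<open>g\<close> is measurable all the same.\<close>
  define g where "g x = lim (\<lambda>k. f (r k) x)" for x
  have gm [measurable]: "g \<in> borel_measurable M"
    unfolding g_def by measurable
  have fatou: "(\<integral>\<^sup>+ x. ennreal ((cmod (f n x - g x))\<^sup>2) \<partial>M) \<le> ennreal (e\<^sup>2)"
    if e: "\<forall>\<^sub>F k in sequentially. ?d n (r k) \<le> e" for n e
  proof -
    have "(\<integral>\<^sup>+ x. ennreal ((cmod (f n x - g x))\<^sup>2) \<partial>M) =
      (\<integral>\<^sup>+ x. liminf (\<lambda>k. ennreal ((cmod (f n x - f (r k) x))\<^sup>2)) \<partial>M)"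
    proof (rule nn_integral_cong_AE)
      show "AE x in M. ennreal ((cmod (f n x - g x))\<^sup>2) = liminf (\<lambda>k. ennreal ((cmod (f n x - f (r k) x))\<^sup>2))"
        using conv
      proof eventually_elim
        case (elim x)
        then have "(\<lambda>k. f (r k) x) \<longlonglongrightarrow> g x" by (simp add: g_def convergent_LIMSEQ_iff)
        then have "(\<lambda>k. ennreal ((cmod (f n x - f (r k) x))\<^sup>2)) \<longlonglongrightarrow> ennreal ((cmod (f n x - g x))\<^sup>2)"
          by (intro tendsto_intros)
        then show ?case by (intro lim_imp_Liminf[symmetric]) auto
      qed
    qed
    also have "\<dots> \<le> liminf (\<lambda>k. \<integral>\<^sup>+ x. ennreal ((cmod (f n x - f (r k) x))\<^sup>2) \<partial>M)"
      by (rule nn_integral_liminf) simp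
    also have "\<dots> = liminf (\<lambda>k. ennreal ((?d n (r k))\<^sup>2))"
      by (simp add: L2_norm(3)[OF square_integrable_diff[OF f f]])
    also have "\<dots> \<le> limsup (\<lambda>k. ennreal ((?d n (r k))\<^sup>2))"
      by (rule Liminf_le_Limsup) simp
    also have "\<dots> \<le> ennreal (e\<^sup>2)"
    proof (rule Limsup_bounded)
      show "\<forall>\<^sub>F k in sequentially. ennreal ((?d n (r k))\<^sup>2) \<le> ennreal (e\<^sup>2)"
        using e by eventually_elim
          (auto intro!: ennreal_leI power_mono L2_norm(2) square_integrable_diff f)
    qed
    finally show ?thesis .
  qed
  have dsq: "(\<lambda>x. f n x - g x) \<in> square_integrable M"
    if "\<forall>\<^sub>F k in sequentially. ?d n (r k) \<le> e" for n e
  proof -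
    have "integrable M (\<lambda>x. (cmod (f n x - g x))\<^sup>2)"
    proof (rule integrableI_nonneg)
      show "(\<integral>\<^sup>+ x. ennreal ((cmod (f n x - g x))\<^sup>2) \<partial>M) < \<infinity>"
        using fatou[OF that] by (auto intro: le_less_trans)
    qed auto
    then show ?thesis by (simp add: square_integrable_def)
  qed
  have ev: "\<exists>N. \<forall>n\<ge>N. \<forall>\<^sub>F k in sequentially. ?d n (r k) \<le> e" if e: "0 < e" for e
  proof -
    obtain N where N: "\<And>m n. N \<le> m \<Longrightarrow> N \<le> n \<Longrightarrow> ?d m n < e" using cau[OF e] by blast
    have "\<forall>\<^sub>F k in sequentially. ?d n (r k) \<le> e" if n: "N \<le> n" for n
      using eventually_ge_at_top[of N]
    proof eventually_elim
      case (elim k)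
      then show ?case using N[OF n, of "r k"] rk[of k] by simp
    qed
    then show ?thesis by blast
  qed
  obtain N1 where N1: "\<And>n. N1 \<le> n \<Longrightarrow> \<forall>\<^sub>F k in sequentially. ?d n (r k) \<le> 1"
    using ev[of 1] by auto
  \<comment> \<open>\<open>g\<close> is \<open>f N1\<close> minus the difference
    \<open>f N1 - g\<close>, which is square-integrable by the Fatou bound.\<close>
  have g: "g \<in> square_integrable M"
    using square_integrable_diff[OF f[of N1] dsq[OF N1[OF order_refl]]] by simp
  have "(\<lambda>n. ip_norm (L2 M) (ae_class M (\<lambda>x. f n x - g x))) \<longlonglongrightarrow> 0"
  proof (rule LIMSEQ_I)
    fix e :: real assume e: "0 < e"
    obtain N where N: "\<And>n. N \<le> n \<Longrightarrow> \<forall>\<^sub>F k in sequentially. ?d n (r k) \<le> e / 2"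
      using ev[of "e / 2"] e by auto
    have "norm (ip_norm (L2 M) (ae_class M (\<lambda>x. f n x - g x)) - 0) < e" if n: "N \<le> n" for n
    proof -
      note sq = square_integrable_diff[OF f[of n] g]
      have "ennreal ((ip_norm (L2 M) (ae_class M (\<lambda>x. f n x - g x)))\<^sup>2) \<le> ennreal ((e / 2)\<^sup>2)"
        using fatou[OF N[OF n]] by (simp add: L2_norm(3)[OF sq])
      then have "(ip_norm (L2 M) (ae_class M (\<lambda>x. f n x - g x)))\<^sup>2 \<le> (e / 2)\<^sup>2"
        by (simp add: ennreal_le_iff)
      then have "ip_norm (L2 M) (ae_class M (\<lambda>x. f n x - g x)) \<le> e / 2"
        by (rule power2_le_imp_le) (use e in simp)
      then show ?thesis using e L2_norm(2)[OF sq] by simp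
    qed
    then show "\<exists>no. \<forall>n\<ge>no. norm (ip_norm (L2 M) (ae_class M (\<lambda>x. f n x - g x)) - 0) < e" by blast
  qed
  then show ?thesis using g by blast
qed

theorem (in prob_space) hilbert_space_L2: "hilbert_space (L2 M)"
proof (intro hilbert_space.intro complex_module.intro L2_module hilbert_space_axioms.intro)
  fix F G K assume FG: "F \<in> carrier (L2 M)" "G \<in> carrier (L2 M)"
  then obtain f g where fg: "f \<in> square_integrable M" "F = ae_class M f" "g \<in> square_integrable M" "G = ae_class M g"
    by (auto simp: L2_carrier)
  show "ip (L2 M) (F \<oplus>\<^bsub>L2 M\<^esub> G) K = ip (L2 M) F K + ip (L2 M) G K" if "K \<in> carrier (L2 M)"
  proof -
    obtain k where k: "k \<in> square_integrable M" "K = ae_class M k" using \<open>K \<in> _\<close> by (auto simp: L2_carrier)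
    show ?thesis
      using integrable_mult_cnj[OF fg(1) k(1)] integrable_mult_cnj[OF fg(3) k(1)]
      by (simp add: fg k L2_add L2_ip square_integrable_add distrib_right)
  qed
  show "ip (L2 M) (c \<odot>\<^bsub>L2 M\<^esub> F) G = c * ip (L2 M) F G" for c
    by (simp add: fg L2_scale L2_ip square_integrable_scale mult.assoc)
  have "cnj (LINT x|M. f x * cnj (g x)) = (LINT x|M. cnj (f x * cnj (g x)))"
    by (rule Bochner_Integration.integral_cnj[symmetric])
  then show "cnj (ip (L2 M) F G) = ip (L2 M) G F"
    by (simp add: fg L2_ip mult.commute)
  have self: "ip (L2 M) F F = of_real (LINT x|M. (cmod (f x))\<^sup>2)"
  proof -
    have "ip (L2 M) F F = (LINT x|M. complex_of_real ((cmod (f x))\<^sup>2))"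
      unfolding fg L2_ip[OF fg(1) fg(1)]
      by (rule Bochner_Integration.integral_cong) (simp_all only: complex_norm_square)
    then show ?thesis by (simp only: integral_complex_of_real)
  qed
  show "0 \<le> Re (ip (L2 M) F F)" by (simp add: self)
  show "F = \<zero>\<^bsub>L2 M\<^esub>" if "ip (L2 M) F F = 0"
  proof -
    have "(LINT x|M. (cmod (f x))\<^sup>2) = 0" using that by (simp add: self)
    then have "AE x in M. (cmod (f x))\<^sup>2 = 0"
      using integral_nonneg_eq_0_iff_AE[OF square_integrableD(2)[OF fg(1)]] by simp
    then have "AE x in M. f x = 0" by eventually_elim simp
    then show ?thesis
      by (simp add: fg L2_zero ae_class_eq_iff square_integrable_zero)
  qed
next
  fix u :: "nat \<Rightarrow> ('a \<Rightarrow> complex) set" assume u: "range u \<subseteq> carrier (L2 M)"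
    and cau: "\<And>e. 0 < e \<Longrightarrow> \<exists>N. \<forall>m n. N \<le> m \<longrightarrow> N \<le> n \<longrightarrow> ip_norm (L2 M) (u m \<ominus>\<^bsub>L2 M\<^esub> u n) < e"
  have "\<forall>n. \<exists>f. f \<in> square_integrable M \<and> u n = ae_class M f"
    using u by (auto simp: L2_carrier image_subset_iff image_iff Bex_def)
  from choice[OF this] obtain f where "\<forall>n. f n \<in> square_integrable M \<and> u n = ae_class M (f n)" ..
  then have f: "f n \<in> square_integrable M" "u n = ae_class M (f n)" for n by simp_all
  have diff: "u m \<ominus>\<^bsub>L2 M\<^esub> u n = ae_class M (\<lambda>x. f m x - f n x)" for m n
    unfolding f(2) by (rule L2_minus[OF f(1) f(1)])
  have cau': "\<exists>N. \<forall>m n. N \<le> m \<longrightarrow> N \<le> n \<longrightarrow> ip_norm (L2 M) (ae_class M (\<lambda>x. f m x - f n x)) < e"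
    if "0 < e" for e
    using cau[OF that] unfolding diff .
  obtain g where g: "g \<in> square_integrable M"
    "(\<lambda>n. ip_norm (L2 M) (ae_class M (\<lambda>x. f n x - g x))) \<longlonglongrightarrow> 0"
    using bexE[OF L2_complete[of f, OF f(1) cau']] by blast
  then show "\<exists>l\<in>carrier (L2 M). (\<lambda>n. ip_norm (L2 M) (u n \<ominus>\<^bsub>L2 M\<^esub> l)) \<longlonglongrightarrow> 0"
    by (intro bexI[of _ "ae_class M g"]) (auto simp: f L2_minus ae_class_mem)
qed

section \<open>Infinite paths\<close>

lemma mor_Omega [simp]: "(p, q) \<in> mor Omega \<longleftrightarrow> p \<le> q"
  by (simp add: Omega_def)

context kgraph
begin

text \<open>Composing \<open>l\<close> with its range on the left or its source on the right gives
  two factorizations of \<open>l\<close> with first factor of degree 0; uniqueness identifies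
  them.\<close>

lemma deg_zero_vertex:
  assumes l: "l \<in> mor L" and d: "deg L l = 0"
  shows "l \<in> vertices L"
proof -
  have "rng L l = l \<and> l = src L l"
  proof (rule factorization_unique)
    show "cmp L (rng L l) l = cmp L l (src L l)"
      using l by (simp add: comp_id_left comp_id_right)
    show "deg L (rng L l) = deg L l"
      using l d by (simp add: deg_vertex rng_vertex)
  qed (use l in \<open>auto simp: rng_mor src_mor rng_src vertex_src rng_vertex\<close>)
  then show ?thesis using l by (simp add: vertices_def)
qed

lemma comp_left_cancel:
  assumes "cmp L m n = cmp L m n'" "m \<in> mor L" "n \<in> mor L" "n' \<in> mor L" "src L m = rng L n" "src L m = rng L n'"
  shows "n = n'"
  using factorization_unique[OF assms(2,3,5,2,4,6,1)] by simp

text \<open>Describes the families that are initial segments \<open>x (0, q)\<close> of an infinite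
  path; \<open>path_of\<close> recovers \<open>x (p, q)\<close> as the unique morphism completing
  \<open>y p\<close> to \<open>y q\<close>.\<close>

definition consistent :: "(nat ^ 'k \<Rightarrow> 'a) \<Rightarrow> bool" where
  "consistent y \<longleftrightarrow> (\<forall>q. y q \<in> mor L \<and> deg L (y q) = q) \<and>
     (\<forall>p q. p \<le> q \<longrightarrow> (\<exists>w\<in>mor L. src L (y p) = rng L w \<and> y q = cmp L (y p) w))"

definition path_of :: "(nat ^ 'k \<Rightarrow> 'a) \<Rightarrow> (nat ^ 'k) \<times> (nat ^ 'k) \<Rightarrow> 'a" where
  "path_of y = restrict (\<lambda>(p, q). SOME w. w \<in> mor L \<and> src L (y p) = rng L w \<and> y q = cmp L (y p) w) (mor Omega)"

lemma path_of:
  assumes y: "consistent y"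
  shows "path_of y \<in> infinite_paths L" "path_of y (0, q) = y q"
proof -
  let ?x = "path_of y"
  have ym: "y q \<in> mor L" "deg L (y q) = q" for q using y by (simp_all add: consistent_def)
  have x: "?x (p, q) \<in> mor L \<and> src L (y p) = rng L (?x (p, q)) \<and> y q = cmp L (y p) (?x (p, q))"
    if "p \<le> q" for p q
  proof -
    have "\<exists>w. w \<in> mor L \<and> src L (y p) = rng L w \<and> y q = cmp L (y p) w"
      using y that unfolding consistent_def Bex_def by blast
    from someI_ex[OF this] show ?thesis using that by (simp add: path_of_def)
  qed
  have xm: "?x (p, q) \<in> mor L" and xr: "rng L (?x (p, q)) = src L (y p)"
    and xy: "y q = cmp L (y p) (?x (p, q))" if "p \<le> q" for p q
    using x[OF that] by simp_all
  have xs: "src L (?x (p, q)) = src L (y q)" if "p \<le> q" for p q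
    unfolding xy[OF that] using xm[OF that] xr[OF that] ym by (simp add: src_comp)
  have xd: "deg L (?x (p, q)) = q - p" if "p \<le> q" for p q
  proof -
    have "deg L (y q) = deg L (y p) + deg L (?x (p, q))"
      unfolding xy[OF that] using xm[OF that] xr[OF that] ym by (simp add: deg_comp)
    then show ?thesis unfolding ym by (metis vec_nat_diff_simps(1))
  qed
  have diag: "?x (p, p) = src L (y p)" for p
  proof -
    have v: "?x (p, p) \<in> vertices L"
      using xm[of p p] xd[of p p] by (intro deg_zero_vertex) auto
    then show ?thesis using xr[of p p] vertex_rng[OF v] by simp
  qed
  have comp: "?x (p, r) = cmp L (?x (p, q)) (?x (q, r))" if pq: "p \<le> q" and qr: "q \<le> r" for p q r
  proof -
    have pr: "p \<le> r" using pq qr by (rule order_trans)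
    have c: "src L (?x (p, q)) = rng L (?x (q, r))" using xs[OF pq] xr[OF qr] by simp
    have "cmp L (y p) (?x (p, r)) = y r" using xy[OF pr] by simp
    also have "\<dots> = cmp L (cmp L (y p) (?x (p, q))) (?x (q, r))"
      unfolding xy[OF pq, symmetric] by (rule xy[OF qr])
    also have "\<dots> = cmp L (y p) (cmp L (?x (p, q)) (?x (q, r)))"
      using xm[OF pq] xm[OF qr] xr[OF pq] c ym by (intro comp_assoc) auto
    finally show ?thesis
      by (rule comp_left_cancel) (simp_all add: ym xm[OF pr] xr[OF pr] xr[OF pq] comp_mor[OF xm[OF pq] xm[OF qr] c]
        rng_comp[OF xm[OF pq] xm[OF qr] c])
  qed
  have "kgraph_morphism Omega L ?x"
    unfolding kgraph_morphism_def
  proof (intro conjI ballI impI)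
    show "?x \<in> mor Omega \<rightarrow> mor L" using xm by auto
    fix a :: "(nat ^ 'k) \<times> (nat ^ 'k)" assume a: "a \<in> mor Omega"
    obtain p q where pq: "a = (p, q)" by (cases a)
    have le: "p \<le> q" using a pq by simp
    show "rng L (?x a) = ?x (rng Omega a)" "src L (?x a) = ?x (src Omega a)" "deg L (?x a) = deg Omega a"
      using xr[OF le] xs[OF le] xd[OF le] diag by (simp_all add: pq Omega_def)
    fix b :: "(nat ^ 'k) \<times> (nat ^ 'k)" assume b: "b \<in> mor Omega" "src Omega a = rng Omega b"
    obtain q' r where qr: "b = (q', r)" by (cases b)
    have "q' = q" using b(2) by (simp add: pq qr Omega_def)
    then show "?x (cmp Omega a b) = cmp L (?x a) (?x b)"
      using comp[OF le, of r] b(1) by (simp add: pq qr Omega_def)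
  qed
  then show "?x \<in> infinite_paths L"
    by (simp add: infinite_paths_def path_of_def)
  have v: "y 0 \<in> vertices L" using ym[of 0] by (intro deg_zero_vertex) auto
  have "y q = cmp L (y 0) (?x (0, q))" by (rule xy) simp
  also have "y 0 = rng L (?x (0, q))" using xr[of 0 q] vertex_src[OF v] by simp
  also have "cmp L (rng L (?x (0, q))) (?x (0, q)) = ?x (0, q)"
    by (rule comp_id_left[OF xm]) simp
  finally show "?x (0, q) = y q" by simp
qed

text \<open>The degrees above any fixed \<open>D\<close> are cofinal. The choice
  \<open>D = deg L l\<close> suits prepended paths, whose segments are given explicitly from degree
  \<open>deg L l\<close> on.\<close>

lemma infinite_path_eqI:
  assumes x: "x \<in> infinite_paths L" and z: "z \<in> infinite_paths L"
    and eq: "\<And>q. x (0, D + q) = z (0, D + q)"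
  shows "x = z"
proof (rule extensionalityI[of _ "mor Omega"])
  show "x \<in> extensional (mor Omega)" "z \<in> extensional (mor Omega)"
    using x z by (simp_all add: infinite_paths_def)
  fix a :: "(nat ^ 'k) \<times> (nat ^ 'k)" assume a: "a \<in> mor Omega"
  obtain p q where pq: "a = (p, q)" by (cases a)
  have le: "p \<le> q" using a pq by simp
  let ?N = "D + q"
  have l2: "q \<le> ?N" "p \<le> ?N" using le by (auto intro: order_trans)
  note f = infinite_path_simps[OF x] infinite_path_comp[OF x] and g = infinite_path_simps[OF z] infinite_path_comp[OF z]
  have d: "cmp L (x (0, p)) (cmp L (x (p, q)) (x (q, ?N))) = cmp L (z (0, p)) (cmp L (z (p, q)) (z (q, ?N)))"
    using eq[of q] f(5)[of 0 p ?N] g(5)[of 0 p ?N] f(5)[OF le l2(1)] g(5)[OF le l2(1)] l2 by simp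
  have "cmp L (x (p, q)) (x (q, ?N)) = cmp L (z (p, q)) (z (q, ?N))"
    using factorization_unique[OF _ _ _ _ _ _ d] f(1-4)[of 0 p] f(1-4)[OF le] f(1-4)[OF l2(1)]
      g(1-4)[of 0 p] g(1-4)[OF le] g(1-4)[OF l2(1)] by (simp add: comp_mor rng_comp)
  from factorization_unique[OF _ _ _ _ _ _ this] have "x (p, q) = z (p, q)"
    using f(1-4)[OF le] f(1-4)[OF l2(1)] g(1-4)[OF le] g(1-4)[OF l2(1)] by simp
  then show "x a = z a" by (simp add: pq)
qed

section \<open>Shifting and prepending\<close>

lemma shift_apply: "a \<le> b \<Longrightarrow> shift p x (a, b) = x (a + p, b + p)"
  by (simp add: shift_def)

lemma add_mono_right: "a \<le> b \<Longrightarrow> a + p \<le> b + (p :: nat ^ 'k)"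
  by (simp add: vec_le_iff)

lemma shift_infinite_path:
  assumes x: "x \<in> infinite_paths L"
  shows "shift p x \<in> infinite_paths L"
proof -
  note f = infinite_path_simps[OF x] infinite_path_comp[OF x]
  have "kgraph_morphism Omega L (shift p x)"
    unfolding kgraph_morphism_def
  proof (intro conjI ballI impI)
    show "shift p x \<in> mor Omega \<rightarrow> mor L"
    proof
      fix a :: "(nat ^ 'k) \<times> (nat ^ 'k)" assume "a \<in> mor Omega"
      then show "shift p x a \<in> mor L" by (cases a) (simp add: shift_apply f add_mono_right)
    qed
    fix a :: "(nat ^ 'k) \<times> (nat ^ 'k)" assume a: "a \<in> mor Omega"
    obtain m n where mn: "a = (m, n)" by (cases a)
    have le: "m \<le> n" using a mn by simp
    have dd: "n + p - (m + p) = n - m" by (simp add: Finite_Cartesian_Product.vec_eq_iff)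
    show "rng L (shift p x a) = shift p x (rng Omega a)" "src L (shift p x a) = shift p x (src Omega a)"
      "deg L (shift p x a) = deg Omega a"
      using le f(2-4)[OF add_mono_right[OF le, of p]] dd by (simp_all add: mn Omega_def shift_apply)
    fix b :: "(nat ^ 'k) \<times> (nat ^ 'k)" assume b: "b \<in> mor Omega" "src Omega a = rng Omega b"
    obtain n' r where nr: "b = (n', r)" by (cases b)
    have n': "n' = n" using b(2) by (simp add: mn nr Omega_def)
    have le2: "n \<le> r" using b(1) nr n' by simp
    show "shift p x (cmp Omega a b) = cmp L (shift p x a) (shift p x b)"
      using f(5)[OF add_mono_right[OF le] add_mono_right[OF le2], of p] le le2 order_trans[OF le le2]
      by (simp add: mn nr n' Omega_def shift_apply)
  qed
  then show ?thesis by (simp add: infinite_paths_def shift_def)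
qed

lemma shift_zero:
  assumes "x \<in> infinite_paths L"
  shows "shift 0 x = x"
  using assms unfolding infinite_paths_def shift_def
  by (intro extensionalityI[of _ "mor Omega"]) (auto simp: extensional_def)

lemma shift_shift: "shift p (shift q x) = shift (q + p :: nat ^ 'k) x"
  unfolding shift_def
  by (intro restrict_ext) (auto simp: add_mono_right add_ac)

text \<open>The segment of degree \<open>q\<close> is cut from \<open>l\<close> followed by
  \<open>x (0, q)\<close>, whose degree \<open>deg L l + q\<close> is always large enough; no
  degrees need to be subtracted.\<close>

definition prepend :: "'a \<Rightarrow> ((nat ^ 'k) \<times> (nat ^ 'k) \<Rightarrow> 'a) \<Rightarrow> (nat ^ 'k) \<times> (nat ^ 'k) \<Rightarrow> 'a" where
  "prepend l x = path_of (\<lambda>q. SOME m. m \<in> mor L \<and> deg L m = q \<and>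
     (\<exists>w\<in>mor L. src L m = rng L w \<and> cmp L l (x (0, q)) = cmp L m w))"

lemma prepend:
  assumes l: "l \<in> mor L" and x: "x \<in> infinite_paths L" and x0: "x (0, 0) = src L l"
  shows "prepend l x \<in> infinite_paths L" "prepend l x (0, deg L l + q) = cmp L l (x (0, q))"
    "prepend l x (0, deg L l) = l"
proof -
  note f = infinite_path_simps[OF x] infinite_path_comp[OF x]
  define P where "P q m \<longleftrightarrow> m \<in> mor L \<and> deg L m = q \<and>
     (\<exists>w\<in>mor L. src L m = rng L w \<and> cmp L l (x (0, q)) = cmp L m w)" for q m
  define y where "y q = (SOME m. P q m)" for q
  have lx: "cmp L l (x (0, q)) \<in> mor L" "deg L (cmp L l (x (0, q))) = deg L l + q"
    "src L (cmp L l (x (0, q))) = x (q, q)" for q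
    using l f(1-4)[of 0 q] x0 by (simp_all add: comp_mor deg_comp src_comp)
  have "\<exists>m. P q m" for q
  proof -
    have le: "q \<le> deg L (cmp L l (x (0, q)))" by (simp add: lx)
    obtain m w where "m \<in> mor L" "w \<in> mor L" "src L m = rng L w" "cmp L l (x (0, q)) = cmp L m w" "deg L m = q"
      using factor_leE[OF lx(1) le] .
    then show ?thesis unfolding P_def by blast
  qed
  then have yP: "P q (y q)" for q unfolding y_def by (rule someI_ex)
  have ext: "cmp L l (x (0, r)) = cmp L (cmp L l (x (0, q))) (x (q, r))" if "q \<le> r" for q r
    using l f(1-4)[of 0 q] f(1-4)[OF that] f(5)[of 0 q r] that x0 by (simp add: comp_assoc)
  \<comment> \<open>The segment of degree \<open>q\<close> does not depend on how far
    \<open>x\<close> is followed: reading on to \<open>r\<close> yields the same cut.\<close>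
  have uniq: "m = y q"
    if m: "m \<in> mor L" "deg L m = q" "w \<in> mor L" "src L m = rng L w" "q \<le> r"
      "cmp L l (x (0, r)) = cmp L m w" for m q w r
  proof -
    obtain w' where y: "y q \<in> mor L" "deg L (y q) = q" "w' \<in> mor L" "src L (y q) = rng L w'"
      "cmp L l (x (0, q)) = cmp L (y q) w'"
      using yP[of q] unfolding P_def by blast
    have c: "src L w' = rng L (x (q, r))"
      using y lx(3)[of q] f(3)[OF m(5)] src_comp[OF y(1,3,4)] by simp
    have "cmp L m w = cmp L (cmp L (y q) w') (x (q, r))"
      using ext[OF m(5)] m(6) y(5) by simp
    also have "\<dots> = cmp L (y q) (cmp L w' (x (q, r)))"
      using y c f(1)[OF m(5)] by (intro comp_assoc) auto
    finally show ?thesis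
      using factorization_unique[OF m(1,3,4) y(1), of "cmp L w' (x (q, r))"] m y c f(1)[OF m(5)]
      by (simp add: comp_mor rng_comp)
  qed
  have y_lx: "y (deg L l + q) = cmp L l (x (0, q))" for q
  proof (rule uniq[symmetric])
    show "deg L l + q \<le> deg L l + q" by simp
    show "cmp L l (x (0, deg L l + q)) = cmp L (cmp L l (x (0, q))) (x (q, deg L l + q))"
      by (rule ext) simp
  qed (use lx f(1)[of q "deg L l + q"] f(3)[of q "deg L l + q"] in auto)
  have "consistent y"
    unfolding consistent_def
  proof (intro conjI allI impI)
    show "y q \<in> mor L" "deg L (y q) = q" for q using yP[of q] by (simp_all add: P_def)
    fix p q :: "nat ^ 'k" assume pq: "p \<le> q"
    obtain w where y: "y q \<in> mor L" "deg L (y q) = q" "w \<in> mor L" "src L (y q) = rng L w"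
      "cmp L l (x (0, q)) = cmp L (y q) w"
      using yP[of q] unfolding P_def by blast
    have "p \<le> deg L (y q)" using pq y by simp
    then obtain m n where mn: "m \<in> mor L" "n \<in> mor L" "src L m = rng L n" "y q = cmp L m n" "deg L m = p"
      using factor_leE[OF y(1)] by blast
    have "src L n = rng L w" using y(4) mn by (simp add: src_comp)
    then have "m = y p"
      using y mn by (intro uniq[OF mn(1,5) _ _ pq, of "cmp L n w"]) (simp_all add: comp_mor rng_comp comp_assoc)
    then show "\<exists>w\<in>mor L. src L (y p) = rng L w \<and> y q = cmp L (y p) w" using mn by blast
  qed
  moreover have "prepend l x = path_of y" unfolding prepend_def y_def[abs_def] P_def ..
  ultimately have px: "prepend l x \<in> infinite_paths L" "prepend l x (0, q) = y q" for q
    using path_of by simp_all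
  show "prepend l x \<in> infinite_paths L" by (rule px)
  show "prepend l x (0, deg L l + q) = cmp L l (x (0, q))" by (simp add: px y_lx)
  show "prepend l x (0, deg L l) = l"
    using y_lx[of 0] l x0 by (simp add: px comp_id_right)
qed

section \<open>Cylinder sets\<close>

lemma cylinderD: "x \<in> cylinder L l \<Longrightarrow> x \<in> infinite_paths L" "x \<in> cylinder L l \<Longrightarrow> x (0, deg L l) = l"
  by (simp_all add: cylinder_def)

lemma cylinder_vertex: "v \<in> vertices L \<Longrightarrow> x \<in> cylinder L v \<longleftrightarrow> x \<in> infinite_paths L \<and> x (0, 0) = v"
  by (simp add: cylinder_def deg_vertex)

lemma cylinder_endpoints:
  assumes "x \<in> cylinder L l"
  shows "x (0, 0) = rng L l" "x (deg L l, deg L l) = src L l"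
  using infinite_path_simps[OF cylinderD(1)[OF assms], of 0 "deg L l"] cylinderD(2)[OF assms] by simp_all

lemma prepend_cylinder:
  assumes "l \<in> mor L" "x \<in> cylinder L (src L l)"
  shows "prepend l x \<in> cylinder L l"
  using assms prepend[of l x] by (simp add: cylinder_vertex src_vertex) (simp add: cylinder_def)

lemma shift_cylinder:
  assumes "l \<in> mor L" "x \<in> cylinder L l"
  shows "shift (deg L l) x \<in> cylinder L (src L l)"
  using assms cylinder_endpoints[OF assms(2)]
  by (simp add: cylinder_vertex src_vertex shift_infinite_path cylinderD shift_apply)

lemma prepend_shift:
  assumes l: "l \<in> mor L" and x: "x \<in> cylinder L l"
  shows "prepend l (shift (deg L l) x) = x"
proof (rule infinite_path_eqI)
  note y = shift_cylinder[OF l x, unfolded cylinder_vertex[OF src_vertex[OF l]]]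
  show "prepend l (shift (deg L l) x) \<in> infinite_paths L"
    using y by (intro prepend l) auto
  show "x \<in> infinite_paths L" by (rule cylinderD(1)[OF x])
  fix q
  have "prepend l (shift (deg L l) x) (0, deg L l + q) = cmp L l (x (deg L l, deg L l + q))"
    using prepend(2)[OF l conjunct1[OF y] conjunct2[OF y], of q] by (simp add: shift_apply add.commute)
  then show "prepend l (shift (deg L l) x) (0, deg L l + q) = x (0, deg L l + q)"
    using infinite_path_comp[OF cylinderD(1)[OF x], of 0 "deg L l" "deg L l + q"] cylinderD(2)[OF x] by simp
qed

lemma cylinder_cmp:
  assumes l: "l \<in> mor L" and m: "m \<in> mor L" and c: "src L l = rng L m"
  shows "x \<in> cylinder L (cmp L l m) \<longleftrightarrow> x \<in> cylinder L l \<and> shift (deg L l) x \<in> cylinder L m"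
proof (cases "x \<in> infinite_paths L")
  case True
  let ?p = "deg L l" and ?q = "deg L l + deg L m"
  note f = infinite_path_simps[OF True]
  have e: "x (0, ?q) = cmp L (x (0, ?p)) (x (?p, ?q))"
    by (rule infinite_path_comp[OF True]) simp_all
  have "x (0, ?q) = cmp L l m \<longleftrightarrow> x (0, ?p) = l \<and> x (?p, ?q) = m"
    using factorization_unique[of "x (0, ?p)" "x (?p, ?q)" l m] l m c f[of 0 ?p] f[of ?p ?q] e
    by auto
  then show ?thesis
    using True l m c by (simp add: cylinder_def deg_comp shift_infinite_path shift_apply add.commute)
qed (simp add: cylinder_def)

lemma shift_prepend:
  assumes l: "l \<in> mor L" and y: "y \<in> cylinder L (src L l)"
  shows "shift (deg L l) (prepend l y) = y"
proof (rule infinite_path_eqI[where D = 0])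
  note y' = y[unfolded cylinder_vertex[OF src_vertex[OF l]]]
  note p = prepend[OF l conjunct1[OF y'] conjunct2[OF y']]
  show "shift (deg L l) (prepend l y) \<in> infinite_paths L" by (rule shift_infinite_path[OF p(1)])
  show "y \<in> infinite_paths L" using y' ..
  fix q
  let ?z = "prepend l y (deg L l, deg L l + q)"
  note z = infinite_path_simps[OF p(1), of "deg L l" "deg L l + q"] and f = infinite_path_simps[OF conjunct1[OF y'], of 0 q]
  have "?z = y (0, q)"
  proof (rule comp_left_cancel[of l])
    show "cmp L l ?z = cmp L l (y (0, q))"
      using infinite_path_comp[OF p(1), of 0 "deg L l" "deg L l + q"] p(2)[of q] p(3) by simp
    show "src L l = rng L ?z"
      using z(3) infinite_path_simps(4)[OF p(1), of 0 "deg L l"] p(3) by simp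
  qed (use l z f y' in simp_all)
  then show "shift (deg L l) (prepend l y) (0, 0 + q) = y (0, 0 + q)"
    by (simp add: shift_apply add.commute)
qed

lemma prepend_cylinder_cmp:
  assumes "l \<in> mor L" "m \<in> mor L" "src L l = rng L m" "y \<in> cylinder L (src L l)"
  shows "prepend l y \<in> cylinder L (cmp L l m) \<longleftrightarrow> y \<in> cylinder L m"
  using assms by (simp add: cylinder_cmp prepend_cylinder shift_prepend)

lemma cylinder_subset_vertex:
  assumes "l \<in> mor L"
  shows "cylinder L l \<subseteq> cylinder L (rng L l)"
proof
  fix x assume x: "x \<in> cylinder L l"
  show "x \<in> cylinder L (rng L l)"
    unfolding cylinder_vertex[OF rng_vertex[OF assms]] using cylinderD(1)[OF x] cylinder_endpoints(1)[OF x] ..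
qed

lemma ex1_cylinder:
  assumes x: "x \<in> infinite_paths L"
  shows "l \<in> mor L \<and> deg L l = n \<and> x \<in> cylinder L l \<longleftrightarrow> l = x (0, n)"
  using x infinite_path_simps[OF x, of 0 n] by (auto simp: cylinder_def)

end

section \<open>The Perron-Frobenius measure\<close>

text \<open>\<open>c n\<close> stands for the inverse of \<open>spectral_radius_power L n\<close>
  and \<open>e\<close> for the Perron-Frobenius vector.\<close>

locale path_measure = kgraph L + prob_space M
  for L :: "('a, 'k::finite) kgraph" and M :: "('a, 'k) path measure" +
  fixes c :: "nat ^ 'k \<Rightarrow> real" and e :: "'a \<Rightarrow> real"
  assumes finite: "finite_kgraph L"
    and space: "space M = infinite_paths L"
    and sets: "sets M = sigma_sets (infinite_paths L) {U. openin (path_topology L) U}"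
    and cylinder_measure: "l \<in> mor L \<Longrightarrow> measure M (cylinder L l) = c (deg L l) * e (src L l)"
    and c_pos: "0 < c n" and c_zero: "c 0 = 1" and c_add: "c (m + n) = c m * c n"
    and e_pos: "v \<in> vertices L \<Longrightarrow> 0 < e v"
begin

text \<open>Cylinders around a fixed path shrink as the degree grows, and \<open>m + n\<close> is
  above both \<open>m\<close> and \<open>n\<close>; hence the cylinders form a basis and not merely
  a subbasis.\<close>

lemma open_contains_cylinder:
  assumes "openin (path_topology L) U"
  shows "U \<subseteq> infinite_paths L \<and> (\<forall>x\<in>U. \<exists>n. cylinder L (x (0, n)) \<subseteq> U)"
proof -
  have "generate_topology_on (cylinder L ` mor L) U"
    using assms by (simp add: path_topology_def openin_topology_generated_by_iff)
  then show ?thesis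
  proof induction
    case (Int U V)
    have "\<exists>n. cylinder L (x (0, n)) \<subseteq> U \<inter> V" if x: "x \<in> U \<inter> V" for x
    proof -
      have xi: "x \<in> infinite_paths L" using x Int.IH by blast
      have sub: "cylinder L (x (0, m + n)) \<subseteq> cylinder L (x (0, m))" for m n
      proof
        fix z assume z: "z \<in> cylinder L (x (0, m + n))"
        have e: "x (0, m + n) = cmp L (x (0, m)) (x (m, m + n))"
          by (rule infinite_path_comp[OF xi]) simp_all
        show "z \<in> cylinder L (x (0, m))"
          using z cylinder_cmp[of "x (0, m)" "x (m, m + n)" z] infinite_path_simps[OF xi, of 0 m]
            infinite_path_simps[OF xi, of m "m + n"] by (simp add: e)
      qed
      obtain m n where "cylinder L (x (0, m)) \<subseteq> U" "cylinder L (x (0, n)) \<subseteq> V" using Int.IH x by blast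
      then show ?thesis using sub[of m n] sub[of n m] by (intro exI[of _ "m + n"]) (auto simp: add.commute)
    qed
    then show ?case using Int.IH by blast
  next
    case (UN K)
    then show ?case by (meson Sup_least Union_iff Union_upper order_trans)
  next
    case (Basis U)
    then obtain l where l: "l \<in> mor L" "U = cylinder L l" by blast
    then show ?case by (auto simp: cylinderD intro!: exI[of _ "deg L l"])
  qed simp
qed

lemma cylinder_sets [measurable, simp]: "l \<in> mor L \<Longrightarrow> cylinder L l \<in> sets M"
  unfolding sets path_topology_def
  by (intro sigma_sets.Basic) (simp add: topology_generated_by_Basis)

lemma prefix_eq_UN: "{x \<in> space M. P (x (0, n))} = (\<Union>l\<in>{l \<in> mor L. deg L l = n \<and> P l}. cylinder L l)"
  using infinite_path_simps[of _ 0 n] by (auto simp: space cylinder_def)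

lemma finite_degree: "finite {l \<in> mor L. deg L l = n}"
  using finite by (simp add: finite_kgraph_def)

lemma prefix_sets [measurable, simp]: "{x \<in> space M. P (x (0, n))} \<in> sets M"
  unfolding prefix_eq_UN
  by (intro sets.countable_UN' countable_subset[OF _ countable_mor]) auto

text \<open>The offset \<open>d\<close> lets two measures be compared on cylinders of degree at least \<open>d\<close> only.\<close>

definition prefix_events :: "nat ^ 'k \<Rightarrow> ('a, 'k) path set set" where
  "prefix_events d = {{x \<in> space M. P (x (0, d + n))} | P n. True}"

lemma prefix_events_subset: "prefix_events d \<subseteq> Pow (infinite_paths L)"
  by (auto simp: prefix_events_def space)

lemma prefix_determined:
  assumes "x \<in> infinite_paths L" "z \<in> infinite_paths L" "x (0, m + n) = z (0, m + n)"
  shows "x (0, m) = z (0, m)"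
  using assms(3) infinite_path_comp[OF assms(1), of 0 m "m + n"] infinite_path_comp[OF assms(2), of 0 m "m + n"]
    infinite_path_simps[OF assms(1), of 0 m] infinite_path_simps[OF assms(2), of 0 m]
    infinite_path_simps[OF assms(1), of m "m + n"] infinite_path_simps[OF assms(2), of m "m + n"]
    factorization_unique[of "x (0, m)" "x (m, m + n)" "z (0, m)" "z (m, m + n)"] by simp

text \<open>Brings two events to a common degree. The new predicate asks for some path with the
  given longer segment; by \<open>prefix_determined\<close> all such paths share the shorter
  one.\<close>

lemma prefix_events_extend:
  "\<exists>Q. {x \<in> space M. P (x (0, m))} = {x \<in> space M. Q (x (0, m + n))}"
proof (intro exI)
  show "{x \<in> space M. P (x (0, m))} = {x \<in> space M. \<exists>z\<in>space M. z (0, m + n) = x (0, m + n) \<and> P (z (0, m))}"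
    using prefix_determined by (auto simp: space) metis
qed

lemma prefix_events_Int: "Int_stable (prefix_events d)"
  unfolding Int_stable_def
proof (intro ballI)
  fix A B assume "A \<in> prefix_events d" "B \<in> prefix_events d"
  then obtain P m Q n where A: "A = {x \<in> space M. P (x (0, d + m))}" and B: "B = {x \<in> space M. Q (x (0, d + n))}"
    by (auto simp: prefix_events_def)
  obtain P' Q' where "A = {x \<in> space M. P' (x (0, d + m + n))}" "B = {x \<in> space M. Q' (x (0, d + n + m))}"
    using prefix_events_extend[of P "d + m" n] prefix_events_extend[of Q "d + n" m] A B by auto
  then have "A \<inter> B = {x \<in> space M. (\<lambda>l. P' l \<and> Q' l) (x (0, d + (m + n)))}"
    by (auto simp: add_ac)
  then show "A \<inter> B \<in> prefix_events d" unfolding prefix_events_def by (intro CollectI exI conjI TrueI)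
qed

lemma cylinder_prefix_event:
  assumes l: "l \<in> mor L"
  shows "cylinder L l \<in> prefix_events d"
proof -
  obtain Q where "{x \<in> space M. x (0, deg L l) = l} = {x \<in> space M. Q (x (0, deg L l + d))}"
    using prefix_events_extend[of "\<lambda>k. k = l" "deg L l" d] by blast
  moreover have "cylinder L l = {x \<in> space M. x (0, deg L l) = l}"
    by (simp add: cylinder_def space)
  ultimately show ?thesis by (auto simp: prefix_events_def add.commute[of d])
qed

text \<open>An open set is a union of cylinders, of which there are only countably many, and each
  cylinder is an event about a segment of degree at least \<open>d\<close>.\<close>

lemma sets_prefix_events: "sets M = sigma_sets (infinite_paths L) (prefix_events d)"
proof (rule antisym)
  interpret S: sigma_algebra "infinite_paths L" "sigma_sets (infinite_paths L) (prefix_events d)"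
    by (rule sigma_algebra_sigma_sets[OF prefix_events_subset])
  show "sets M \<subseteq> sigma_sets (infinite_paths L) (prefix_events d)"
    unfolding sets
  proof (rule S.sigma_sets_subset, rule subsetI)
    fix U assume "U \<in> {U. openin (path_topology L) U}"
    then have U: "U \<subseteq> infinite_paths L" "\<And>x. x \<in> U \<Longrightarrow> \<exists>n. cylinder L (x (0, n)) \<subseteq> U"
      using open_contains_cylinder by auto
    have "U = (\<Union>l\<in>{l \<in> mor L. cylinder L l \<subseteq> U}. cylinder L l)"
    proof
      show "U \<subseteq> (\<Union>l\<in>{l \<in> mor L. cylinder L l \<subseteq> U}. cylinder L l)"
      proof
        fix x assume x: "x \<in> U"
        obtain n where n: "cylinder L (x (0, n)) \<subseteq> U" using U(2)[OF x] ..
        have "x \<in> infinite_paths L" using x U by blast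
        then have "x (0, n) \<in> mor L" "x \<in> cylinder L (x (0, n))"
          using ex1_cylinder[of x "x (0, n)" n] by auto
        then show "x \<in> (\<Union>l\<in>{l \<in> mor L. cylinder L l \<subseteq> U}. cylinder L l)" using n by blast
      qed
    qed blast
    also have "\<dots> \<in> sigma_sets (infinite_paths L) (prefix_events d)"
      using countable_mor by (intro S.countable_UN'[OF countable_subset[OF _ countable_mor]])
        (auto intro: sigma_sets.Basic cylinder_prefix_event)
    finally show "U \<in> sigma_sets (infinite_paths L) (prefix_events d)" .
  qed
  show "sigma_sets (infinite_paths L) (prefix_events d) \<subseteq> sets M"
    unfolding space[symmetric] by (rule sets.sigma_sets_subset) (auto simp: prefix_events_def)
qed

section \<open>Measurability of shifting and prepending\<close>

lemma measurable_pathI: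
  assumes "\<And>x. x \<in> space M \<Longrightarrow> f x \<in> space M"
    and "\<And>P n. {x \<in> space M. P (f x (0, d + n))} \<in> sets M"
  shows "f \<in> measurable M M"
proof (rule measurable_sigma_sets[OF sets_prefix_events[of d] prefix_events_subset])
  show "f \<in> space M \<rightarrow> infinite_paths L" using assms(1) by (auto simp: space)
  fix A assume "A \<in> prefix_events d"
  then obtain P n where A: "A = {x \<in> space M. P (x (0, d + n))}" by (auto simp: prefix_events_def)
  have "f -` A \<inter> space M = {x \<in> space M. P (f x (0, d + n))}" using assms(1) A by auto
  then show "f -` A \<inter> space M \<in> sets M" using assms(2) by simp
qed

lemma shift_measurable [measurable]: "shift p \<in> measurable M M"
proof (rule measurable_pathI[where d = 0])
  fix P n
  have "{x \<in> space M. P (shift p x (0, 0 + n))} = {x \<in> space M. P (x (p, p + n))}"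
    by (simp add: shift_apply add.commute)
  \<comment> \<open>The segment from \<open>p\<close> to \<open>p + n\<close> is a function of the
    initial segment of degree \<open>p + n\<close>.\<close>
  also have "\<dots> = {x \<in> space M. \<exists>z\<in>space M. z (0, p + n) = x (0, p + n) \<and> P (z (p, p + n))}"
  proof -
    have "x (p, p + n) = z (p, p + n)"
      if "x \<in> infinite_paths L" "z \<in> infinite_paths L" "x (0, p + n) = z (0, p + n)" for x z
    proof (rule comp_left_cancel[of "x (0, p)"])
      show "cmp L (x (0, p)) (x (p, p + n)) = cmp L (x (0, p)) (z (p, p + n))"
        using prefix_determined[OF that] infinite_path_comp[OF that(1), of 0 p "p + n"]
          infinite_path_comp[OF that(2), of 0 p "p + n"] that(3) by simp
      show "src L (x (0, p)) = rng L (z (p, p + n))"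
        using prefix_determined[OF that] infinite_path_simps[OF that(2), of 0 p]
          infinite_path_simps[OF that(2), of p "p + n"] by simp
    qed (use infinite_path_simps[OF that(1), of 0 p] infinite_path_simps[OF that(1), of p "p + n"]
        infinite_path_simps[OF that(2), of p "p + n"] in simp_all)
    then show ?thesis by (auto simp: space) metis
  qed
  finally show "{x \<in> space M. P (shift p x (0, 0 + n))} \<in> sets M"
    using prefix_sets[of "\<lambda>k. \<exists>z\<in>space M. z (0, p + n) = k \<and> P (z (p, p + n))" "p + n"]
    by (rule ssubst)
qed (simp add: space shift_infinite_path)

text \<open>Made total by the identity outside the cylinder of the source, so that it is a
  measurable map on the whole space.\<close>

definition extend :: "'a \<Rightarrow> ('a, 'k) path \<Rightarrow> ('a, 'k) path" where
  "extend l x = (if x \<in> cylinder L (src L l) then prepend l x else x)"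

lemma extend:
  assumes "l \<in> mor L" "x \<in> cylinder L (src L l)"
  shows "extend l x \<in> cylinder L l" "shift (deg L l) (extend l x) = x"
  using assms by (simp_all add: extend_def prepend_cylinder shift_prepend)

lemma extend_shift: "l \<in> mor L \<Longrightarrow> x \<in> cylinder L l \<Longrightarrow> extend l (shift (deg L l) x) = x"
  by (simp add: extend_def shift_cylinder prepend_shift)

lemma extend_measurable [measurable]:
  assumes l: "l \<in> mor L"
  shows "extend l \<in> measurable M M"
\<comment> \<open>From this degree on, a segment of the prepended path is \<open>l\<close> followed
  by \<open>x (0, n)\<close>.\<close>
proof (rule measurable_pathI[where d = "deg L l"])
  note v = cylinder_vertex[OF src_vertex[OF l]]
  show "extend l x \<in> space M" if "x \<in> space M" for x
    using that l by (auto simp: extend_def space prepend v)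
  fix P n
  have "{x \<in> space M. P (extend l x (0, deg L l + n))} =
      {x \<in> space M. x (0, 0) = src L l} \<inter> {x \<in> space M. P (cmp L l (x (0, n)))} \<union>
      {x \<in> space M. x (0, 0) \<noteq> src L l} \<inter> {x \<in> space M. P (x (0, deg L l + n))}"
    using l by (auto simp: extend_def space v prepend)
  also have "\<dots> \<in> sets M"
    using prefix_sets[of "\<lambda>k. k = src L l" 0] prefix_sets[of "\<lambda>k. k \<noteq> src L l" 0]
      prefix_sets[of "\<lambda>k. P (cmp L l k)" n] prefix_sets[of P "deg L l + n"] by blast
  finally show "{x \<in> space M. P (extend l x (0, deg L l + n))} \<in> sets M" .
qed

text \<open>As the graph is finite, an event about segments of degree \<open>d + n\<close> is a
  finite disjoint union of cylinders of that degree.\<close>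

lemma measure_eqI_cylinders:
  assumes N: "sets N = sets M" and N': "sets N' = sets M" and fin: "emeasure N (space M) \<noteq> \<infinity>"
    and eq: "\<And>l. l \<in> mor L \<Longrightarrow> d \<le> deg L l \<Longrightarrow> emeasure N (cylinder L l) = emeasure N' (cylinder L l)"
  shows "N = N'"
proof (rule measure_eqI_generator_eq[OF prefix_events_Int[of d] prefix_events_subset])
  show "sets N = sigma_sets (infinite_paths L) (prefix_events d)"
    "sets N' = sigma_sets (infinite_paths L) (prefix_events d)"
    using N N' sets_prefix_events[of d] by simp_all
  show "range (\<lambda>_::nat. infinite_paths L) \<subseteq> prefix_events d"
    unfolding prefix_events_def space by auto
  show "emeasure N (infinite_paths L) \<noteq> \<infinity>" using fin by (simp add: space)
  fix A assume "A \<in> prefix_events d"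
  then obtain P n where A: "A = (\<Union>l\<in>{l \<in> mor L. deg L l = d + n \<and> P l}. cylinder L l)"
    by (auto simp: prefix_events_def prefix_eq_UN)
  let ?F = "{l \<in> mor L. deg L l = d + n \<and> P l}"
  have f: "finite ?F" by (rule finite_subset[OF _ finite_degree[of "d + n"]]) auto
  have dj: "disjoint_family_on (cylinder L) ?F"
    by (auto simp: disjoint_family_on_def cylinder_def)
  have c: "cylinder L ` ?F \<subseteq> sets M" by auto
  have "emeasure N A = (\<Sum>l\<in>?F. emeasure N (cylinder L l))"
    unfolding A by (rule sum_emeasure[OF _ dj f, symmetric]) (simp only: N c)
  also have "\<dots> = (\<Sum>l\<in>?F. emeasure N' (cylinder L l))"
    by (intro sum.cong refl eq) auto
  also have "\<dots> = emeasure N' A"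
    unfolding A by (rule sum_emeasure[OF _ dj f]) (simp only: N' c)
  finally show "emeasure N A = emeasure N' A" .
qed auto

text \<open>Prepending \<open>l\<close> maps the cylinder of \<open>src L l\<close> onto that of
  \<open>l\<close> and scales the measure by \<open>c (deg L l)\<close>. The cylinder of
  \<open>t = a b\<close> with \<open>deg L a = deg L l\<close> meets that of \<open>l\<close> only
  if \<open>a = l\<close>, and then the claim is multiplicativity of \<open>c\<close>.\<close>

lemma density_cylinder:
  assumes l: "l \<in> mor L"
  shows "density M (\<lambda>x. ennreal (indicat_real (cylinder L l) x)) =
    distr (density M (\<lambda>x. ennreal (c (deg L l) * indicat_real (cylinder L (src L l)) x))) M (extend l)"
proof (rule measure_eqI_cylinders[where d = "deg L l"])
  let ?v = "src L l"
  let ?N = "density M (\<lambda>x. ennreal (indicat_real (cylinder L l) x))"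
  let ?N' = "density M (\<lambda>x. ennreal (c (deg L l) * indicat_real (cylinder L ?v) x))"
  have v: "?v \<in> mor L" using l by (rule src_mor)
  note [measurable] = cylinder_sets[OF l] cylinder_sets[OF v] extend_measurable[OF l]
  show "sets ?N = sets M" "sets (distr ?N' M (extend l)) = sets M" by simp_all
  have N: "emeasure ?N A = measure M (cylinder L l \<inter> A)" if [measurable]: "A \<in> sets M" for A
  proof -
    have "emeasure ?N A = (\<integral>\<^sup>+ x. ennreal (indicat_real (cylinder L l) x) * indicator A x \<partial>M)"
      by (rule emeasure_density) measurable
    also have "\<dots> = (\<integral>\<^sup>+ x. indicator (cylinder L l \<inter> A) x \<partial>M)"
      by (rule nn_integral_cong) (auto split: split_indicator)
    also have "\<dots> = emeasure M (cylinder L l \<inter> A)" by (rule nn_integral_indicator) measurable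
    finally show ?thesis by (simp only: emeasure_eq_measure)
  qed
  have N': "emeasure ?N' A = ennreal (c (deg L l) * measure M (cylinder L ?v \<inter> A))" if [measurable]: "A \<in> sets M" for A
  proof -
    have "emeasure ?N' A = (\<integral>\<^sup>+ x. ennreal (c (deg L l) * indicat_real (cylinder L ?v) x) * indicator A x \<partial>M)"
      by (rule emeasure_density) measurable
    also have "\<dots> = (\<integral>\<^sup>+ x. ennreal (c (deg L l)) * indicator (cylinder L ?v \<inter> A) x \<partial>M)"
      by (rule nn_integral_cong) (auto split: split_indicator)
    also have "\<dots> = ennreal (c (deg L l)) * emeasure M (cylinder L ?v \<inter> A)"
      by (rule nn_integral_cmult_indicator) measurable
    finally show ?thesis using c_pos[of "deg L l"] by (simp only: emeasure_eq_measure) (simp add: ennreal_mult')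
  qed
  show "emeasure ?N (space M) \<noteq> \<infinity>" by (simp add: N)
  fix t assume t: "t \<in> mor L" "deg L l \<le> deg L t"
  note [measurable] = cylinder_sets[OF t(1)]
  obtain a b where ab: "a \<in> mor L" "b \<in> mor L" "src L a = rng L b" "t = cmp L a b" "deg L a = deg L l"
    using factor_leE[OF t] .
  have "measure M (cylinder L l \<inter> cylinder L t) =
      c (deg L l) * measure M (cylinder L ?v \<inter> (extend l -` cylinder L t \<inter> space M))"
  proof (cases "a = l")
    case True
    have "cylinder L l \<inter> cylinder L t = cylinder L t"
      using cylinder_cmp[OF ab(1-3)] True ab by auto
    moreover have "cylinder L ?v \<inter> (extend l -` cylinder L t \<inter> space M) = cylinder L b"
    proof -
      have "x \<in> cylinder L b \<Longrightarrow> x \<in> cylinder L ?v" for x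
        using cylinder_subset_vertex[OF ab(2)] ab(3) True by auto
      moreover have "x \<in> cylinder L ?v \<Longrightarrow> extend l x \<in> cylinder L t \<longleftrightarrow> x \<in> cylinder L b" for x
        using prepend_cylinder_cmp[OF ab(1-3), of x] True ab by (simp add: extend_def)
      ultimately show ?thesis by (auto simp: space cylinderD)
    qed
    ultimately show ?thesis
      using t ab True by (simp add: cylinder_measure deg_comp src_comp c_add)
  next
    case False
    have "x \<notin> cylinder L t" if "x \<in> cylinder L l" for x
      using that cylinder_cmp[OF ab(1-3), of x] False ab by (auto simp: cylinder_def)
    then have "cylinder L l \<inter> cylinder L t = {}" "cylinder L ?v \<inter> (extend l -` cylinder L t \<inter> space M) = {}"
      using extend(1)[OF l] by auto
    then show ?thesis by simp
  qed
  then show "emeasure ?N (cylinder L t) = emeasure (distr ?N' M (extend l)) (cylinder L t)"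
    by (simp add: N N' emeasure_distr)
qed

text \<open>Change of variables along \<open>extend l\<close>, the inverse of the shift on the
  cylinder of \<open>l\<close>.\<close>

lemma
  fixes g :: "('a, 'k) path \<Rightarrow> 'c::{banach, second_countable_topology}"
  assumes l: "l \<in> mor L" and g [measurable]: "g \<in> borel_measurable M"
  shows integrable_cylinder: "integrable M (\<lambda>x. indicator (cylinder L l) x *\<^sub>R g x) \<longleftrightarrow>
      integrable M (\<lambda>x. (c (deg L l) * indicator (cylinder L (src L l)) x) *\<^sub>R g (extend l x))"
    and integral_cylinder: "(LINT x|M. indicator (cylinder L l) x *\<^sub>R g x) =
      (LINT x|M. (c (deg L l) * indicator (cylinder L (src L l)) x) *\<^sub>R g (extend l x))"
proof -
  let ?v = "src L l"
  have v: "?v \<in> mor L" using l by (rule src_mor)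
  note [measurable] = cylinder_sets[OF l] cylinder_sets[OF v] extend_measurable[OF l]
  let ?N = "density M (\<lambda>x. ennreal (indicat_real (cylinder L l) x))"
  let ?N' = "density M (\<lambda>x. ennreal (c (deg L l) * indicat_real (cylinder L ?v) x))"
  have "integrable ?N g \<longleftrightarrow> integrable ?N' (\<lambda>x. g (extend l x))"
    unfolding density_cylinder[OF l] by (rule integrable_distr_eq) measurable
  then show "integrable M (\<lambda>x. indicator (cylinder L l) x *\<^sub>R g x) \<longleftrightarrow>
      integrable M (\<lambda>x. (c (deg L l) * indicator (cylinder L (src L l)) x) *\<^sub>R g (extend l x))"
    using c_pos[of "deg L l"] by (simp add: integrable_density)
  have "integral\<^sup>L ?N g = (LINT x|?N'. g (extend l x))"
    unfolding density_cylinder[OF l] by (rule integral_distr) measurable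
  then show "(LINT x|M. indicator (cylinder L l) x *\<^sub>R g x) =
      (LINT x|M. (c (deg L l) * indicator (cylinder L (src L l)) x) *\<^sub>R g (extend l x))"
    using c_pos[of "deg L l"] by (simp add: integral_density)
qed

end

section \<open>The representation on square-integrable functions\<close>

text \<open>Operators are given on functions, where they have pointwise formulas; linearity and the
  norm bound make them compatible with equality almost everywhere.\<close>

definition L2_contraction :: "'x measure \<Rightarrow> (('x \<Rightarrow> complex) \<Rightarrow> 'x \<Rightarrow> complex) \<Rightarrow> bool" where
  "L2_contraction M T \<longleftrightarrow> (\<forall>f\<in>square_integrable M. T f \<in> square_integrable M
      \<and> (LINT x|M. (cmod (T f x))\<^sup>2) \<le> (LINT x|M. (cmod (f x))\<^sup>2))
    \<and> (\<forall>f g. T (\<lambda>x. f x + g x) = (\<lambda>x. T f x + T g x))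
    \<and> (\<forall>f a. T (\<lambda>x. a * f x) = (\<lambda>x. a * T f x))"

lemma L2_contractionD:
  assumes "L2_contraction M T"
  shows "f \<in> square_integrable M \<Longrightarrow> T f \<in> square_integrable M"
    "f \<in> square_integrable M \<Longrightarrow> (LINT x|M. (cmod (T f x))\<^sup>2) \<le> (LINT x|M. (cmod (f x))\<^sup>2)"
    "T (\<lambda>x. f x + g x) = (\<lambda>x. T f x + T g x)" "T (\<lambda>x. a * f x) = (\<lambda>x. a * T f x)"
  using assms by (simp_all add: L2_contraction_def)

definition L2_operator :: "'x measure \<Rightarrow> (('x \<Rightarrow> complex) \<Rightarrow> 'x \<Rightarrow> complex) \<Rightarrow> ('x \<Rightarrow> complex) set \<Rightarrow> ('x \<Rightarrow> complex) set" where
  "L2_operator M T = (\<lambda>F\<in>carrier (L2 M). ae_class M (T (SOME f. f \<in> F)))"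

text \<open>Two representatives differ by a function of norm 0, which \<open>T\<close> maps to one
  of norm 0; so the choice made by \<open>SOME\<close> is immaterial.\<close>

lemma L2_operator_class:
  assumes T: "L2_contraction M T" and f: "f \<in> square_integrable M"
  shows "L2_operator M T (ae_class M f) = ae_class M (T f)"
proof -
  note TD = L2_contractionD[OF T]
  define g where "g = (SOME g. g \<in> ae_class M f)"
  have "g \<in> ae_class M f" unfolding g_def using ae_class_self[OF f] by (rule someI[where P = "\<lambda>g. g \<in> ae_class M f"])
  then have g: "g \<in> square_integrable M" and ae: "AE x in M. f x = g x" by (auto simp: ae_class_iff f)
  define h where "h x = f x + (- 1) * g x" for x
  have h: "h \<in> square_integrable M"
    unfolding h_def[abs_def] using f g by (intro square_integrable_add square_integrable_scale)
  have Th: "T h x = T f x - T g x" for x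
    unfolding h_def[abs_def] TD(3) TD(4) by simp
  have "(LINT x|M. (cmod (h x))\<^sup>2) = (LINT x|M. 0)"
  proof (rule integral_cong_AE)
    show "(\<lambda>x. (cmod (h x))\<^sup>2) \<in> borel_measurable M"
      by (rule borel_measurable_integrable[OF square_integrableD(2)[OF h]])
    show "AE x in M. (cmod (h x))\<^sup>2 = 0" using ae by eventually_elim (simp add: h_def)
  qed simp
  then have "(LINT x|M. (cmod (T h x))\<^sup>2) \<le> 0" using TD(2)[OF h] by simp
  moreover have "0 \<le> (LINT x|M. (cmod (T h x))\<^sup>2)" by (rule Bochner_Integration.integral_nonneg) simp
  ultimately have "AE x in M. (cmod (T h x))\<^sup>2 = 0"
    using square_integrableD(2)[OF TD(1)[OF h]] by (subst integral_nonneg_eq_0_iff_AE[symmetric]) auto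
  then have "AE x in M. T f x = T g x" by eventually_elim (simp add: Th)
  then have "ae_class M (T f) = ae_class M (T g)"
    by (subst ae_class_eq_iff) (simp_all add: TD f g)
  then show ?thesis using f by (simp add: L2_operator_def ae_class_mem g_def)
qed

lemma (in prob_space) L2_operator_bounded:
  assumes T: "L2_contraction M T"
  shows "bounded_operator (L2 M) (L2_operator M T)"
proof -
  interpret H: hilbert_space "L2 M" by (rule hilbert_space_L2)
  note TD = L2_contractionD[OF T] and c = L2_operator_class[OF T]
  have "bounded_operator (L2 M) (restrict (L2_operator M T) (carrier (L2 M)))"
  proof (rule H.bounded_operatorI[where C = 1])
    fix F assume "F \<in> carrier (L2 M)"
    then obtain f where f: "f \<in> square_integrable M" "F = ae_class M f" by (auto simp: L2_carrier)
    show "L2_operator M T F \<in> carrier (L2 M)" using f by (simp add: c ae_class_mem TD)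
    show "L2_operator M T (a \<odot>\<^bsub>L2 M\<^esub> F) = a \<odot>\<^bsub>L2 M\<^esub> L2_operator M T F" for a
      using f by (simp add: c L2_scale square_integrable_scale TD)
    have "(ip_norm (L2 M) (ae_class M (T f)))\<^sup>2 \<le> (ip_norm (L2 M) (ae_class M f))\<^sup>2"
      unfolding L2_norm(1)[OF f(1)] L2_norm(1)[OF TD(1)[OF f(1)]] by (rule TD(2)[OF f(1)])
    then have "ip_norm (L2 M) (ae_class M (T f)) \<le> ip_norm (L2 M) (ae_class M f)"
      by (rule power2_le_imp_le) (rule L2_norm(2)[OF f(1)])
    then show "ip_norm (L2 M) (L2_operator M T F) \<le> 1 * ip_norm (L2 M) F"
      unfolding f(2) c[OF f(1)] by simp
    fix G assume "G \<in> carrier (L2 M)"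
    then obtain g where g: "g \<in> square_integrable M" "G = ae_class M g" by (auto simp: L2_carrier)
    show "L2_operator M T (F \<oplus>\<^bsub>L2 M\<^esub> G) = L2_operator M T F \<oplus>\<^bsub>L2 M\<^esub> L2_operator M T G"
      using f g by (simp add: c L2_add square_integrable_add TD)
  qed
  then show ?thesis by (simp add: L2_operator_def)
qed

lemma (in prob_space) L2_operator_adjoint:
  assumes T: "L2_contraction M T" and T': "L2_contraction M T'"
    and adj: "\<And>f g. f \<in> square_integrable M \<Longrightarrow> g \<in> square_integrable M \<Longrightarrow>
      (LINT x|M. T f x * cnj (g x)) = (LINT x|M. f x * cnj (T' g x))"
  shows "hilbert_space.adjoint_pair (L2 M) (L2_operator M T) (L2_operator M T')"
proof -
  interpret H: hilbert_space "L2 M" by (rule hilbert_space_L2)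
  have "ip (L2 M) (L2_operator M T F) G = ip (L2 M) F (L2_operator M T' G)"
    if "F \<in> carrier (L2 M)" "G \<in> carrier (L2 M)" for F G
    using that adj L2_contractionD(1)[OF T] L2_contractionD(1)[OF T']
    by (auto simp: L2_carrier L2_operator_class T T' L2_ip)
  then show ?thesis
    by (simp add: H.adjoint_pair_def L2_operator_bounded T T')
qed

section \<open>The operators of the paths\<close>

context path_measure
begin

text \<open>Square root of the Radon-Nikodym derivative of the shift on the cylinder of \<open>l\<close>.\<close>

definition scaling :: "'a \<Rightarrow> real" where
  "scaling l = 1 / sqrt (c (deg L l))"

lemma scaling: "0 < scaling l" "c (deg L l) * scaling l = 1 / scaling l" "c (deg L l) * (scaling l)\<^sup>2 = 1"
  using c_pos[of "deg L l"] by (simp_all add: scaling_def power_divide real_div_sqrt)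

definition push :: "'a \<Rightarrow> (('a, 'k) path \<Rightarrow> complex) \<Rightarrow> ('a, 'k) path \<Rightarrow> complex" where
  "push l f x = indicator (cylinder L l) x * (of_real (scaling l) * f (shift (deg L l) x))"

text \<open>The adjoint of \<open>push l\<close>: it prepends where \<open>push l\<close> shifts,
  and the change of variables turns the factor into its inverse.\<close>

definition pull :: "'a \<Rightarrow> (('a, 'k) path \<Rightarrow> complex) \<Rightarrow> ('a, 'k) path \<Rightarrow> complex" where
  "pull l f x = indicator (cylinder L (src L l)) x * (of_real (1 / scaling l) * f (extend l x))"

lemma push_pull:
  assumes l: "l \<in> mor L"
  shows "pull l (push l f) x = indicator (cylinder L (src L l)) x * f x"
    "push l (pull l f) x = indicator (cylinder L l) x * f x"
  using scaling(1)[of l] extend[OF l, of x] extend_shift[OF l, of x] shift_cylinder[OF l, of x]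
  by (simp_all add: push_def pull_def indicator_def)

lemma push_comp:
  assumes l: "l \<in> mor L" and m: "m \<in> mor L" and lm: "src L l = rng L m"
  shows "push l (push m f) = push (cmp L l m) f"
proof
  fix x
  have "scaling (cmp L l m) = scaling l * scaling m"
    using assms by (simp add: scaling_def deg_comp c_add real_sqrt_mult)
  then show "push l (push m f) x = push (cmp L l m) f x"
    using cylinder_cmp[OF assms, of x] assms by (simp add: push_def indicator_def shift_shift deg_comp)
qed

lemma push_vertex:
  assumes v: "v \<in> vertices L"
  shows "push v f x = indicator (cylinder L v) x * f x" "pull v f x = indicator (cylinder L v) x * f x"
proof -
  have s: "scaling v = 1" using v by (simp add: scaling_def deg_vertex c_zero)
  show p: "push v f x = indicator (cylinder L v) x * f x" for f
    using v s by (auto simp: push_def indicator_def deg_vertex shift_zero cylinderD)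
  have "x \<in> cylinder L v \<Longrightarrow> extend v x = x"
    using extend_shift[OF vertex_mor[OF v], of x] v by (simp add: deg_vertex shift_zero cylinderD)
  then show "pull v f x = indicator (cylinder L v) x * f x"
    using v s by (auto simp: pull_def indicator_def vertex_src)
qed

lemma push_contraction:
  assumes l: "l \<in> mor L"
  shows "L2_contraction M (push l)"
  unfolding L2_contraction_def
proof (intro conjI ballI allI)
  note [measurable] = cylinder_sets[OF l] cylinder_sets[OF src_mor[OF l]] extend_measurable[OF l]
  fix f assume f: "f \<in> square_integrable M"
  note [measurable] = square_integrableD(1)[OF f]
  have [measurable]: "push l f \<in> borel_measurable M" unfolding push_def[abs_def] by measurable
  define g where "g x = (scaling l)\<^sup>2 * (cmod (f (shift (deg L l) x)))\<^sup>2" for x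
  have [measurable]: "g \<in> borel_measurable M" unfolding g_def[abs_def] by measurable
  have 1: "(cmod (push l f x))\<^sup>2 = indicator (cylinder L l) x *\<^sub>R g x" for x
    by (simp add: push_def g_def indicator_def norm_mult power_mult_distrib)
  \<comment> \<open>Prepending undoes the shift, and \<open>c (deg L l)\<close> cancels the square
    of \<open>scaling l\<close>.\<close>
  have 2: "(c (deg L l) * indicator (cylinder L (src L l)) x) *\<^sub>R g (extend l x) =
      indicator (cylinder L (src L l)) x *\<^sub>R (cmod (f x))\<^sup>2" for x
    using extend[OF l, of x] scaling(3)[of l] by (simp add: g_def indicator_def flip: mult.assoc)
  have i: "integrable M (\<lambda>x. indicator (cylinder L (src L l)) x *\<^sub>R (cmod (f x))\<^sup>2)"
    by (rule integrable_mult_indicator[OF _ square_integrableD(2)[OF f]]) measurable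
  then have "integrable M (\<lambda>x. (cmod (push l f x))\<^sup>2)"
    unfolding 1 by (subst integrable_cylinder[OF l]) (simp_all only: 2, measurable)
  then show "push l f \<in> square_integrable M" by (simp add: square_integrable_def)
  have "(LINT x|M. (cmod (push l f x))\<^sup>2) = (LINT x|M. indicator (cylinder L (src L l)) x *\<^sub>R (cmod (f x))\<^sup>2)"
    unfolding 1 2[symmetric] by (rule integral_cylinder[OF l]) measurable
  also have "\<dots> \<le> (LINT x|M. (cmod (f x))\<^sup>2)"
    using i square_integrableD(2)[OF f] by (intro integral_mono) (auto simp: indicator_def)
  finally show "(LINT x|M. (cmod (push l f x))\<^sup>2) \<le> (LINT x|M. (cmod (f x))\<^sup>2)" .
qed (auto simp: push_def algebra_simps)

lemma pull_contraction:
  assumes l: "l \<in> mor L"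
  shows "L2_contraction M (pull l)"
  unfolding L2_contraction_def
proof (intro conjI ballI allI)
  note [measurable] = cylinder_sets[OF l] cylinder_sets[OF src_mor[OF l]] extend_measurable[OF l]
  fix f assume f: "f \<in> square_integrable M"
  note [measurable] = square_integrableD(1)[OF f]
  have [measurable]: "pull l f \<in> borel_measurable M" unfolding pull_def[abs_def] by measurable
  define g where "g x = (cmod (f x))\<^sup>2" for x
  have [measurable]: "g \<in> borel_measurable M" unfolding g_def[abs_def] by measurable
  have 1: "(cmod (pull l f x))\<^sup>2 = (c (deg L l) * indicator (cylinder L (src L l)) x) *\<^sub>R g (extend l x)" for x
    using scaling(1,3)[of l]
    by (simp add: pull_def g_def indicator_def norm_mult norm_divide power_mult_distrib power_divide field_simps)
  have i: "integrable M (\<lambda>x. indicator (cylinder L l) x *\<^sub>R g x)"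
    unfolding g_def by (rule integrable_mult_indicator[OF _ square_integrableD(2)[OF f]]) measurable
  then have "integrable M (\<lambda>x. (cmod (pull l f x))\<^sup>2)"
    unfolding 1 by (subst integrable_cylinder[OF l, symmetric]) measurable
  then show "pull l f \<in> square_integrable M" by (simp add: square_integrable_def)
  have "(LINT x|M. (cmod (pull l f x))\<^sup>2) = (LINT x|M. indicator (cylinder L l) x *\<^sub>R g x)"
    unfolding 1 by (rule integral_cylinder[OF l, symmetric]) measurable
  also have "\<dots> \<le> (LINT x|M. (cmod (f x))\<^sup>2)"
    using i square_integrableD(2)[OF f] by (intro integral_mono) (auto simp: indicator_def g_def)
  finally show "(LINT x|M. (cmod (pull l f x))\<^sup>2) \<le> (LINT x|M. (cmod (f x))\<^sup>2)" .
qed (auto simp: pull_def algebra_simps add_divide_distrib)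

lemma push_pull_adjoint:
  assumes l: "l \<in> mor L" and f: "f \<in> square_integrable M" and g: "g \<in> square_integrable M"
  shows "(LINT x|M. push l f x * cnj (g x)) = (LINT x|M. f x * cnj (pull l g x))"
proof -
  note [measurable] = cylinder_sets[OF l] extend_measurable[OF l]
    square_integrableD(1)[OF f] square_integrableD(1)[OF g]
  define h where "h x = of_real (scaling l) * (f (shift (deg L l) x) * cnj (g x))" for x
  have [measurable]: "h \<in> borel_measurable M" unfolding h_def[abs_def] by measurable
  have 1: "push l f x * cnj (g x) = indicator (cylinder L l) x *\<^sub>R h x" for x
    by (simp add: push_def h_def indicator_def)
  have "complex_of_real (c (deg L l)) * of_real (scaling l) = 1 / of_real (scaling l)"
    by (simp only: scaling(2) of_real_divide of_real_1 flip: of_real_mult)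
  then have 2: "f x * cnj (pull l g x) = (c (deg L l) * indicator (cylinder L (src L l)) x) *\<^sub>R h (extend l x)" for x
    using extend[OF l, of x]
    by (simp add: pull_def h_def indicator_def scaleR_conv_of_real flip: mult.assoc)
  show ?thesis
    unfolding 1 2 by (rule integral_cylinder[OF l]) measurable
qed

sublocale H: hilbert_space "L2 M"
  by (rule hilbert_space_L2)

definition path_operator :: "'a \<Rightarrow> (('a, 'k) path \<Rightarrow> complex) set \<Rightarrow> (('a, 'k) path \<Rightarrow> complex) set" where
  "path_operator l = L2_operator M (push l)"

lemma path_operator_adjoint: "l \<in> mor L \<Longrightarrow> H.adjoint_pair (path_operator l) (L2_operator M (pull l))"
  unfolding path_operator_def
  by (intro L2_operator_adjoint push_contraction pull_contraction push_pull_adjoint)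

lemma path_operator_carrier:
  assumes "l \<in> mor L"
  shows "path_operator l \<in> carrier H.adjointable" "L2_operator M (pull l) \<in> carrier H.adjointable"
  using H.adjointableI path_operator_adjoint[OF assms] H.adjoint_pair_sym by blast+

lemma path_operator_invol: "l \<in> mor L \<Longrightarrow> invol H.adjointable (path_operator l) = L2_operator M (pull l)"
  using H.adjoint_operator_eq[OF path_operator_adjoint] by simp

lemma path_operator_class:
  assumes "l \<in> mor L" "f \<in> square_integrable M"
  shows "path_operator l (ae_class M f) = ae_class M (push l f)"
    "L2_operator M (pull l) (ae_class M f) = ae_class M (pull l f)"
    "push l f \<in> square_integrable M" "pull l f \<in> square_integrable M"
  using assms L2_contractionD(1)[OF push_contraction] L2_contractionD(1)[OF pull_contraction]
  by (simp_all add: path_operator_def L2_operator_class push_contraction pull_contraction)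

sublocale B: cstar_algebra H.adjointable
  by (rule H.cstar_algebra_adjointable)

lemma adjointable_eqI:
  assumes "S \<in> carrier H.adjointable" "T \<in> carrier H.adjointable"
    and "\<And>f. f \<in> square_integrable M \<Longrightarrow> S (ae_class M f) = T (ae_class M f)"
  shows "S = T"
  using assms by (intro H.adjointable_ext) (auto simp: L2_carrier)

abbreviation range_projection where
  "range_projection l \<equiv> path_operator l \<otimes>\<^bsub>H.adjointable\<^esub> invol H.adjointable (path_operator l)"

lemma range_projection_carrier: "l \<in> mor L \<Longrightarrow> range_projection l \<in> carrier H.adjointable"
  by (intro B.mult_closed B.invol_closed path_operator_carrier)

lemma range_projection_class:
  assumes l: "l \<in> mor L" and f: "f \<in> square_integrable M"
  shows "range_projection l (ae_class M f) = ae_class M (\<lambda>x. indicator (cylinder L l) x * f x)"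
    and "(\<lambda>x. indicator (cylinder L l) x * f x) \<in> square_integrable M"
proof -
  have e: "push l (pull l f) = (\<lambda>x. indicator (cylinder L l) x * f x)"
    by (rule ext) (rule push_pull(2)[OF l])
  note p = path_operator_class[OF l f] and q = path_operator_class[OF l path_operator_class(4)[OF l f]]
  show "(\<lambda>x. indicator (cylinder L l) x * f x) \<in> square_integrable M" using q(3) unfolding e .
  show "range_projection l (ae_class M f) = ae_class M (\<lambda>x. indicator (cylinder L l) x * f x)"
    unfolding path_operator_invol[OF l] using p q f by (simp add: ae_class_mem e)
qed

lemma sum_range_projections:
  assumes "finite F" "F \<subseteq> mor L" and f: "f \<in> square_integrable M"
  shows "(\<Oplus>\<^bsub>H.adjointable\<^esub>l\<in>F. range_projection l) (ae_class M f) =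
      ae_class M (\<lambda>x. (\<Sum>l\<in>F. indicator (cylinder L l) x) * f x)
    \<and> (\<lambda>x. (\<Sum>l\<in>F. indicator (cylinder L l) x) * f x) \<in> square_integrable M"
  using assms(1,2)
proof induction
  case empty
  then show ?case using f by (simp add: ae_class_mem L2_zero square_integrable_zero)
next
  case (insert l F)
  have c: "range_projection \<in> F \<rightarrow> carrier H.adjointable" "range_projection l \<in> carrier H.adjointable"
    using insert.prems range_projection_carrier by blast+
  have l: "l \<in> mor L" using insert.prems by simp
  note r = range_projection_class[OF l f]
  show ?case
    using B.M.finsum_insert[OF insert.hyps c] insert r f L2_add[OF r(2)] square_integrable_add[OF r(2)]
    by (simp add: ae_class_mem distrib_right del: H.adjointable_simps(1,5) )
qed

theorem path_operator_family: "cuntz_krieger_family L H.adjointable path_operator"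
  unfolding cuntz_krieger_family_def
proof (intro conjI ballI allI impI)
  note cl = path_operator_class and ca = path_operator_carrier
  \<comment> \<open>Established first, because together with (CK2) it shows that the operators are
    partial isometries.\<close>
  have CK3: "invol H.adjointable (path_operator m) \<otimes>\<^bsub>H.adjointable\<^esub> path_operator m = path_operator (src L m)"
    if m: "m \<in> mor L" for m
  proof (rule adjointable_eqI)
    fix f assume f: "f \<in> square_integrable M"
    have "pull m (push m f) = push (src L m) f"
      using push_pull(1)[OF m] push_vertex(1)[OF src_vertex[OF m]] by auto
    then show "(invol H.adjointable (path_operator m) \<otimes>\<^bsub>H.adjointable\<^esub> path_operator m) (ae_class M f) =
        path_operator (src L m) (ae_class M f)"
      unfolding path_operator_invol[OF m]
      using cl[OF m f] cl[OF m cl(3)[OF m f]] cl[OF src_mor[OF m] f] f by (simp add: ae_class_mem)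
  qed (use m ca B.mult_closed B.invol_closed src_mor in auto)
  show "invol H.adjointable (path_operator m) \<otimes>\<^bsub>H.adjointable\<^esub> path_operator m = path_operator (src L m)"
    if "m \<in> mor L" for m using that by (rule CK3)
  have CK2: "path_operator m \<otimes>\<^bsub>H.adjointable\<^esub> path_operator l = path_operator (cmp L m l)"
    if m: "m \<in> mor L" and l: "l \<in> mor L" and ml: "src L m = rng L l" for m l
  proof (rule adjointable_eqI)
    fix f assume f: "f \<in> square_integrable M"
    show "(path_operator m \<otimes>\<^bsub>H.adjointable\<^esub> path_operator l) (ae_class M f) =
        path_operator (cmp L m l) (ae_class M f)"
      using cl[OF l f] cl[OF m cl(3)[OF l f]] cl[OF comp_mor[OF m l ml] f] f push_comp[OF m l ml]
      by (simp add: ae_class_mem)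
  qed (use m l ml ca B.mult_closed comp_mor in auto)
  show "path_operator m \<otimes>\<^bsub>H.adjointable\<^esub> path_operator l = path_operator (cmp L m l)"
    if "m \<in> mor L" "l \<in> mor L" "src L m = rng L l" for m l using that by (rule CK2)
  show "partial_isometry H.adjointable (path_operator l)" if l: "l \<in> mor L" for l
    unfolding partial_isometry_def
    using CK3[OF l] CK2[OF l src_mor[OF l]] l ca[OF l] B.mult_assoc[of "path_operator l" "invol H.adjointable (path_operator l)" "path_operator l"]
      B.invol_closed[of "path_operator l"]
    by (simp add: rng_src comp_id_right del: H.adjointable_simps)
  have v_class: "path_operator v (ae_class M f) = ae_class M (\<lambda>x. indicator (cylinder L v) x * f x)"
    if v: "v \<in> vertices L" and f: "f \<in> square_integrable M" for v f
    using cl(1)[OF vertex_mor[OF v] f] push_vertex(1)[OF v, abs_def] by simp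
  show "projection H.adjointable (path_operator v)" if v: "v \<in> vertices L" for v
    unfolding projection_def
  proof (intro conjI)
    have vm: "v \<in> mor L" using v by (rule vertex_mor)
    show "path_operator v \<in> carrier H.adjointable" using ca vm by simp
    have "push v = pull v" using push_vertex[OF v] by (intro ext) simp
    then show "invol H.adjointable (path_operator v) = path_operator v"
      unfolding path_operator_invol[OF vm] by (simp add: path_operator_def)
    show "path_operator v \<otimes>\<^bsub>H.adjointable\<^esub> path_operator v = path_operator v"
      using CK2[OF vm vm] v comp_id_left[OF vm] by (simp add: vertex_rng vertex_src del: H.adjointable_simps)
  qed
  show "path_operator v \<otimes>\<^bsub>H.adjointable\<^esub> path_operator w = \<zero>\<^bsub>H.adjointable\<^esub>"
    if v: "v \<in> vertices L" and w: "w \<in> vertices L" and neq: "v \<noteq> w" for v w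
  proof (rule adjointable_eqI)
    note vm = vertex_mor[OF v] and wm = vertex_mor[OF w]
    fix f assume f: "f \<in> square_integrable M"
    have "push v (push w f) = (\<lambda>_. 0)"
      using neq by (intro ext) (auto simp: push_vertex v w indicator_def cylinder_vertex)
    then show "(path_operator v \<otimes>\<^bsub>H.adjointable\<^esub> path_operator w) (ae_class M f) = \<zero>\<^bsub>H.adjointable\<^esub> (ae_class M f)"
      using cl[OF wm f] cl[OF vm cl(3)[OF wm f]] f by (simp add: ae_class_mem L2_zero)
  qed (use ca[OF vertex_mor[OF v]] ca[OF vertex_mor[OF w]] B.mult_closed B.M.zero_closed in blast)+
  fix v n assume v: "v \<in> vertices L"
  let ?F = "{l \<in> mor L. deg L l = n \<and> rng L l = v}"
  have F: "finite ?F" by (rule finite_subset[OF _ finite_degree[of n]]) auto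
  show "path_operator v = (\<Oplus>\<^bsub>H.adjointable\<^esub>l\<in>?F. range_projection l)"
  proof (rule adjointable_eqI)
    show "path_operator v \<in> carrier H.adjointable" using ca vertex_mor[OF v] by simp
    show "(\<Oplus>\<^bsub>H.adjointable\<^esub>l\<in>?F. range_projection l) \<in> carrier H.adjointable"
      by (intro B.M.finsum_closed) (use range_projection_carrier in auto)
    fix f assume f: "f \<in> square_integrable M"
    \<comment> \<open>A path with range \<open>v\<close> lies in exactly one cylinder of degree
      \<open>n\<close>, that of its initial segment \<open>x (0, n)\<close>.\<close>
    have "(\<Sum>l\<in>?F. indicator (cylinder L l) x) = (indicator (cylinder L v) x :: complex)" for x
    proof (cases "x \<in> cylinder L v")
      case True
      then have x: "x \<in> infinite_paths L" "x (0, 0) = v" using v by (auto simp: cylinder_vertex)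
      have "?F \<inter> {l. x \<in> cylinder L l} = {x (0, n)}"
        using infinite_path_simps[OF x(1), of 0 n] x by (auto simp: cylinder_def)
      then show ?thesis using F True by (simp add: indicator_def sum.If_cases)
    next
      case False
      then have "x \<notin> cylinder L l" if "l \<in> ?F" for l
        using that cylinder_subset_vertex[of l] by auto
      then show ?thesis using False by simp
    qed
    then show "path_operator v (ae_class M f) = (\<Oplus>\<^bsub>H.adjointable\<^esub>l\<in>?F. range_projection l) (ae_class M f)"
      using sum_range_projections[OF F _ f] v_class[OF v f] by simp
  qed
qed

lemma path_operator_vertex_neq_zero:
  assumes v: "v \<in> vertices L"
  shows "path_operator v \<noteq> \<zero>\<^bsub>H.adjointable\<^esub>"
proof
  note vm = vertex_mor[OF v]
  have one: "(\<lambda>_. 1) \<in> square_integrable M" by (simp add: square_integrable_def)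
  have ind: "push v (\<lambda>_. 1) = indicator (cylinder L v)"
    using push_vertex(1)[OF v, of "\<lambda>_. 1"] by auto
  assume "path_operator v = \<zero>\<^bsub>H.adjointable\<^esub>"
  then have "ae_class M (push v (\<lambda>_. 1)) = ae_class M (\<lambda>_. 0)"
    using path_operator_class(1)[OF vm one] one by (simp add: ae_class_mem L2_zero)
  then have "AE x in M. indicator (cylinder L v) x = (0 :: complex)"
    using path_operator_class(3)[OF vm one] by (simp add: ae_class_eq_iff square_integrable_zero ind)
  then have "AE x in M. x \<notin> cylinder L v" by eventually_elim (simp add: indicator_def split: if_splits)
  then have "emeasure M (cylinder L v) = 0"
    using cylinder_sets[OF vm] by (subst AE_iff_measurable[symmetric, of _ _ "\<lambda>x. x \<notin> cylinder L v"])
      (auto simp: space cylinderD)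
  then show False
    using cylinder_measure[OF vm] e_pos[OF v] v by (simp add: emeasure_eq_measure deg_vertex c_zero vertex_src)
qed

end

section \<open>From the Perron-Frobenius data to the path measure\<close>

context kgraph
begin

text \<open>The point is that every spectral radius is positive. The vector has norm 1, so there is
  a vertex \<open>v\<close>; its cylinder has positive measure and contains a path, whose initial
  segment of degree \<open>axis i 1\<close> makes row \<open>v\<close> of the \<open>i\<close>-th
  vertex matrix nonzero. The eigenvector equation at \<open>v\<close> then has a positive left-hand
  side.\<close>

lemma path_measure_of_perron_frobenius:
  assumes fin: "finite_kgraph L" and PF: "perron_frobenius_measure L M"
  shows "\<exists>c e. path_measure L M c e"
proof -
  obtain e where prob: "prob_space M" and sp: "space M = infinite_paths L"
    and st: "sets M = sigma_sets (infinite_paths L) {U. openin (path_topology L) U}"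
    and vec: "perron_frobenius_vector L e"
    and cyl: "\<And>l. l \<in> mor L \<Longrightarrow> measure M (cylinder L l) = inverse (spectral_radius_power L (deg L l)) * e (src L l)"
    using PF unfolding perron_frobenius_measure_def by blast
  have e_pos: "0 < e v" if "v \<in> vertices L" for v using vec that by (simp add: perron_frobenius_vector_def)
  have sum: "(\<Sum>v\<in>vertices L. \<bar>e v\<bar>) = 1" using vec by (simp add: perron_frobenius_vector_def)
  then have "vertices L \<noteq> {}" by force
  then obtain v where v: "v \<in> vertices L" by blast
  \<comment> \<open>A sum over an infinite set is 0 by convention, whereas this one is 1.\<close>
  have finv: "finite (vertices L)" using sum by (metis sum.infinite zero_neq_one)
  have zero: "spectral_radius_power L 0 = 1" by (simp add: spectral_radius_power_def)
  have "measure M (cylinder L v) > 0"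
    using cyl[OF vertex_mor[OF v]] e_pos[OF v] v by (simp add: deg_vertex vertex_src zero)
  then obtain x where x: "x \<in> cylinder L v" by (metis all_not_in_conv less_irrefl measure_empty)
  have rho: "0 < vertex_spectral_radius L i" for i
  proof -
    let ?n = "axis i 1 :: nat ^ 'k" and ?l = "x (0, axis i 1)"
    note f = infinite_path_simps[OF cylinderD(1)[OF x], of 0 ?n]
    have l: "?l \<in> mor L" "deg L ?l = ?n" "rng L ?l = v"
      using f x v by (simp_all add: cylinder_vertex)
    let ?w = "src L ?l"
    have w: "?w \<in> vertices L" using l by (intro src_vertex)
    have "finite {k \<in> mor L. deg L k = ?n \<and> rng L k = v \<and> src L k = ?w}"
      using fin by (auto simp: finite_kgraph_def elim: finite_subset[rotated])
    then have "0 < vertex_matrix L i v ?w"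
      unfolding vertex_matrix_def using l by (subst card_gt_0_iff) auto
    then have "0 < real (vertex_matrix L i v ?w) * e ?w" using e_pos[OF w] by simp
    also have "\<dots> \<le> (\<Sum>w\<in>vertices L. real (vertex_matrix L i v w) * e w)"
      by (rule member_le_sum[where f = "\<lambda>w. real (vertex_matrix L i v w) * e w", OF w _ finv])
        (auto intro!: mult_nonneg_nonneg less_imp_le[OF e_pos])
    also have "\<dots> = vertex_spectral_radius L i * e v"
      using vec v by (simp add: perron_frobenius_vector_def)
    finally show ?thesis using e_pos[OF v] by (simp add: zero_less_mult_iff)
  qed
  have "path_measure L M (\<lambda>n. inverse (spectral_radius_power L n)) e"
  proof (intro path_measure.intro path_measure_axioms.intro kgraph_axioms prob fin sp st cyl e_pos)
    show "0 < inverse (spectral_radius_power L n)" for n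
      by (simp add: spectral_radius_power_def prod_pos rho)
    show "inverse (spectral_radius_power L (m + n)) =
        inverse (spectral_radius_power L m) * inverse (spectral_radius_power L n)" for m n
      by (simp add: spectral_radius_power_def power_add prod.distrib)
  qed (simp_all add: zero)
  then show ?thesis by (intro exI)
qed

end

theorem corollary3p6:
  fixes L :: "('a, 'k::finite) kgraph"
    and M :: "('a, 'k) path measure"
    and A :: "'b cstar" and s :: "'a \<Rightarrow> 'b"
  assumes "kgraph L"
    and "strongly_connected L"
    and "aperiodic L"
    and "finite_kgraph L"
    and "perron_frobenius_measure L M"
    and "is_kgraph_cstar_algebra L A s"
  shows "\<exists>\<pi>. faithful_representation A (L2 M) \<pi>"
proof -
  obtain c e where "path_measure L M c e"
    using kgraph.path_measure_of_perron_frobenius[OF assms(1,4,5)] by blast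
  then interpret path_measure L M c e .
  obtain f where f: "star_hom A H.adjointable f" and fs: "\<And>l. l \<in> mor L \<Longrightarrow> f (s l) = path_operator l"
    using kgraph_cstar_universal[OF assms(1,6) H.cstar_algebra_adjointable path_operator_family] by blast
  have "inj_on f (carrier A)"
  proof (rule cuntz_krieger_uniqueness[OF assms(1,4,3) _ _ _ H.cstar_algebra_adjointable f])
    show "cstar_algebra A" "cuntz_krieger_family L A s" "generates_cstar A (s ` mor L)"
      using assms(6) by (simp_all add: is_kgraph_cstar_algebra_def)
    show "f (s v) \<noteq> \<zero>\<^bsub>H.adjointable\<^esub>" if "v \<in> vertices L" for v
      using path_operator_vertex_neq_zero[OF that] fs[OF vertex_mor[OF that]] by (simp del: H.adjointable_simps)
  qed
  then show ?thesis
    using H.star_hom_bounded_operators[OF f] unfolding faithful_representation_def by blast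
qed

end
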